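(* Let $k\ge2$ be an integer, $a,b\ge0$, $d:=\frac{a+(k-1)b}{k}$, assume $d>1$, and let $\tau=\tau_d$ be the unique solution in $(0,1)$ of $\tau e^{-\tau}=de^{-d}$, i.e. $\tau=\sum_{j=1}^{\infty}\frac{j^{j-1}}{j!}(de^{-d})^j$. If $$\frac{a\ln a+(k-1)b\ln b}{k}-\frac{a+(k-1)b}{k}\ln\frac{a+(k-1)b}{k}>\min\left(\frac{1-\tau}{1-\tau k/(a+(k-1)b)}\,2\ln k,\ \ 2\ln k-2\ln(2)\,e^{-a/k}\bigl(1-(1-e^{-b/k})^{k-1}\bigr)\right),$$ then the Typicality Sampling Algorithm detects communities in $\mathrm{SBM}(n,k,a,b)$: for $\delta>0$ small enough there exists $\varepsilon>0$ such that, for $(\sigma,G)\sim\mathrm{SBM}(n,k,a,b)$ and $\hat\sigma$ drawn uniformly at random from $T_\delta(G)$, $$\mathbb{P}\{A(\sigma,\hat\sigma)\ge 1/k+\varepsilon\}=1-o(1)\qquad(n\to\infty).$$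
   Context: **Model.** $\mathrm{SBM}(n,k,a,b)$: each vertex $v\in[n]$ is independently assigned a uniform community $\sigma_v\in[k]$; then for every $v\ne v'$ an edge is placed independently with probability $a/n$ if $\sigma_v=\sigma_{v'}$ and $b/n$ otherwise; $G$ is the resulting graph. Convention: $0\ln0=0$. **Agreement.** For $x,y\in[k]^n$, $A(x,y)=\max_{\pi\in S_k}\frac1n\sum_{i=1}^n\mathbb{1}(x_i=\pi(y_i))$. In the symmetric model, detecting communities means outputting $\hat\sigma\in[k]^n$ with agreement at least $1/k+\varepsilon$ with probability $1-o(1)$, for some $\varepsilon>0$. **Typical set / Typicality Sampling Algorithm.** For $\delta>0$ let $\mathrm{Bal}(n,k,\delta)=\{x\in[k]^n:\ \forall i\in[k],\ |\{u\in[n]:x_u=i\}|/n\in[1/k-\delta,1/k+\delta]\}$. For $x\in[k]^n$ let $E_{\mathrm{in}}(x)$ be the number of edges $\{u,v\}$ of $G$ with $x_u=x_v$ and $E_{\mathrm{out}}(x)$ the number of edges with $x_u\ne x_v$. If $a\ge b$, $$T_\delta(G)=\{x\in\mathrm{Bal}(n,k,\delta):E_{\mathrm{in}}(x)\ge\tfrac{an}{2k}(1-\delta),\ E_{\mathrm{out}}(x)\le\tfrac{bn(k-1)}{2k}(1+\delta)\};$$ if $a<b$, $T_\delta(G)=\{x\in\mathrm{Bal}(n,k,\delta):E_{\mathrm{in}}(x)\le\tfrac{an}{2k}(1+\delta),\ E_{\mathrm{out}}(x)\ge\tfrac{bn(k-1)}{2k}(1-\delta)\}$. Given $G$, the algorithm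 outputs a uniformly random element of $T_\delta(G)$ (and an arbitrary element of $[k]^n$ if $T_\delta(G)$ is empty). *)

theory Defs
  imports "HOL-Probability.Probability" "HOL-Combinatorics.Permutations"
begin

text \<open>
  Vertices are \<open>0, \<dots>, n - 1\<close>, communities are \<open>0, \<dots>, k - 1\<close>, and a graph on the vertices is
  the set of its edges, each edge being a two-element set of vertices. Labellings are extensional,
  so that each element of \<open>[k]\<^sup>n\<close> is represented by exactly one function; this matters for the
  uniform distribution on sets of labellings.
\<close>

definition labellings :: "nat \<Rightarrow> nat \<Rightarrow> (nat \<Rightarrow> nat) set" where
  "labellings n k = {..<n} \<rightarrow>\<^sub>E {..<k}"

definition vertex_pairs :: "nat \<Rightarrow> nat set set" where
  "vertex_pairs n = {e. e \<subseteq> {..<n} \<and> card e = 2}"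

definition monochromatic :: "(nat \<Rightarrow> nat) \<Rightarrow> nat set \<Rightarrow> bool" where
  "monochromatic x e \<longleftrightarrow> (\<forall>u\<in>e. \<forall>v\<in>e. x u = x v)"

text \<open>
  The default value \<open>undefined\<close> makes the random labelling an element of \<^term>\<open>labellings n k\<close>.
  The parameter of \<^const>\<open>bernoulli_pmf\<close> is truncated to the unit interval, which only matters for
  the finitely many \<open>n\<close> with \<open>n < max a b\<close>.
\<close>

definition sbm :: "nat \<Rightarrow> nat \<Rightarrow> real \<Rightarrow> real \<Rightarrow> ((nat \<Rightarrow> nat) \<times> nat set set) pmf" where
  "sbm n k a b = do {
     \<sigma> \<leftarrow> Pi_pmf {..<n} undefined (\<lambda>_. pmf_of_set {..<k});
     g \<leftarrow> Pi_pmf (vertex_pairs n) False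
            (\<lambda>e. bernoulli_pmf ((if monochromatic \<sigma> e then a else b) / real n));
     return_pmf (\<sigma>, {e. g e})
   }"

definition agreement :: "nat \<Rightarrow> nat \<Rightarrow> (nat \<Rightarrow> nat) \<Rightarrow> (nat \<Rightarrow> nat) \<Rightarrow> real" where
  "agreement n k x y =
     (MAX \<pi>\<in>{\<pi>. \<pi> permutes {..<k}}. real (card {i\<in>{..<n}. x i = \<pi> (y i)}) / real n)"

definition balanced :: "nat \<Rightarrow> nat \<Rightarrow> real \<Rightarrow> (nat \<Rightarrow> nat) set" where
  "balanced n k \<delta> = {x \<in> labellings n k.
     \<forall>i<k. real (card {u\<in>{..<n}. x u = i}) / real n \<in> {1 / real k - \<delta> .. 1 / real k + \<delta>}}"

definition E_in :: "nat set set \<Rightarrow> (nat \<Rightarrow> nat) \<Rightarrow> real" where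
  "E_in G x = real (card {e\<in>G. monochromatic x e})"

definition E_out :: "nat set set \<Rightarrow> (nat \<Rightarrow> nat) \<Rightarrow> real" where
  "E_out G x = real (card {e\<in>G. \<not> monochromatic x e})"

definition typical_set ::
    "nat \<Rightarrow> nat \<Rightarrow> real \<Rightarrow> real \<Rightarrow> real \<Rightarrow> nat set set \<Rightarrow> (nat \<Rightarrow> nat) set" where
  "typical_set n k a b \<delta> G =
     (if a \<ge> b then
        {x \<in> balanced n k \<delta>.
           E_in G x \<ge> a * real n / (2 * real k) * (1 - \<delta>) \<and>
           E_out G x \<le> b * real n * (real k - 1) / (2 * real k) * (1 + \<delta>)}
      else
        {x \<in> balanced n k \<delta>.
           E_in G x \<le> a * real n / (2 * real k) * (1 + \<delta>) \<and>
           E_out G x \<ge> b * real n * (real k - 1) / (2 * real k) * (1 - \<delta>)})"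

text \<open>
  The function \<open>fallback\<close> provides the arbitrary output used when the typical set is empty.
\<close>

definition typicality_sampling ::
    "(nat \<Rightarrow> nat set set \<Rightarrow> nat \<Rightarrow> nat) \<Rightarrow> nat \<Rightarrow> nat \<Rightarrow> real \<Rightarrow> real \<Rightarrow> real \<Rightarrow>
     nat set set \<Rightarrow> (nat \<Rightarrow> nat) pmf" where
  "typicality_sampling fallback n k a b \<delta> G =
     (if typical_set n k a b \<delta> G = {} then return_pmf (fallback n G)
      else pmf_of_set (typical_set n k a b \<delta> G))"

text \<open>The joint law of the planted labelling and the output of a randomized algorithm.\<close>

definition planted_and_output ::
    "nat \<Rightarrow> nat \<Rightarrow> real \<Rightarrow> real \<Rightarrow> (nat set set \<Rightarrow> (nat \<Rightarrow> nat) pmf) \<Rightarrow>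
     ((nat \<Rightarrow> nat) \<times> (nat \<Rightarrow> nat)) pmf" where
  "planted_and_output n k a b alg = do {
     (\<sigma>, G) \<leftarrow> sbm n k a b;
     \<sigma>' \<leftarrow> alg G;
     return_pmf (\<sigma>, \<sigma>')
   }"

definition dual_root :: "real \<Rightarrow> real" where
  "dual_root d = (THE t. 0 < t \<and> t < 1 \<and> t * exp (- t) = d * exp (- d))"

text \<open>The description defining \<^const>\<open>dual_root\<close> is proper for \<open>d > 1\<close>.\<close>

lemma dual_root_ex1:
  fixes d :: real
  assumes "d > 1"
  shows "\<exists>!t. 0 < t \<and> t < 1 \<and> t * exp (- t) = d * exp (- d)"
proof -
  let ?f = "\<lambda>t::real. t * exp (- t)"
  have deriv: "(?f has_real_derivative (1 - t) * exp (- t)) (at t)" for t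
    by (auto intro!: derivative_eq_intros simp: algebra_simps)
  have mono: "?f s < ?f t" if "s < t" "t \<le> 1" for s t
    by (rule DERIV_pos_imp_increasing_open[OF that(1)])
       (use that deriv in \<open>auto intro!: continuous_intros exI[of _ "(1 - _) * exp (- _)"]\<close>)
  have anti: "?f d < ?f 1"
    by (rule DERIV_neg_imp_decreasing_open[OF assms])
       (use deriv in \<open>auto intro!: continuous_intros exI[of _ "(1 - _) * exp (- _)"]
          simp: mult_neg_pos\<close>)
  have "\<exists>t\<ge>0. t \<le> 1 \<and> ?f t = ?f d"
    by (rule IVT') (use anti assms in \<open>auto intro!: continuous_intros\<close>)
  then obtain t where t: "0 \<le> t" "t \<le> 1" "?f t = ?f d"
    by blast
  have "t \<noteq> 0" "t \<noteq> 1"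
    using t(3) anti assms by auto
  with t have "0 < t \<and> t < 1 \<and> ?f t = ?f d"
    by auto
  moreover have "s = t" if "0 < s \<and> s < 1 \<and> ?f s = ?f d" for s
    using mono[of s t] mono[of t s] t that by (cases s t rule: linorder_cases) auto
  ultimately show ?thesis
    by blast
qed

lemma
  assumes "d > 1"
  shows dual_root_pos: "0 < dual_root d"
    and dual_root_less_1: "dual_root d < 1"
    and dual_root_eq: "dual_root d * exp (- dual_root d) = d * exp (- d)"
  using theI'[OF dual_root_ex1[OF assms]] unfolding dual_root_def by auto

end

theory Submission
  imports Defs "HOL-Real_Asymp.Real_Asymp"
begin

text \<open>
  Let \<open>I\<close> be the left-hand side of the hypothesis. A labelling \<open>x\<close> whose overlaps with the planted
  labelling \<open>\<sigma>\<close> are all close to \<open>1/k\<^sup>2\<close> is typical with probability at most \<open>exp (-n I/2 + o(n))\<close>, by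
  tilting each edge with \<open>a/d\<close> or \<open>b/d\<close>: the tilt has expectation close to one because the linear terms
  cancel. So \<open>exp (n (ln k - I/2) + o(n))\<close> bounds the number of bad typical labellings, and it suffices
  to produce exponentially more typical labellings. Since \<open>\<sigma>\<close> itself is typical, their number is at
  least \<open>exp (H - o(n))\<close> for the conditional entropy \<open>H\<close> of \<open>\<sigma>\<close> given the graph, because the posterior
  weight of \<open>\<sigma>\<close> is at most \<open>exp (-H + o(n))\<close>: the log-likelihood of the graph has variance \<open>O(n)\<close> by the
  Efron--Stein inequality, and its mean is determined by \<open>H\<close>.

  The two terms of the minimum are two lower bounds for \<open>H\<close>, both obtained from the chain rule and the
  fact that conditioning reduces entropy. For the second one, a vertex without neighbours in its own
  class and in some other class can be moved freely, contributing \<open>ln 2\<close>. For the first one, vertices of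
  degree at most one are removed in a bounded number of rounds; each removed vertex hangs on a tree of
  vertices removed before it, where the conditional law is explicit. The surviving proportions of
  vertices and edges are computed from the survival of the local branching process, and they converge,
  as the number of rounds grows, to expressions in its extinction probability \<open>\<tau>/d\<close>.
\<close>

section \<open>Expectations over random edge sets\<close>

text \<open>Let h be the entropy per vertex. The bad labellings number about exp (n (ln k - I/2)),
  so the aim is h > ln k - I/2. In the peeling bound I appears on both sides: a removed vertex
  brings ln k, but each removed edge costs its log-ratio, in total I/2 per vertex times the
  proportion of removed edges. With q = tau/d, a proportion (1 - q)^2 of surviving edges and (1 +
  mu) exp (- mu) of removed vertices, where exp (- mu) = q, the inequality becomes (1 - q) ((1 - q)
  I/2 - (1 - tau) ln k) > 0; this is the origin of the first term of the minimum.

  The obstacle is that an entropy is an average, whereas the typical set must be large for almost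
  every graph. The graph likelihood is therefore measured against the weight (d/n)^|G|: otherwise
  one extra edge would change its logarithm by about ln n and the variance would not be linear in n.

  All expectations are finite sums with explicit weights; probability mass functions enter only at
  the end.\<close>

definition bern_weight :: "'e set \<Rightarrow> ('e \<Rightarrow> real) \<Rightarrow> 'e set \<Rightarrow> real" where
  "bern_weight A p G = (\<Prod>e\<in>A. if e \<in> G then p e else 1 - p e)"

text \<open>A finite sum with arbitrary real parameters, so linearity needs no side condition; only
  order properties ask for \<open>p\<close> to lie in the unit interval.
  \<open>expectation_random_edges\<close> identifies it with the product measure.\<close>

definition bexp :: "'e set \<Rightarrow> ('e \<Rightarrow> real) \<Rightarrow> ('e set \<Rightarrow> real) \<Rightarrow> real" where
  "bexp A p F = (\<Sum>G\<in>Pow A. bern_weight A p G * F G)"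

lemma bexp_empty [simp]: "bexp {} p F = F {}"
  by (simp add: bexp_def bern_weight_def)

lemma bern_weight_insert:
  assumes "finite A" "e \<notin> A" "G \<subseteq> A"
  shows "bern_weight (insert e A) p (insert e G) = p e * bern_weight A p G"
    and "bern_weight (insert e A) p G = (1 - p e) * bern_weight A p G"
proof -
  have "(\<Prod>x\<in>A. if x \<in> insert e G then p x else 1 - p x) = (\<Prod>x\<in>A. if x \<in> G then p x else 1 - p x)"
    by (rule prod.cong) (use assms in auto)
  then show "bern_weight (insert e A) p (insert e G) = p e * bern_weight A p G"
    using assms by (simp add: bern_weight_def)
  show "bern_weight (insert e A) p G = (1 - p e) * bern_weight A p G"
    using assms by (auto simp: bern_weight_def)
qed

lemma bexp_insert:
  assumes "finite A" "e \<notin> A"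
  shows "bexp (insert e A) p F = p e * bexp A p (\<lambda>G. F (insert e G)) + (1 - p e) * bexp A p F"
proof -
  have inj: "inj_on (insert e) (Pow A)"
    using assms by (auto simp: inj_on_def)
  have "bexp (insert e A) p F
      = (\<Sum>G\<in>Pow A. bern_weight (insert e A) p G * F G)
        + (\<Sum>G\<in>insert e ` Pow A. bern_weight (insert e A) p G * F G)"
    unfolding bexp_def Pow_insert using assms by (intro sum.union_disjoint) auto
  also have "(\<Sum>G\<in>insert e ` Pow A. bern_weight (insert e A) p G * F G)
      = (\<Sum>G\<in>Pow A. p e * (bern_weight A p G * F (insert e G)))"
    using assms by (subst sum.reindex[OF inj]) (auto intro!: sum.cong simp: bern_weight_insert)
  also have "(\<Sum>G\<in>Pow A. bern_weight (insert e A) p G * F G)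
      = (\<Sum>G\<in>Pow A. (1 - p e) * (bern_weight A p G * F G))"
    using assms by (auto intro!: sum.cong simp: bern_weight_insert)
  finally show ?thesis
    by (simp add: bexp_def sum_distrib_left)
qed

lemma bexp_cong:
  assumes "\<And>G. G \<subseteq> A \<Longrightarrow> F G = F' G"
  shows "bexp A p F = bexp A p F'"
  unfolding bexp_def by (rule sum.cong) (use assms in auto)

lemma bexp_cong_prob:
  assumes "\<And>e. e \<in> A \<Longrightarrow> p e = q e"
  shows "bexp A p F = bexp A q F"
  unfolding bexp_def bern_weight_def
  by (intro sum.cong arg_cong2[where f="(*)"] prod.cong refl) (use assms in auto)

lemma bexp_add: "bexp A p (\<lambda>G. F G + F' G) = bexp A p F + bexp A p F'"
  by (simp add: bexp_def algebra_simps sum.distrib)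

lemma bexp_diff: "bexp A p (\<lambda>G. F G - F' G) = bexp A p F - bexp A p F'"
  by (simp add: bexp_def algebra_simps sum_subtractf)

lemma bexp_cmult: "bexp A p (\<lambda>G. c * F G) = c * bexp A p F"
  by (simp add: bexp_def algebra_simps sum_distrib_left)

lemma bexp_multc: "bexp A p (\<lambda>G. F G * c) = bexp A p F * c"
  by (simp add: bexp_def algebra_simps sum_distrib_left)

lemma bexp_divide: "bexp A p (\<lambda>G. F G / c) = bexp A p F / c"
  by (simp add: bexp_def algebra_simps sum_divide_distrib)

lemma bexp_sum: "bexp A p (\<lambda>G. \<Sum>i\<in>I. F i G) = (\<Sum>i\<in>I. bexp A p (F i))"
  unfolding bexp_def sum_distrib_left by (rule sum.swap)

lemma bexp_const:
  assumes "finite A"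
  shows "bexp A p (\<lambda>_. c) = c"
  using assms by induction (auto simp: bexp_insert algebra_simps)

lemma bern_weight_nonneg:
  assumes "\<And>e. e \<in> A \<Longrightarrow> 0 \<le> p e \<and> p e \<le> 1"
  shows "0 \<le> bern_weight A p G"
  unfolding bern_weight_def by (rule prod_nonneg) (use assms in auto)

lemma bexp_mono:
  assumes "\<And>e. e \<in> A \<Longrightarrow> 0 \<le> p e \<and> p e \<le> 1" "\<And>G. G \<subseteq> A \<Longrightarrow> F G \<le> F' G"
  shows "bexp A p F \<le> bexp A p F'"
  unfolding bexp_def by (intro sum_mono mult_left_mono bern_weight_nonneg) (use assms in auto)

lemma bexp_nonneg:
  assumes "\<And>e. e \<in> A \<Longrightarrow> 0 \<le> p e \<and> p e \<le> 1" "\<And>G. G \<subseteq> A \<Longrightarrow> 0 \<le> F G"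
  shows "0 \<le> bexp A p F"
  unfolding bexp_def by (intro sum_nonneg mult_nonneg_nonneg bern_weight_nonneg) (use assms in auto)

lemma bexp_le_const:
  assumes "finite A" "\<And>e. e \<in> A \<Longrightarrow> 0 \<le> p e \<and> p e \<le> 1" "\<And>G. G \<subseteq> A \<Longrightarrow> F G \<le> c"
  shows "bexp A p F \<le> c"
proof -
  have "bexp A p F \<le> bexp A p (\<lambda>_. c)"
    by (rule bexp_mono) (use assms in auto)
  then show ?thesis
    using assms(1) by (simp add: bexp_const)
qed

lemma bexp_union:
  assumes "finite A" "finite B" "A \<inter> B = {}"
  shows "bexp (A \<union> B) p F = bexp A p (\<lambda>G. bexp B p (\<lambda>H. F (G \<union> H)))"
  using assms
proof (induction A arbitrary: F)
  case (insert e A)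
  then have "bexp (insert e A \<union> B) p F
      = p e * bexp (A \<union> B) p (\<lambda>G. F (insert e G)) + (1 - p e) * bexp (A \<union> B) p F"
    by (simp add: bexp_insert)
  with insert show ?case
    by (simp add: bexp_insert)
qed simp

text \<open>Edges outside \<open>B\<close> are integrated out first; along them the integrand is
  constant.\<close>

lemma bexp_marginal:
  assumes "finite A" "B \<subseteq> A" "\<And>G. G \<subseteq> A \<Longrightarrow> F G = F (G \<inter> B)"
  shows "bexp A p F = bexp B p F"
proof -
  have fin: "finite B" "finite (A - B)"
    using assms finite_subset by auto
  have "bexp A p F = bexp (B \<union> (A - B)) p F"
    using assms(2) by (simp add: Un_absorb1)
  also have "\<dots> = bexp B p (\<lambda>G. bexp (A - B) p (\<lambda>H. F (G \<union> H)))"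
    using fin by (intro bexp_union) auto
  also have "\<dots> = bexp B p (\<lambda>G. bexp (A - B) p (\<lambda>H. F G))"
  proof (intro bexp_cong)
    fix G H assume "G \<subseteq> B" "H \<subseteq> A - B"
    then have "(G \<union> H) \<inter> B = G" "G \<union> H \<subseteq> A"
      using assms(2) by auto
    then show "F (G \<union> H) = F G"
      using assms(3) by metis
  qed
  finally show ?thesis
    using fin by (simp add: bexp_const)
qed

lemma bexp_prod:
  assumes "finite A"
  shows "bexp A p (\<lambda>G. \<Prod>e\<in>A. if e \<in> G then s e else t e) = (\<Prod>e\<in>A. p e * s e + (1 - p e) * t e)"
  using assms
proof induction
  case (insert e A)
  have "bexp A p (\<lambda>G. \<Prod>x\<in>insert e A. if x \<in> insert e G then s x else t x)
      = bexp A p (\<lambda>G. s e * (\<Prod>x\<in>A. if x \<in> G then s x else t x))"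
    using insert by (intro bexp_cong) (auto intro!: prod.cong)
  moreover have "bexp A p (\<lambda>G. \<Prod>x\<in>insert e A. if x \<in> G then s x else t x)
      = bexp A p (\<lambda>G. t e * (\<Prod>x\<in>A. if x \<in> G then s x else t x))"
    using insert by (intro bexp_cong) auto
  ultimately show ?case
    using insert by (simp add: bexp_insert bexp_cmult algebra_simps)
qed simp

text \<open>Independence of one edge from a function that ignores it. Comparing
  \<open>insert e G\<close> with \<open>G\<close> is the form in which the walk events satisfy
  this.\<close>

lemma bexp_edge_mult:
  assumes "finite A" "e \<in> A" "\<And>G. G \<subseteq> A - {e} \<Longrightarrow> F (insert e G) = F G"
  shows "bexp A p (\<lambda>G. of_bool (e \<in> G) * F G) = p e * bexp A p F"
proof -
  have A: "A = insert e (A - {e})" and fin: "finite (A - {e})"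
    using assms by auto
  have "bexp A p (\<lambda>G. of_bool (e \<in> G) * F G)
      = p e * bexp (A - {e}) p F + (1 - p e) * bexp (A - {e}) p (\<lambda>G. of_bool (e \<in> G) * F G)"
    using fin assms(3) by (subst A, subst bexp_insert) (auto intro!: bexp_cong)
  also have "bexp (A - {e}) p (\<lambda>G. of_bool (e \<in> G) * F G) = bexp (A - {e}) p (\<lambda>G. 0)"
    by (rule bexp_cong) auto
  also have "\<dots> = 0"
    using fin by (simp add: bexp_const)
  finally have 1: "bexp A p (\<lambda>G. of_bool (e \<in> G) * F G) = p e * bexp (A - {e}) p F"
    by simp
  have "bexp A p F = p e * bexp (A - {e}) p F + (1 - p e) * bexp (A - {e}) p F"
    using fin assms(3) by (subst A, subst bexp_insert) (auto intro!: bexp_cong)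
  with 1 show ?thesis
    by (simp add: algebra_simps)
qed

lemma bexp_edge:
  assumes "finite A" "e \<in> A"
  shows "bexp A p (\<lambda>G. of_bool (e \<in> G)) = p e"
  using bexp_edge_mult[OF assms, of "\<lambda>_. 1" p] assms(1) by (simp add: bexp_const)

text \<open>The summands are centred and independent, so the cross terms vanish and each edge leaves
  its Bernoulli variance.\<close>

lemma bexp_square_sum:
  assumes "finite A"
  shows "bexp A p (\<lambda>G. \<Sum>e\<in>A. c e * (of_bool (e \<in> G) - p e)) = 0"
    and "bexp A p (\<lambda>G. (\<Sum>e\<in>A. c e * (of_bool (e \<in> G) - p e))\<^sup>2) = (\<Sum>e\<in>A. (c e)\<^sup>2 * (p e * (1 - p e)))"
proof -
  have *: "bexp A p (\<lambda>G. \<Sum>e\<in>A. c e * (of_bool (e \<in> G) - p e)) = 0" if "finite A" for A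
    using that by (simp add: bexp_sum bexp_cmult bexp_diff bexp_const bexp_edge cong: sum.cong)
  show "bexp A p (\<lambda>G. \<Sum>e\<in>A. c e * (of_bool (e \<in> G) - p e)) = 0"
    using assms by (rule *)
  show "bexp A p (\<lambda>G. (\<Sum>e\<in>A. c e * (of_bool (e \<in> G) - p e))\<^sup>2) = (\<Sum>e\<in>A. (c e)\<^sup>2 * (p e * (1 - p e)))"
    using assms
  proof induction
    case empty
    then show ?case by simp
  next
    case (insert x A)
    define Y where "Y G = (\<Sum>e\<in>A. c e * (of_bool (e \<in> G) - p e))" for G
    have Y0: "bexp A p Y = 0"
      unfolding Y_def by (rule *) fact
    have Yi: "Y (insert x G) = Y G" for G
      unfolding Y_def using insert by (intro sum.cong) auto
    have sq: "bexp A p (\<lambda>G. (t + Y G)\<^sup>2) = t\<^sup>2 + bexp A p (\<lambda>G. (Y G)\<^sup>2)" for t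
    proof -
      have "bexp A p (\<lambda>G. (t + Y G)\<^sup>2) = bexp A p (\<lambda>G. t\<^sup>2 + (Y G)\<^sup>2 + 2 * t * Y G)"
        by (simp add: power2_sum)
      also have "\<dots> = t\<^sup>2 + bexp A p (\<lambda>G. (Y G)\<^sup>2) + 2 * t * bexp A p Y"
        unfolding bexp_add bexp_cmult using insert by (simp add: bexp_const)
      finally show ?thesis
        using Y0 by simp
    qed
    have "bexp (insert x A) p (\<lambda>G. (\<Sum>e\<in>insert x A. c e * (of_bool (e \<in> G) - p e))\<^sup>2)
        = p x * bexp A p (\<lambda>G. (c x * (1 - p x) + Y G)\<^sup>2) + (1 - p x) * bexp A p (\<lambda>G. (c x * (0 - p x) + Y G)\<^sup>2)"
      using insert by (simp add: bexp_insert Y_def[symmetric] Yi)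
        (auto intro!: bexp_cong simp: subset_iff)
    also have "\<dots> = p x * ((c x * (1 - p x))\<^sup>2 + bexp A p (\<lambda>G. (Y G)\<^sup>2))
         + (1 - p x) * ((c x * p x)\<^sup>2 + bexp A p (\<lambda>G. (Y G)\<^sup>2))"
      unfolding sq by (simp add: power_mult_distrib)
    also have "\<dots> = (c x)\<^sup>2 * (p x * (1 - p x)) + bexp A p (\<lambda>G. (Y G)\<^sup>2)"
      by (simp add: power2_eq_square algebra_simps)
    finally show ?case
      using insert unfolding Y_def by simp
  qed
qed

text \<open>The comparison value for an edge is \<open>F\<close> with that edge deleted, not a
  conditional mean. The variance along one edge is p (1 - p) D^2 for the jump D, while deletion
  yields p D^2, which is at least as large.\<close>

lemma bexp_efron_stein:
  assumes "finite A" "\<And>e. e \<in> A \<Longrightarrow> 0 \<le> p e \<and> p e \<le> 1"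
  shows "bexp A p (\<lambda>G. (F G)\<^sup>2) - (bexp A p F)\<^sup>2 \<le> (\<Sum>e\<in>A. bexp A p (\<lambda>G. (F G - F (G - {e}))\<^sup>2))"
  using assms
proof (induction A arbitrary: F)
  case empty
  then show ?case by simp
next
  case (insert x A)
  have p: "0 \<le> p e \<and> p e \<le> 1" if "e \<in> insert x A" for e
    using insert that by auto
  \<comment> \<open>\<open>\<phi>\<close> averages out \<open>x\<close>. The variance of
    \<open>F\<close> is the mean variance along \<open>x\<close>, treated in \<open>first\<close>,
    plus the variance of \<open>\<phi>\<close>, whose deletion differences are controlled in
    \<open>each\<close> by convexity of the square.\<close>
  define \<phi> where "\<phi> G = p x * F (insert x G) + (1 - p x) * F G" for G
  have IH: "bexp A p (\<lambda>G. (\<phi> G)\<^sup>2) - (bexp A p \<phi>)\<^sup>2 \<le> (\<Sum>e\<in>A. bexp A p (\<lambda>G. (\<phi> G - \<phi> (G - {e}))\<^sup>2))"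
    using insert by auto
  have conv: "(p x * s + (1 - p x) * t)\<^sup>2 \<le> p x * s\<^sup>2 + (1 - p x) * t\<^sup>2" for s t :: real
  proof -
    have "p x * s\<^sup>2 + (1 - p x) * t\<^sup>2 - (p x * s + (1 - p x) * t)\<^sup>2 = p x * (1 - p x) * (s - t)\<^sup>2"
      by (simp add: power2_eq_square algebra_simps)
    moreover have "0 \<le> p x * (1 - p x) * (s - t)\<^sup>2"
      using p by (intro mult_nonneg_nonneg) auto
    ultimately show ?thesis by linarith
  qed
  have each: "bexp A p (\<lambda>G. (\<phi> G - \<phi> (G - {e}))\<^sup>2) \<le> bexp (insert x A) p (\<lambda>G. (F G - F (G - {e}))\<^sup>2)"
    if "e \<in> A" for e
  proof -
    have ex: "e \<noteq> x"
      using that insert by auto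
    then have i: "insert x G - {e} = insert x (G - {e})" for G
      by auto
    have "bexp A p (\<lambda>G. (\<phi> G - \<phi> (G - {e}))\<^sup>2)
        \<le> bexp A p (\<lambda>G. p x * (F (insert x G) - F (insert x (G - {e})))\<^sup>2 + (1 - p x) * (F G - F (G - {e}))\<^sup>2)"
    proof (rule bexp_mono)
      fix G
      have "\<phi> G - \<phi> (G - {e}) = p x * (F (insert x G) - F (insert x (G - {e}))) + (1 - p x) * (F G - F (G - {e}))"
        by (simp add: \<phi>_def algebra_simps)
      then show "(\<phi> G - \<phi> (G - {e}))\<^sup>2 \<le> p x * (F (insert x G) - F (insert x (G - {e})))\<^sup>2 + (1 - p x) * (F G - F (G - {e}))\<^sup>2"
        using conv by simp
    qed (use p in auto)
    then show ?thesis
      using insert by (simp add: bexp_insert bexp_add bexp_cmult i)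
  qed
  have first: "bexp (insert x A) p (\<lambda>G. (F G)\<^sup>2) - bexp A p (\<lambda>G. (\<phi> G)\<^sup>2)
      \<le> bexp (insert x A) p (\<lambda>G. (F G - F (G - {x}))\<^sup>2)"
  proof -
    have "bexp (insert x A) p (\<lambda>G. (F G)\<^sup>2) - bexp A p (\<lambda>G. (\<phi> G)\<^sup>2)
        = bexp A p (\<lambda>G. p x * (1 - p x) * (F (insert x G) - F G)\<^sup>2)"
      using insert by (simp add: bexp_insert flip: bexp_cmult bexp_add bexp_diff)
        (auto intro!: bexp_cong simp: \<phi>_def power2_eq_square algebra_simps)
    also have "\<dots> \<le> bexp A p (\<lambda>G. p x * (F (insert x G) - F G)\<^sup>2)"
    proof (rule bexp_mono)
      fix G
      have "p x * (1 - p x) \<le> p x"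
        using p[of x] by (simp add: mult_left_le)
      then show "p x * (1 - p x) * (F (insert x G) - F G)\<^sup>2 \<le> p x * (F (insert x G) - F G)\<^sup>2"
        by (rule mult_right_mono) simp
    qed (use p in auto)
    also have "\<dots> = p x * bexp A p (\<lambda>G. (F (insert x G) - F (insert x G - {x}))\<^sup>2)"
      unfolding bexp_cmult
    proof (intro arg_cong2[where f="(*)"] bexp_cong refl)
      fix G assume "G \<subseteq> A"
      then have "insert x G - {x} = G"
        using insert by auto
      then show "(F (insert x G) - F G)\<^sup>2 = (F (insert x G) - F (insert x G - {x}))\<^sup>2"
        by simp
    qed
    also have "\<dots> = bexp (insert x A) p (\<lambda>G. (F G - F (G - {x}))\<^sup>2)"
    proof -
      have "bexp A p (\<lambda>G. (F G - F (G - {x}))\<^sup>2) = bexp A p (\<lambda>G. 0)"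
      proof (rule bexp_cong)
        fix G assume "G \<subseteq> A"
        then have "G - {x} = G"
          using insert by auto
        then show "(F G - F (G - {x}))\<^sup>2 = 0" by simp
      qed
      then show ?thesis
        using insert by (simp add: bexp_insert bexp_const)
    qed
    finally show ?thesis .
  qed
  have sum_le: "(\<Sum>e\<in>A. bexp A p (\<lambda>G. (\<phi> G - \<phi> (G - {e}))\<^sup>2))
      \<le> (\<Sum>e\<in>A. bexp (insert x A) p (\<lambda>G. (F G - F (G - {e}))\<^sup>2))"
    by (rule sum_mono) (rule each)
  have mean: "bexp (insert x A) p F = bexp A p \<phi>"
    using insert by (simp add: bexp_insert \<phi>_def[abs_def] bexp_add bexp_cmult)
  have "bexp (insert x A) p (\<lambda>G. (F G)\<^sup>2) - (bexp (insert x A) p F)\<^sup>2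
      \<le> bexp (insert x A) p (\<lambda>G. (F G - F (G - {x}))\<^sup>2) + (\<Sum>e\<in>A. bexp (insert x A) p (\<lambda>G. (F G - F (G - {e}))\<^sup>2))"
    unfolding mean using first IH sum_le by linarith
  then show ?case
    using insert by simp
qed

lemma bexp_jensen_square:
  assumes "finite A" "\<And>e. e \<in> A \<Longrightarrow> 0 \<le> p e \<and> p e \<le> 1"
  shows "(bexp A p F)\<^sup>2 \<le> bexp A p (\<lambda>G. (F G)\<^sup>2)"
proof -
  define m where "m = bexp A p F"
  have "0 \<le> bexp A p (\<lambda>G. (F G - m)\<^sup>2)"
    using assms by (intro bexp_nonneg) auto
  also have "bexp A p (\<lambda>G. (F G - m)\<^sup>2) = bexp A p (\<lambda>G. (F G)\<^sup>2) - m\<^sup>2"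
    using assms(1)
    by (simp add: power2_diff bexp_add bexp_diff bexp_const bexp_cmult bexp_multc mult.assoc m_def[symmetric])
       (simp add: power2_eq_square)
  finally show ?thesis
    by (simp add: m_def)
qed

section \<open>Random walks and the sparse random graph\<close>

lemma finite_vertex_pairs [simp]: "finite (vertex_pairs n)"
  unfolding vertex_pairs_def by (rule finite_subset[of _ "Pow {..<n}"]) auto

lemma pair_in_vertex_pairs [simp]: "{u, v} \<in> vertex_pairs n \<longleftrightarrow> u < n \<and> v < n \<and> u \<noteq> v"
  by (auto simp: vertex_pairs_def card_insert_if)

lemma vertex_pairsE:
  assumes "e \<in> vertex_pairs n"
  obtains u v where "e = {u, v}" "u < v" "v < n"
proof -
  obtain u v where uv: "e = {u, v}" "u \<noteq> v"
    using assms by (auto simp: vertex_pairs_def card_2_iff)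
  then have "u < n" "v < n"
    using assms by (auto simp: vertex_pairs_def)
  then show thesis
    using uv that[of u v] that[of v u] by (cases "u < v") (auto simp: insert_commute)
qed

lemma vertex_pairs_Suc: "vertex_pairs (Suc n) = vertex_pairs n \<union> (\<lambda>u. {u, n}) ` {..<n}"
proof (intro equalityI subsetI)
  fix e assume "e \<in> vertex_pairs (Suc n)"
  then obtain u v where "e = {u, v}" "u < v" "v < Suc n"
    by (rule vertex_pairsE)
  then show "e \<in> vertex_pairs n \<union> (\<lambda>u. {u, n}) ` {..<n}"
    by (cases "v = n") auto
qed (auto simp: vertex_pairs_def card_insert_if)

lemma sum_vertex_pairs_Suc:
  "(\<Sum>e\<in>vertex_pairs (Suc n). f e) = (\<Sum>e\<in>vertex_pairs n. f e) + (\<Sum>u<n. f {u, n})"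
proof -
  have "inj_on (\<lambda>u. {u, n}) {..<n}"
    by (auto simp: inj_on_def doubleton_eq_iff)
  moreover have "vertex_pairs n \<inter> (\<lambda>u. {u, n}) ` {..<n} = {}"
    by (auto simp: vertex_pairs_def)
  ultimately show ?thesis
    by (simp add: vertex_pairs_Suc sum.union_disjoint sum.reindex)
qed

lemma sum_vertex_pairs: "(\<Sum>e\<in>vertex_pairs n. f e) = (\<Sum>v<n. \<Sum>u<v. f {u, v})"
proof (induction n)
  case 0
  have "vertex_pairs 0 = {}" by (auto simp: vertex_pairs_def)
  then show ?case by simp
qed (simp add: sum_vertex_pairs_Suc)

lemma card_vertex_pairs: "real (card (vertex_pairs n)) = real n * (real n - 1) / 2"
proof -
  have "real (card (vertex_pairs n)) = (\<Sum>e\<in>vertex_pairs n. 1)"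
    by simp
  also have "\<dots> = (\<Sum>v<n. real v)"
    by (simp only: sum_vertex_pairs) simp
  also have "\<dots> = real n * (real n - 1) / 2"
    by (induction n) (auto simp: field_simps)
  finally show ?thesis .
qed

lemma sum_constant_le:
  fixes y :: real
  assumes "card A \<le> m" "0 \<le> y"
  shows "(\<Sum>x\<in>A. y) \<le> real m * y"
  using assms by (auto intro!: mult_right_mono)

text \<open>The pairs exposed when a walk leaves \<open>v\<close>, as opposed to those of
  \<open>pairs_off\<close>, which are still unexposed. For \<open>v\<close> in \<open>T\<close> the
  two sets are disjoint, which is the source of every conditional independence below.\<close>

definition star :: "nat \<Rightarrow> nat set \<Rightarrow> nat \<Rightarrow> nat set set" where
  "star n T v = (\<lambda>w. {v, w}) ` ({..<n} - T)"

definition pairs_off :: "nat \<Rightarrow> nat set \<Rightarrow> nat set set" where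
  "pairs_off n T = {e \<in> vertex_pairs n. e \<inter> T = {}}"

lemma inj_on_doubleton [simp]: "inj_on (\<lambda>w. {v, w}) A"
  by (auto simp: inj_on_def doubleton_eq_iff)

lemma finite_star [simp]: "finite (star n T v)"
  by (simp add: star_def)

lemma finite_pairs_off [simp]: "finite (pairs_off n T)"
  by (simp add: pairs_off_def)

lemma star_subset: "v \<in> T \<Longrightarrow> T \<subseteq> {..<n} \<Longrightarrow> star n T v \<subseteq> vertex_pairs n"
  by (auto simp: star_def)

lemma pairs_off_subset: "pairs_off n T \<subseteq> vertex_pairs n"
  by (auto simp: pairs_off_def)

lemma star_pairs_off_disjoint: "v \<in> T \<Longrightarrow> star n T v \<inter> pairs_off n T = {}"
  by (auto simp: star_def pairs_off_def)

text \<open>\<open>long r G v T\<close>: a self-avoiding walk with \<open>r\<close> steps starts at \<open>v\<close> and avoids \<open>T\<close>. The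
  set \<open>T\<close> contains \<open>v\<close> and accumulates the visited vertices; each step therefore only depends on
  edges not queried before, which makes the recursion for the probabilities exact.\<close>

primrec long :: "nat \<Rightarrow> nat set set \<Rightarrow> nat \<Rightarrow> nat set \<Rightarrow> bool" where
  "long 0 G v T \<longleftrightarrow> True"
| "long (Suc r) G v T \<longleftrightarrow> (\<exists>w. w \<notin> T \<and> {v, w} \<in> G \<and> long r G w (insert w T))"

text \<open>The walk closes up: some visited vertex other than the predecessor \<open>p\<close> is adjacent to
  the current one, within \<open>r\<close> steps.\<close>

primrec closes :: "nat \<Rightarrow> nat set set \<Rightarrow> nat \<Rightarrow> nat set \<Rightarrow> nat \<Rightarrow> bool" where
  "closes 0 G v T p \<longleftrightarrow> False"
| "closes (Suc r) G v T p \<longleftrightarrow> (\<exists>s\<in>T - {v, p}. {v, s} \<in> G) \<or>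
     (\<exists>w. w \<notin> T \<and> {v, w} \<in> G \<and> closes r G w (insert w T) v)"

section \<open>Locality of walks and exposure of one vertex at a time\<close>

lemma long_mono: "long r G v T' \<Longrightarrow> T \<subseteq> T' \<Longrightarrow> long r G v T"
proof (induction r arbitrary: v T T')
  case (Suc r)
  then obtain w where "w \<notin> T'" "{v, w} \<in> G" "long r G w (insert w T')"
    by auto
  with Suc.prems Suc.IH[of w "insert w T'" "insert w T"] show ?case
    by auto
qed simp

text \<open>Each step inspects only pairs from the current vertex to an unvisited one, so pairs
  inside the visited set are irrelevant.\<close>

lemma long_cong:
  assumes "\<And>e. e \<inter> T \<subseteq> {v} \<Longrightarrow> e \<in> G \<longleftrightarrow> e \<in> G'"
  shows "long r G v T \<longleftrightarrow> long r G' v T"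
  using assms
proof (induction r arbitrary: v T)
  case (Suc r)
  have "long r G w (insert w T) \<longleftrightarrow> long r G' w (insert w T)" if "w \<notin> T" for w
    using that by (intro Suc.IH Suc.prems) auto
  moreover have "{v, w} \<in> G \<longleftrightarrow> {v, w} \<in> G'" if "w \<notin> T" for w
    using that by (intro Suc.prems) auto
  ultimately show ?case by auto
qed simp

text \<open>For \<open>p\<close> in \<open>T\<close>, the edge \<open>{v, p}\<close> by which the
  walk arrived is never inspected again, so the event may be multiplied with the presence of that
  edge.\<close>

lemma closes_cong:
  assumes "\<And>e. \<not> e \<subseteq> T \<or> (v \<in> e \<and> p \<notin> e) \<Longrightarrow> e \<in> G \<longleftrightarrow> e \<in> G'" "v \<in> T" "v \<noteq> p"
  shows "closes r G v T p \<longleftrightarrow> closes r G' v T p"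
  using assms
proof (induction r arbitrary: v T p)
  case (Suc r)
  have "closes r G w (insert w T) v \<longleftrightarrow> closes r G' w (insert w T) v" if "w \<notin> T" for w
  proof (rule Suc.IH)
    show "w \<in> insert w T" "w \<noteq> v" using that Suc.prems by auto
    fix e :: "nat set" assume "\<not> e \<subseteq> insert w T \<or> (w \<in> e \<and> v \<notin> e)"
    then show "e \<in> G \<longleftrightarrow> e \<in> G'"
      using that by (intro Suc.prems) auto
  qed
  moreover have "{v, w} \<in> G \<longleftrightarrow> {v, w} \<in> G'" if "w \<notin> T" for w
    using that by (intro Suc.prems) auto
  moreover have "{v, s} \<in> G \<longleftrightarrow> {v, s} \<in> G'" if "s \<in> T - {v, p}" for s
    using that \<open>v \<noteq> p\<close> by (intro Suc.prems) auto
  ultimately show ?case by auto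
qed simp

text \<open>For a graph \<open>H\<close> on the pairs off \<open>T\<close>, this is the conditional
  mean number of neighbours of \<open>v\<close> from which the walk goes on for \<open>r\<close>
  steps.\<close>

definition walk_mass :: "(nat set \<Rightarrow> real) \<Rightarrow> nat \<Rightarrow> nat \<Rightarrow> nat set set \<Rightarrow> nat set \<Rightarrow> nat \<Rightarrow> real" where
  "walk_mass p n r H T v = (\<Sum>w\<in>{..<n} - T. p {v, w} * of_bool (long r H w (insert w T)))"

lemma bexp_star_none:
  assumes "finite T'" 
  shows "bexp (star n T v) p (\<lambda>G. \<Prod>w\<in>{..<n} - T. 1 - of_bool ({v, w} \<in> G) * f w)
       = (\<Prod>w\<in>{..<n} - T. 1 - p {v, w} * f w)"
proof -
  \<comment> \<open>The factors are indexed by vertices, but \<open>bexp_prod\<close> is indexed by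
    edges; \<open>g\<close> reads the endpoint back from the edge.\<close>
  define g where "g e = f (THE w. e = {v, w})" for e
  have g: "g {v, w} = f w" for w
    unfolding g_def by (intro arg_cong[where f=f]) (auto simp: doubleton_eq_iff)
  have "(\<Prod>w\<in>{..<n} - T. 1 - of_bool ({v, w} \<in> G) * f w)
      = (\<Prod>e\<in>star n T v. if e \<in> G then 1 - g e else 1)" for G
    unfolding star_def by (subst prod.reindex) (auto intro!: prod.cong simp: g)
  then have "bexp (star n T v) p (\<lambda>G. \<Prod>w\<in>{..<n} - T. 1 - of_bool ({v, w} \<in> G) * f w)
      = (\<Prod>e\<in>star n T v. p e * (1 - g e) + (1 - p e) * 1)"
    by (simp only: bexp_prod finite_star)
  also have "\<dots> = (\<Prod>w\<in>{..<n} - T. 1 - p {v, w} * f w)"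
    unfolding star_def by (subst prod.reindex) (auto intro!: prod.cong simp: g algebra_simps)
  finally show ?thesis .
qed

lemma of_bool_not_long_Suc:
  assumes "G \<subseteq> vertex_pairs n" "v \<in> T"
  shows "of_bool (\<not> long (Suc r) G v T)
    = (\<Prod>w\<in>{..<n} - T. 1 - of_bool ({v, w} \<in> G) * of_bool (long r G w (insert w T)) :: real)"
proof (cases "long (Suc r) G v T")
  case True
  then obtain w where w: "w \<notin> T" "{v, w} \<in> G" "long r G w (insert w T)"
    by auto
  then have "w < n"
    using assms pair_in_vertex_pairs by blast
  then have "(\<Prod>w\<in>{..<n} - T. 1 - of_bool ({v, w} \<in> G) * of_bool (long r G w (insert w T)) :: real) = 0"
    using w by (intro prod_zero) auto
  with True show ?thesis by simp
next
  case False
  then have "(\<Prod>w\<in>{..<n} - T. 1 - of_bool ({v, w} \<in> G) * of_bool (long r G w (insert w T)) :: real) = 1"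
    by (intro prod.neutral) auto
  with False show ?thesis by simp
qed

lemma long_restrict_off:
  assumes "w \<notin> T" "w < n" "H \<subseteq> pairs_off n T" "G \<inter> pairs_off n T = H" "G \<subseteq> vertex_pairs n"
  shows "long r G w (insert w T) \<longleftrightarrow> long r H w (insert w T)"
proof (rule long_cong)
  fix e :: "nat set" assume "e \<inter> insert w T \<subseteq> {w}"
  then have "e \<inter> T = {}" using assms(1) by auto
  then show "e \<in> G \<longleftrightarrow> e \<in> H"
    using assms by (auto simp: pairs_off_def)
qed

text \<open>Expose the pairs off \<open>T\<close> first: they decide from which \<open>w\<close> the
  walk can continue. The edges at \<open>v\<close> are independent of them and of each other, so the
  conditional probability that none of them leads on is a product.\<close>

lemma bexp_not_long_Suc:
  assumes "v \<in> T" "T \<subseteq> {..<n}"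
  shows "bexp (vertex_pairs n) p (\<lambda>G. of_bool (\<not> long (Suc r) G v T))
    = bexp (pairs_off n T) p (\<lambda>H. \<Prod>w\<in>{..<n} - T. 1 - p {v, w} * of_bool (long r H w (insert w T)))"
proof -
  define B where "B = pairs_off n T \<union> star n T v"
  define P where "P G = (\<Prod>w\<in>{..<n} - T. 1 - of_bool ({v, w} \<in> G) * of_bool (long r G w (insert w T)) :: real)" for G
  have B: "B \<subseteq> vertex_pairs n"
    using star_subset[OF assms] pairs_off_subset by (auto simp: B_def)
  have "bexp (vertex_pairs n) p (\<lambda>G. of_bool (\<not> long (Suc r) G v T)) = bexp (vertex_pairs n) p P"
    using assms(1) by (intro bexp_cong) (simp only: of_bool_not_long_Suc P_def)
  also have "\<dots> = bexp B p P"
  proof (rule bexp_marginal)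
    fix G assume G: "G \<subseteq> vertex_pairs n"
    have "long r G w (insert w T) \<longleftrightarrow> long r (G \<inter> B) w (insert w T)" if "w < n" "w \<notin> T" for w
      using that G assms B
        long_restrict_off[of w T n "G \<inter> pairs_off n T" G r]
        long_restrict_off[of w T n "G \<inter> pairs_off n T" "G \<inter> B" r]
      by (auto simp: B_def)
    moreover have "{v, w} \<in> G \<longleftrightarrow> {v, w} \<in> G \<inter> B" if "w < n" "w \<notin> T" for w
      using that by (auto simp: B_def star_def)
    ultimately show "P G = P (G \<inter> B)"
      unfolding P_def by (intro prod.cong) auto
  qed (use B in auto)
  also have "\<dots> = bexp (pairs_off n T) p (\<lambda>H. bexp (star n T v) p (\<lambda>N. P (H \<union> N)))"
    unfolding B_def using star_pairs_off_disjoint[OF assms(1)] by (intro bexp_union) auto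
  also have "\<dots> = bexp (pairs_off n T) p (\<lambda>H. \<Prod>w\<in>{..<n} - T. 1 - p {v, w} * of_bool (long r H w (insert w T)))"
  proof (rule bexp_cong)
    fix H assume H: "H \<subseteq> pairs_off n T"
    have "bexp (star n T v) p (\<lambda>N. P (H \<union> N)) = bexp (star n T v) p
        (\<lambda>N. \<Prod>w\<in>{..<n} - T. 1 - of_bool ({v, w} \<in> N) * of_bool (long r H w (insert w T)))"
    proof (rule bexp_cong)
      fix N assume N: "N \<subseteq> star n T v"
      have HN: "(H \<union> N) \<inter> pairs_off n T = H" "H \<union> N \<subseteq> vertex_pairs n"
        using H N star_pairs_off_disjoint[OF assms(1)] B by (auto simp: B_def)
      have "{v, w} \<notin> H" for w
        using H assms(1) by (auto simp: pairs_off_def)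
      then show "P (H \<union> N) = (\<Prod>w\<in>{..<n} - T. 1 - of_bool ({v, w} \<in> N) * of_bool (long r H w (insert w T)))"
        unfolding P_def using long_restrict_off[OF _ _ H HN] by (intro prod.cong) auto
    qed
    then show "bexp (star n T v) p (\<lambda>N. P (H \<union> N))
        = (\<Prod>w\<in>{..<n} - T. 1 - p {v, w} * of_bool (long r H w (insert w T)))"
      by (simp only: bexp_star_none[OF finite.emptyI])
  qed
  finally show ?thesis .
qed

text \<open>Both walks avoid the same \<open>T\<close>, hence continue in the same graph
  \<open>H\<close>, and the stars of \<open>u\<close> and \<open>v\<close> are disjoint. Given
  \<open>H\<close> the two failures are independent, so only fluctuations of \<open>H\<close> can
  correlate them.\<close>

lemma bexp_not_long_Suc2:
  assumes "u \<in> T" "v \<in> T" "u \<noteq> v" "T \<subseteq> {..<n}"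
  shows "bexp (vertex_pairs n) p (\<lambda>G. of_bool (\<not> long (Suc r) G u T \<and> \<not> long (Suc r) G v T))
    = bexp (pairs_off n T) p (\<lambda>H. (\<Prod>w\<in>{..<n} - T. 1 - p {u, w} * of_bool (long r H w (insert w T)))
        * (\<Prod>w\<in>{..<n} - T. 1 - p {v, w} * of_bool (long r H w (insert w T))))"
proof -
  define B where "B = pairs_off n T \<union> (star n T u \<union> star n T v)"
  define P where "P v G = (\<Prod>w\<in>{..<n} - T. 1 - of_bool ({v, w} \<in> G) * of_bool (long r G w (insert w T)) :: real)" for v G
  have disj: "star n T u \<inter> star n T v = {}"
    using assms by (auto simp: star_def doubleton_eq_iff)
  have B: "B \<subseteq> vertex_pairs n"
    using star_subset[OF assms(1,4)] star_subset[OF assms(2,4)] pairs_off_subset by (auto simp: B_def)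
  have "bexp (vertex_pairs n) p (\<lambda>G. of_bool (\<not> long (Suc r) G u T \<and> \<not> long (Suc r) G v T))
      = bexp (vertex_pairs n) p (\<lambda>G. P u G * P v G)"
    using assms(1,2) by (intro bexp_cong) (simp only: of_bool_conj of_bool_not_long_Suc P_def)
  also have "\<dots> = bexp B p (\<lambda>G. P u G * P v G)"
  proof (rule bexp_marginal)
    fix G assume G: "G \<subseteq> vertex_pairs n"
    have "long r G w (insert w T) \<longleftrightarrow> long r (G \<inter> B) w (insert w T)" if "w < n" "w \<notin> T" for w
      using that G assms B
        long_restrict_off[of w T n "G \<inter> pairs_off n T" G r]
        long_restrict_off[of w T n "G \<inter> pairs_off n T" "G \<inter> B" r]
      by (auto simp: B_def)
    moreover have "{x, w} \<in> G \<longleftrightarrow> {x, w} \<in> G \<inter> B" if "w < n" "w \<notin> T" "x = u \<or> x = v" for w x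
      using that by (auto simp: B_def star_def)
    ultimately show "P u G * P v G = P u (G \<inter> B) * P v (G \<inter> B)"
      unfolding P_def by (intro arg_cong2[where f="(*)"] prod.cong) auto
  qed (use B in auto)
  also have "\<dots> = bexp (pairs_off n T) p (\<lambda>H. bexp (star n T u) p (\<lambda>N. bexp (star n T v) p (\<lambda>N'.
      P u (H \<union> (N \<union> N')) * P v (H \<union> (N \<union> N')))))"
    unfolding B_def using star_pairs_off_disjoint[OF assms(1)] star_pairs_off_disjoint[OF assms(2)] disj
    by (subst bexp_union; (subst bexp_union)?) auto
  also have "\<dots> = bexp (pairs_off n T) p (\<lambda>H. (\<Prod>w\<in>{..<n} - T. 1 - p {u, w} * of_bool (long r H w (insert w T)))
        * (\<Prod>w\<in>{..<n} - T. 1 - p {v, w} * of_bool (long r H w (insert w T))))"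
  proof (rule bexp_cong)
    fix H assume H: "H \<subseteq> pairs_off n T"
    define Q where "Q x N = (\<Prod>w\<in>{..<n} - T. 1 - of_bool ({x, w} \<in> N) * of_bool (long r H w (insert w T)) :: real)" for x N
    have "bexp (star n T u) p (\<lambda>N. bexp (star n T v) p (\<lambda>N'.
        P u (H \<union> (N \<union> N')) * P v (H \<union> (N \<union> N'))))
      = bexp (star n T u) p (\<lambda>N. bexp (star n T v) p (\<lambda>N'. Q u N * Q v N'))"
    proof (intro bexp_cong)
      fix N N' assume N: "N \<subseteq> star n T u" and N': "N' \<subseteq> star n T v"
      have HN: "(H \<union> (N \<union> N')) \<inter> pairs_off n T = H" "H \<union> (N \<union> N') \<subseteq> vertex_pairs n"
        using H N N' star_pairs_off_disjoint[OF assms(1), of n] star_pairs_off_disjoint[OF assms(2), of n] B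
        by (auto simp: B_def)
      have H0: "{u, w} \<notin> H" "{v, w} \<notin> H" for w
        using H assms(1,2) by (auto simp: pairs_off_def)
      have N0: "{v, w} \<notin> N" "{u, w} \<notin> N'" if "w \<notin> T" for w
        using N N' assms that by (auto simp: star_def doubleton_eq_iff)
      have "P u (H \<union> (N \<union> N')) = Q u N" "P v (H \<union> (N \<union> N')) = Q v N'"
        unfolding P_def Q_def using long_restrict_off[OF _ _ H HN] H0 N0
        by (auto intro!: prod.cong)
      then show "P u (H \<union> (N \<union> N')) * P v (H \<union> (N \<union> N')) = Q u N * Q v N'" by simp
    qed
    also have "\<dots> = bexp (star n T u) p (Q u) * bexp (star n T v) p (Q v)"
      by (simp add: bexp_cmult bexp_multc)
    finally show "bexp (star n T u) p (\<lambda>N. bexp (star n T v) p (\<lambda>N'.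
        P u (H \<union> (N \<union> N')) * P v (H \<union> (N \<union> N'))))
      = (\<Prod>w\<in>{..<n} - T. 1 - p {u, w} * of_bool (long r H w (insert w T)))
        * (\<Prod>w\<in>{..<n} - T. 1 - p {v, w} * of_bool (long r H w (insert w T)))"
      unfolding Q_def by (simp only: bexp_star_none[OF finite.emptyI])
  qed
  finally show ?thesis .
qed

text \<open>A union bound along the walk: each step branches with mean at most \<open>c\<close>, and
  a closing edge ends in one of at most \<open>s + r\<close> visited vertices, each with probability
  at most c/n. The power of \<open>c + 1\<close> absorbs the branching.\<close>

lemma bexp_closes_le:
  assumes "\<And>e. e \<in> vertex_pairs n \<Longrightarrow> 0 \<le> p e \<and> p e \<le> c / real n" "0 \<le> c" "c \<le> real n"
    "v \<in> T" "q \<in> T" "v \<noteq> q" "T \<subseteq> {..<n}" "card T \<le> s"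
  shows "bexp (vertex_pairs n) p (\<lambda>G. of_bool (closes r G v T q)) \<le> real r * (c + 1) ^ Suc r * real (s + r) / real n"
  using assms(4-8)
proof (induction r arbitrary: v T q s)
  case 0
  then show ?case by (simp add: bexp_const)
next
  case (Suc r)
  have n: "n > 0" using Suc.prems by (metis empty_iff lessThan_0 neq0_conv subset_empty)
  have finT: "finite T" using Suc.prems finite_subset by blast
  have p01: "0 \<le> p e \<and> p e \<le> 1" if "e \<in> vertex_pairs n" for e
    using assms(1)[OF that] assms(3) n by (auto intro: order_trans simp: divide_le_eq)
  define b where "b = real r * (c + 1) ^ Suc r * real (Suc s + r) / real n"
  have b0: "0 \<le> b" using assms(2) by (simp add: b_def)
  have "bexp (vertex_pairs n) p (\<lambda>G. of_bool (closes (Suc r) G v T q))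
     \<le> bexp (vertex_pairs n) p (\<lambda>G. (\<Sum>x\<in>T - {v, q}. of_bool ({v, x} \<in> G))
          + (\<Sum>w\<in>{..<n} - T. of_bool ({v, w} \<in> G) * of_bool (closes r G w (insert w T) v)))"
  proof (rule bexp_mono[OF p01])
    fix G assume G: "G \<subseteq> vertex_pairs n"
    show "of_bool (closes (Suc r) G v T q) \<le> (\<Sum>x\<in>T - {v, q}. of_bool ({v, x} \<in> G))
          + (\<Sum>w\<in>{..<n} - T. of_bool ({v, w} \<in> G) * of_bool (closes r G w (insert w T) v) :: real)"
    proof (cases "closes (Suc r) G v T q")
      case True
      then consider x where "x \<in> T - {v, q}" "{v, x} \<in> G"
        | w where "w \<notin> T" "{v, w} \<in> G" "closes r G w (insert w T) v"
        by auto
      then show ?thesis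
      proof cases
        case 1
        then have "(1::real) \<le> (\<Sum>x\<in>T - {v, q}. of_bool ({v, x} \<in> G))"
          using finT member_le_sum[of x "T - {v, q}" "\<lambda>x. of_bool ({v, x} \<in> G) :: real"] by auto
        moreover have "0 \<le> (\<Sum>w\<in>{..<n} - T. of_bool ({v, w} \<in> G) * of_bool (closes r G w (insert w T) v) :: real)"
          by (intro sum_nonneg) auto
        ultimately show ?thesis using True by simp
      next
        case 2
        then have "w < n" using G by (metis pair_in_vertex_pairs subsetD)
        then have "(1::real) \<le> (\<Sum>w\<in>{..<n} - T. of_bool ({v, w} \<in> G) * of_bool (closes r G w (insert w T) v))"
          using 2 member_le_sum[of w "{..<n} - T"
              "\<lambda>w. of_bool ({v, w} \<in> G) * of_bool (closes r G w (insert w T) v) :: real"] by auto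
        moreover have "0 \<le> (\<Sum>x\<in>T - {v, q}. of_bool ({v, x} \<in> G) :: real)"
          by (intro sum_nonneg) auto
        ultimately show ?thesis using True by simp
      qed
    qed (auto intro!: add_nonneg_nonneg sum_nonneg)
  qed
  also have "\<dots> = (\<Sum>x\<in>T - {v, q}. p {v, x})
      + (\<Sum>w\<in>{..<n} - T. p {v, w} * bexp (vertex_pairs n) p (\<lambda>G. of_bool (closes r G w (insert w T) v)))"
    unfolding bexp_add bexp_sum
  proof (intro arg_cong2[where f="(+)"] sum.cong refl)
    fix x assume "x \<in> T - {v, q}"
    then show "bexp (vertex_pairs n) p (\<lambda>G. of_bool ({v, x} \<in> G)) = p {v, x}"
      using Suc.prems by (intro bexp_edge) auto
  next
    fix w assume w: "w \<in> {..<n} - T"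
    show "bexp (vertex_pairs n) p (\<lambda>G. of_bool ({v, w} \<in> G) * of_bool (closes r G w (insert w T) v))
        = p {v, w} * bexp (vertex_pairs n) p (\<lambda>G. of_bool (closes r G w (insert w T) v))"
    proof (rule bexp_edge_mult)
      show "{v, w} \<in> vertex_pairs n" using w Suc.prems by auto
      fix G
      have "closes r (insert {v, w} G) w (insert w T) v \<longleftrightarrow> closes r G w (insert w T) v"
        using w Suc.prems by (intro closes_cong) auto
      then show "of_bool (closes r (insert {v, w} G) w (insert w T) v) = of_bool (closes r G w (insert w T) v)"
        by simp
    qed simp
  qed
  finally have step: "bexp (vertex_pairs n) p (\<lambda>G. of_bool (closes (Suc r) G v T q))
      \<le> (\<Sum>x\<in>T - {v, q}. p {v, x})
      + (\<Sum>w\<in>{..<n} - T. p {v, w} * bexp (vertex_pairs n) p (\<lambda>G. of_bool (closes r G w (insert w T) v)))" .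
  have pv: "0 \<le> p {v, x} \<and> p {v, x} \<le> c / n" if "x < n" "x \<noteq> v" for x
    using that Suc.prems by (intro assms(1)) auto
  note step
  also have "(\<Sum>x\<in>T - {v, q}. p {v, x})
      + (\<Sum>w\<in>{..<n} - T. p {v, w} * bexp (vertex_pairs n) p (\<lambda>G. of_bool (closes r G w (insert w T) v)))
      \<le> (\<Sum>x\<in>T - {v, q}. c / n) + (\<Sum>w\<in>{..<n} - T. c / n * b)"
  proof (intro add_mono sum_mono mult_mono)
    fix w assume w: "w \<in> {..<n} - T"
    then show "bexp (vertex_pairs n) p (\<lambda>G. of_bool (closes r G w (insert w T) v)) \<le> b"
      unfolding b_def using Suc.prems finT by (intro Suc.IH) auto
    show "0 \<le> bexp (vertex_pairs n) p (\<lambda>G. of_bool (closes r G w (insert w T) v))"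
      by (intro bexp_nonneg p01) auto
    show "0 \<le> c / n" using assms by simp
    show "p {v, w} \<le> c / n" using pv w Suc.prems by auto
  next
    fix x assume "x \<in> T - {v, q}"
    then show "p {v, x} \<le> c / n" using pv Suc.prems by auto
  qed
  also have "\<dots> \<le> real s * (c / n) + real n * (c / n * b)"
  proof -
    have "card (T - {v, q}) \<le> s" "card ({..<n} - T) \<le> n"
      using Suc.prems finT card_mono[of T "T - {v, q}"] card_mono[of "{..<n}" "{..<n} - T"] by auto
    then show ?thesis
      using assms(2) b0 by (intro add_mono sum_constant_le) auto
  qed
  also have "\<dots> = (real s * c + c * (real r * (c + 1) ^ Suc r * real (Suc s + r))) / n"
    using n by (simp add: b_def field_simps)
  also have "\<dots> \<le> real (Suc r) * (c + 1) ^ Suc (Suc r) * real (s + Suc r) / real n"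
  proof (rule divide_right_mono)
    have "real s * c \<le> real (s + Suc r) * (c + 1) ^ Suc (Suc r)"
    proof (rule mult_mono)
      have "c + 1 \<le> (c + 1) ^ Suc (Suc r)"
        using assms(2) self_le_power[of "c + 1" "Suc (Suc r)"] by auto
      then show "c \<le> (c + 1) ^ Suc (Suc r)" by simp
    qed (use assms(2) in auto)
    moreover have "c * (real r * (c + 1) ^ Suc r * real (Suc s + r))
        \<le> (c + 1) * (real r * (c + 1) ^ Suc r * real (Suc s + r))"
      using assms(2) by (intro mult_right_mono) auto
    ultimately show "real s * c + c * (real r * (c + 1) ^ Suc r * real (Suc s + r))
        \<le> real (Suc r) * (c + 1) ^ Suc (Suc r) * real (s + Suc r)"
      by (simp add: algebra_simps)
  qed (use n in auto)
  finally show ?case .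
qed

text \<open>All that the analysis of walks needs to know about the planted labelling. The limits
  below are uniform over such \<open>p\<close>; balanced labellings supply the property in
  \<open>balanced_imp_regular\<close>.\<close>

definition regular :: "nat \<Rightarrow> real \<Rightarrow> real \<Rightarrow> real \<Rightarrow> (nat set \<Rightarrow> real) \<Rightarrow> bool" where
  "regular n c d \<delta> p \<longleftrightarrow> (\<forall>e\<in>vertex_pairs n. 0 \<le> p e \<and> p e \<le> c / real n) \<and>
     (\<forall>v<n. \<bar>(\<Sum>w\<in>{..<n} - {v}. p {v, w}) - d\<bar> \<le> \<delta>)"

text \<open>\<open>ext_prob d r\<close> is the probability that a Poisson(\<open>d\<close>) branching process dies out
  before generation \<open>r\<close>.\<close>

primrec ext_prob :: "real \<Rightarrow> nat \<Rightarrow> real" where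
  "ext_prob d 0 = 0"
| "ext_prob d (Suc r) = exp (- (d * (1 - ext_prob d r)))"

lemma ext_prob_bounds: "d \<ge> 0 \<Longrightarrow> 0 \<le> ext_prob d r \<and> ext_prob d r \<le> 1"
  by (induction r) (auto intro!: mult_nonneg_nonneg)

text \<open>Poisson approximation: the factors lie in the unit interval and are exchanged one at a
  time, each at the cost of the square of its \<open>x i\<close>.\<close>

lemma abs_prod_diff_exp_le:
  fixes x :: "'i \<Rightarrow> real"
  assumes "\<And>i. i \<in> A \<Longrightarrow> 0 \<le> x i \<and> x i \<le> 1" "finite A"
  shows "\<bar>(\<Prod>i\<in>A. 1 - x i) - exp (- (\<Sum>i\<in>A. x i))\<bar> \<le> (\<Sum>i\<in>A. (x i)\<^sup>2)"
proof -
  have single: "\<bar>1 - y - exp (- y)\<bar> \<le> y\<^sup>2" if "0 \<le> y" "y \<le> 1" for y :: real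
  proof -
    have "1 \<le> (1 + y) * (1 - y + y\<^sup>2)"
      using that by (simp add: algebra_simps power2_eq_square)
    also have "\<dots> \<le> exp y * (1 - y + y\<^sup>2)"
      using that exp_ge_add_one_self[of y] by (intro mult_right_mono) auto
    finally have "exp (- y) \<le> 1 - y + y\<^sup>2"
      by (simp add: exp_minus field_simps)
    moreover have "1 - y \<le> exp (- y)"
      using exp_ge_add_one_self[of "- y"] by simp
    ultimately show ?thesis by (simp add: abs_if)
  qed
  have "\<bar>(\<Prod>i\<in>A. 1 - x i) - (\<Prod>i\<in>A. exp (- x i))\<bar> \<le> (\<Sum>i\<in>A. \<bar>(1 - x i) - exp (- x i)\<bar>)"
    unfolding real_norm_def[symmetric] by (rule norm_prod_diff) (use assms(1) in auto)
  also have "\<dots> \<le> (\<Sum>i\<in>A. (x i)\<^sup>2)"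
    using single assms by (intro sum_mono) auto
  also have "(\<Prod>i\<in>A. exp (- x i)) = exp (- (\<Sum>i\<in>A. x i))"
    using assms(2) by (simp add: exp_sum flip: sum_negf)
  finally show ?thesis .
qed

lemma abs_exp_minus_diff_le:
  fixes x y :: real
  assumes "0 \<le> x" "0 \<le> y"
  shows "\<bar>exp (- x) - exp (- y)\<bar> \<le> \<bar>x - y\<bar>"
proof -
  have *: "exp (- x) - exp (- y) \<le> y - x" if "0 \<le> x" "x \<le> y" for x y :: real
  proof -
    have "exp (- x) - exp (- y) = exp (- x) * (1 - exp (x - y))"
      by (simp add: algebra_simps flip: exp_add)
    also have "\<dots> \<le> 1 * (1 - exp (x - y))"
      using that by (intro mult_right_mono) auto
    also have "\<dots> \<le> y - x"
      using exp_ge_add_one_self[of "x - y"] unfolding mult_1 by linarith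
    finally show ?thesis .
  qed
  show ?thesis
    using *[of x y] *[of y x] assms by (cases "x \<le> y") auto
qed

text \<open>Trades a first absolute moment for a second moment with a free parameter. When the
  second moment is at most \<open>\<beta>\<^sup>2\<close>, both terms have size
  \<open>\<beta>\<close>.\<close>

lemma abs_le_add_square_div:
  fixes y \<beta> :: real
  assumes "\<beta> > 0"
  shows "\<bar>y\<bar> \<le> \<beta> + y\<^sup>2 / \<beta>"
proof (cases "\<bar>y\<bar> \<le> \<beta>")
  case False
  then have "\<bar>y\<bar> * \<beta> \<le> \<bar>y\<bar> * \<bar>y\<bar>"
    using assms by (intro mult_left_mono) auto
  then have "\<bar>y\<bar> \<le> y\<^sup>2 / \<beta>"
    using assms by (simp add: power2_eq_square field_simps)
  then show ?thesis using assms by simp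
qed (use assms in \<open>auto intro: order_trans\<close>)

section \<open>Concentration of the walk mass\<close>

context
  fixes n :: nat and c :: real and p :: "nat set \<Rightarrow> real"
  assumes p: "\<And>e. e \<in> vertex_pairs n \<Longrightarrow> 0 \<le> p e \<and> p e \<le> c / real n"
    and c: "0 \<le> c" "c \<le> real n" "n > 0"
begin

lemma prob_bounds: "e \<in> vertex_pairs n \<Longrightarrow> 0 \<le> p e \<and> p e \<le> 1"
  using p[of e] c by (auto intro: order_trans simp: divide_le_eq)

lemma prob_pair_bounds:
  assumes "v < n" "w < n" "v \<noteq> w"
  shows "0 \<le> p {v, w}" "p {v, w} \<le> 1" "p {v, w} \<le> c / n"
  using p[of "{v, w}"] prob_bounds[of "{v, w}"] assms by auto

lemma prob_off_bounds:
  assumes "v \<in> T" "T \<subseteq> {..<n}" "w < n" "w \<notin> T"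
  shows "0 \<le> p {v, w}" "p {v, w} \<le> 1" "p {v, w} \<le> c / n"
  using prob_pair_bounds[of v w] assms by auto

lemma sum_prob_squares_le:
  assumes "v < n" "A \<subseteq> {..<n} - {v}"
  shows "(\<Sum>w\<in>A. (p {v, w})\<^sup>2) \<le> c\<^sup>2 / n"
proof -
  have "(\<Sum>w\<in>A. (p {v, w})\<^sup>2) \<le> (\<Sum>w\<in>A. (c / n)\<^sup>2)"
  proof (intro sum_mono power_mono)
    fix w assume "w \<in> A"
    then have "w < n" "v \<noteq> w" using assms by auto
    then show "0 \<le> p {v, w}" "p {v, w} \<le> c / n"
      using prob_pair_bounds[of v w] assms by auto
  qed
  also have "\<dots> \<le> real n * (c / n)\<^sup>2"
  proof -
    have "A \<subseteq> {..<n}" using assms by auto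
    then have "card A \<le> n" using card_mono[of "{..<n}" A] by simp
    then show ?thesis by (auto intro!: mult_right_mono)
  qed
  also have "\<dots> = c\<^sup>2 / n"
    using c by (simp add: power2_eq_square)
  finally show ?thesis .
qed

lemma walk_mass_bounds:
  assumes "v \<in> T" "T \<subseteq> {..<n}"
  shows "0 \<le> walk_mass p n r H T v" "walk_mass p n r H T v \<le> c"
proof -
  show "0 \<le> walk_mass p n r H T v"
    unfolding walk_mass_def using assms prob_off_bounds[OF assms(1,2)] by (intro sum_nonneg) auto
  have "walk_mass p n r H T v \<le> (\<Sum>w\<in>{..<n} - T. c / n * 1)"
    unfolding walk_mass_def using assms prob_off_bounds[OF assms(1,2)] c by (intro sum_mono mult_mono) auto
  also have "\<dots> \<le> real n * (c / n)"
    unfolding mult_1_right using card_mono[of "{..<n}" "{..<n} - T"] c by (intro sum_constant_le) auto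
  finally show "walk_mass p n r H T v \<le> c"
    using c by simp
qed

lemma prod_walk_approx:
  assumes "v \<in> T" "T \<subseteq> {..<n}"
  shows "\<bar>(\<Prod>w\<in>{..<n} - T. 1 - p {v, w} * of_bool (long r H w (insert w T)))
           - exp (- walk_mass p n r H T v)\<bar> \<le> c\<^sup>2 / n"
proof -
  have "\<bar>(\<Prod>w\<in>{..<n} - T. 1 - p {v, w} * of_bool (long r H w (insert w T)))
           - exp (- walk_mass p n r H T v)\<bar>
      \<le> (\<Sum>w\<in>{..<n} - T. (p {v, w} * of_bool (long r H w (insert w T)))\<^sup>2)"
    unfolding walk_mass_def using assms prob_off_bounds[OF assms(1,2)]
    by (intro abs_prod_diff_exp_le) auto
  also have "\<dots> \<le> (\<Sum>w\<in>{..<n} - T. (p {v, w})\<^sup>2)"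
    by (intro sum_mono) auto
  also have "\<dots> \<le> c\<^sup>2 / n"
    using assms by (intro sum_prob_squares_le) auto
  finally show ?thesis .
qed

lemma prod_walk_approx_limit:
  assumes "v \<in> T" "T \<subseteq> {..<n}" "0 \<le> \<mu>" "\<beta> > 0"
  shows "\<bar>(\<Prod>w\<in>{..<n} - T. 1 - p {v, w} * of_bool (long r H w (insert w T))) - exp (- \<mu>)\<bar>
    \<le> c\<^sup>2 / n + \<beta> + (walk_mass p n r H T v - \<mu>)\<^sup>2 / \<beta>"
  using prod_walk_approx[OF assms(1,2), of r H]
    abs_exp_minus_diff_le[OF walk_mass_bounds(1)[OF assms(1,2), of r H] assms(3)]
    abs_le_add_square_div[OF assms(4), of "walk_mass p n r H T v - \<mu>"]
  by linarith

lemma prod_walk_01: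
  assumes "v \<in> T" "T \<subseteq> {..<n}"
  shows "0 \<le> (\<Prod>w\<in>{..<n} - T. 1 - p {v, w} * of_bool (long r H w (insert w T)))"
    "(\<Prod>w\<in>{..<n} - T. 1 - p {v, w} * of_bool (long r H w (insert w T))) \<le> 1"
  using assms prob_off_bounds[OF assms(1,2)] by (auto intro!: prod_nonneg prod_le_1)

lemma bexp_abs_diff_le:
  assumes "finite A" "A \<subseteq> vertex_pairs n" "\<And>H. H \<subseteq> A \<Longrightarrow> \<bar>F H - t\<bar> \<le> B H"
  shows "\<bar>bexp A p F - t\<bar> \<le> bexp A p B"
proof -
  have "bexp A p (\<lambda>H. F H - t) \<le> bexp A p B" "bexp A p (\<lambda>H. t - F H) \<le> bexp A p B"
    using assms(2,3) prob_bounds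
    by (auto intro!: bexp_mono simp: abs_le_iff)
  then show ?thesis
    using assms(1) by (simp add: bexp_diff bexp_const abs_le_iff)
qed

lemma not_long_Suc_approx:
  assumes T: "v \<in> T" "T \<subseteq> {..<n}" and "0 \<le> \<mu>" "\<beta> > 0"
    and conc: "bexp (pairs_off n T) p (\<lambda>H. (walk_mass p n r H T v - \<mu>)\<^sup>2) \<le> \<eta>"
  shows "\<bar>bexp (vertex_pairs n) p (\<lambda>G. of_bool (\<not> long (Suc r) G v T)) - exp (- \<mu>)\<bar>
     \<le> c\<^sup>2 / n + \<beta> + \<eta> / \<beta>"
proof -
  have "\<bar>bexp (vertex_pairs n) p (\<lambda>G. of_bool (\<not> long (Suc r) G v T)) - exp (- \<mu>)\<bar>
     \<le> bexp (pairs_off n T) p (\<lambda>H. c\<^sup>2 / n + \<beta> + (walk_mass p n r H T v - \<mu>)\<^sup>2 / \<beta>)"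
    unfolding bexp_not_long_Suc[OF T]
    by (intro bexp_abs_diff_le prod_walk_approx_limit assms) (auto simp: pairs_off_subset)
  also have "\<dots> \<le> c\<^sup>2 / n + \<beta> + \<eta> / \<beta>"
    unfolding bexp_add bexp_divide using conc \<open>\<beta> > 0\<close> by (auto simp: bexp_const intro!: divide_right_mono)
  finally show ?thesis .
qed

lemma not_long_Suc2_approx:
  assumes T: "u \<in> T" "v \<in> T" "u \<noteq> v" "T \<subseteq> {..<n}" and l: "0 \<le> \<mu>" "\<beta> > 0"
    and conc: "bexp (pairs_off n T) p (\<lambda>H. (walk_mass p n r H T u - \<mu>)\<^sup>2) \<le> \<eta>"
       "bexp (pairs_off n T) p (\<lambda>H. (walk_mass p n r H T v - \<mu>)\<^sup>2) \<le> \<eta>"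
  shows "\<bar>bexp (vertex_pairs n) p (\<lambda>G. of_bool (\<not> long (Suc r) G u T \<and> \<not> long (Suc r) G v T)) - (exp (- \<mu>))\<^sup>2\<bar>
     \<le> 2 * (c\<^sup>2 / n + \<beta> + \<eta> / \<beta>)"
proof -
  define P where "P v H = (\<Prod>w\<in>{..<n} - T. 1 - p {v, w} * of_bool (long r H w (insert w T)))" for v H
  have "\<bar>P u H * P v H - (exp (- \<mu>))\<^sup>2\<bar>
      \<le> (c\<^sup>2 / n + \<beta> + (walk_mass p n r H T u - \<mu>)\<^sup>2 / \<beta>) + (c\<^sup>2 / n + \<beta> + (walk_mass p n r H T v - \<mu>)\<^sup>2 / \<beta>)" for H
  proof -
    have "P u H * P v H - (exp (- \<mu>))\<^sup>2 = P u H * (P v H - exp (- \<mu>)) + exp (- \<mu>) * (P u H - exp (- \<mu>))"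
      by (simp add: algebra_simps power2_eq_square)
    also have "\<bar>\<dots>\<bar> \<le> \<bar>P u H\<bar> * \<bar>P v H - exp (- \<mu>)\<bar> + \<bar>exp (- \<mu>)\<bar> * \<bar>P u H - exp (- \<mu>)\<bar>"
      by (metis abs_mult abs_triangle_ineq)
    also have "\<dots> \<le> 1 * \<bar>P v H - exp (- \<mu>)\<bar> + 1 * \<bar>P u H - exp (- \<mu>)\<bar>"
      using prod_walk_01[OF T(1,4), of r H] l by (intro add_mono mult_right_mono) (auto simp: P_def)
    also have "\<dots> \<le> (c\<^sup>2 / n + \<beta> + (walk_mass p n r H T u - \<mu>)\<^sup>2 / \<beta>) + (c\<^sup>2 / n + \<beta> + (walk_mass p n r H T v - \<mu>)\<^sup>2 / \<beta>)"
      using prod_walk_approx_limit[OF T(1,4) l, of r H] prod_walk_approx_limit[OF T(2,4) l, of r H]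
      by (simp add: P_def)
    finally show ?thesis .
  qed
  then have "\<bar>bexp (vertex_pairs n) p (\<lambda>G. of_bool (\<not> long (Suc r) G u T \<and> \<not> long (Suc r) G v T)) - (exp (- \<mu>))\<^sup>2\<bar>
     \<le> bexp (pairs_off n T) p (\<lambda>H. (c\<^sup>2 / n + \<beta> + (walk_mass p n r H T u - \<mu>)\<^sup>2 / \<beta>) + (c\<^sup>2 / n + \<beta> + (walk_mass p n r H T v - \<mu>)\<^sup>2 / \<beta>))"
    unfolding bexp_not_long_Suc2[OF T] P_def
    by (intro bexp_abs_diff_le) (auto simp: pairs_off_subset)
  also have "\<dots> \<le> (c\<^sup>2 / n + \<beta> + \<eta> / \<beta>) + (c\<^sup>2 / n + \<beta> + \<eta> / \<beta>)"
    unfolding bexp_add bexp_divide using conc \<open>\<beta> > 0\<close>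
    by (intro add_mono divide_right_mono) (auto simp: bexp_const)
  finally show ?thesis by simp
qed

text \<open>A second moment computation. The diagonal costs at most c^2/n, and off the diagonal
  \<open>pair\<close> makes the continuation events nearly uncorrelated. Replacing the degree sum
  \<open>S\<close> by \<open>d\<close> costs \<open>\<delta>\<close> and the mass
  \<open>real s * c / n\<close> lost to the vertices of \<open>T\<close>.\<close>

lemma walk_mass_concentration_step:
  assumes T: "v \<in> T" "T \<subseteq> {..<n}" "card T \<le> s"
    and deg: "\<bar>(\<Sum>w\<in>{..<n} - {v}. p {v, w}) - d\<bar> \<le> \<delta>" and "0 \<le> d"
    and small: "\<delta> + real s * c / n \<le> 1"
    and q: "0 \<le> q" "q \<le> 1" "0 \<le> \<theta>"
    and single: "\<And>w. w < n \<Longrightarrow> w \<notin> T \<Longrightarrow>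
      \<bar>bexp (vertex_pairs n) p (\<lambda>G. of_bool (\<not> long r G w (insert w T))) - q\<bar> \<le> \<theta>"
    and pair: "\<And>w w'. w < n \<Longrightarrow> w' < n \<Longrightarrow> w \<notin> T \<Longrightarrow> w' \<notin> T \<Longrightarrow> w \<noteq> w' \<Longrightarrow>
      \<bar>bexp (vertex_pairs n) p (\<lambda>G. of_bool (\<not> long r G w (insert w (insert w' T))
          \<and> \<not> long r G w' (insert w (insert w' T)))) - q\<^sup>2\<bar> \<le> \<theta>"
  shows "bexp (pairs_off n T) p (\<lambda>H. (walk_mass p n r H T v - d * (1 - q))\<^sup>2)
     \<le> \<delta> + real s * c / n + 5 * (d + 1)\<^sup>2 * \<theta> + c\<^sup>2 / n"
proof -
  define W where "W = {..<n} - T"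
  define N where "N w G = (of_bool (long r G w (insert w T)) :: real)" for w G
  define E where "E = bexp (vertex_pairs n) p"
  define S where "S = (\<Sum>w\<in>W. p {v, w})"
  define \<mu> where "\<mu> = d * (1 - q)"
  have finT: "finite T" using T finite_subset by blast
  have vn: "v < n" using T by auto
  have pw: "0 \<le> p {v, w}" if "w \<in> W" for w
    using that vn T prob_pair_bounds by (auto simp: W_def)
  have S: "S \<le> d + \<delta>" "d - \<delta> - real s * c / n \<le> S" "0 \<le> S"
  proof -
    have *: "(\<Sum>w\<in>{..<n} - {v}. p {v, w}) = S + (\<Sum>w\<in>T - {v}. p {v, w})"
    proof -
      have "{..<n} - {v} = W \<union> (T - {v})" "W \<inter> (T - {v}) = {}"
        using T by (auto simp: W_def)
      then show ?thesis
        unfolding S_def using finT by (simp add: sum.union_disjoint W_def)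
    qed
    have "(\<Sum>w\<in>T - {v}. p {v, w}) \<le> (\<Sum>w\<in>T - {v}. c / n)"
      using vn T prob_pair_bounds by (intro sum_mono) auto
    also have "\<dots> \<le> real s * (c / n)"
    proof -
      have "card (T - {v}) \<le> s"
        using T finT card_mono[of T "T - {v}"] by auto
      then show ?thesis
        using c by (intro sum_constant_le) auto
    qed
    finally have 1: "(\<Sum>w\<in>T - {v}. p {v, w}) \<le> real s * c / n" by simp
    have 2: "0 \<le> (\<Sum>w\<in>T - {v}. p {v, w})"
      using vn T prob_pair_bounds by (intro sum_nonneg) auto
    show "S \<le> d + \<delta>" "d - \<delta> - real s * c / n \<le> S"
      using * 1 2 deg by (auto simp: abs_le_iff)
    show "0 \<le> S"
      unfolding S_def using pw by (rule sum_nonneg)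
  qed
  have X: "walk_mass p n r H T v = (\<Sum>w\<in>W. p {v, w} * N w H)" for H
    by (simp add: walk_mass_def W_def N_def)
  have N_off: "N w G = N w (G \<inter> pairs_off n T)" if "w \<in> W" "G \<subseteq> vertex_pairs n" for w G
    using long_restrict_off[of w T n "G \<inter> pairs_off n T" G r] that by (auto simp: N_def W_def)
  have EN: "\<bar>E (N w) - (1 - q)\<bar> \<le> \<theta>" if "w \<in> W" for w
  proof -
    have "E (N w) = E (\<lambda>G. 1 - of_bool (\<not> long r G w (insert w T)))"
      unfolding E_def by (intro bexp_cong) (auto simp: N_def)
    then show ?thesis
      using single[of w] that by (simp add: E_def bexp_diff bexp_const W_def)
  qed
  \<comment> \<open>Inclusion-exclusion with both failures measured for the larger set
    \<open>insert w (insert w' T)\<close>, where exposure of the two walks is symmetric. Failing for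
    the smaller sets implies failing for the larger one, so this gives an upper bound, which is all
    a variance needs.\<close>
  have ENN: "E (\<lambda>G. N w G * N w' G) \<le> (1 - q)\<^sup>2 + 3 * \<theta>" if "w \<in> W" "w' \<in> W" "w \<noteq> w'" for w w'
  proof -
    have "E (\<lambda>G. N w G * N w' G) \<le> E (\<lambda>G. N w G + N w' G - 1 + of_bool (\<not> long r G w (insert w (insert w' T))
          \<and> \<not> long r G w' (insert w (insert w' T))))"
      unfolding E_def
    proof (rule bexp_mono[OF prob_bounds])
      fix G
      have "long r G w (insert w (insert w' T)) \<Longrightarrow> long r G w (insert w T)"
        "long r G w' (insert w (insert w' T)) \<Longrightarrow> long r G w' (insert w' T)"
        by (erule long_mono; blast)+
      then show "N w G * N w' G \<le> N w G + N w' G - 1 + of_bool (\<not> long r G w (insert w (insert w' T))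
          \<and> \<not> long r G w' (insert w (insert w' T)))"
        by (auto simp: N_def)
    qed
    also have "\<dots> \<le> (1 - q + \<theta>) + (1 - q + \<theta>) - 1 + (q\<^sup>2 + \<theta>)"
      unfolding E_def bexp_add bexp_diff using EN[OF that(1)] EN[OF that(2)] pair[of w w'] that
      by (simp add: bexp_const E_def W_def abs_le_iff)
    also have "\<dots> = (1 - q)\<^sup>2 + 3 * \<theta>"
      by (simp add: power2_eq_square algebra_simps)
    finally show ?thesis .
  qed
  have "bexp (pairs_off n T) p (\<lambda>H. (walk_mass p n r H T v - \<mu>)\<^sup>2) = E (\<lambda>H. (walk_mass p n r H T v - \<mu>)\<^sup>2)"
    unfolding E_def X using N_off by (intro bexp_marginal[symmetric] pairs_off_subset) auto
  also have "\<dots> = E (\<lambda>H. (\<Sum>w\<in>W. \<Sum>w'\<in>W. (p {v, w} * p {v, w'}) * (N w H * N w' H))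
       - 2 * \<mu> * (\<Sum>w\<in>W. p {v, w} * N w H) + \<mu>\<^sup>2)"
    unfolding X power2_diff by (simp add: power2_eq_square sum_product algebra_simps)
  also have "\<dots> = (\<Sum>w\<in>W. \<Sum>w'\<in>W. p {v, w} * p {v, w'} * E (\<lambda>H. N w H * N w' H))
       - 2 * \<mu> * (\<Sum>w\<in>W. p {v, w} * E (N w)) + \<mu>\<^sup>2"
    unfolding E_def bexp_add bexp_diff by (simp add: bexp_sum bexp_cmult bexp_const)
  also have "\<dots> \<le> ((1 - q)\<^sup>2 + 3 * \<theta>) * S\<^sup>2 + c\<^sup>2 / n - 2 * \<mu> * ((1 - q - \<theta>) * S) + \<mu>\<^sup>2"
  proof (intro add_mono diff_mono order_refl)
    have EN1: "E (\<lambda>H. N w H * N w' H) \<le> 1" for w w'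
      unfolding E_def by (intro bexp_le_const prob_bounds) (auto simp: N_def)
    have "(\<Sum>w\<in>W. \<Sum>w'\<in>W. p {v, w} * p {v, w'} * E (\<lambda>H. N w H * N w' H))
       \<le> (\<Sum>w\<in>W. \<Sum>w'\<in>W. p {v, w} * p {v, w'} * ((1 - q)\<^sup>2 + 3 * \<theta>) + (if w' = w then (p {v, w})\<^sup>2 else 0))"
    proof (intro sum_mono)
      fix w w' assume w: "w \<in> W" "w' \<in> W"
      have pp: "0 \<le> p {v, w} * p {v, w'}" using pw w by simp
      show "p {v, w} * p {v, w'} * E (\<lambda>H. N w H * N w' H)
          \<le> p {v, w} * p {v, w'} * ((1 - q)\<^sup>2 + 3 * \<theta>) + (if w' = w then (p {v, w})\<^sup>2 else 0)"
      proof (cases "w' = w")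
        case True
        then have "p {v, w} * p {v, w'} * E (\<lambda>H. N w H * N w' H) \<le> (p {v, w})\<^sup>2"
          using mult_left_mono[OF EN1 pp, of w w'] by (simp add: power2_eq_square)
        moreover have "0 \<le> p {v, w} * p {v, w'} * ((1 - q)\<^sup>2 + 3 * \<theta>)"
          using q by (intro mult_nonneg_nonneg[OF pp]) auto
        ultimately show ?thesis using True by simp
      next
        case False
        then show ?thesis using mult_left_mono[OF ENN[OF w] pp] by auto
      qed
    qed
    also have "\<dots> = ((1 - q)\<^sup>2 + 3 * \<theta>) * S\<^sup>2 + (\<Sum>w\<in>W. (p {v, w})\<^sup>2)"
      by (simp add: sum.distrib S_def power2_eq_square sum_product sum_distrib_left sum_distrib_right W_def mult_ac)
    also have "(\<Sum>w\<in>W. (p {v, w})\<^sup>2) \<le> c\<^sup>2 / n"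
      using vn T by (intro sum_prob_squares_le) (auto simp: W_def)
    finally show "(\<Sum>w\<in>W. \<Sum>w'\<in>W. p {v, w} * p {v, w'} * E (\<lambda>H. N w H * N w' H))
       \<le> ((1 - q)\<^sup>2 + 3 * \<theta>) * S\<^sup>2 + c\<^sup>2 / n" by simp
    have "(1 - q - \<theta>) * S \<le> (\<Sum>w\<in>W. p {v, w} * E (N w))"
      unfolding S_def sum_distrib_left
    proof (intro sum_mono)
      fix w assume w: "w \<in> W"
      have "p {v, w} * (1 - q - \<theta>) \<le> p {v, w} * E (N w)"
        using EN[OF w] pw[OF w] by (intro mult_left_mono) auto
      then show "(1 - q - \<theta>) * p {v, w} \<le> p {v, w} * E (N w)"
        by (simp add: mult.commute)
    qed
    moreover have "0 \<le> 2 * \<mu>" using q \<open>0 \<le> d\<close> by (simp add: \<mu>_def)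
    ultimately show "2 * \<mu> * ((1 - q - \<theta>) * S) \<le> 2 * \<mu> * (\<Sum>w\<in>W. p {v, w} * E (N w))"
      by (rule mult_left_mono)
  qed
  \<comment> \<open>The terms free of \<open>\<theta>\<close> and of the diagonal recombine into a
    square, because \<open>\<mu>\<close> is \<open>d * (1 - q)\<close>.\<close>
  also have "\<dots> = (1 - q)\<^sup>2 * (S - d)\<^sup>2 + (3 * S\<^sup>2 + 2 * \<mu> * S) * \<theta> + c\<^sup>2 / n"
    by (simp add: \<mu>_def power2_eq_square algebra_simps)
  also have "\<dots> \<le> (\<delta> + real s * c / n) + 5 * (d + 1)\<^sup>2 * \<theta> + c\<^sup>2 / n"
  proof (intro add_mono order_refl mult_right_mono)
    have sc: "0 \<le> real s * c / n" "0 \<le> \<delta>" using c deg by auto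
    have "(S - d)\<^sup>2 = \<bar>S - d\<bar> * \<bar>S - d\<bar>" by (simp add: power2_eq_square flip: abs_mult)
    also have "\<dots> \<le> (\<delta> + real s * c / n) * 1"
      using S small sc by (intro mult_mono) (auto simp: abs_le_iff)
    finally have "(S - d)\<^sup>2 \<le> \<delta> + real s * c / n" by simp
    moreover have "(1 - q)\<^sup>2 * (S - d)\<^sup>2 \<le> 1 * (S - d)\<^sup>2"
      using q by (intro mult_right_mono) (auto simp: power_le_one)
    ultimately show "(1 - q)\<^sup>2 * (S - d)\<^sup>2 \<le> \<delta> + real s * c / n" by linarith
    have S1: "S \<le> d + 1" using S small sc by linarith
    have "S\<^sup>2 \<le> (d + 1)\<^sup>2" using S1 S by (intro power_mono) auto
    moreover have "\<mu> * S \<le> (d + 1) * (d + 1)"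
      using S1 S \<open>0 \<le> d\<close> q mult_left_le[of "1 - q" d] by (intro mult_mono) (auto simp: \<mu>_def)
    ultimately show "3 * S\<^sup>2 + 2 * \<mu> * S \<le> 5 * (d + 1)\<^sup>2" by (simp add: power2_eq_square)
  qed (use q in auto)
  finally show ?thesis by (simp add: \<mu>_def)
qed

end

lemma eventually_const_over_n_less:
  fixes c e :: real
  assumes "e > 0"
  shows "\<forall>\<^sub>F n in sequentially. c / real n < e"
  using lim_const_over_n[of c] assms by (rule order_tendstoD(2))

text \<open>This and \<open>walk_concentration\<close> are proved by alternation: limits for
  \<open>r\<close> give concentration for \<open>r\<close>, which gives limits for
  \<open>Suc r\<close>. Concentration adjoins two more vertices to \<open>T\<close>, so it needs the
  limits for \<open>s + 2\<close>; hence the quantification over \<open>s\<close>, besides the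
  uniformity in \<open>p\<close> and \<open>T\<close>.\<close>

definition walk_limits :: "real \<Rightarrow> real \<Rightarrow> nat \<Rightarrow> nat \<Rightarrow> bool" where
  "walk_limits c d s r \<longleftrightarrow> (\<forall>\<theta>>0. \<exists>\<delta>>0. \<forall>\<^sub>F n in sequentially. \<forall>p. regular n c d \<delta> p \<longrightarrow>
     (\<forall>T. T \<subseteq> {..<n} \<and> card T \<le> s \<longrightarrow>
        (\<forall>v\<in>T. \<bar>bexp (vertex_pairs n) p (\<lambda>G. of_bool (\<not> long r G v T)) - ext_prob d r\<bar> \<le> \<theta>) \<and>
        (\<forall>u\<in>T. \<forall>v\<in>T. u \<noteq> v \<longrightarrow>
           \<bar>bexp (vertex_pairs n) p (\<lambda>G. of_bool (\<not> long r G u T \<and> \<not> long r G v T)) - (ext_prob d r)\<^sup>2\<bar> \<le> \<theta>)))"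

definition walk_concentration :: "real \<Rightarrow> real \<Rightarrow> nat \<Rightarrow> nat \<Rightarrow> bool" where
  "walk_concentration c d s r \<longleftrightarrow> (\<forall>\<eta>>0. \<exists>\<delta>>0. \<forall>\<^sub>F n in sequentially. \<forall>p. regular n c d \<delta> p \<longrightarrow>
     (\<forall>T. T \<subseteq> {..<n} \<and> card T \<le> s \<longrightarrow>
        (\<forall>v\<in>T. bexp (pairs_off n T) p (\<lambda>H. (walk_mass p n r H T v - d * (1 - ext_prob d r))\<^sup>2) \<le> \<eta>)))"

lemma regular_mono: "regular n c d \<delta> p \<Longrightarrow> \<delta> \<le> \<delta>' \<Longrightarrow> regular n c d \<delta>' p"
  unfolding regular_def by (meson order_trans)

lemma walk_limits_imp_concentration:
  assumes c: "0 \<le> c" and d: "0 \<le> d" and lim: "walk_limits c d (s + 2) r"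
  shows "walk_concentration c d s r"
  unfolding walk_concentration_def
proof (intro allI impI)
  fix \<eta> :: real assume \<eta>: "\<eta> > 0"
  \<comment> \<open>Four error terms share \<open>\<eta>\<close>; this makes the one with
    \<open>\<theta>\<close> equal to a quarter.\<close>
  define \<theta> where "\<theta> = \<eta> / (20 * (d + 1)\<^sup>2)"
  have \<theta>: "\<theta> > 0" "5 * (d + 1)\<^sup>2 * \<theta> = \<eta> / 4"
    using \<eta> d by (auto simp: \<theta>_def field_simps)
  obtain \<delta>0 where \<delta>0: "\<delta>0 > 0" and ev: "\<forall>\<^sub>F n in sequentially. \<forall>p. regular n c d \<delta>0 p \<longrightarrow>
     (\<forall>T. T \<subseteq> {..<n} \<and> card T \<le> s + 2 \<longrightarrow>
        (\<forall>v\<in>T. \<bar>bexp (vertex_pairs n) p (\<lambda>G. of_bool (\<not> long r G v T)) - ext_prob d r\<bar> \<le> \<theta>) \<and>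
        (\<forall>u\<in>T. \<forall>v\<in>T. u \<noteq> v \<longrightarrow>
           \<bar>bexp (vertex_pairs n) p (\<lambda>G. of_bool (\<not> long r G u T \<and> \<not> long r G v T)) - (ext_prob d r)\<^sup>2\<bar> \<le> \<theta>))"
    using lim \<theta>(1) unfolding walk_limits_def by blast
  define \<delta> where "\<delta> = min \<delta>0 (min (\<eta> / 4) (1 / 2))"
  have \<delta>: "\<delta> > 0" "\<delta> \<le> \<delta>0" "\<delta> \<le> \<eta> / 4" "\<delta> \<le> 1 / 2"
    using \<delta>0 \<eta> by (auto simp: \<delta>_def)
  have "\<forall>\<^sub>F n in sequentially. real s * c / real n < \<eta> / 4" "\<forall>\<^sub>F n in sequentially. real s * c / real n < 1 / 2"
    "\<forall>\<^sub>F n in sequentially. c\<^sup>2 / real n < \<eta> / 4" "\<forall>\<^sub>F n in sequentially. c / real n < 1"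
    using \<eta> by (auto intro!: eventually_const_over_n_less)
  with ev have "\<forall>\<^sub>F n in sequentially. \<forall>p. regular n c d \<delta> p \<longrightarrow>
     (\<forall>T. T \<subseteq> {..<n} \<and> card T \<le> s \<longrightarrow>
        (\<forall>v\<in>T. bexp (pairs_off n T) p (\<lambda>H. (walk_mass p n r H T v - d * (1 - ext_prob d r))\<^sup>2) \<le> \<eta>))"
    using eventually_gt_at_top[of 0]
  proof eventually_elim
    case (elim n)
    show ?case
    proof (intro allI impI ballI)
      fix p T v
      assume reg: "regular n c d \<delta> p" and T: "T \<subseteq> {..<n} \<and> card T \<le> s" and v: "v \<in> T"
      have reg0: "regular n c d \<delta>0 p"
        using regular_mono[OF reg \<delta>(2)] .
      have finT: "finite T" using T finite_subset by blast
      have "bexp (pairs_off n T) p (\<lambda>H. (walk_mass p n r H T v - d * (1 - ext_prob d r))\<^sup>2)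
         \<le> \<delta> + real s * c / n + 5 * (d + 1)\<^sup>2 * \<theta> + c\<^sup>2 / n"
      proof (rule walk_mass_concentration_step)
        show "0 \<le> p e \<and> p e \<le> c / real n" if "e \<in> vertex_pairs n" for e
          using reg that by (auto simp: regular_def)
        show "c \<le> real n" "n > 0" using elim by (auto simp: field_simps)
        have "v < n" using v T by auto
        then show "\<bar>(\<Sum>w\<in>{..<n} - {v}. p {v, w}) - d\<bar> \<le> \<delta>"
          using reg by (auto simp: regular_def)
        show "\<delta> + real s * c / n \<le> 1" using elim \<delta> by linarith
        show "\<bar>bexp (vertex_pairs n) p (\<lambda>G. of_bool (\<not> long r G w (insert w T))) - ext_prob d r\<bar> \<le> \<theta>"
          if "w < n" "w \<notin> T" for w
        proof -
          have "insert w T \<subseteq> {..<n} \<and> card (insert w T) \<le> s + 2"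
            using that T finT by auto
          then show ?thesis using elim(1) reg0 by blast
        qed
        show "\<bar>bexp (vertex_pairs n) p (\<lambda>G. of_bool (\<not> long r G w (insert w (insert w' T))
          \<and> \<not> long r G w' (insert w (insert w' T)))) - (ext_prob d r)\<^sup>2\<bar> \<le> \<theta>"
          if "w < n" "w' < n" "w \<notin> T" "w' \<notin> T" "w \<noteq> w'" for w w'
        proof -
          have "insert w (insert w' T) \<subseteq> {..<n} \<and> card (insert w (insert w' T)) \<le> s + 2"
            using that T finT by (auto simp: card_insert_if)
          then show ?thesis using elim(1) reg0 that(5) by blast
        qed
      qed (use v T c d \<theta> ext_prob_bounds[OF d, of r] in auto)
      also have "\<dots> \<le> \<eta>"
        using elim \<delta> \<theta>(2) by linarith
      finally show "bexp (pairs_off n T) p (\<lambda>H. (walk_mass p n r H T v - d * (1 - ext_prob d r))\<^sup>2) \<le> \<eta>" .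
    qed
  qed
  with \<delta>(1) show "\<exists>\<delta>>0. \<forall>\<^sub>F n in sequentially. \<forall>p. regular n c d \<delta> p \<longrightarrow>
     (\<forall>T. T \<subseteq> {..<n} \<and> card T \<le> s \<longrightarrow>
        (\<forall>v\<in>T. bexp (pairs_off n T) p (\<lambda>H. (walk_mass p n r H T v - d * (1 - ext_prob d r))\<^sup>2) \<le> \<eta>))"
    by blast
qed

lemma walk_concentration_imp_limits:
  assumes c: "0 \<le> c" and d: "0 \<le> d" and conc: "walk_concentration c d s r"
  shows "walk_limits c d s (Suc r)"
  unfolding walk_limits_def
proof (intro allI impI)
  fix \<theta> :: real assume \<theta>: "\<theta> > 0"
  \<comment> \<open>With concentration at level \<open>\<beta>\<^sup>2\<close> the error is c^2/n
    plus \<open>2 * \<beta>\<close>. The pair statement doubles it, and c^2/n is eventually below a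
    quarter of \<open>\<theta>\<close>, so one eighth is what fits.\<close>
  define \<beta> where "\<beta> = \<theta> / 8"
  define \<mu> where "\<mu> = d * (1 - ext_prob d r)"
  have \<beta>: "\<beta> > 0" and \<mu>: "0 \<le> \<mu>"
    using \<theta> d ext_prob_bounds[OF d, of r] by (auto simp: \<beta>_def \<mu>_def)
  then have "0 < \<beta>\<^sup>2" by simp
  from conc[unfolded walk_concentration_def, folded \<mu>_def, THEN spec, THEN mp, OF this]
  obtain \<delta> where \<delta>: "\<delta> > 0" and ev: "\<forall>\<^sub>F n in sequentially. \<forall>p. regular n c d \<delta> p \<longrightarrow>
     (\<forall>T. T \<subseteq> {..<n} \<and> card T \<le> s \<longrightarrow>
        (\<forall>v\<in>T. bexp (pairs_off n T) p (\<lambda>H. (walk_mass p n r H T v - \<mu>)\<^sup>2) \<le> \<beta>\<^sup>2))"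
    by blast
  have "\<forall>\<^sub>F n in sequentially. c\<^sup>2 / real n < \<theta> / 4" "\<forall>\<^sub>F n in sequentially. c / real n < 1"
    using \<theta> by (auto intro!: eventually_const_over_n_less)
  with ev have "\<forall>\<^sub>F n in sequentially. \<forall>p. regular n c d \<delta> p \<longrightarrow>
     (\<forall>T. T \<subseteq> {..<n} \<and> card T \<le> s \<longrightarrow>
        (\<forall>v\<in>T. \<bar>bexp (vertex_pairs n) p (\<lambda>G. of_bool (\<not> long (Suc r) G v T)) - ext_prob d (Suc r)\<bar> \<le> \<theta>) \<and>
        (\<forall>u\<in>T. \<forall>v\<in>T. u \<noteq> v \<longrightarrow>
           \<bar>bexp (vertex_pairs n) p (\<lambda>G. of_bool (\<not> long (Suc r) G u T \<and> \<not> long (Suc r) G v T)) - (ext_prob d (Suc r))\<^sup>2\<bar> \<le> \<theta>))"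
    using eventually_gt_at_top[of 0]
  proof eventually_elim
    case (elim n)
    have n: "c \<le> real n" using elim by (auto simp: field_simps)
    have \<beta>2: "\<beta>\<^sup>2 / \<beta> = \<beta>" using \<beta> by (simp add: power2_eq_square)
    show ?case
    proof (intro allI impI ballI conjI)
      fix p T u v
      assume reg: "regular n c d \<delta> p" and T: "T \<subseteq> {..<n} \<and> card T \<le> s" and v: "v \<in> T"
      have p: "0 \<le> p e \<and> p e \<le> c / real n" if "e \<in> vertex_pairs n" for e
        using reg that by (auto simp: regular_def)
      have conc: "bexp (pairs_off n T) p (\<lambda>H. (walk_mass p n r H T v - \<mu>)\<^sup>2) \<le> \<beta>\<^sup>2" if "v \<in> T" for v
        using elim(1) reg T that by blast
      show "\<bar>bexp (vertex_pairs n) p (\<lambda>G. of_bool (\<not> long (Suc r) G v T)) - ext_prob d (Suc r)\<bar> \<le> \<theta>"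
        using not_long_Suc_approx[OF p c n \<open>0 < n\<close> v _ \<mu> \<beta> conc[OF v]] T elim(2) \<beta> \<beta>2 \<theta>
        unfolding ext_prob.simps \<mu>_def[symmetric] by (simp add: \<beta>_def)
      assume u: "u \<in> T" and uv: "v \<noteq> u"
      show "\<bar>bexp (vertex_pairs n) p (\<lambda>G. of_bool (\<not> long (Suc r) G v T \<and> \<not> long (Suc r) G u T)) - (ext_prob d (Suc r))\<^sup>2\<bar> \<le> \<theta>"
        using not_long_Suc2_approx[OF p c n \<open>0 < n\<close> v u uv _ \<mu> \<beta> conc[OF v] conc[OF u]] T elim(2) \<beta> \<beta>2
        unfolding ext_prob.simps \<mu>_def[symmetric] by (simp add: \<beta>_def)
    qed
  qed
  with \<delta> show "\<exists>\<delta>>0. \<forall>\<^sub>F n in sequentially. \<forall>p. regular n c d \<delta> p \<longrightarrow>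
     (\<forall>T. T \<subseteq> {..<n} \<and> card T \<le> s \<longrightarrow>
        (\<forall>v\<in>T. \<bar>bexp (vertex_pairs n) p (\<lambda>G. of_bool (\<not> long (Suc r) G v T)) - ext_prob d (Suc r)\<bar> \<le> \<theta>) \<and>
        (\<forall>u\<in>T. \<forall>v\<in>T. u \<noteq> v \<longrightarrow>
           \<bar>bexp (vertex_pairs n) p (\<lambda>G. of_bool (\<not> long (Suc r) G u T \<and> \<not> long (Suc r) G v T)) - (ext_prob d (Suc r))\<^sup>2\<bar> \<le> \<theta>))"
    by blast
qed

lemma walk_limits:
  assumes "0 \<le> c" "0 \<le> d"
  shows "walk_limits c d s r"
proof (induction r arbitrary: s)
  case 0
  show ?case
    unfolding walk_limits_def by (auto intro!: exI[of _ "1::real"] simp: bexp_const)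
next
  case (Suc r)
  then show ?case
    using assms by (intro walk_concentration_imp_limits walk_limits_imp_concentration) auto
qed

lemma walk_concentration:
  assumes "0 \<le> c" "0 \<le> d"
  shows "walk_concentration c d s r"
  using assms by (intro walk_limits_imp_concentration walk_limits)

section \<open>Peeling by rounds and its local approximation\<close>

primrec core :: "nat \<Rightarrow> nat set set \<Rightarrow> nat \<Rightarrow> nat set" where
  "core n G 0 = {..<n}"
| "core n G (Suc r) = {v \<in> core n G r. \<exists>u w. u \<noteq> w \<and> u \<in> core n G r \<and> w \<in> core n G r \<and> {v, u} \<in> G \<and> {v, w} \<in> G}"

lemma core_antimono: "r \<le> r' \<Longrightarrow> core n G r' \<subseteq> core n G r"
  by (rule lift_Suc_antimono_le[of "core n G"]) auto

text \<open>A surviving vertex has two surviving neighbours of the previous round, so one of them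
  differs from the predecessor \<open>q\<close>. Going there either meets a visited vertex, which
  closes the walk, or extends it.\<close>

lemma core_imp_long_or_closes:
  assumes "v \<in> core n G r" "G \<subseteq> vertex_pairs n" "v \<in> T" "q \<in> T"
  shows "long r G v T \<or> closes r G v T q"
  using assms(1,3,4)
proof (induction r arbitrary: v T q)
  case (Suc r)
  then obtain x y where "x \<noteq> y" "x \<in> core n G r" "y \<in> core n G r" "{v, x} \<in> G" "{v, y} \<in> G"
    by auto
  then obtain w where w: "w \<noteq> q" "w \<in> core n G r" "{v, w} \<in> G"
    using that[of x] that[of y] by (cases "x = q") auto
  then have "w \<noteq> v"
    using assms(2) pair_in_vertex_pairs by blast
  show ?case
  proof (cases "w \<in> T")
    case True
    then show ?thesis using w \<open>w \<noteq> v\<close> by auto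
  next
    case False
    then show ?thesis
      using Suc.IH[of w "insert w T" v] w Suc.prems by auto
  qed
qed simp

text \<open>Unlike \<open>long\<close>, revisits are allowed and only an immediate return is
  forbidden. Such walks can be prolonged backwards through an edge, which is what the induction for
  the core requires.\<close>

primrec nonbacktracking :: "nat \<Rightarrow> nat set set \<Rightarrow> nat \<Rightarrow> nat \<Rightarrow> bool" where
  "nonbacktracking 0 G u v \<longleftrightarrow> True"
| "nonbacktracking (Suc r) G u v \<longleftrightarrow> (\<exists>w. w \<noteq> v \<and> {u, w} \<in> G \<and> nonbacktracking r G w u)"

lemma nonbacktracking_Suc_imp: "nonbacktracking (Suc r) G u v \<Longrightarrow> nonbacktracking r G u v"
proof (induction r arbitrary: u v)
  case (Suc r)
  from Suc.prems[unfolded nonbacktracking.simps(2)[of "Suc r"]]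
  obtain w where "w \<noteq> v" "{u, w} \<in> G" "nonbacktracking (Suc r) G w u"
    by (elim exE conjE)
  with Suc.IH[of w u] show ?case by auto
qed simp

lemma long_imp_nonbacktracking: "long r G u T \<Longrightarrow> u \<in> T \<Longrightarrow> v \<in> T \<Longrightarrow> nonbacktracking r G u v"
proof (induction r arbitrary: u v T)
  case (Suc r)
  then obtain w where "w \<notin> T" "{u, w} \<in> G" "long r G w (insert w T)" by auto
  with Suc.IH[of w "insert w T" u] Suc.prems show ?case by auto
qed simp

text \<open>If walks leave both ends of \<open>{u, v}\<close>, then the first step \<open>w\<close>
  of the walk from \<open>u\<close> gives another edge \<open>{u, w}\<close> with the same property
  for one step less. So \<open>v\<close> and \<open>w\<close> are two surviving neighbours of
  \<open>u\<close>.\<close>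

lemma nonbacktracking_imp_core:
  assumes "{u, v} \<in> G" "nonbacktracking r G u v" "nonbacktracking r G v u" "G \<subseteq> vertex_pairs n"
  shows "u \<in> core n G r \<and> v \<in> core n G r"
  using assms(1-3)
proof (induction r arbitrary: u v)
  case 0
  then show ?case using assms(4) pair_in_vertex_pairs by auto
next
  case (Suc r)
  have *: "u \<in> core n G (Suc r)"
    if h: "{u, v} \<in> G" "nonbacktracking (Suc r) G u v" "nonbacktracking (Suc r) G v u" for u v
  proof -
    obtain w where w: "w \<noteq> v" "{u, w} \<in> G" "nonbacktracking r G w u"
      using h by auto
    have nb: "nonbacktracking r G u v" "nonbacktracking r G v u"
      using h nonbacktracking_Suc_imp by blast+
    \<comment> \<open>Leaving \<open>u\<close> away from \<open>w\<close>, one can go to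
      \<open>v\<close> first; that uses one step, and the walk from \<open>v\<close> provides the
      other \<open>r - 1\<close>.\<close>
    have "nonbacktracking r G u w"
    proof (cases r)
      case (Suc j)
      then show ?thesis
        using nonbacktracking_Suc_imp[of j G v u] nb(2) w(1) h(1) by auto
    qed simp
    then have "w \<in> core n G r" using Suc.IH[of u w] w by auto
    moreover have "u \<in> core n G r \<and> v \<in> core n G r" using Suc.IH[of u v] h nb by auto
    ultimately show ?thesis using w h by auto
  qed
  show ?case
    using *[of u v] *[of v u] Suc.prems by (auto simp: insert_commute)
qed

text \<open>Walks from both ends that avoid \<open>{u, v}\<close> ignore the edge itself, so its
  presence factors out. Two long walks put the edge into the core, and conversely up to a closing
  event of probability O(1/n). The error is relative to \<open>p e\<close> because it will be summed
  over all pairs.\<close>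

lemma core_edge_limit:
  assumes c: "0 \<le> c" and d: "0 \<le> d" and \<eta>: "\<eta> > 0"
  shows "\<exists>\<delta>>0. \<forall>\<^sub>F n in sequentially. \<forall>p. regular n c d \<delta> p \<longrightarrow> (\<forall>e\<in>vertex_pairs n.
    \<bar>bexp (vertex_pairs n) p (\<lambda>G. of_bool (e \<in> G \<and> e \<subseteq> core n G r)) - p e * (1 - ext_prob d r)\<^sup>2\<bar> \<le> p e * \<eta>)"
proof -
  define \<theta> where "\<theta> = \<eta> / 6"
  have \<theta>: "\<theta> > 0" using \<eta> by (simp add: \<theta>_def)
  define q where "q = ext_prob d r"
  obtain \<delta> where \<delta>: "\<delta> > 0" and ev: "\<forall>\<^sub>F n in sequentially. \<forall>p. regular n c d \<delta> p \<longrightarrow>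
     (\<forall>T. T \<subseteq> {..<n} \<and> card T \<le> 2 \<longrightarrow>
        (\<forall>v\<in>T. \<bar>bexp (vertex_pairs n) p (\<lambda>G. of_bool (\<not> long r G v T)) - q\<bar> \<le> \<theta>) \<and>
        (\<forall>u\<in>T. \<forall>v\<in>T. u \<noteq> v \<longrightarrow>
           \<bar>bexp (vertex_pairs n) p (\<lambda>G. of_bool (\<not> long r G u T \<and> \<not> long r G v T)) - q\<^sup>2\<bar> \<le> \<theta>))"
    using walk_limits[OF c d, of 2 r] \<theta> unfolding walk_limits_def q_def by blast
  define K where "K = real r * (c + 1) ^ Suc r * real (2 + r)"
  have "\<forall>\<^sub>F n in sequentially. K / real n < \<eta> / 4" "\<forall>\<^sub>F n in sequentially. c / real n < 1"
    using \<eta> by (auto intro!: eventually_const_over_n_less)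
  with ev have "\<forall>\<^sub>F n in sequentially. \<forall>p. regular n c d \<delta> p \<longrightarrow> (\<forall>e\<in>vertex_pairs n.
    \<bar>bexp (vertex_pairs n) p (\<lambda>G. of_bool (e \<in> G \<and> e \<subseteq> core n G r)) - p e * (1 - q)\<^sup>2\<bar> \<le> p e * \<eta>)"
    using eventually_gt_at_top[of 0]
  proof eventually_elim
    case (elim n)
    have n: "c \<le> real n" using elim by (auto simp: field_simps)
    show ?case
    proof (intro allI impI ballI)
      fix p e assume reg: "regular n c d \<delta> p" and e: "e \<in> vertex_pairs n"
      have p: "0 \<le> p e \<and> p e \<le> c / real n" if "e \<in> vertex_pairs n" for e
        using reg that by (auto simp: regular_def)
      note p01 = prob_bounds[where p = p, OF p c n \<open>0 < n\<close>]
      obtain u v where uv: "e = {u, v}" "u < v" "v < n"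
        using e by (rule vertex_pairsE)
      define T where "T = {u, v}"
      have T: "T \<subseteq> {..<n}" "card T \<le> 2" "u \<in> T" "v \<in> T" "u \<noteq> v"
        using uv by (auto simp: T_def)
      define E where "E = bexp (vertex_pairs n) p"
      define L where "L G = (of_bool (long r G u T \<and> long r G v T) :: real)" for G
      define B where "B G = (of_bool (closes r G u T v) + of_bool (closes r G v T u) :: real)" for G
      have EL: "\<bar>E L - (1 - q)\<^sup>2\<bar> \<le> 3 * \<theta>"
      proof -
        have "E L = E (\<lambda>G. 1 - of_bool (\<not> long r G u T) - of_bool (\<not> long r G v T)
            + of_bool (\<not> long r G u T \<and> \<not> long r G v T))"
          unfolding E_def by (rule bexp_cong) (auto simp: L_def)
        also have "\<dots> = 1 - E (\<lambda>G. of_bool (\<not> long r G u T)) - E (\<lambda>G. of_bool (\<not> long r G v T))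
            + E (\<lambda>G. of_bool (\<not> long r G u T \<and> \<not> long r G v T))"
          unfolding E_def bexp_add bexp_diff by (simp add: bexp_const)
        finally have eq: "E L = 1 - E (\<lambda>G. of_bool (\<not> long r G u T)) - E (\<lambda>G. of_bool (\<not> long r G v T))
            + E (\<lambda>G. of_bool (\<not> long r G u T \<and> \<not> long r G v T))" .
        have "\<bar>E (\<lambda>G. of_bool (\<not> long r G u T)) - q\<bar> \<le> \<theta>" "\<bar>E (\<lambda>G. of_bool (\<not> long r G v T)) - q\<bar> \<le> \<theta>"
          "\<bar>E (\<lambda>G. of_bool (\<not> long r G u T \<and> \<not> long r G v T)) - q\<^sup>2\<bar> \<le> \<theta>"
          using elim(1) reg T unfolding E_def by blast+
        moreover have "(1 - q)\<^sup>2 = 1 - q - q + q\<^sup>2" by (simp add: power2_diff)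
        ultimately show ?thesis unfolding eq by linarith
      qed
      have EB: "E B \<le> 2 * (K / n)"
      proof -
        have "bexp (vertex_pairs n) p (\<lambda>G. of_bool (closes r G u T v)) \<le> K / n"
          "bexp (vertex_pairs n) p (\<lambda>G. of_bool (closes r G v T u)) \<le> K / n"
          unfolding K_def
          using bexp_closes_le[where p = p and T = T and s = 2 and r = r and v = u and q = v, OF p c n]
            bexp_closes_le[where p = p and T = T and s = 2 and r = r and v = v and q = u, OF p c n] T by auto
        then show ?thesis unfolding B_def E_def bexp_add by linarith
      qed
      have indep: "L (insert e G) = L G" "B (insert e G) = B G" for G
      proof -
        have "long r (insert e G) x T \<longleftrightarrow> long r G x T" if "x \<in> T" for x
          using that T by (intro long_cong) (auto simp: uv T_def)
        then show "L (insert e G) = L G" using T by (simp add: L_def)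
        have "closes r (insert e G) u T v \<longleftrightarrow> closes r G u T v"
          using T by (intro closes_cong) (auto simp: uv T_def)
        moreover have "closes r (insert e G) v T u \<longleftrightarrow> closes r G v T u"
          using T by (intro closes_cong) (auto simp: uv T_def)
        ultimately show "B (insert e G) = B G" by (simp add: B_def)
      qed
      have lower: "p e * E L \<le> E (\<lambda>G. of_bool (e \<in> G \<and> e \<subseteq> core n G r))"
      proof -
        have "p e * E L = E (\<lambda>G. of_bool (e \<in> G) * L G)"
          unfolding E_def using e indep by (intro bexp_edge_mult[symmetric]) auto
        also have "\<dots> \<le> E (\<lambda>G. of_bool (e \<in> G \<and> e \<subseteq> core n G r))"
          unfolding E_def
        proof (rule bexp_mono[OF p01])
          fix G assume G: "G \<subseteq> vertex_pairs n"
          have "e \<subseteq> core n G r" if "e \<in> G" "long r G u T" "long r G v T"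
            using nonbacktracking_imp_core[of u v G r n] that G uv T
              long_imp_nonbacktracking[of r G u T v] long_imp_nonbacktracking[of r G v T u] by auto
          then show "of_bool (e \<in> G) * L G \<le> of_bool (e \<in> G \<and> e \<subseteq> core n G r)"
            by (auto simp: L_def)
        qed auto
        finally show ?thesis .
      qed
      have upper: "E (\<lambda>G. of_bool (e \<in> G \<and> e \<subseteq> core n G r)) \<le> p e * (E L + E B)"
      proof -
        have "E (\<lambda>G. of_bool (e \<in> G \<and> e \<subseteq> core n G r)) \<le> E (\<lambda>G. of_bool (e \<in> G) * (L G + B G))"
          unfolding E_def
        proof (rule bexp_mono[OF p01])
          fix G assume G: "G \<subseteq> vertex_pairs n"
          have "1 \<le> L G + B G" if "e \<subseteq> core n G r"
            using core_imp_long_or_closes[of u n G r T v] core_imp_long_or_closes[of v n G r T u] that G uv T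
            by (auto simp: L_def B_def)
          then show "of_bool (e \<in> G \<and> e \<subseteq> core n G r) \<le> of_bool (e \<in> G) * (L G + B G)"
            by (auto simp: L_def B_def)
        qed auto
        also have "\<dots> = p e * E (\<lambda>G. L G + B G)"
          unfolding E_def using e indep by (intro bexp_edge_mult) auto
        finally show ?thesis by (simp add: E_def bexp_add)
      qed
      have pe: "0 \<le> p e" using p[OF e] by simp
      have "p e * E L \<ge> p e * ((1 - q)\<^sup>2 - \<eta>)" "p e * (E L + E B) \<le> p e * ((1 - q)\<^sup>2 + \<eta>)"
      proof -
        have "(1 - q)\<^sup>2 - \<eta> \<le> E L" "E L + E B \<le> (1 - q)\<^sup>2 + \<eta>"
          using EL EB elim(2) \<eta> unfolding \<theta>_def by linarith+
        then show "p e * E L \<ge> p e * ((1 - q)\<^sup>2 - \<eta>)" "p e * (E L + E B) \<le> p e * ((1 - q)\<^sup>2 + \<eta>)"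
          using pe by (auto intro!: mult_left_mono)
      qed
      then show "\<bar>bexp (vertex_pairs n) p (\<lambda>G. of_bool (e \<in> G \<and> e \<subseteq> core n G r)) - p e * (1 - q)\<^sup>2\<bar> \<le> p e * \<eta>"
        using lower upper unfolding E_def by (simp add: algebra_simps abs_le_iff)
    qed
  qed
  with \<delta> show ?thesis unfolding q_def by blast
qed

text \<open>Complements \<open>bexp_star_none\<close>: together they give the probability that at
  most one neighbour leads on.\<close>

lemma bexp_star_at_most_one:
  fixes f :: "nat \<Rightarrow> real"
  shows "bexp (star n T v) p (\<lambda>G. \<Sum>w\<in>{..<n} - T. of_bool ({v, w} \<in> G) * f w * (\<Prod>w'\<in>{..<n} - T - {w}. 1 - of_bool ({v, w'} \<in> G) * f w'))
       = (\<Sum>w\<in>{..<n} - T. p {v, w} * f w * (\<Prod>w'\<in>{..<n} - T - {w}. 1 - p {v, w'} * f w'))"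
  unfolding bexp_sum
proof (rule sum.cong[OF refl])
  fix w assume w: "w \<in> {..<n} - T"
  have star: "{..<n} - T - {w} = {..<n} - insert w T" by auto
  have "bexp (star n T v) p (\<lambda>G. of_bool ({v, w} \<in> G) * (f w * (\<Prod>w'\<in>{..<n} - T - {w}. 1 - of_bool ({v, w'} \<in> G) * f w')))
      = p {v, w} * bexp (star n T v) p (\<lambda>G. f w * (\<Prod>w'\<in>{..<n} - T - {w}. 1 - of_bool ({v, w'} \<in> G) * f w'))"
  proof (rule bexp_edge_mult)
    show "{v, w} \<in> star n T v" using w by (auto simp: star_def)
    fix G
    have "{v, w'} \<in> insert {v, w} G \<longleftrightarrow> {v, w'} \<in> G" if "w' \<noteq> w" for w'
      using that by (auto simp: doubleton_eq_iff)
    then show "f w * (\<Prod>w'\<in>{..<n} - T - {w}. 1 - of_bool ({v, w'} \<in> insert {v, w} G) * f w')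
        = f w * (\<Prod>w'\<in>{..<n} - T - {w}. 1 - of_bool ({v, w'} \<in> G) * f w')"
      by (intro arg_cong2[where f="(*)"] prod.cong refl) auto
  qed simp
  also have "bexp (star n T v) p (\<lambda>G. f w * (\<Prod>w'\<in>{..<n} - T - {w}. 1 - of_bool ({v, w'} \<in> G) * f w'))
      = f w * bexp (star n (insert w T) v) p (\<lambda>G. \<Prod>w'\<in>{..<n} - insert w T. 1 - of_bool ({v, w'} \<in> G) * f w')"
    unfolding bexp_cmult star
  proof (intro arg_cong2[where f="(*)"] refl bexp_marginal)
    show "star n (insert w T) v \<subseteq> star n T v" by (auto simp: star_def)
    fix G
    show "(\<Prod>w'\<in>{..<n} - insert w T. 1 - of_bool ({v, w'} \<in> G) * f w')
        = (\<Prod>w'\<in>{..<n} - insert w T. 1 - of_bool ({v, w'} \<in> G \<inter> star n (insert w T) v) * f w')"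
      by (intro prod.cong) (auto simp: star_def)
  qed simp
  also have "\<dots> = f w * (\<Prod>w'\<in>{..<n} - T - {w}. 1 - p {v, w'} * f w')"
    by (simp only: bexp_star_none[OF finite.emptyI] star)
  finally show "bexp (star n T v) p (\<lambda>G. of_bool ({v, w} \<in> G) * f w * (\<Prod>w'\<in>{..<n} - T - {w}. 1 - of_bool ({v, w'} \<in> G) * f w'))
      = p {v, w} * f w * (\<Prod>w'\<in>{..<n} - T - {w}. 1 - p {v, w'} * f w')"
    by (simp add: mult.assoc)
qed

text \<open>\<open>(1 + x) * exp (- x)\<close> is the probability that a Poisson variable of mean
  \<open>x\<close> is at most one; its derivative \<open>- x * exp (- x)\<close> is bounded by one
  in absolute value.\<close>

lemma at_most_one_lipschitz:
  fixes x y :: real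
  assumes "0 \<le> x" "0 \<le> y"
  shows "\<bar>(1 + x) * exp (- x) - (1 + y) * exp (- y)\<bar> \<le> \<bar>x - y\<bar>"
proof -
  have *: "\<bar>(1 + x) * exp (- x) - (1 + y) * exp (- y)\<bar> \<le> y - x" if xy: "0 \<le> x" "x < y" for x y :: real
  proof -
    have "((\<lambda>t. (1 + t) * exp (- t)) has_real_derivative - t * exp (- t)) (at t)" for t :: real
      by (auto intro!: derivative_eq_intros simp: algebra_simps)
    from MVT2[OF xy(2), of "\<lambda>t. (1 + t) * exp (- t)" "\<lambda>t. - t * exp (- t)"] this
    obtain z where z: "x < z" "z < y"
      "(1 + y) * exp (- y) - (1 + x) * exp (- x) = (y - x) * (- z * exp (- z))"
      by auto
    have "z * exp (- z) \<le> exp z * exp (- z)"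
      using exp_ge_add_one_self[of z] by (intro mult_right_mono; linarith?) simp
    then have "z * exp (- z) \<le> 1" by (simp flip: exp_add)
    moreover have "0 \<le> z * exp (- z)" using z xy by simp
    ultimately have "\<bar>(y - x) * (- z * exp (- z))\<bar> \<le> (y - x) * 1"
      unfolding abs_mult using xy by (intro mult_mono) auto
    then show ?thesis using z(3) by (simp add: abs_minus_commute)
  qed
  show ?thesis
    using *[of x y] *[of y x] assms by (cases x y rule: linorder_cases) (auto simp: abs_minus_commute)
qed

lemma two_neighbours_le:
  fixes a :: "'i \<Rightarrow> bool"
  assumes "finite W"
  shows "of_bool (\<exists>u w. u \<noteq> w \<and> u \<in> W \<and> w \<in> W \<and> a u \<and> a w)
    \<le> 1 - (\<Prod>w\<in>W. 1 - of_bool (a w)) - (\<Sum>w\<in>W. of_bool (a w) * (\<Prod>w'\<in>W - {w}. 1 - of_bool (a w')) :: real)"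
proof -
  consider (none) "\<forall>w\<in>W. \<not> a w" | (one) w where "w \<in> W" "a w" "\<forall>w'\<in>W - {w}. \<not> a w'"
    | (two) u w where "u \<in> W" "w \<in> W" "u \<noteq> w" "a u" "a w" by blast
  then show ?thesis
  proof cases
    case none
    then show ?thesis by (auto intro!: sum_nonneg simp: assms)
  next
    case one
    have "(\<Prod>w\<in>W. 1 - of_bool (a w) :: real) = 0"
      using one assms by (intro prod_zero) auto
    moreover have "(\<Sum>w\<in>W. of_bool (a w) * (\<Prod>w'\<in>W - {w}. 1 - of_bool (a w')) :: real) = (\<Sum>w'\<in>{w}. 1)"
      using one assms by (intro sum.mono_neutral_cong_right) auto
    moreover have "\<not> (\<exists>u w. u \<noteq> w \<and> u \<in> W \<and> w \<in> W \<and> a u \<and> a w)" using one by blast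
    ultimately show ?thesis by simp
  next
    case two
    have "(\<Prod>w\<in>W. 1 - of_bool (a w) :: real) = 0"
      using two assms by (intro prod_zero) auto
    moreover have "(\<Sum>x\<in>W. of_bool (a x) * (\<Prod>w'\<in>W - {x}. 1 - of_bool (a w')) :: real) = 0"
    proof (intro sum.neutral ballI)
      fix x assume "x \<in> W"
      have "\<exists>y\<in>W - {x}. a y" using two by blast
      then have "(\<Prod>w'\<in>W - {x}. 1 - of_bool (a w') :: real) = 0"
        using assms by (intro prod_zero) auto
      then show "of_bool (a x) * (\<Prod>w'\<in>W - {x}. 1 - of_bool (a w') :: real) = 0" by simp
    qed
    ultimately show ?thesis by simp
  qed
qed

text \<open>To survive round \<open>r + 1\<close> a vertex needs two neighbours in
  \<open>core n G r\<close>, each starting a long walk away from it unless a closing event occurs.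
  The number of such neighbours is nearly Poisson of mean \<open>\<mu>\<close>. An upper bound
  suffices, since it bounds the number of peeled vertices from below.\<close>

lemma core_vertex_limit:
  fixes c d \<eta> :: real and r :: nat
  assumes c: "0 \<le> c" and d: "0 \<le> d" and \<eta>: "\<eta> > 0"
  defines "\<mu> \<equiv> d * (1 - ext_prob d r)"
  shows "\<exists>\<delta>>0. \<forall>\<^sub>F n in sequentially. \<forall>p. regular n c d \<delta> p \<longrightarrow> (\<forall>v<n.
    bexp (vertex_pairs n) p (\<lambda>G. of_bool (v \<in> core n G (Suc r))) \<le> 1 - (1 + \<mu>) * exp (- \<mu>) + \<eta>)"
proof -
  define \<beta> where "\<beta> = \<eta> / 8"
  have \<beta>: "\<beta> > 0" "0 < \<beta>\<^sup>2" "\<beta>\<^sup>2 / \<beta> = \<beta>" using \<eta> by (auto simp: \<beta>_def power2_eq_square)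
  have \<mu>: "0 \<le> \<mu>" using d ext_prob_bounds[OF d, of r] by (auto simp: \<mu>_def)
  from walk_concentration[OF c d, of 1 r, unfolded walk_concentration_def, folded \<mu>_def, THEN spec, THEN mp, OF \<beta>(2)]
  obtain \<delta> where \<delta>: "\<delta> > 0" and ev: "\<forall>\<^sub>F n in sequentially. \<forall>p. regular n c d \<delta> p \<longrightarrow>
     (\<forall>T. T \<subseteq> {..<n} \<and> card T \<le> 1 \<longrightarrow>
        (\<forall>v\<in>T. bexp (pairs_off n T) p (\<lambda>H. (walk_mass p n r H T v - \<mu>)\<^sup>2) \<le> \<beta>\<^sup>2))"
    by blast
  define K where "K = real r * (c + 1) ^ Suc r * real (2 + r)"
  have "\<forall>\<^sub>F n in sequentially. c * K / real n < \<eta> / 4" "\<forall>\<^sub>F n in sequentially. c / real n < 1"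
    "\<forall>\<^sub>F n in sequentially. (1 + c) * c\<^sup>2 / real n < \<eta> / 4"
    using \<eta> by (auto intro!: eventually_const_over_n_less)
  with ev have "\<forall>\<^sub>F n in sequentially. \<forall>p. regular n c d \<delta> p \<longrightarrow> (\<forall>v<n.
    bexp (vertex_pairs n) p (\<lambda>G. of_bool (v \<in> core n G (Suc r))) \<le> 1 - (1 + \<mu>) * exp (- \<mu>) + \<eta>)"
    using eventually_gt_at_top[of 0]
  proof eventually_elim
    case (elim n)
    have n: "c \<le> real n" using elim by (auto simp: field_simps)
    show ?case
    proof (intro allI impI)
      fix p v assume reg: "regular n c d \<delta> p" and v: "v < n"
      have p: "0 \<le> p e \<and> p e \<le> c / real n" if "e \<in> vertex_pairs n" for e
        using reg that by (auto simp: regular_def)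
      note p01 = prob_bounds[where p = p, OF p c n \<open>0 < n\<close>]
      define W where "W = {..<n} - {v}"
      define E where "E = bexp (vertex_pairs n) p"
      define N where "N G w = long r G w (insert w {v})" for G w
      define A where "A G w \<longleftrightarrow> {v, w} \<in> G \<and> N G w" for G w
      define X where "X H = walk_mass p n r H {v} v" for H
      define F where "F G = 1 - (\<Prod>w\<in>W. 1 - of_bool (A G w)) - (\<Sum>w\<in>W. of_bool (A G w) * (\<Prod>w'\<in>W - {w}. 1 - of_bool (A G w')) :: real)" for G
      have T: "v \<in> {v}" "{v} \<subseteq> {..<n}" "card {v} \<le> 1" using v by auto
      have finW: "finite W" by (simp add: W_def)
      have "E (\<lambda>G. of_bool (v \<in> core n G (Suc r))) \<le> E (\<lambda>G. F G + (\<Sum>w\<in>W. of_bool ({v, w} \<in> G) * of_bool (closes r G w {v, w} v)))"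
        unfolding E_def
      proof (rule bexp_mono[OF p01])
        fix G assume G: "G \<subseteq> vertex_pairs n"
        let ?C = "(\<Sum>w\<in>W. of_bool ({v, w} \<in> G) * of_bool (closes r G w {v, w} v)) :: real"
        have C0: "0 \<le> ?C" by (intro sum_nonneg) auto
        have F0: "of_bool (\<exists>u w. u \<noteq> w \<and> u \<in> W \<and> w \<in> W \<and> A G u \<and> A G w) \<le> F G"
          unfolding F_def by (rule two_neighbours_le[OF finW])
        have "of_bool (v \<in> core n G (Suc r)) \<le> of_bool (\<exists>u w. u \<noteq> w \<and> u \<in> W \<and> w \<in> W \<and> A G u \<and> A G w) + ?C"
        proof (cases "v \<in> core n G (Suc r)")
          case True
          then obtain x y where xy: "x \<noteq> y" "x \<in> core n G r" "y \<in> core n G r" "{v, x} \<in> G" "{v, y} \<in> G" by auto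
          have "{v, x} \<in> vertex_pairs n" "{v, y} \<in> vertex_pairs n" using xy(4,5) G by (auto simp only: subset_iff)
          then have W: "x \<in> W" "y \<in> W"
            by (auto simp: W_def)
          have dich: "A G z \<or> closes r G z {v, z} v" if "z \<in> core n G r" "{v, z} \<in> G" for z
            using core_imp_long_or_closes[OF that(1) G, of "{v, z}" v] that(2) by (auto simp: A_def N_def insert_commute)
          show ?thesis
          proof (cases "A G x \<and> A G y")
            case True
            then have "of_bool (\<exists>u w. u \<noteq> w \<and> u \<in> W \<and> w \<in> W \<and> A G u \<and> A G w) = (1::real)"
              using xy W by auto
            then show ?thesis using C0 by simp
          next
            case False
            then obtain z where z: "z \<in> W" "{v, z} \<in> G" "closes r G z {v, z} v"
              using dich xy W by blast
            then have "1 \<le> ?C"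
              using member_le_sum[of z W "\<lambda>w. of_bool ({v, w} \<in> G) * of_bool (closes r G w {v, w} v) :: real"] finW
              by auto
            then show ?thesis using True by simp
          qed
        qed (use C0 in auto)
        then show "of_bool (v \<in> core n G (Suc r)) \<le> F G + ?C" using F0 by linarith
      qed auto
      also have "\<dots> = E F + (\<Sum>w\<in>W. E (\<lambda>G. of_bool ({v, w} \<in> G) * of_bool (closes r G w {v, w} v)))"
        unfolding E_def bexp_add bexp_sum ..
      also have "(\<Sum>w\<in>W. E (\<lambda>G. of_bool ({v, w} \<in> G) * of_bool (closes r G w {v, w} v))) \<le> (\<Sum>w\<in>W. c / n * (K / n))"
      proof (rule sum_mono)
        fix w assume w: "w \<in> W"
        have e: "{v, w} \<in> vertex_pairs n" using w v by (auto simp: W_def)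
        have "E (\<lambda>G. of_bool ({v, w} \<in> G) * of_bool (closes r G w {v, w} v)) = p {v, w} * E (\<lambda>G. of_bool (closes r G w {v, w} v))"
          unfolding E_def
        proof (rule bexp_edge_mult[OF _ e])
          fix G
          have "closes r (insert {v, w} G) w {v, w} v \<longleftrightarrow> closes r G w {v, w} v"
            using w by (intro closes_cong) (auto simp: W_def)
          then show "of_bool (closes r (insert {v, w} G) w {v, w} v) = of_bool (closes r G w {v, w} v)" by simp
        qed simp
        also have "\<dots> \<le> c / n * (K / n)"
        proof (rule mult_mono)
          show "E (\<lambda>G. of_bool (closes r G w {v, w} v)) \<le> K / n"
            unfolding E_def K_def using w v
            by (intro bexp_closes_le[where p = p and T = "{v, w}" and s = 2 and r = r and v = w and q = v, OF p c n])
              (auto simp: W_def)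
          show "0 \<le> E (\<lambda>G. of_bool (closes r G w {v, w} v))"
            unfolding E_def by (intro bexp_nonneg p01) auto
        qed (use p[OF e] c in auto)
        finally show "E (\<lambda>G. of_bool ({v, w} \<in> G) * of_bool (closes r G w {v, w} v)) \<le> c / n * (K / n)" .
      qed
      also have "\<dots> \<le> real n * (c / n * (K / n))"
        using c by (intro sum_constant_le) (auto simp: W_def K_def v)
      also have "\<dots> = c * K / n" using elim by simp
      finally have 1: "E (\<lambda>G. of_bool (v \<in> core n G (Suc r))) \<le> E F + c * K / n" by simp
      define P where "P H = (\<Prod>w\<in>W. 1 - p {v, w} * of_bool (N H w))" for H
      define Q where "Q H w = (\<Prod>w'\<in>W - {w}. 1 - p {v, w'} * of_bool (N H w'))" for H w
      have vpairs: "vertex_pairs n = pairs_off n {v} \<union> star n {v} v"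
      proof (intro equalityI subsetI)
        fix e assume e: "e \<in> vertex_pairs n"
        then obtain x y where "e = {x, y}" "x < y" "y < n" by (rule vertex_pairsE)
        then show "e \<in> pairs_off n {v} \<union> star n {v} v"
          using e by (auto simp: pairs_off_def star_def doubleton_eq_iff)
      qed (use v in \<open>auto simp: pairs_off_def star_def\<close>)
      have "E F = bexp (pairs_off n {v}) p (\<lambda>H. bexp (star n {v} v) p (\<lambda>S. F (H \<union> S)))"
        unfolding E_def vpairs using star_pairs_off_disjoint[of v "{v}" n] by (intro bexp_union) auto
      also have "\<dots> = bexp (pairs_off n {v}) p (\<lambda>H. 1 - P H - (\<Sum>w\<in>W. p {v, w} * of_bool (N H w) * Q H w))"
      proof (rule bexp_cong)
        fix H assume H: "H \<subseteq> pairs_off n {v}"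
        have "bexp (star n {v} v) p (\<lambda>S. F (H \<union> S)) = bexp (star n {v} v) p (\<lambda>S.
           1 - (\<Prod>w\<in>W. 1 - of_bool ({v, w} \<in> S) * of_bool (N H w)) -
           (\<Sum>w\<in>W. of_bool ({v, w} \<in> S) * of_bool (N H w) * (\<Prod>w'\<in>W - {w}. 1 - of_bool ({v, w'} \<in> S) * of_bool (N H w'))))"
        proof (rule bexp_cong)
          fix S assume S: "S \<subseteq> star n {v} v"
          have "A (H \<union> S) w \<longleftrightarrow> {v, w} \<in> S \<and> N H w" if "w \<in> W" for w
          proof -
            have "N (H \<union> S) w \<longleftrightarrow> N H w"
              unfolding N_def using that H S vpairs star_pairs_off_disjoint[of v "{v}" n]
              by (intro long_restrict_off[of w "{v}" n]) (auto simp: W_def)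
            moreover have "{v, w} \<notin> H" using H by (auto simp: pairs_off_def)
            ultimately show ?thesis by (auto simp: A_def)
          qed
          then show "F (H \<union> S) = 1 - (\<Prod>w\<in>W. 1 - of_bool ({v, w} \<in> S) * of_bool (N H w)) -
           (\<Sum>w\<in>W. of_bool ({v, w} \<in> S) * of_bool (N H w) * (\<Prod>w'\<in>W - {w}. 1 - of_bool ({v, w'} \<in> S) * of_bool (N H w')))"
            unfolding F_def by (intro arg_cong2[where f="(-)"] prod.cong sum.cong arg_cong2[where f="(*)"] refl) auto
        qed
        also have "\<dots> = 1 - P H - (\<Sum>w\<in>W. p {v, w} * of_bool (N H w) * Q H w)"
          unfolding bexp_diff W_def P_def Q_def
          by (simp only: bexp_star_none[OF finite.emptyI] bexp_star_at_most_one bexp_const finite_star)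
        finally show "bexp (star n {v} v) p (\<lambda>S. F (H \<union> S)) = 1 - P H - (\<Sum>w\<in>W. p {v, w} * of_bool (N H w) * Q H w)" .
      qed
      also have "\<dots> \<le> bexp (pairs_off n {v}) p (\<lambda>H. 1 - (1 + \<mu>) * exp (- \<mu>) + (1 + c) * c\<^sup>2 / n + \<beta> + (X H - \<mu>)\<^sup>2 / \<beta>)"
      proof (rule bexp_mono)
        fix H
        have x: "0 \<le> X H" "X H \<le> c"
          unfolding X_def using walk_mass_bounds[where p = p and r = r and H = H, OF p c n \<open>0 < n\<close> T(1,2)] by auto
        have pw: "0 \<le> p {v, w}" "p {v, w} \<le> 1" if "w \<in> W" for w
          using that v prob_pair_bounds[where p = p and v = v and w = w, OF p c n \<open>0 < n\<close>] by (auto simp: W_def)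
        have f01: "0 \<le> 1 - p {v, w} * of_bool (N H w)" "1 - p {v, w} * of_bool (N H w) \<le> 1" if "w \<in> W" for w
          using pw[OF that] by auto
        \<comment> \<open>Omitting a factor at most one enlarges the product. Hence the probability
          of exactly one continuing neighbour is at least \<open>X H * P H\<close>, and with that of
          none this gives \<open>(1 + X H) * P H\<close>.\<close>
        have "P H \<le> Q H w" if "w \<in> W" for w
        proof -
          have "P H = (1 - p {v, w} * of_bool (N H w)) * Q H w"
            unfolding P_def Q_def by (rule prod.remove[OF finW that])
          also have "\<dots> \<le> 1 * Q H w"
            unfolding Q_def using f01 that by (intro mult_right_mono prod_nonneg) auto
          finally show ?thesis by simp
        qed
        then have "(\<Sum>w\<in>W. p {v, w} * of_bool (N H w) * P H) \<le> (\<Sum>w\<in>W. p {v, w} * of_bool (N H w) * Q H w)"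
          using pw by (intro sum_mono mult_left_mono) auto
        moreover have "(\<Sum>w\<in>W. p {v, w} * of_bool (N H w) * P H) = X H * P H"
          unfolding X_def walk_mass_def W_def N_def sum_distrib_right ..
        ultimately have "1 - P H - (\<Sum>w\<in>W. p {v, w} * of_bool (N H w) * Q H w) \<le> 1 - (1 + X H) * P H"
          by (simp add: algebra_simps)
        also have "(1 + X H) * (exp (- X H) - c\<^sup>2 / n) \<le> (1 + X H) * P H"
          using prod_walk_approx[where p = p and r = r and H = H, OF p c n \<open>0 < n\<close> T(1,2)] x
          by (intro mult_left_mono) (auto simp: P_def W_def N_def X_def abs_le_iff)
        then have "1 - (1 + X H) * P H \<le> 1 - (1 + X H) * exp (- X H) + (1 + X H) * (c\<^sup>2 / n)"
          by (simp add: algebra_simps)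
        also have "(1 + X H) * (c\<^sup>2 / n) \<le> (1 + c) * (c\<^sup>2 / n)"
          using x by (intro mult_right_mono) auto
        also have "1 - (1 + X H) * exp (- X H) \<le> 1 - (1 + \<mu>) * exp (- \<mu>) + (\<beta> + (X H - \<mu>)\<^sup>2 / \<beta>)"
          using at_most_one_lipschitz[OF x(1) \<mu>] abs_le_add_square_div[OF \<beta>(1), of "X H - \<mu>"] by linarith
        finally show "1 - P H - (\<Sum>w\<in>W. p {v, w} * of_bool (N H w) * Q H w)
           \<le> 1 - (1 + \<mu>) * exp (- \<mu>) + (1 + c) * c\<^sup>2 / n + \<beta> + (X H - \<mu>)\<^sup>2 / \<beta>" by simp
      next
        fix e assume "e \<in> pairs_off n {v}"
        then show "0 \<le> p e \<and> p e \<le> 1" using p01 pairs_off_subset by blast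
      qed
      also have "\<dots> \<le> 1 - (1 + \<mu>) * exp (- \<mu>) + (1 + c) * c\<^sup>2 / n + \<beta> + \<beta>\<^sup>2 / \<beta>"
        unfolding bexp_add bexp_divide
      proof (intro add_mono divide_right_mono)
        show "bexp (pairs_off n {v}) p (\<lambda>H. (X H - \<mu>)\<^sup>2) \<le> \<beta>\<^sup>2"
          unfolding X_def using elim(1) reg T by blast
      qed (use \<beta> in \<open>auto simp: bexp_const\<close>)
      finally have "E F \<le> 1 - (1 + \<mu>) * exp (- \<mu>) + (1 + c) * c\<^sup>2 / n + \<beta> + \<beta>"
        unfolding \<beta>(3) .
      moreover have "\<beta> + \<beta> = \<eta> / 4" by (simp add: \<beta>_def)
      ultimately have "E (\<lambda>G. of_bool (v \<in> core n G (Suc r))) \<le> 1 - (1 + \<mu>) * exp (- \<mu>) + \<eta>"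
        using 1 elim(2,4) \<eta> by linarith
      then show "bexp (vertex_pairs n) p (\<lambda>G. of_bool (v \<in> core n G (Suc r))) \<le> 1 - (1 + \<mu>) * exp (- \<mu>) + \<eta>"
        by (simp only: E_def)
    qed
  qed
  with \<delta> show ?thesis by blast
qed

section \<open>Chain rule for the entropy of the labels\<close>

lemma finite_labellings [simp]: "finite (labellings n k)"
  by (simp add: labellings_def finite_PiE)

lemma card_labellings: "card (labellings n k) = k ^ n"
  by (simp add: labellings_def card_PiE)

lemma labellings_less: "x \<in> labellings n k \<Longrightarrow> v < n \<Longrightarrow> x v < k"
  by (auto simp: labellings_def)

lemma labellings_update: "x \<in> labellings n k \<Longrightarrow> v < n \<Longrightarrow> c < k \<Longrightarrow> x(v := c) \<in> labellings n k"
  by (auto simp: labellings_def PiE_iff extensional_def)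

text \<open>Exchanging the label at \<open>s\<close> with the new value \<open>c\<close> is an
  involution of the pairs \<open>(x, c)\<close>, so each labelling is counted \<open>k\<close>
  times.\<close>

lemma sum_labellings_update:
  assumes "s < n"
  shows "(\<Sum>x\<in>labellings n k. \<Sum>c<k. g (x(s := c))) = real k * (\<Sum>x\<in>labellings n k. g x)"
proof -
  have "(\<Sum>x\<in>labellings n k. \<Sum>c<k. g (x(s := c))) = (\<Sum>(x, c)\<in>labellings n k \<times> {..<k}. g (x(s := c)))"
    by (simp add: sum.cartesian_product)
  also have "\<dots> = (\<Sum>(x, c)\<in>labellings n k \<times> {..<k}. g x)"
    by (rule sum.reindex_bij_witness[where i = "\<lambda>(x, c). (x(s := c), x s)" and j = "\<lambda>(x, c). (x(s := c), x s)"])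
       (use assms in \<open>auto simp: labellings_update labellings_less\<close>)
  also have "\<dots> = real k * (\<Sum>x\<in>labellings n k. g x)"
    by (simp add: sum.cartesian_product[symmetric] sum_distrib_left)
  finally show ?thesis .
qed

text \<open>For a weight \<open>F\<close> on labellings this is the marginal, at \<open>x\<close>, of the labels outside \<open>D\<close>.\<close>

definition relabel_sum :: "nat \<Rightarrow> nat set \<Rightarrow> ((nat \<Rightarrow> nat) \<Rightarrow> real) \<Rightarrow> (nat \<Rightarrow> nat) \<Rightarrow> real" where
  "relabel_sum k D F x = (\<Sum>z\<in>D \<rightarrow>\<^sub>E {..<k}. F (\<lambda>u. if u \<in> D then z u else x u))"

lemma relabel_sum_empty [simp]: "relabel_sum k {} F x = F x"
  by (simp add: relabel_sum_def)

lemma relabel_sum_insert: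
  assumes "u \<notin> D" "finite D"
  shows "relabel_sum k (insert u D) F x = (\<Sum>c<k. relabel_sum k D F (x(u := c)))"
proof -
  have "relabel_sum k (insert u D) F x
      = (\<Sum>(c, z)\<in>{..<k} \<times> (D \<rightarrow>\<^sub>E {..<k}). F (\<lambda>w. if w \<in> D then z w else (x(u := c)) w))"
    unfolding relabel_sum_def PiE_insert_eq
    using assms(1)
    by (subst sum.reindex[OF inj_combinator[where T = "\<lambda>_. {..<k}", OF assms(1)]])
       (auto intro!: sum.cong arg_cong[where f = F] simp: fun_eq_iff)
  then show ?thesis
    by (simp add: relabel_sum_def sum.cartesian_product)
qed

lemma relabel_sum_insert':
  assumes "u \<notin> D" "finite D"
  shows "relabel_sum k (insert u D) F x = relabel_sum k D (\<lambda>y. \<Sum>c<k. F (y(u := c))) x"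
proof -
  have "(\<lambda>w. if w \<in> D then z w else (x(u := c)) w) = (\<lambda>w. if w \<in> D then z w else x w)(u := c)" for z c
    using assms by (auto simp: fun_eq_iff)
  then show ?thesis
    unfolding relabel_sum_insert[OF assms] unfolding relabel_sum_def
    by (subst sum.swap) simp
qed

lemma relabel_sum_cong_off:
  assumes "\<And>u. u \<notin> D \<Longrightarrow> x u = y u"
  shows "relabel_sum k D F x = relabel_sum k D F y"
  unfolding relabel_sum_def using assms by (intro sum.cong arg_cong[where f = F]) auto

lemma relabel_in_labellings:
  assumes "x \<in> labellings n k" "D \<subseteq> {..<n}" "z \<in> D \<rightarrow>\<^sub>E {..<k}"
  shows "(\<lambda>u. if u \<in> D then z u else x u) \<in> labellings n k"
  using assms by (auto simp: labellings_def PiE_iff extensional_def)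

lemma relabel_sum_mono:
  assumes "x \<in> labellings n k" "D \<subseteq> {..<n}"
    "\<And>y. y \<in> labellings n k \<Longrightarrow> (\<And>u. u \<notin> D \<Longrightarrow> y u = x u) \<Longrightarrow> F y \<le> F' y"
  shows "relabel_sum k D F x \<le> relabel_sum k D F' x"
  unfolding relabel_sum_def by (intro sum_mono assms(3) relabel_in_labellings[OF assms(1,2)]) auto

lemma relabel_sum_cmult: "relabel_sum k D (\<lambda>y. c * F y) x = c * relabel_sum k D F x"
  by (simp add: relabel_sum_def sum_distrib_left)

lemma relabel_sum_nonneg: "(\<And>y. 0 \<le> F y) \<Longrightarrow> 0 \<le> relabel_sum k D F x"
  by (simp add: relabel_sum_def sum_nonneg)

text \<open>One vertex at a time: its current label is among those summed over, and the other terms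
  are nonnegative.\<close>

lemma relabel_sum_subset_le:
  assumes "x \<in> labellings n k" "D \<subseteq> D'" "D' \<subseteq> {..<n}" "\<And>y. 0 \<le> F y"
  shows "relabel_sum k D F x \<le> relabel_sum k D' F x"
proof -
  have "finite D'" using assms(3) finite_subset by blast
  have "relabel_sum k D F x \<le> relabel_sum k (D \<union> E) F x" if "E \<subseteq> D'" for E
    using finite_subset[OF that \<open>finite D'\<close>] that
  proof (induction E)
    case (insert e E)
    show ?case
    proof (cases "e \<in> D \<union> E")
      case True
      then have "insert e (D \<union> E) = D \<union> E" by auto
      then show ?thesis using insert by simp
    next
      case False
      have e: "e < n" using insert assms(3) by auto
      have fin: "finite (D \<union> E)" using insert assms(2) \<open>finite D'\<close> finite_subset by blast
      have "relabel_sum k D F x \<le> relabel_sum k (D \<union> E) F (x(e := x e))"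
        using insert by simp
      also have "\<dots> \<le> (\<Sum>c<k. relabel_sum k (D \<union> E) F (x(e := c)))"
        using labellings_less[OF assms(1) e]
        by (intro member_le_sum[of "x e" "{..<k}" "\<lambda>c. relabel_sum k (D \<union> E) F (x(e := c))"])
          (auto intro: relabel_sum_nonneg assms(4))
      also have "\<dots> = relabel_sum k (D \<union> insert e E) F x"
        using relabel_sum_insert[OF False fin] by simp
      finally show ?thesis .
    qed
  qed simp
  from this[of D'] show ?thesis
    using assms(2) by (simp add: Un_absorb1)
qed

lemma relabel_sum_ge:
  assumes "x \<in> labellings n k" "D \<subseteq> {..<n}" "\<And>y. 0 \<le> F y"
  shows "F x \<le> relabel_sum k D F x"
  using relabel_sum_subset_le[of x n k "{}" D F] assms by simp

lemma relabel_sum_all: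
  assumes "x \<in> labellings n k"
  shows "relabel_sum k {..<n} F x = (\<Sum>y\<in>labellings n k. F y)"
  unfolding relabel_sum_def labellings_def
proof (intro sum.cong refl arg_cong[where f = F])
  fix z assume "z \<in> {..<n} \<rightarrow>\<^sub>E {..<k}"
  then show "(\<lambda>u. if u \<in> {..<n} then z u else x u) = z"
    using assms by (auto simp: fun_eq_iff labellings_def PiE_iff extensional_def)
qed

text \<open>The marginal and \<open>h\<close> both ignore the labels on \<open>D\<close>, so the sum
  over all \<open>x\<close> counts every fibre \<open>k ^ card D\<close> times.\<close>

lemma sum_relabel_sum:
  assumes "D \<subseteq> {..<n}" "\<And>x y. (\<And>u. u \<notin> D \<Longrightarrow> x u = y u) \<Longrightarrow> h x = h y"
  shows "(\<Sum>x\<in>labellings n k. relabel_sum k D F x * h x) = real k ^ card D * (\<Sum>x\<in>labellings n k. F x * h x)"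
proof -
  have "finite D" using assms(1) finite_subset by blast
  then show ?thesis using assms
  proof (induction D)
    case (insert s D)
    have h: "h (x(s := c)) = h x" for x c
      by (rule insert.prems(2)) auto
    have "(\<Sum>x\<in>labellings n k. relabel_sum k (insert s D) F x * h x)
        = (\<Sum>x\<in>labellings n k. \<Sum>c<k. (\<lambda>y. relabel_sum k D F y * h y) (x(s := c)))"
      using insert.hyps by (simp add: relabel_sum_insert sum_distrib_right h)
    also have "\<dots> = real k * (\<Sum>x\<in>labellings n k. relabel_sum k D F x * h x)"
      using insert.prems(1) by (intro sum_labellings_update) auto
    also have "(\<Sum>x\<in>labellings n k. relabel_sum k D F x * h x) = real k ^ card D * (\<Sum>x\<in>labellings n k. F x * h x)"
    proof (rule insert.IH)
      fix x y :: "nat \<Rightarrow> nat" assume "\<And>u. u \<notin> D \<Longrightarrow> x u = y u"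
      then show "h x = h y" by (intro insert.prems(2)) auto
    qed (use insert.prems(1) in auto)
    finally show ?case using insert.hyps by simp
  next
    case empty
    show ?case by simp
  qed
qed

text \<open>The bound \<open>ln t \<le> t - 1\<close> reduces this to a computation with marginals.\<close>

lemma conditional_entropy_mono:
  assumes "k > 0" "A \<subseteq> {..<n}" "B \<subseteq> A" "s \<in> B" and p: "\<And>y. 0 \<le> p y"
  shows "(\<Sum>x\<in>labellings n k. p x * ln (relabel_sum k (A - {s}) p x / relabel_sum k A p x))
    \<le> (\<Sum>x\<in>labellings n k. p x * ln (relabel_sum k (B - {s}) p x / relabel_sum k B p x))"
proof -
  define X where "X = labellings n k"
  define m where "m D = relabel_sum k D p" for D
  \<comment> \<open>The quotient of two conditional probabilities of the label of \<open>s\<close>: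
    given the labels outside \<open>A\<close>, and given the larger set of labels outside
    \<open>B\<close>. The claim is that the mean logarithm of \<open>R\<close> is not positive,
    which follows once the mean of \<open>R\<close> is at most one.\<close>
  define R where "R x = m (A - {s}) x * m B x / (m A x * m (B - {s}) x)" for x
  have fin: "finite A" "finite B"
    by (rule finite_subset[OF assms(2) finite_lessThan],
        rule finite_subset[OF subset_trans[OF assms(3,2)] finite_lessThan])
  have sn: "s < n" using subsetD[OF assms(2) subsetD[OF assms(3,4)]] by simp
  have sub: "B \<subseteq> {..<n}" "A - {s} \<subseteq> {..<n}" "B - {s} \<subseteq> {..<n}"
    by (rule subset_trans[OF assms(3,2)], rule subset_trans[OF Diff_subset assms(2)],
        rule subset_trans[OF Diff_subset subset_trans[OF assms(3,2)]])
  have m0: "0 \<le> m D x" for D x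
    unfolding m_def by (rule relabel_sum_nonneg) (rule p)
  have minsert: "m D x = (\<Sum>c<k. m (D - {s}) (x(s := c)))" if "s \<in> D" "finite D" for D x
    unfolding m_def using relabel_sum_insert[of s "D - {s}" k p x] that by (simp add: insert_absorb)
  have mpos: "0 < m D x" if "p x > 0" "x \<in> X" "D \<subseteq> {..<n}" for D x
  proof -
    have "p x \<le> m D x"
      unfolding m_def using that(2,3) p unfolding X_def by (rule relabel_sum_ge)
    then show ?thesis using that(1) by linarith
  qed
  have moff: "m D x = m D y" if "\<And>u. u \<notin> D \<Longrightarrow> x u = y u" for D x y
    unfolding m_def using that by (rule relabel_sum_cong_off)
  have moff': "m D x = m D y" if "\<And>u. u \<notin> D' \<Longrightarrow> x u = y u" "D' \<subseteq> D" for D D' x y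
    using that by (intro moff) auto
  have step1: "real k ^ card (B - {s}) * (\<Sum>x\<in>X. p x * R x) = (\<Sum>x\<in>X. m (B - {s}) x * R x)"
    unfolding m_def[of "B - {s}"] X_def
  proof (rule sum_relabel_sum[symmetric])
    fix x y :: "nat \<Rightarrow> nat" assume xy: "\<And>u. u \<notin> B - {s} \<Longrightarrow> x u = y u"
    have eq: "m D x = m D y" if "B - {s} \<subseteq> D" for D
      using xy that by (rule moff')
    have "B - {s} \<subseteq> A - {s}" "B - {s} \<subseteq> B" "B - {s} \<subseteq> A" using assms(3) by auto
    then show "R x = R y" unfolding R_def by (simp only: eq order_refl)
  qed (rule sub)
  \<comment> \<open>If a marginal vanishes, the quotient is 0 rather than 1, so the cancellations
    here and in \<open>a3\<close> are inequalities; they point in the required direction.\<close>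
  have a1: "(\<Sum>x\<in>X. m (B - {s}) x * R x) \<le> (\<Sum>x\<in>X. m (A - {s}) x * (m B x / m A x))"
  proof (rule sum_mono)
    fix x
    have "m (B - {s}) x * R x = (m (B - {s}) x / m (B - {s}) x) * (m (A - {s}) x * (m B x / m A x))"
      by (simp add: R_def)
    also have "\<dots> \<le> 1 * (m (A - {s}) x * (m B x / m A x))"
      using m0 by (intro mult_right_mono mult_nonneg_nonneg divide_nonneg_nonneg) (auto simp: divide_self_if)
    finally show "m (B - {s}) x * R x \<le> m (A - {s}) x * (m B x / m A x)" by simp
  qed
  have a2: "real k * (\<Sum>x\<in>X. m (A - {s}) x * (m B x / m A x)) = (\<Sum>x\<in>X. m A x * (m B x / m A x))"
  proof -
    have "real k * (\<Sum>x\<in>X. m (A - {s}) x * (m B x / m A x))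
        = (\<Sum>x\<in>X. \<Sum>c<k. m (A - {s}) (x(s := c)) * (m B (x(s := c)) / m A (x(s := c))))"
      unfolding X_def by (rule sum_labellings_update[symmetric, OF sn])
    also have "\<dots> = (\<Sum>x\<in>X. \<Sum>c<k. m (A - {s}) (x(s := c)) * (m B x / m A x))"
    proof (intro sum.cong refl arg_cong2[where f = "(*)"] arg_cong2[where f = "(/)"])
      fix x c
      show "m B (x(s := c)) = m B x" "m A (x(s := c)) = m A x"
        using assms(3,4) by (auto intro!: moff)
    qed
    also have "\<dots> = (\<Sum>x\<in>X. m A x * (m B x / m A x))"
    proof (intro sum.cong refl)
      fix x
      have "m A x = (\<Sum>c<k. m (A - {s}) (x(s := c)))"
        using assms(3,4) fin by (intro minsert) auto
      then show "(\<Sum>c<k. m (A - {s}) (x(s := c)) * (m B x / m A x)) = m A x * (m B x / m A x)"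
        by (simp only: sum_distrib_right)
    qed
    finally show ?thesis .
  qed
  have a3: "(\<Sum>x\<in>X. m A x * (m B x / m A x)) \<le> (\<Sum>x\<in>X. m B x * 1)"
  proof (rule sum_mono)
    fix x show "m A x * (m B x / m A x) \<le> m B x * 1"
      using m0[of B x] by (cases "m A x = 0") auto
  qed
  have a4: "(\<Sum>x\<in>X. m B x * 1) = real k ^ card B * (\<Sum>x\<in>X. p x * 1)"
    unfolding m_def X_def by (rule sum_relabel_sum[OF sub(1)]) simp
  have "real k * (\<Sum>x\<in>X. m (B - {s}) x * R x) \<le> real k * (\<Sum>x\<in>X. m (A - {s}) x * (m B x / m A x))"
    by (rule mult_left_mono[OF a1]) simp
  also note a2
  also note a3
  also note a4
  finally have le: "real k * (\<Sum>x\<in>X. m (B - {s}) x * R x) \<le> real k ^ card B * (\<Sum>x\<in>X. p x)"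
    by (simp only: mult_1_right)
  have "card B = Suc (card (B - {s}))"
    by (rule card.remove[OF fin(2) assms(4)])
  with le have "(real k * real k ^ card (B - {s})) * (\<Sum>x\<in>X. p x * R x)
      \<le> (real k * real k ^ card (B - {s})) * (\<Sum>x\<in>X. p x)"
    unfolding step1[symmetric] by (simp add: mult.assoc)
  then have total: "(\<Sum>x\<in>X. p x * R x) \<le> (\<Sum>x\<in>X. p x)"
    by (rule mult_left_le_imp_le) (use assms(1) in auto)
  have "(\<Sum>x\<in>X. p x * ln (m (A - {s}) x / m A x)) - (\<Sum>x\<in>X. p x * ln (m (B - {s}) x / m B x))
      \<le> (\<Sum>x\<in>X. p x * R x - p x)"
    unfolding sum_subtractf[symmetric]
  proof (rule sum_mono)
    fix x assume x: "x \<in> X"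
    show "p x * ln (m (A - {s}) x / m A x) - p x * ln (m (B - {s}) x / m B x) \<le> p x * R x - p x"
    proof (cases "p x > 0")
      case True
      have pos: "0 < m A x" "0 < m (A - {s}) x" "0 < m B x" "0 < m (B - {s}) x"
        by (rule mpos[OF True x assms(2)] mpos[OF True x sub(1)] mpos[OF True x sub(2)] mpos[OF True x sub(3)])+
      then have "ln (m (A - {s}) x / m A x) - ln (m (B - {s}) x / m B x) = ln (R x)"
        by (simp add: R_def ln_div ln_mult)
      also have "\<dots> \<le> R x - 1"
        using pos by (intro ln_le_minus_one) (auto simp: R_def)
      finally have "p x * (ln (m (A - {s}) x / m A x) - ln (m (B - {s}) x / m B x)) \<le> p x * (R x - 1)"
        using True by (intro mult_left_mono) auto
      then show ?thesis by (simp add: algebra_simps)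
    next
      case False
      then have "p x = 0" using p[of x] by linarith
      then show ?thesis by simp
    qed
  qed
  also have "\<dots> \<le> 0"
    using total by (simp add: sum_subtractf)
  finally show ?thesis
    unfolding m_def X_def by linarith
qed

text \<open>Treating the vertices by increasing key, the log-probability telescopes into conditional
  ones: at \<open>v\<close> one conditions on the labels outside the set of vertices treated so far,
  including \<open>v\<close>. Shrinking that set to \<open>S v\<close> conditions on more labels,
  and \<open>conditional_entropy_mono\<close> says in which direction the sum moves.\<close>

lemma entropy_chain:
  fixes key :: "nat \<Rightarrow> nat"
  assumes "k > 0" "U \<subseteq> {..<n}" "inj_on key U"
    and S: "\<And>v. v \<in> U \<Longrightarrow> v \<in> S v \<and> S v \<subseteq> {u \<in> U. key u \<le> key v}" and p: "\<And>y. 0 \<le> p y"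
  shows "(\<Sum>x\<in>labellings n k. p x * ln (p x / relabel_sum k U p x))
    \<le> (\<Sum>v\<in>U. \<Sum>x\<in>labellings n k. p x * ln (relabel_sum k (S v - {v}) p x / relabel_sum k (S v) p x))"
proof -
  have "finite U" using assms(2) finite_subset by blast
  then show ?thesis using assms(2-4)
  proof (induction U rule: finite_ranking_induct[where f = key])
    case (insert v U)
    show ?case
    proof (cases "v \<in> U")
      case True
      then have eq: "insert v U = U" by auto
      show ?thesis
        unfolding eq by (rule insert.IH) (use insert.prems in \<open>simp_all only: eq\<close>)
    next
      case v: False
    have S': "u \<in> S u \<and> S u \<subseteq> {w \<in> U. key w \<le> key u}" if "u \<in> U" for u
    proof -
      have "v \<notin> S u"
      proof
        assume "v \<in> S u"
        then have "key v \<le> key u" using insert.prems(3)[of u] that by blast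
        then have "key v = key u" using insert.hyps(2)[OF that] by simp
        then have "v = u" using insert.prems(2) that by (auto simp: inj_on_def)
        then show False using that v by simp
      qed
      then show ?thesis using insert.prems(3)[of u] that by blast
    qed
    have IH: "(\<Sum>x\<in>labellings n k. p x * ln (p x / relabel_sum k U p x))
      \<le> (\<Sum>v\<in>U. \<Sum>x\<in>labellings n k. p x * ln (relabel_sum k (S v - {v}) p x / relabel_sum k (S v) p x))"
    proof (rule insert.IH)
      show "U \<subseteq> {..<n}" "inj_on key U"
        using insert.prems(1,2) by (auto simp: inj_on_def)
    qed (rule S')
    have "(\<Sum>x\<in>labellings n k. p x * ln (p x / relabel_sum k (insert v U) p x))
       = (\<Sum>x\<in>labellings n k. p x * ln (p x / relabel_sum k U p x)
           + p x * ln (relabel_sum k (insert v U - {v}) p x / relabel_sum k (insert v U) p x))"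
    proof (intro sum.cong refl)
      fix x assume x: "x \<in> labellings n k"
      show "p x * ln (p x / relabel_sum k (insert v U) p x) = p x * ln (p x / relabel_sum k U p x)
           + p x * ln (relabel_sum k (insert v U - {v}) p x / relabel_sum k (insert v U) p x)"
      proof (cases "p x > 0")
        case True
        have sub: "U \<subseteq> {..<n}" using insert.prems(1) by simp
        have pos: "0 < relabel_sum k U p x" "0 < relabel_sum k (insert v U) p x"
          using relabel_sum_ge[where F = p and D = U, OF x sub p]
            relabel_sum_ge[where F = p and D = "insert v U", OF x insert.prems(1) p] True
          by linarith+
        have "insert v U - {v} = U" using v by simp
        then have "ln (p x / relabel_sum k (insert v U) p x) = ln (p x / relabel_sum k U p x)
           + ln (relabel_sum k (insert v U - {v}) p x / relabel_sum k (insert v U) p x)"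
          using pos True by (simp add: ln_div)
        then show ?thesis
          by (simp only: distrib_left)
      next
      case False
      then have "p x = 0" using p[of x] by linarith
      then show ?thesis by simp
    qed
    qed
    also have "\<dots> \<le> (\<Sum>v\<in>U. \<Sum>x\<in>labellings n k. p x * ln (relabel_sum k (S v - {v}) p x / relabel_sum k (S v) p x))
       + (\<Sum>x\<in>labellings n k. p x * ln (relabel_sum k (S v - {v}) p x / relabel_sum k (S v) p x))"
      unfolding sum.distrib
    proof (intro add_mono IH conditional_entropy_mono)
      show "v \<in> S v" "S v \<subseteq> insert v U" "insert v U \<subseteq> {..<n}"
        using insert.prems(1) insert.prems(3)[of v] by simp_all auto
    qed (use assms(1) p in simp_all)
    finally show ?thesis
      using insert.hyps(1) v by simp
    qed
  next
    case empty
    have "p x * ln (p x / p x) = 0" for x by (cases "p x = 0") auto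
    then show ?case by (simp only: relabel_sum_empty sum.neutral_const sum.empty order_refl)
  qed
qed

section \<open>Likelihood of the block model\<close>

definition edge_prob :: "nat \<Rightarrow> real \<Rightarrow> real \<Rightarrow> (nat \<Rightarrow> nat) \<Rightarrow> nat set \<Rightarrow> real" where
  "edge_prob n a b x e = (if monochromatic x e then a else b) / real n"

definition graph_weight :: "nat \<Rightarrow> real \<Rightarrow> real \<Rightarrow> (nat \<Rightarrow> nat) \<Rightarrow> nat set set \<Rightarrow> real" where
  "graph_weight n a b x G = bern_weight (vertex_pairs n) (edge_prob n a b x) G"

definition log_nonedges :: "nat \<Rightarrow> real \<Rightarrow> real \<Rightarrow> (nat \<Rightarrow> nat) \<Rightarrow> real" where
  "log_nonedges n a b x = (\<Sum>e\<in>vertex_pairs n. ln (1 - edge_prob n a b x e))"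

definition edge_odds :: "nat \<Rightarrow> real \<Rightarrow> real \<Rightarrow> (nat \<Rightarrow> nat) \<Rightarrow> nat set \<Rightarrow> real" where
  "edge_odds n a b x e = edge_prob n a b x e / (1 - edge_prob n a b x e)"

definition class_size :: "nat \<Rightarrow> (nat \<Rightarrow> 'c) \<Rightarrow> 'c \<Rightarrow> real" where
  "class_size n x i = real (card {u \<in> {..<n}. x u = i})"

lemma monochromatic_pair [simp]: "monochromatic x {u, v} \<longleftrightarrow> x u = x v"
  by (auto simp: monochromatic_def)

lemma class_size_eq_sum: "class_size n x i = (\<Sum>u<n. of_bool (x u = i))"
  by (simp add: class_size_def Int_def)

lemma sum_class_size:
  assumes "finite L" "x ` {..<n} \<subseteq> L"
  shows "(\<Sum>i\<in>L. class_size n x i) = real n"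
proof -
  have "(\<Sum>i\<in>L. class_size n x i) = (\<Sum>u<n. \<Sum>i\<in>L. of_bool (x u = i))"
    unfolding class_size_eq_sum by (rule sum.swap)
  also have "\<dots> = (\<Sum>u<n. 1)"
    using assms by (intro sum.cong refl) (auto simp: of_bool_def sum.delta')
  finally show ?thesis by simp
qed

text \<open>Ordered pairs with equal labels are counted class by class by the squared class sizes,
  and the diagonal contributes \<open>n\<close>.\<close>

lemma sum_vertex_pairs_equal:
  assumes "finite L" "x ` {..<n} \<subseteq> L"
  shows "2 * (\<Sum>v<n. \<Sum>u<v. of_bool (x u = x v)) = (\<Sum>i\<in>L. (class_size n x i)\<^sup>2) - real n"
proof -
  have double: "2 * (\<Sum>v<n. \<Sum>u<v. f u v) + real n = (\<Sum>v<n. \<Sum>u<n. f u v)"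
    if "\<And>u v. f u v = f v u" "\<And>u. f u u = 1" for f :: "nat \<Rightarrow> nat \<Rightarrow> real" and n
  proof (induction n)
    case (Suc n)
    have "(\<Sum>v<n. f n v) = (\<Sum>u<n. f u n)"
      using that(1) by (intro sum.cong refl)
    with Suc show ?case using that(2)[of n] by (simp add: sum.distrib algebra_simps)
  qed simp
  have "2 * (\<Sum>v<n. \<Sum>u<v. of_bool (x u = x v)) + real n = (\<Sum>v<n. \<Sum>u<n. of_bool (x u = x v))"
    by (rule double) (rule arg_cong[where f = of_bool], rule eq_commute, simp)
  also have "\<dots> = (\<Sum>v<n. \<Sum>u<n. \<Sum>i\<in>L. of_bool (x u = i) * of_bool (x v = i))"
  proof (intro sum.cong refl)
    fix u v assume "u \<in> {..<n}"
    then have "x u \<in> L" using assms(2) by auto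
    then have "(\<Sum>i\<in>L. of_bool (x u = i) * of_bool (x v = i) :: real) = (\<Sum>i\<in>{x u}. of_bool (x v = i))"
      using assms(1) by (intro sum.mono_neutral_cong_right) auto
    also have "(\<Sum>i\<in>{x u}. of_bool (x v = i) :: real) = of_bool (x v = x u)"
      by simp
    also have "\<dots> = of_bool (x u = x v)"
      by (rule arg_cong[where f = of_bool]) (rule eq_commute)
    finally show "(of_bool (x u = x v) :: real) = (\<Sum>i\<in>L. of_bool (x u = i) * of_bool (x v = i))"
      by (rule sym)
  qed
  also have "\<dots> = (\<Sum>v<n. \<Sum>i\<in>L. \<Sum>u<n. of_bool (x u = i) * of_bool (x v = i))"
    by (intro sum.cong refl sum.swap)
  also have "\<dots> = (\<Sum>i\<in>L. \<Sum>v<n. \<Sum>u<n. of_bool (x u = i) * of_bool (x v = i))"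
    by (rule sum.swap)
  also have "\<dots> = (\<Sum>i\<in>L. (class_size n x i)\<^sup>2)"
    unfolding class_size_eq_sum power2_eq_square sum_product
    by (intro sum.cong refl) (simp only: mult.commute)
  finally show ?thesis by simp
qed

definition mono_pairs :: "nat \<Rightarrow> (nat \<Rightarrow> nat) \<Rightarrow> real" where
  "mono_pairs n x = real (card {e \<in> vertex_pairs n. monochromatic x e})"

lemma mono_pairs_eq_sum: "mono_pairs n x = (\<Sum>e\<in>vertex_pairs n. of_bool (monochromatic x e))"
  by (simp add: mono_pairs_def Int_def)

lemma mono_pairs_formula:
  assumes "x \<in> labellings n k"
  shows "2 * mono_pairs n x = (\<Sum>i<k. (class_size n x i)\<^sup>2) - real n"
  unfolding mono_pairs_eq_sum sum_vertex_pairs monochromatic_pair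
  by (rule sum_vertex_pairs_equal) (use assms labellings_less in auto)

lemma log_nonedges_eq:
  "log_nonedges n a b x
    = mono_pairs n x * ln (1 - a / n) + (real (card (vertex_pairs n)) - mono_pairs n x) * ln (1 - b / n)"
proof -
  have "log_nonedges n a b x = (\<Sum>e\<in>vertex_pairs n. of_bool (monochromatic x e) * ln (1 - a / n)
      + (1 - of_bool (monochromatic x e)) * ln (1 - b / n))"
    unfolding log_nonedges_def edge_prob_def by (intro sum.cong refl) auto
  also have "\<dots> = mono_pairs n x * ln (1 - a / n) + (real (card (vertex_pairs n)) - mono_pairs n x) * ln (1 - b / n)"
    by (simp add: sum.distrib mono_pairs_eq_sum sum_distrib_right sum_subtractf left_diff_distrib)
  finally show ?thesis .
qed

lemma edge_prob_bounds:
  assumes "0 \<le> a" "0 \<le> b" "max a b \<le> c" "c \<le> real n"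
  shows "0 \<le> edge_prob n a b x e" "edge_prob n a b x e \<le> c / n" "edge_prob n a b x e \<le> 1"
proof -
  show 1: "0 \<le> edge_prob n a b x e" "edge_prob n a b x e \<le> c / n"
    using assms by (auto simp: edge_prob_def intro!: divide_right_mono)
  have "c / n \<le> 1" using assms by (simp add: divide_le_eq)
  then show "edge_prob n a b x e \<le> 1" using 1 by linarith
qed

lemma graph_weight_nonneg:
  assumes "0 \<le> a" "0 \<le> b" "max a b \<le> real n"
  shows "0 \<le> graph_weight n a b x G"
  unfolding graph_weight_def using edge_prob_bounds[OF assms(1,2) order_refl assms(3)]
  by (intro bern_weight_nonneg) auto

text \<open>Separates a global factor, which sees the labelling only through its number of
  monochromatic pairs, from one local factor per edge. Relabelling arguments treat the first as
  nearly constant and compute with the second exactly.\<close>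

lemma graph_weight_eq:
  assumes "0 \<le> a" "0 \<le> b" "max a b < real n" "G \<subseteq> vertex_pairs n"
  shows "graph_weight n a b x G = exp (log_nonedges n a b x) * (\<Prod>e\<in>G. edge_odds n a b x e)"
proof -
  have lt: "edge_prob n a b x e < 1" for e
    using assms by (auto simp: edge_prob_def divide_less_eq)
  have "graph_weight n a b x G
      = (\<Prod>e\<in>vertex_pairs n. (1 - edge_prob n a b x e) * (if e \<in> G then edge_odds n a b x e else 1))"
    unfolding graph_weight_def bern_weight_def edge_odds_def using lt
    by (intro prod.cong refl) (auto simp: less_imp_neq[THEN not_sym] dest: less_imp_neq)
  also have "\<dots> = (\<Prod>e\<in>vertex_pairs n. 1 - edge_prob n a b x e) * (\<Prod>e\<in>G. edge_odds n a b x e)"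
    unfolding prod.distrib using assms(4) by (simp add: prod.inter_restrict[symmetric] Int_absorb1)
  also have "(\<Prod>e\<in>vertex_pairs n. 1 - edge_prob n a b x e) = exp (log_nonedges n a b x)"
    unfolding log_nonedges_def using lt by (simp add: exp_sum)
  finally show ?thesis .
qed

lemma balanced_class_size:
  assumes "x \<in> balanced n k \<delta>" "i < k" "n > 0"
  shows "\<bar>class_size n x i - n / k\<bar> \<le> \<delta> * n"
proof -
  have "\<bar>class_size n x i / n - 1 / k\<bar> \<le> \<delta>"
    using assms by (auto simp: balanced_def class_size_def abs_le_iff)
  then have "\<bar>class_size n x i / n - 1 / k\<bar> * n \<le> \<delta> * n"
    by (rule mult_right_mono) simp
  also have "\<bar>class_size n x i / n - 1 / k\<bar> * n = \<bar>(class_size n x i / n - 1 / k) * n\<bar>"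
    by (simp add: abs_mult)
  also have "(class_size n x i / n - 1 / k) * n = class_size n x i - n / k"
    using assms(3) by (simp add: field_simps)
  finally show ?thesis .
qed

lemma balanced_imp_labellings: "x \<in> balanced n k \<delta> \<Longrightarrow> x \<in> labellings n k"
  by (simp add: balanced_def)

lemma class_size_diff_le:
  assumes "\<And>u. u \<notin> S \<Longrightarrow> y u = x u" "finite S"
  shows "\<bar>class_size n y i - class_size n x i\<bar> \<le> card S"
proof -
  have "\<bar>class_size n y i - class_size n x i\<bar> = \<bar>\<Sum>u<n. of_bool (y u = i) - of_bool (x u = i)\<bar>"
    by (simp add: class_size_eq_sum sum_subtractf del: sum_of_bool_eq)
  also have "\<dots> \<le> (\<Sum>u<n. \<bar>of_bool (y u = i) - of_bool (x u = i)\<bar>)"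
    by (rule sum_abs)
  also have "\<dots> \<le> (\<Sum>u<n. of_bool (u \<in> S))"
    using assms(1) by (intro sum_mono) (auto simp: of_bool_def)
  also have "\<dots> = real (card ({..<n} \<inter> S))"
    by (simp add: Int_def)
  also have "\<dots> \<le> card S"
    using assms(2) by (simp add: card_mono)
  finally show ?thesis .
qed

lemma ln_one_minus_bounds:
  fixes t :: real
  assumes "0 \<le> t" "t \<le> 1 / 2"
  shows "- 2 * t \<le> ln (1 - t)" "ln (1 - t) \<le> - t" "ln (1 - t) \<le> 0"
proof -
  show 1: "ln (1 - t) \<le> - t" using assms ln_le_minus_one[of "1 - t"] by simp
  then show "ln (1 - t) \<le> 0" using assms by linarith
  have "- ln (1 - t) = ln (1 / (1 - t))" using assms by (simp add: ln_div)
  also have "\<dots> \<le> 1 / (1 - t) - 1" using assms by (intro ln_le_minus_one) auto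
  also have "\<dots> = t / (1 - t)" using assms by (simp add: field_simps)
  also have "\<dots> \<le> t / (1 / 2)" using assms by (intro divide_left_mono) auto
  finally show "- 2 * t \<le> ln (1 - t)" by simp
qed

text \<open>Relabelling m vertices can change about m n pairs, hence the logarithm by order m, which
  would be too much. At a balanced labelling the leading part cancels, and the extra factor
  \<open>2 * \<delta> + card S / n\<close> appears.\<close>

lemma log_nonedges_diff_le:
  fixes c :: real
  assumes "0 \<le> a" "0 \<le> b" "max a b \<le> c" "2 * c \<le> n" "n > 0" "k > 0"
    "x \<in> balanced n k \<delta>" "y \<in> labellings n k" "\<And>u. u \<notin> S \<Longrightarrow> y u = x u" "finite S"
  shows "\<bar>log_nonedges n a b y - log_nonedges n a b x\<bar> \<le> c * k * card S * (2 * \<delta> + card S / n)"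
proof -
  define s where "s = real (card S)"
  define \<Delta> where "\<Delta> i = class_size n y i - class_size n x i" for i
  have x: "x \<in> labellings n k" using assms(7) by (rule balanced_imp_labellings)
  have \<Delta>: "\<bar>\<Delta> i\<bar> \<le> s" for i
    unfolding \<Delta>_def s_def by (rule class_size_diff_le) (use assms in auto)
  have tot: "(\<Sum>i<k. class_size n z i) = n" if "z \<in> labellings n k" for z
    by (rule sum_class_size) (use that labellings_less in auto)
  have "(\<Sum>i<k. \<Delta> i) = 0"
    unfolding \<Delta>_def sum_subtractf using tot x assms(8) by simp
  \<comment> \<open>The total number of vertices is fixed, so the part of the change proportional to
    the common mean class size n/k sums to zero.\<close>
  then have \<Delta>0: "(\<Sum>i<k. 2 * (n / k) * \<Delta> i) = 0"
    unfolding sum_distrib_left[symmetric] by simp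
  have "2 * mono_pairs n y - 2 * mono_pairs n x = (\<Sum>i<k. (class_size n y i)\<^sup>2 - (class_size n x i)\<^sup>2)"
    by (simp add: mono_pairs_formula[OF x] mono_pairs_formula[OF assms(8)] sum_subtractf)
  also have "\<dots> = (\<Sum>i<k. \<Delta> i * (2 * (class_size n x i - n / k) + \<Delta> i) + 2 * (n / k) * \<Delta> i)"
    unfolding \<Delta>_def by (intro sum.cong refl) (simp add: power2_eq_square algebra_simps)
  also have "\<dots> = (\<Sum>i<k. \<Delta> i * (2 * (class_size n x i - n / k) + \<Delta> i))"
    unfolding sum.distrib \<Delta>0 by simp
  also have "\<bar>\<dots>\<bar> \<le> (\<Sum>i<k. s * (2 * (\<delta> * n) + s))"
  proof (rule order_trans[OF sum_abs sum_mono])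
    fix i assume i: "i \<in> {..<k}"
    have "\<bar>2 * (class_size n x i - n / k) + \<Delta> i\<bar> \<le> 2 * (\<delta> * n) + s"
      using balanced_class_size[OF assms(7) _ assms(5), of i] i \<Delta>[of i] by auto
    then show "\<bar>\<Delta> i * (2 * (class_size n x i - n / k) + \<Delta> i)\<bar> \<le> s * (2 * (\<delta> * n) + s)"
      unfolding abs_mult using \<Delta>[of i] by (intro mult_mono) (auto simp: s_def)
  qed
  also have "\<dots> = k * s * (2 * (\<delta> * n) + s)" by simp
  finally have M: "\<bar>mono_pairs n y - mono_pairs n x\<bar> \<le> k * s * (2 * (\<delta> * n) + s) / 2"
    by linarith
  have an: "0 \<le> a / n" "a / n \<le> c / n" "0 \<le> b / n" "b / n \<le> c / n" "c / n \<le> 1 / 2"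
    using assms by (auto simp: divide_right_mono field_simps)
  have ln: "\<bar>ln (1 - a / n) - ln (1 - b / n)\<bar> \<le> 2 * (c / n)"
    using ln_one_minus_bounds[OF an(1) order_trans[OF an(2,5)]]
      ln_one_minus_bounds[OF an(3) order_trans[OF an(4,5)]] an by linarith
  have "log_nonedges n a b y - log_nonedges n a b x
      = (mono_pairs n y - mono_pairs n x) * (ln (1 - a / n) - ln (1 - b / n))"
    unfolding log_nonedges_eq by (simp add: algebra_simps)
  also have "\<bar>\<dots>\<bar> \<le> (k * s * (2 * (\<delta> * n) + s) / 2) * (2 * (c / n))"
    unfolding abs_mult by (rule mult_mono[OF M ln order_trans[OF abs_ge_zero M] abs_ge_zero])
  also have "\<dots> = c * k * s * (2 * \<delta> + s / n)"
    using assms(5) by (simp add: field_simps)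
  finally show ?thesis by (simp add: s_def)
qed

section \<open>Peeling order\<close>

text \<open>The peeling order: by the number of rounds survived, ties broken by the index.\<close>

definition rounds :: "nat \<Rightarrow> nat set set \<Rightarrow> nat \<Rightarrow> nat \<Rightarrow> nat" where
  "rounds n G r v = card {j \<in> {1..r}. v \<in> core n G j}"

definition peel_key :: "nat \<Rightarrow> nat set set \<Rightarrow> nat \<Rightarrow> nat \<Rightarrow> nat" where
  "peel_key n G r v = rounds n G r v * n + v"

text \<open>The cores decrease, so the rounds survived form an initial segment, and their number is
  the last of them.\<close>

lemma mem_core_iff_rounds:
  assumes "v < n" "j \<le> r"
  shows "v \<in> core n G j \<longleftrightarrow> j \<le> rounds n G r v"
proof
  assume v: "v \<in> core n G j"
  have "{1..j} \<subseteq> {i \<in> {1..r}. v \<in> core n G i}"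
  proof
    fix i assume "i \<in> {1..j}"
    then show "i \<in> {i \<in> {1..r}. v \<in> core n G i}"
      using v assms(2) subsetD[OF core_antimono[of i j n G]] by auto
  qed
  then have "card {1..j} \<le> rounds n G r v"
    unfolding rounds_def by (rule card_mono[rotated]) auto
  then show "j \<le> rounds n G r v" by simp
next
  assume j: "j \<le> rounds n G r v"
  show "v \<in> core n G j"
  proof (rule ccontr)
    assume v: "v \<notin> core n G j"
    then have "0 < j" using assms by (cases j) auto
    have "{i \<in> {1..r}. v \<in> core n G i} \<subseteq> {1..<j}"
    proof
      fix i assume "i \<in> {i \<in> {1..r}. v \<in> core n G i}"
      then show "i \<in> {1..<j}" using v core_antimono[of j i n G] by (cases "j \<le> i") auto
    qed
    then have "rounds n G r v \<le> card {1..<j}"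
      unfolding rounds_def by (rule card_mono[rotated]) auto
    then show False using j \<open>0 < j\<close> by simp
  qed
qed

lemma peel_key_le_rounds:
  assumes "peel_key n G r u < peel_key n G r v" "v < n"
  shows "rounds n G r u \<le> rounds n G r v"
proof (rule ccontr)
  assume "\<not> ?thesis"
  then have "Suc (rounds n G r v) * n \<le> rounds n G r u * n"
    by (intro mult_le_mono1) auto
  then show False using assms by (simp add: peel_key_def)
qed

lemma inj_on_peel_key: "inj_on (peel_key n G r) {..<n}"
proof (rule inj_onI)
  fix u v assume uv: "u \<in> {..<n}" "v \<in> {..<n}" "peel_key n G r u = peel_key n G r v"
  then have "peel_key n G r u mod n = peel_key n G r v mod n" by simp
  then show "u = v" using uv by (simp add: peel_key_def)
qed

definition peeled :: "nat \<Rightarrow> nat set set \<Rightarrow> nat \<Rightarrow> nat set" where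
  "peeled n G r = {..<n} - core n G r"

definition later :: "nat \<Rightarrow> nat set set \<Rightarrow> nat \<Rightarrow> nat \<Rightarrow> nat set" where
  "later n G r v = {w. {v, w} \<in> G \<and> peel_key n G r v < peel_key n G r w}"

lemma later_subset: "G \<subseteq> vertex_pairs n \<Longrightarrow> later n G r v \<subseteq> {..<n}"
  unfolding later_def using pair_in_vertex_pairs by blast

text \<open>Two later neighbours would both be in the core at the last round that \<open>v\<close>
  survives, and \<open>v\<close> would then survive one more.\<close>

lemma later_unique:
  assumes G: "G \<subseteq> vertex_pairs n" and v: "v \<in> peeled n G r" and w: "w \<in> later n G r v" and w': "w' \<in> later n G r v"
  shows "w = w'"
proof (rule ccontr)
  assume "w \<noteq> w'"
  define j where "j = rounds n G r v"
  have vn: "v < n" and vr: "v \<notin> core n G r" using v by (auto simp: peeled_def)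
  have wn: "w < n" "w' < n" using later_subset[OF G] w w' by auto
  have jr: "j < r"
    using vr mem_core_iff_rounds[OF vn order_refl, of G r] by (auto simp: j_def)
  have "j \<le> rounds n G r w" "j \<le> rounds n G r w'"
    unfolding j_def using w w' wn by (auto simp: later_def intro: peel_key_le_rounds)
  then have "w \<in> core n G j" "w' \<in> core n G j"
    using mem_core_iff_rounds[of _ n j r G] wn jr by auto
  moreover have "v \<in> core n G j" using mem_core_iff_rounds[of v n j r G] vn jr by (simp add: j_def)
  ultimately have "v \<in> core n G (Suc j)"
    using w w' \<open>w \<noteq> w'\<close> by (auto simp: later_def)
  then have "Suc j \<le> rounds n G r v"
    using mem_core_iff_rounds[of v n "Suc j" r G] vn jr by simp
  then show False by (simp add: j_def)
qed

lemma card_later_le: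
  assumes "G \<subseteq> vertex_pairs n" "v \<in> peeled n G r"
  shows "card (later n G r v) \<le> 1" "finite (later n G r v)"
proof -
  show fin: "finite (later n G r v)" using later_subset[OF assms(1)] finite_subset by blast
  show "card (later n G r v) \<le> 1"
    using later_unique[OF assms] card_le_Suc0_iff_eq[OF fin] by auto
qed

text \<open>By \<open>later_unique\<close> each peeled vertex has at most one successor, so the
  peeled vertices form a forest directed towards later ones; \<open>branch\<close> is the subtree
  hanging from \<open>v\<close>, including \<open>v\<close>.\<close>

definition peel_rel :: "nat \<Rightarrow> nat set set \<Rightarrow> nat \<Rightarrow> (nat \<times> nat) set" where
  "peel_rel n G r = {(u, w). u \<in> peeled n G r \<and> w \<in> peeled n G r \<and> w \<in> later n G r u}"

definition branch :: "nat \<Rightarrow> nat set set \<Rightarrow> nat \<Rightarrow> nat \<Rightarrow> nat set" where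
  "branch n G r v = {u \<in> peeled n G r. (u, v) \<in> (peel_rel n G r)\<^sup>*}"

lemma peel_rel_key_le: "(u, v) \<in> (peel_rel n G r)\<^sup>* \<Longrightarrow> peel_key n G r u \<le> peel_key n G r v"
  by (induction rule: rtrancl_induct) (auto simp: peel_rel_def later_def)

lemma branch_key:
  assumes "v \<in> peeled n G r"
  shows "v \<in> branch n G r v \<and> branch n G r v \<subseteq> {u \<in> peeled n G r. peel_key n G r u \<le> peel_key n G r v}"
  using assms peel_rel_key_le by (auto simp: branch_def)

lemma branch_subset: "branch n G r v \<subseteq> {..<n}"
  by (auto simp: branch_def peeled_def)

text \<open>An earlier neighbour survives no more rounds than \<open>u\<close>, hence is peeled as
  well.\<close>

lemma branch_closed_down:
  assumes "u \<in> branch n G r v" "u \<in> later n G r z" "G \<subseteq> vertex_pairs n"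
  shows "z \<in> branch n G r v"
proof -
  have u: "u \<in> peeled n G r" "(u, v) \<in> (peel_rel n G r)\<^sup>*" using assms(1) by (auto simp: branch_def)
  have un: "u < n" using u by (auto simp: peeled_def)
  have "{z, u} \<in> vertex_pairs n" using assms(2,3) by (auto simp: later_def)
  then have zn: "z < n" by simp
  have "rounds n G r z \<le> rounds n G r u"
    using assms(2) un by (auto simp: later_def intro: peel_key_le_rounds)
  moreover have "\<not> r \<le> rounds n G r u"
    using u(1) mem_core_iff_rounds[OF un order_refl, of G r] by (simp add: peeled_def)
  ultimately have "z \<notin> core n G r"
    using mem_core_iff_rounds[OF zn order_refl, of G r] by linarith
  then have z: "z \<in> peeled n G r" using zn by (simp add: peeled_def)
  then have "(z, u) \<in> peel_rel n G r" using u(1) assms(2) by (simp add: peel_rel_def)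
  then show ?thesis using z u(2) by (auto simp: branch_def intro: converse_rtrancl_into_rtrancl)
qed

lemma branch_later:
  assumes "u \<in> branch n G r v" "u \<noteq> v" "G \<subseteq> vertex_pairs n"
  shows "\<exists>w \<in> branch n G r v. later n G r u = {w}"
proof -
  have u: "u \<in> peeled n G r" "(u, v) \<in> (peel_rel n G r)\<^sup>*" using assms(1) by (auto simp: branch_def)
  from u(2) assms(2) obtain w where w: "(u, w) \<in> peel_rel n G r" "(w, v) \<in> (peel_rel n G r)\<^sup>*"
    by (auto elim: converse_rtranclE)
  then have "w \<in> branch n G r v" "w \<in> later n G r u"
    by (auto simp: branch_def peel_rel_def)
  moreover have "later n G r u = {w}"
    using calculation later_unique[OF assms(3) u(1)] by blast
  ultimately show ?thesis by blast
qed

lemma peel_rel_single_valued: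
  assumes "G \<subseteq> vertex_pairs n" "(u, w) \<in> peel_rel n G r" "(u, w') \<in> peel_rel n G r"
  shows "w = w'"
  using assms later_unique[of G n u r w w'] by (auto simp: peel_rel_def)

lemma rtrancl_no_successor:
  assumes "\<nexists>w. (u, w) \<in> R"
  shows "{v. (u, v) \<in> R\<^sup>*} = {u}"
proof -
  have "v = u" if "(u, v) \<in> R\<^sup>*" for v
    using that by (cases rule: converse_rtranclE) (use assms in blast)+
  then show ?thesis by blast
qed

lemma rtrancl_one_successor:
  assumes "(u, w) \<in> R" "\<And>y. (u, y) \<in> R \<Longrightarrow> y = w"
  shows "{v. (u, v) \<in> R\<^sup>*} = insert u {v. (w, v) \<in> R\<^sup>*}"
proof -
  have "v = u \<or> (w, v) \<in> R\<^sup>*" if "(u, v) \<in> R\<^sup>*" for v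
    using that
  proof (cases rule: converse_rtranclE)
    case (step y)
    then show ?thesis using assms(2) by blast
  qed simp
  moreover have "(u, v) \<in> R\<^sup>*" if "(w, v) \<in> R\<^sup>*" for v
    using assms(1) that by (rule converse_rtrancl_into_rtrancl)
  ultimately show ?thesis by blast
qed

text \<open>Along the successor relation the number of rounds never decreases, and it can stay equal
  only in the last step. So a chain has at most one vertex more than the remaining rounds.\<close>

lemma card_ancestors_le:
  assumes G: "G \<subseteq> vertex_pairs n" and u: "u \<in> peeled n G r"
  shows "finite {v. (u, v) \<in> (peel_rel n G r)\<^sup>*} \<and>
    card {v. (u, v) \<in> (peel_rel n G r)\<^sup>*} \<le> r - rounds n G r u + 1"
  using u
proof (induction "r - rounds n G r u" arbitrary: u rule: less_induct)
  case less
  define R where "R = peel_rel n G r"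
  have un: "u < n" using less.prems by (auto simp: peeled_def)
  have ur: "rounds n G r u < r"
    using less.prems mem_core_iff_rounds[OF un order_refl, of G r] by (auto simp: peeled_def)
  show ?case
  proof (cases "\<exists>w. (u, w) \<in> R")
    case False
    then have "{v. (u, v) \<in> R\<^sup>*} = {u}"
      by (rule rtrancl_no_successor)
    then show ?thesis by (simp add: R_def)
  next
    case True
    then obtain w where w: "(u, w) \<in> R" by blast
    have eq: "{v. (u, v) \<in> R\<^sup>*} = insert u {v. (w, v) \<in> R\<^sup>*}"
      using w by (rule rtrancl_one_successor) (use w peel_rel_single_valued[OF G] in \<open>simp add: R_def\<close>)
    have wp: "w \<in> peeled n G r" "w \<in> later n G r u" using w by (auto simp: R_def peel_rel_def)
    have wn: "w < n" using wp by (auto simp: peeled_def)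
    have le: "rounds n G r u \<le> rounds n G r w"
      using wp wn by (auto simp: later_def intro: peel_key_le_rounds)
    show ?thesis
    proof (cases "rounds n G r u = rounds n G r w")
      case False
      then have lt: "r - rounds n G r w < r - rounds n G r u" using le ur by simp
      note IH = less.hyps[OF lt wp(1), folded R_def]
      have "card (insert u {v. (w, v) \<in> R\<^sup>*}) \<le> Suc (card {v. (w, v) \<in> R\<^sup>*})"
        by (rule card_insert_le_m1) auto
      then show ?thesis
        unfolding R_def[symmetric] eq using IH lt by simp
    next
      case True
      \<comment> \<open>If \<open>w\<close> had a further successor \<open>z\<close>, then
        \<open>u\<close> and \<open>z\<close> would be two neighbours of \<open>w\<close> in the
        core of round \<open>j\<close>, and \<open>w\<close> would survive round
        \<open>j + 1\<close>.\<close>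
      have "\<not> (\<exists>z. (w, z) \<in> R)"
      proof
        assume "\<exists>z. (w, z) \<in> R"
        then obtain z where z: "z \<in> peeled n G r" "z \<in> later n G r w" by (auto simp: R_def peel_rel_def)
        define j where "j = rounds n G r w"
        have zn: "z < n" using z by (auto simp: peeled_def)
        have "j \<le> rounds n G r z" "j < r"
          using z zn True ur by (auto simp: later_def j_def intro: peel_key_le_rounds)
        then have "z \<in> core n G j" "u \<in> core n G j" "w \<in> core n G j"
          using mem_core_iff_rounds[of _ n j r G] zn un wn True by (auto simp: j_def)
        moreover have "z \<noteq> u"
          using z(2) wp(2) by (auto simp: later_def)
        moreover have "{w, z} \<in> G" "{w, u} \<in> G"
          using z(2) wp(2) by (auto simp: later_def insert_commute)
        ultimately have "w \<in> core n G (Suc j)" by auto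
        then show False
          using mem_core_iff_rounds[of w n "Suc j" r G] wn \<open>j < r\<close> by (simp add: j_def)
      qed
      then have "{v. (w, v) \<in> R\<^sup>*} = {w}" by (rule rtrancl_no_successor)
      then show ?thesis unfolding R_def[symmetric] eq using ur by (simp add: card_insert_if; arith)
    qed
  qed
qed

text \<open>A single branch need not be small, but every vertex has at most \<open>r + 1\<close>
  ancestors, itself included. Counting pairs the other way bounds the branches on average.\<close>

lemma sum_card_branch_le:
  assumes G: "G \<subseteq> vertex_pairs n"
  shows "(\<Sum>v\<in>peeled n G r. real (card (branch n G r v))) \<le> real n * (real r + 1)"
proof -
  define R where "R = peel_rel n G r"
  define U where "U = peeled n G r"
  have finU: "finite U" by (simp add: U_def peeled_def)
  have "(\<Sum>v\<in>U. real (card (branch n G r v))) = (\<Sum>v\<in>U. \<Sum>u\<in>U. of_bool ((u, v) \<in> R\<^sup>*))"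
    using finU by (intro sum.cong refl) (simp add: branch_def U_def R_def Int_def)
  also have "\<dots> = (\<Sum>u\<in>U. \<Sum>v\<in>U. of_bool ((u, v) \<in> R\<^sup>*))"
    by (rule sum.swap)
  also have "\<dots> \<le> (\<Sum>u\<in>U. real r + 1)"
  proof (rule sum_mono)
    fix u assume u: "u \<in> U"
    have "(\<Sum>v\<in>U. of_bool ((u, v) \<in> R\<^sup>*) :: real) = real (card {v \<in> U. (u, v) \<in> R\<^sup>*})"
      using finU by (simp add: Int_def)
    also have "card {v \<in> U. (u, v) \<in> R\<^sup>*} \<le> card {v. (u, v) \<in> R\<^sup>*}"
      using card_ancestors_le[OF G u[unfolded U_def]] unfolding R_def by (intro card_mono) auto
    also have "\<dots> \<le> r + 1"
      using card_ancestors_le[OF G u[unfolded U_def]] unfolding R_def by auto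
    finally show "(\<Sum>v\<in>U. of_bool ((u, v) \<in> R\<^sup>*) :: real) \<le> real r + 1" by simp
  qed
  also have "\<dots> \<le> real n * (real r + 1)"
  proof (rule sum_constant_le)
    show "card U \<le> n" using card_mono[of "{..<n}" U] by (auto simp: U_def peeled_def)
  qed simp
  finally show ?thesis by (simp add: U_def)
qed

text \<open>An edge not inside the core is charged to its endpoint with the smaller key, which is
  peeled because it survives no longer than the other one.\<close>

lemma sum_later_edges:
  assumes G: "G \<subseteq> vertex_pairs n"
  shows "(\<Sum>v\<in>peeled n G r. \<Sum>w\<in>later n G r v. h {v, w}) = (\<Sum>e\<in>{e \<in> G. \<not> e \<subseteq> core n G r}. h e :: real)"
proof -
  define P where "P = Sigma (peeled n G r) (later n G r)"
  have inj: "inj_on (\<lambda>(v, w). {v, w}) P"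
    by (auto simp: inj_on_def P_def doubleton_eq_iff later_def)
  have img: "(\<lambda>(v, w). {v, w}) ` P = {e \<in> G. \<not> e \<subseteq> core n G r}"
  proof (intro equalityI subsetI)
    fix e assume "e \<in> (\<lambda>(v, w). {v, w}) ` P"
    then show "e \<in> {e \<in> G. \<not> e \<subseteq> core n G r}"
      by (auto simp: P_def later_def peeled_def)
  next
    fix e assume e: "e \<in> {e \<in> G. \<not> e \<subseteq> core n G r}"
    then obtain u v where uv: "e = {u, v}" "u < v" "v < n"
      using G vertex_pairsE by blast
    have "peel_key n G r u \<noteq> peel_key n G r v"
      using inj_onD[OF inj_on_peel_key[of n G r], of u v] uv by auto
    then obtain x y where xy: "e = {x, y}" "x < n" "y < n" "peel_key n G r x < peel_key n G r y"
      using that[of u v] that[of v u] uv by (auto simp: insert_commute neq_iff)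
    have "rounds n G r x \<le> rounds n G r y" using xy by (intro peel_key_le_rounds) auto
    then have "x \<notin> core n G r"
      using e xy mem_core_iff_rounds[OF xy(2) order_refl, of G r] mem_core_iff_rounds[OF xy(3) order_refl, of G r] by auto
    then show "e \<in> (\<lambda>(v, w). {v, w}) ` P"
      using xy e by (auto simp: P_def peeled_def later_def)
  qed
  have "(\<Sum>v\<in>peeled n G r. \<Sum>w\<in>later n G r v. h {v, w}) = (\<Sum>(v, w)\<in>P. h {v, w})"
    unfolding P_def using later_subset[OF G] finite_subset
    by (subst sum.Sigma) (auto simp: peeled_def intro: finite_subset[OF later_subset[OF G]])
  also have "\<dots> = (\<Sum>e\<in>(\<lambda>(v, w). {v, w}) ` P. h e)"
    by (subst sum.reindex[OF inj]) (auto intro!: sum.cong)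
  finally show ?thesis by (simp add: img)
qed

lemma relabel_sum_cong:
  assumes "x \<in> labellings n k" "D \<subseteq> {..<n}"
    "\<And>y. y \<in> labellings n k \<Longrightarrow> (\<And>u. u \<notin> D \<Longrightarrow> y u = x u) \<Longrightarrow> F y = F' y"
  shows "relabel_sum k D F x = relabel_sum k D F' x"
  unfolding relabel_sum_def by (intro sum.cong refl assms(3) relabel_in_labellings[OF assms(1,2)]) auto

text \<open>Leaf elimination: the label of the earliest vertex occurs in no other factor, so summing
  over it turns its own factor into the constant \<open>\<kappa>\<close>.\<close>

lemma relabel_sum_tree:
  fixes key :: "nat \<Rightarrow> nat"
  assumes x: "x \<in> labellings n k" and D: "D \<subseteq> {..<n}" "inj_on key D"
    and row: "\<And>u y. u \<in> D \<Longrightarrow> y \<in> labellings n k \<Longrightarrow> (\<Sum>c<k. g u (y(u := c))) = \<kappa>"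
    and indep: "\<And>u u' y c. u \<in> D \<Longrightarrow> u' \<in> D \<Longrightarrow> key u < key u' \<Longrightarrow> g u' (y(u := c)) = g u' y"
  shows "relabel_sum k D (\<lambda>y. \<Prod>u\<in>D. g u y) x = \<kappa> ^ card D"
proof -
  have "finite D" by (rule finite_subset[OF D(1) finite_lessThan])
  \<comment> \<open>Ranking by the negated key makes the vertex added last the earliest one, so that
    \<open>relabel_sum_insert'\<close> sums over it innermost.\<close>
  have "relabel_sum k D' (\<lambda>y. \<Prod>u\<in>D'. g u y) x = \<kappa> ^ card D'" if "D' \<subseteq> D" for D'
    using finite_subset[OF that \<open>finite D\<close>] that
  proof (induction D' rule: finite_ranking_induct[where f = "\<lambda>u. - int (key u)"])
    case empty
    show ?case by simp
  next
    case (insert u D')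
    show ?case
    proof (cases "u \<in> D'")
      case True
      then have eq: "insert u D' = D'" by auto
      show ?thesis unfolding eq by (rule insert.IH) (use insert.prems in auto)
    next
      case False
      have uD: "u \<in> D" "D' \<subseteq> D" using insert.prems by auto
      have "relabel_sum k (insert u D') (\<lambda>y. \<Prod>u\<in>insert u D'. g u y) x
          = relabel_sum k D' (\<lambda>y. \<Sum>c<k. \<Prod>u'\<in>insert u D'. g u' (y(u := c))) x"
        using False insert.hyps(1) by (rule relabel_sum_insert')
      also have "\<dots> = relabel_sum k D' (\<lambda>y. \<kappa> * (\<Prod>u\<in>D'. g u y)) x"
      proof (rule relabel_sum_cong[OF x])
        show "D' \<subseteq> {..<n}" using uD(2) D(1) by (rule subset_trans)
        fix y assume y: "y \<in> labellings n k"
        have ind: "g u' (y(u := c)) = g u' y" if "u' \<in> D'" for u' c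
        proof (rule indep)
          have "key u \<le> key u'" using insert.hyps(2)[OF that] by simp
          moreover have "key u \<noteq> key u'" using inj_onD[OF D(2), of u u'] uD that False by auto
          ultimately show "key u < key u'" by simp
        qed (use uD that in auto)
        have "(\<Sum>c<k. \<Prod>u'\<in>insert u D'. g u' (y(u := c))) = (\<Sum>c<k. g u (y(u := c)) * (\<Prod>u'\<in>D'. g u' y))"
          using False insert.hyps(1) ind by (intro sum.cong refl) (simp add: prod.insert cong: prod.cong)
        also have "\<dots> = \<kappa> * (\<Prod>u\<in>D'. g u y)"
          unfolding sum_distrib_right[symmetric] row[OF uD(1) y] ..
        finally show "(\<Sum>c<k. \<Prod>u'\<in>insert u D'. g u' (y(u := c))) = \<kappa> * (\<Prod>u\<in>D'. g u y)" .
      qed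
      also have "\<dots> = \<kappa> * \<kappa> ^ card D'"
        unfolding relabel_sum_cmult using insert.IH uD(2) by simp
      finally show ?thesis using False insert.hyps(1) by simp
    qed
  qed
  from this[of D] show ?thesis by simp
qed

definition log_ratio :: "real \<Rightarrow> real \<Rightarrow> real \<Rightarrow> (nat \<Rightarrow> nat) \<Rightarrow> nat set \<Rightarrow> real" where
  "log_ratio a b d x e = ln ((if monochromatic x e then a else b) / d)"

text \<open>As in \<open>sum_later_edges\<close>, an edge that meets the branch is charged to its
  earlier endpoint; \<open>branch_closed_down\<close> puts that endpoint into the branch.\<close>

lemma prod_edges_touching_branch:
  fixes h :: "nat set \<Rightarrow> real"
  assumes G: "G \<subseteq> vertex_pairs n"
  shows "(\<Prod>e\<in>G. h e) = (\<Prod>e\<in>{e \<in> G. e \<inter> branch n G r v = {}}. h e)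
    * (\<Prod>u\<in>branch n G r v. \<Prod>w\<in>later n G r u. h {u, w})"
proof -
  define S where "S = branch n G r v"
  define P where "P = Sigma S (later n G r)"
  have finG: "finite G" by (rule finite_subset[OF G finite_vertex_pairs])
  have finS: "finite S" unfolding S_def by (rule finite_subset[OF branch_subset finite_lessThan])
  have inj: "inj_on (\<lambda>(v, w). {v, w}) P"
    by (auto simp: inj_on_def P_def doubleton_eq_iff later_def)
  have img: "(\<lambda>(v, w). {v, w}) ` P = {e \<in> G. e \<inter> S \<noteq> {}}"
  proof (intro equalityI subsetI)
    fix e assume "e \<in> (\<lambda>(v, w). {v, w}) ` P"
    then show "e \<in> {e \<in> G. e \<inter> S \<noteq> {}}"
      by (auto simp: P_def later_def)
  next
    fix e assume e: "e \<in> {e \<in> G. e \<inter> S \<noteq> {}}"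
    then obtain u w where uw: "e = {u, w}" "u < w" "w < n"
      using G vertex_pairsE by blast
    have "peel_key n G r u \<noteq> peel_key n G r w"
      using inj_onD[OF inj_on_peel_key[of n G r], of u w] uw by auto
    then obtain x y where xy: "e = {x, y}" "peel_key n G r x < peel_key n G r y"
      using that[of u w] that[of w u] uw by (auto simp: insert_commute neq_iff)
    then have y: "y \<in> later n G r x" using e by (simp add: later_def)
    have "x \<in> S" using e xy branch_closed_down[OF _ y G, of v] by (auto simp: S_def)
    then show "e \<in> (\<lambda>(v, w). {v, w}) ` P" using xy y by (auto simp: P_def)
  qed
  have "(\<Prod>e\<in>G. h e) = (\<Prod>e\<in>{e \<in> G. e \<inter> S = {}}. h e) * (\<Prod>e\<in>{e \<in> G. e \<inter> S \<noteq> {}}. h e)"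
  proof -
    have "G = {e \<in> G. e \<inter> S = {}} \<union> {e \<in> G. e \<inter> S \<noteq> {}}" by auto
    then show ?thesis
      using finG prod.union_disjoint[of "{e \<in> G. e \<inter> S = {}}" "{e \<in> G. e \<inter> S \<noteq> {}}" h] by auto
  qed
  also have "(\<Prod>e\<in>{e \<in> G. e \<inter> S \<noteq> {}}. h e) = (\<Prod>(u, w)\<in>P. h {u, w})"
    unfolding img[symmetric] by (subst prod.reindex[OF inj]) (auto intro!: prod.cong)
  also have "\<dots> = (\<Prod>u\<in>S. \<Prod>w\<in>later n G r u. h {u, w})"
    unfolding P_def using finS finite_subset[OF later_subset[OF G]] by (subst prod.Sigma) auto
  finally show ?thesis by (simp add: S_def)
qed

context
  fixes n k :: nat and a b c d \<delta> :: real
  assumes ab: "0 \<le> a" "0 \<le> b" "max a b \<le> c" and n: "2 * c \<le> n" "n > 0" "max a b < n" and k: "k > 0"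
    and d: "d = (a + (real k - 1) * b) / k" "d > 0"
begin

lemma edge_prob_half: "0 \<le> edge_prob n a b x e" "edge_prob n a b x e \<le> c / n" "edge_prob n a b x e \<le> 1 / 2"
proof -
  show 1: "0 \<le> edge_prob n a b x e" "edge_prob n a b x e \<le> c / n"
    using edge_prob_bounds[of a b c n x e] ab n by auto
  have "c / n \<le> 1 / 2" using n by (simp add: field_simps)
  then show "edge_prob n a b x e \<le> 1 / 2" using 1 by linarith
qed

lemma edge_odds_nonneg: "0 \<le> edge_odds n a b x e"
  unfolding edge_odds_def using edge_prob_half[of x e] by (intro divide_nonneg_nonneg) auto

text \<open>By the symmetry between labels, summing over one endpoint forgets the label of the
  other. This is the constant needed in \<open>relabel_sum_tree\<close>.\<close>

lemma sum_edge_odds: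
  assumes "y \<in> labellings n k" "u < n" "w < n" "u \<noteq> w"
  shows "(\<Sum>i<k. edge_odds n a b (y(u := i)) {u, w})
    = (a / n) / (1 - a / n) + (real k - 1) * ((b / n) / (1 - b / n))"
proof -
  have yw: "y w < k" using assms by (auto intro: labellings_less)
  have "(\<Sum>i<k. edge_odds n a b (y(u := i)) {u, w})
      = (\<Sum>i<k. if i = y w then (a / n) / (1 - a / n) else (b / n) / (1 - b / n))"
    using assms(4) by (intro sum.cong refl) (auto simp: edge_odds_def edge_prob_def)
  also have "\<dots> = (a / n) / (1 - a / n) + (\<Sum>i\<in>{..<k} - {y w}. (b / n) / (1 - b / n))"
    using yw by (subst sum.remove[of _ "y w"]) (auto intro!: sum.cong)
  also have "(\<Sum>i\<in>{..<k} - {y w}. (b / n) / (1 - b / n)) = (real k - 1) * ((b / n) / (1 - b / n))"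
    using yw by (simp add: of_nat_diff)
  finally show ?thesis .
qed

text \<open>Given the label of its later neighbour, a label has conditional probability about
  alpha/(k d), where alpha is \<open>a\<close> or \<open>b\<close> according to the edge. The term
  \<open>2 * c / n\<close> pays for passing from probabilities to odds.\<close>

lemma log_odds_ratio_ge:
  assumes "edge_prob n a b x e > 0"
  shows "ln k - log_ratio a b d x e - 2 * c / n
    \<le> ln (((a / n) / (1 - a / n) + (real k - 1) * ((b / n) / (1 - b / n))) / edge_odds n a b x e)"
proof -
  define \<alpha> where "\<alpha> = (if monochromatic x e then a else b)"
  have \<alpha>: "\<alpha> > 0" "edge_prob n a b x e = \<alpha> / n"
    using assms n by (auto simp: \<alpha>_def edge_prob_def zero_less_divide_iff split: if_splits)
  have half: "a / n \<le> 1 / 2" "b / n \<le> 1 / 2" "0 \<le> a / n" "0 \<le> b / n" "\<alpha> / n \<le> 1 / 2" "\<alpha> / n \<le> c / n"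
    using ab n edge_prob_half[of x e] \<alpha> by (auto simp: field_simps)
  have kk: "0 \<le> real k - 1" using k by simp
  have "k * d / n = a / n + (real k - 1) * (b / n)"
    using d k n by (simp add: field_simps)
  also have "\<dots> \<le> (a / n) / (1 - a / n) + (real k - 1) * ((b / n) / (1 - b / n))"
  proof -
    have *: "t \<le> t / (1 - t)" if "0 \<le> t" "t \<le> 1 / 2" for t :: real
      using that by (simp add: field_simps)
    show ?thesis using *[of "a / n"] *[of "b / n"] half kk by (intro add_mono mult_left_mono) auto
  qed
  finally have \<kappa>: "k * d / n \<le> (a / n) / (1 - a / n) + (real k - 1) * ((b / n) / (1 - b / n))" .
  have kd: "0 < k * d / n" using d(2) k n by simp
  have odds: "edge_odds n a b x e > 0"
    using \<alpha> half n by (simp add: edge_odds_def)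
  have "ln k - log_ratio a b d x e - 2 * c / n \<le> ln (k * d / n) - ln (\<alpha> / n) + ln (1 - \<alpha> / n)"
  proof -
    have "ln (1 - \<alpha> / n) \<ge> - 2 * (\<alpha> / n)"
      using \<alpha> half n by (intro ln_one_minus_bounds) auto
    moreover have "2 * (\<alpha> / n) \<le> 2 * c / n" using half by simp
    ultimately have "ln (1 - \<alpha> / n) \<ge> - (2 * c / n)" by linarith
    moreover have "ln (k * d / n) - ln (\<alpha> / n) = ln k - log_ratio a b d x e"
      using \<alpha>(1) k d(2) n(2) by (simp add: log_ratio_def \<alpha>_def[symmetric] ln_div ln_mult)
    ultimately show ?thesis by linarith
  qed
  also have "ln (k * d / n) - ln (\<alpha> / n) + ln (1 - \<alpha> / n) = ln ((k * d / n) / edge_odds n a b x e)"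
  proof -
    have *: "ln X - ln Y + ln (1 - Y) = ln (X / (Y / (1 - Y)))" if "X > 0" "Y > 0" "Y \<le> 1 / 2" for X Y :: real
      using that by (simp add: ln_div ln_mult)
    show ?thesis
      unfolding edge_odds_def \<alpha>(2) using kd \<alpha>(1) n(2) half(5) by (intro *) auto
  qed
  also have "\<dots> \<le> ln (((a / n) / (1 - a / n) + (real k - 1) * ((b / n) / (1 - b / n))) / edge_odds n a b x e)"
    by (rule ln_mono[OF divide_right_mono[OF \<kappa> less_imp_le[OF odds]] divide_pos_pos[OF kd odds]])
  finally show ?thesis .
qed

text \<open>Inside the branch the weight is a tree product times a non-edge factor that is constant
  up to \<open>exp \<epsilon>\<close>. Eliminating the tree below \<open>v\<close> gives the same
  power of \<open>\<kappa>\<close> in both marginals; what remains is the sum over the label of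
  \<open>v\<close>, with at most one edge leading out of the branch. The error occurs twice, in
  numerator and denominator.\<close>

lemma log_marginal_ratio_branch:
  assumes G: "G \<subseteq> vertex_pairs n" and x: "x \<in> balanced n k \<delta>" and pos: "graph_weight n a b x G > 0"
    and v: "v \<in> peeled n G r"
  defines "S \<equiv> branch n G r v"
  defines "p \<equiv> (\<lambda>y. graph_weight n a b y G)"
  shows "ln (relabel_sum k S p x / relabel_sum k (S - {v}) p x)
    \<ge> ln k - (\<Sum>w\<in>later n G r v. log_ratio a b d x {v, w}) - 2 * c / n
       - 2 * (c * k * card S * (2 * \<delta> + card S / n))"
proof -
  define \<epsilon> where "\<epsilon> = c * k * card S * (2 * \<delta> + card S / n)"
  define key where "key = peel_key n G r"
  define \<kappa> where "\<kappa> = (a / n) / (1 - a / n) + (real k - 1) * ((b / n) / (1 - b / n))"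
  define g where "g u y = (\<Prod>w\<in>later n G r u. edge_odds n a b y {u, w})" for u y
  define K where "K = (\<Prod>e\<in>{e \<in> G. e \<inter> S = {}}. edge_odds n a b x e)"
  define L where "L = log_nonedges n a b x"
  have xl: "x \<in> labellings n k" using x by (rule balanced_imp_labellings)
  have vS: "v \<in> S" and Skey: "key u \<le> key v" "u \<in> peeled n G r" if "u \<in> S" for u
    using branch_key[OF v] that by (auto simp: S_def key_def)
  have vS: "v \<in> S" using branch_key[OF v] by (simp add: S_def)
  have Sn: "S \<subseteq> {..<n}" unfolding S_def by (rule branch_subset)
  have finS: "finite S" by (rule finite_subset[OF Sn finite_lessThan])
  have vn: "v < n" using Sn vS by auto
  \<comment> \<open>\<open>K\<close> collects the edges that miss the branch and does not change
    under relabelling inside it.\<close>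
  have fac: "p y = exp (log_nonedges n a b y) * K * (\<Prod>u\<in>S. g u y)"
    if yx: "\<And>u. u \<notin> S \<Longrightarrow> y u = x u" for y
  proof -
    have "(\<Prod>e\<in>{e \<in> G. e \<inter> S = {}}. edge_odds n a b y e) = K"
      unfolding K_def
    proof (rule prod.cong[OF refl])
      fix e assume e: "e \<in> {e \<in> G. e \<inter> S = {}}"
      then have "y u = x u" if "u \<in> e" for u
        using that by (intro yx) auto
      then have "monochromatic y e = monochromatic x e"
        by (simp add: monochromatic_def)
      then show "edge_odds n a b y e = edge_odds n a b x e"
        by (simp add: edge_odds_def edge_prob_def)
    qed
    then show ?thesis
      unfolding p_def using graph_weight_eq[OF ab(1,2) n(3) G, of y]
        prod_edges_touching_branch[OF G, of "edge_odds n a b y" r v] by (simp add: S_def g_def)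
  qed
  have g0: "0 \<le> g u y" for u y unfolding g_def by (intro prod_nonneg edge_odds_nonneg)
  have K0: "0 \<le> K" unfolding K_def by (intro prod_nonneg edge_odds_nonneg)
  have Ldiff: "\<bar>log_nonedges n a b y - L\<bar> \<le> \<epsilon>"
    if "y \<in> labellings n k" "\<And>u. u \<notin> S \<Longrightarrow> y u = x u" for y
    unfolding L_def \<epsilon>_def by (rule log_nonedges_diff_le[OF ab n(1,2) k x that finS])
  have later_key: "key u < key w" "w < n" "u \<noteq> w" if "w \<in> later n G r u" for u w
    using that later_subset[OF G, of r u] by (auto simp: later_def key_def)
  have g_upd: "g u' (y(u := c)) = g u' y" if "key u < key u'" for u u' y c
    unfolding g_def
  proof (intro prod.cong refl)
    fix w assume "w \<in> later n G r u'"
    then have "w \<noteq> u" "u' \<noteq> u" using later_key(1)[of w u'] that by auto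
    then show "edge_odds n a b (y(u := c)) {u', w} = edge_odds n a b y {u', w}"
      by (simp add: edge_odds_def edge_prob_def)
  qed
  have row: "(\<Sum>c<k. g u (y(u := c))) = \<kappa>" if "later n G r u = {w}" "u < n" "y \<in> labellings n k" for u w y
    using sum_edge_odds[OF that(3,2), of w] later_key(2,3)[of w u] that(1) by (simp add: g_def \<kappa>_def)
  \<comment> \<open>Below \<open>v\<close> every branch vertex has exactly one later neighbour, so
    each factor is the odds of a single edge and its row sum is \<open>\<kappa>\<close>.\<close>
  have tree: "relabel_sum k (S - {v}) (\<lambda>y. \<Prod>u\<in>S - {v}. g u y) y = \<kappa> ^ card (S - {v})"
    if y: "y \<in> labellings n k" for y
  proof (rule relabel_sum_tree[OF y, where key = key])
    show "S - {v} \<subseteq> {..<n}" using Sn by auto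
    show "inj_on key (S - {v})"
      unfolding key_def by (rule inj_on_subset[OF inj_on_peel_key]) (use Sn in auto)
    show "(\<Sum>c<k. g u (y(u := c))) = \<kappa>" if "u \<in> S - {v}" "y \<in> labellings n k" for u y
    proof -
      have "\<exists>w\<in>branch n G r v. later n G r u = {w}"
        using that(1) by (intro branch_later[OF _ _ G]) (auto simp: S_def)
      then show ?thesis using row[OF _ _ that(2)] that(1) Sn by auto
    qed
  qed (rule g_upd)
  have gv: "relabel_sum k (S - {v}) (\<lambda>y. \<Prod>u\<in>S. g u y) y = g v y * \<kappa> ^ card (S - {v})"
    if y: "y \<in> labellings n k" for y
  proof -
    have "relabel_sum k (S - {v}) (\<lambda>y. \<Prod>u\<in>S. g u y) y = relabel_sum k (S - {v}) (\<lambda>z. g v y * (\<Prod>u\<in>S - {v}. g u z)) y"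
    proof (rule relabel_sum_cong[OF y])
      fix z assume z: "\<And>u. u \<notin> S - {v} \<Longrightarrow> z u = y u"
      have "g v z = g v y"
        unfolding g_def
      proof (intro prod.cong refl)
        fix w assume w: "w \<in> later n G r v"
        then have "w \<notin> S" using Skey(1)[of w] later_key(1)[OF w] by auto
        then have "z w = y w" "z v = y v" using z by auto
        then show "edge_odds n a b z {v, w} = edge_odds n a b y {v, w}"
          by (simp add: edge_odds_def edge_prob_def)
      qed
      then show "(\<Prod>u\<in>S. g u z) = g v y * (\<Prod>u\<in>S - {v}. g u z)"
        using finS vS by (simp add: prod.remove)
    qed (use Sn in auto)
    then show ?thesis using tree[OF y] by (simp add: relabel_sum_cmult)
  qed
  have SS: "S = insert v (S - {v})" using vS by auto
  have all: "relabel_sum k S (\<lambda>y. \<Prod>u\<in>S. g u y) x = (\<Sum>c<k. g v (x(v := c))) * \<kappa> ^ card (S - {v})"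
  proof -
    have "relabel_sum k S (\<lambda>y. \<Prod>u\<in>S. g u y) x = relabel_sum k (insert v (S - {v})) (\<lambda>y. \<Prod>u\<in>S. g u y) x"
      using SS by simp
    also have "\<dots> = (\<Sum>c<k. relabel_sum k (S - {v}) (\<lambda>y. \<Prod>u\<in>S. g u y) (x(v := c)))"
      using finS by (intro relabel_sum_insert) auto
    also have "\<dots> = (\<Sum>c<k. g v (x(v := c)) * \<kappa> ^ card (S - {v}))"
      using xl vn by (intro sum.cong refl gv labellings_update) auto
    finally show ?thesis by (simp add: sum_distrib_right)
  qed
  have up: "relabel_sum k (S - {v}) p x \<le> exp (L + \<epsilon>) * K * (g v x * \<kappa> ^ card (S - {v}))"
  proof -
    have "relabel_sum k (S - {v}) p x \<le> relabel_sum k (S - {v}) (\<lambda>y. exp (L + \<epsilon>) * K * (\<Prod>u\<in>S. g u y)) x"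
    proof (rule relabel_sum_mono[OF xl])
      fix y assume y: "y \<in> labellings n k" "\<And>u. u \<notin> S - {v} \<Longrightarrow> y u = x u"
      have yS: "\<And>u. u \<notin> S \<Longrightarrow> y u = x u" using y(2) by auto
      have "exp (log_nonedges n a b y) \<le> exp (L + \<epsilon>)" using Ldiff[OF y(1) yS] by (simp add: abs_le_iff)
      moreover have "p y = exp (log_nonedges n a b y) * K * (\<Prod>u\<in>S. g u y)"
        by (rule fac) (rule yS)
      ultimately show "p y \<le> exp (L + \<epsilon>) * K * (\<Prod>u\<in>S. g u y)"
        using K0 g0 by (simp add: mult_right_mono prod_nonneg)
    qed (use Sn in auto)
    then show ?thesis using gv[OF xl] by (simp add: relabel_sum_cmult)
  qed
  have low: "exp (L - \<epsilon>) * K * ((\<Sum>c<k. g v (x(v := c))) * \<kappa> ^ card (S - {v})) \<le> relabel_sum k S p x"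
  proof -
    have "relabel_sum k S (\<lambda>y. exp (L - \<epsilon>) * K * (\<Prod>u\<in>S. g u y)) x \<le> relabel_sum k S p x"
    proof (rule relabel_sum_mono[OF xl Sn])
      fix y assume y: "y \<in> labellings n k" "\<And>u. u \<notin> S \<Longrightarrow> y u = x u"
      have "exp (L - \<epsilon>) \<le> exp (log_nonedges n a b y)" using Ldiff[OF y(1) y(2)] by (simp add: abs_le_iff)
      moreover have "p y = exp (log_nonedges n a b y) * K * (\<Prod>u\<in>S. g u y)"
        by (rule fac) (rule y(2))
      ultimately show "exp (L - \<epsilon>) * K * (\<Prod>u\<in>S. g u y) \<le> p y"
        using K0 g0 by (simp add: mult_right_mono prod_nonneg)
    qed
    then show ?thesis using all by (simp add: relabel_sum_cmult)
  qed
  define B where "B = K * \<kappa> ^ card (S - {v})"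
  have px: "p x = exp L * K * (\<Prod>u\<in>S. g u x)" using fac[of x] by (simp add: L_def)
  have "0 < exp L * K * (\<Prod>u\<in>S. g u x)"
    using pos px by (simp add: p_def)
  then have "(\<Prod>u\<in>S. g u x) \<noteq> 0" by auto
  then have posx: "g u x > 0" if "u \<in> S" for u
    using that finS g0[of u x] by (auto simp: less_le)
  have \<kappa>0: "0 \<le> \<kappa>" unfolding \<kappa>_def 
  proof (intro add_nonneg_nonneg mult_nonneg_nonneg divide_nonneg_nonneg)
    show "0 \<le> 1 - a / n" "0 \<le> 1 - b / n" using n(2,3) by (auto simp: field_simps)
  qed (use ab n k in auto)
  have p0: "0 \<le> p y" for y unfolding p_def using ab n by (intro graph_weight_nonneg) auto
  have m0: "0 < relabel_sum k (S - {v}) p x"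
  proof -
    have "S - {v} \<subseteq> {..<n}" using Sn by auto
    from relabel_sum_ge[where F = p, OF xl this p0] show ?thesis using pos by (simp add: p_def)
  qed
  have B0: "B > 0"
  proof -
    have "B * (exp (L + \<epsilon>) * g v x) > 0"
      using m0 up by (simp add: B_def mult_ac)
    moreover have "0 \<le> B" using K0 \<kappa>0 by (simp add: B_def)
    ultimately show ?thesis by (simp add: zero_less_mult_iff)
  qed
  \<comment> \<open>The reciprocal of the conditional probability of the label of \<open>v\<close>
    in the tree model: it equals \<open>k\<close> when there is no later neighbour, and
    \<open>\<kappa>\<close> divided by the odds of the edge otherwise.\<close>
  define \<rho> where "\<rho> = (\<Sum>c<k. g v (x(v := c))) / g v x"
  have gvx: "g v x > 0" using posx vS by auto
  have \<rho>_ge: "ln k - (\<Sum>w\<in>later n G r v. log_ratio a b d x {v, w}) - 2 * c / n \<le> ln \<rho> \<and> \<rho> > 0"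
  proof (cases "later n G r v = {}")
    case True
    then show ?thesis using k ab n by (simp add: \<rho>_def g_def)
  next
    case False
    then obtain w where w: "w \<in> later n G r v" by auto
    then have lw: "later n G r v = {w}" using later_unique[OF G v] by blast
    have eo: "edge_odds n a b x {v, w} > 0" using gvx lw by (simp add: g_def)
    have ep: "edge_prob n a b x {v, w} > 0"
      using eo edge_prob_half[of x "{v, w}"] by (cases "edge_prob n a b x {v, w} = 0") (auto simp: edge_odds_def)
    have \<rho>: "\<rho> = \<kappa> / edge_odds n a b x {v, w}"
      unfolding \<rho>_def using row[OF lw vn xl] lw by (simp add: g_def)
    have "\<kappa> > 0"
    proof -
      have "edge_odds n a b x {v, w} = g v (x(v := x v))" by (simp add: g_def lw)
      also have "\<dots> \<le> \<kappa>"
        unfolding row[OF lw vn xl, symmetric] using labellings_less[OF xl vn] g0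
        by (intro member_le_sum[of "x v" "{..<k}" "\<lambda>c. g v (x(v := c))"]) auto
      finally show ?thesis using eo by linarith
    qed
    then show ?thesis using log_odds_ratio_ge[OF ep] eo by (simp add: \<rho> \<kappa>_def lw)
  qed
  have "\<rho> * exp (- (2 * \<epsilon>)) \<le> relabel_sum k S p x / relabel_sum k (S - {v}) p x"
  proof -
    have "\<rho> * exp (- (2 * \<epsilon>)) = (exp (L - \<epsilon>) * B * (\<rho> * g v x)) / (exp (L + \<epsilon>) * B * g v x)"
    proof -
      have "L - \<epsilon> = (L + \<epsilon>) + (- (2 * \<epsilon>))" by simp
      then have "exp (L - \<epsilon>) = exp (L + \<epsilon>) * exp (- (2 * \<epsilon>))"
        by (simp only: exp_add)
      then show ?thesis using B0 gvx by simp
    qed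
    also have "\<dots> \<le> relabel_sum k S p x / relabel_sum k (S - {v}) p x"
    proof (rule frac_le)
      show "exp (L - \<epsilon>) * B * (\<rho> * g v x) \<le> relabel_sum k S p x"
        using low gvx by (simp add: B_def \<rho>_def mult_ac)
      show "relabel_sum k (S - {v}) p x \<le> exp (L + \<epsilon>) * B * g v x"
        using up by (simp add: B_def mult_ac)
      show "0 \<le> relabel_sum k S p x" by (rule relabel_sum_nonneg) (rule p0)
    qed (rule m0)
    finally show ?thesis .
  qed
  then have "ln (\<rho> * exp (- (2 * \<epsilon>))) \<le> ln (relabel_sum k S p x / relabel_sum k (S - {v}) p x)"
    using \<rho>_ge by (intro ln_mono) auto
  then show ?thesis using \<rho>_ge by (simp add: ln_mult \<epsilon>_def)
qed

end

section \<open>The likelihood ratio concentrates\<close>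

definition label_exp :: "nat \<Rightarrow> nat \<Rightarrow> ((nat \<Rightarrow> nat) \<Rightarrow> real) \<Rightarrow> real" where
  "label_exp n k F = (\<Sum>x\<in>labellings n k. F x) / real k ^ n"

lemma label_exp_cong: "(\<And>x. x \<in> labellings n k \<Longrightarrow> F x = F' x) \<Longrightarrow> label_exp n k F = label_exp n k F'"
  by (simp add: label_exp_def)

lemma label_exp_mono: "(\<And>x. x \<in> labellings n k \<Longrightarrow> F x \<le> F' x) \<Longrightarrow> label_exp n k F \<le> label_exp n k F'"
  unfolding label_exp_def by (intro divide_right_mono sum_mono) auto

lemma label_exp_nonneg: "(\<And>x. x \<in> labellings n k \<Longrightarrow> 0 \<le> F x) \<Longrightarrow> 0 \<le> label_exp n k F"
  unfolding label_exp_def by (intro divide_nonneg_nonneg sum_nonneg) auto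

lemma label_exp_add: "label_exp n k (\<lambda>x. F x + F' x) = label_exp n k F + label_exp n k F'"
  by (simp add: label_exp_def sum.distrib add_divide_distrib)

lemma label_exp_diff: "label_exp n k (\<lambda>x. F x - F' x) = label_exp n k F - label_exp n k F'"
  by (simp add: label_exp_def sum_subtractf diff_divide_distrib)

lemma label_exp_cmult: "label_exp n k (\<lambda>x. c * F x) = c * label_exp n k F"
  by (simp add: label_exp_def flip: sum_distrib_left)

lemma label_exp_multc: "label_exp n k (\<lambda>x. F x * c) = label_exp n k F * c"
  by (simp add: label_exp_def flip: sum_distrib_right)

lemma label_exp_sum: "label_exp n k (\<lambda>x. \<Sum>i\<in>I. F i x) = (\<Sum>i\<in>I. label_exp n k (F i))"
  unfolding label_exp_def sum_divide_distrib[symmetric] by (subst sum.swap) simp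

lemma label_exp_const: "k > 0 \<Longrightarrow> label_exp n k (\<lambda>_. c) = c"
  by (simp add: label_exp_def card_labellings)

lemma label_exp_resample:
  assumes "k > 0" "s < n"
  shows "label_exp n k F = label_exp n k (\<lambda>x. (\<Sum>c<k. F (x(s := c))) / k)"
  using sum_labellings_update[OF assms(2), of F k] assms(1)
  by (simp add: label_exp_def flip: sum_divide_distrib)

lemma sum_of_bool_eq_lessThan:
  fixes i k :: nat
  shows "i < k \<Longrightarrow> (\<Sum>c<k. of_bool (c = i) :: real) = 1"
  "i < k \<Longrightarrow> (\<Sum>c<k. of_bool (i = c) :: real) = 1"
proof -
  have *: "(\<Sum>c<k. of_bool (c = i) :: real) = (\<Sum>c\<in>{i}. 1)" if "i < k"
    using that by (intro sum.mono_neutral_cong_right) auto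
  then show "i < k \<Longrightarrow> (\<Sum>c<k. of_bool (c = i) :: real) = 1" by simp
  show "i < k \<Longrightarrow> (\<Sum>c<k. of_bool (i = c) :: real) = 1"
    unfolding eq_commute[of i] using * by simp
qed

lemma label_exp_equal:
  assumes "k > 0" "u < n" "v < n" "u \<noteq> v"
  shows "label_exp n k (\<lambda>x. of_bool (x u = x v)) = 1 / k"
proof -
  have "label_exp n k (\<lambda>x. of_bool (x u = x v)) = label_exp n k (\<lambda>x. (\<Sum>c<k. of_bool (c = x v)) / k)"
    using assms by (subst label_exp_resample[of k u]) auto
  also have "\<dots> = label_exp n k (\<lambda>x. 1 / k)"
    using assms by (intro label_exp_cong) (simp only: sum_of_bool_eq_lessThan labellings_less)
  finally show ?thesis using assms by (simp add: label_exp_const)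
qed

lemma label_exp_mono_pairs:
  assumes "k > 0"
  shows "label_exp n k (mono_pairs n) = real n * (real n - 1) / 2 / k"
proof -
  have "label_exp n k (mono_pairs n) = (\<Sum>e\<in>vertex_pairs n. label_exp n k (\<lambda>x. of_bool (monochromatic x e)))"
    by (simp only: mono_pairs_eq_sum[abs_def] label_exp_sum)
  also have "\<dots> = (\<Sum>e\<in>vertex_pairs n. 1 / k)"
  proof (rule sum.cong[OF refl])
    fix e assume "e \<in> vertex_pairs n"
    then obtain u v where "e = {u, v}" "u < v" "v < n" by (rule vertex_pairsE)
    then show "label_exp n k (\<lambda>x. of_bool (monochromatic x e)) = 1 / k"
      using label_exp_equal[OF assms, of u n v] by simp
  qed
  finally show ?thesis by (simp add: card_vertex_pairs)
qed

lemma label_exp_class_size_variance: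
  assumes "k > 0" "i < k"
  shows "label_exp n k (\<lambda>x. (class_size n x i - n / k)\<^sup>2) \<le> n"
proof -
  define f where "f u x = (of_bool (x u = i) - 1 / k :: real)" for u and x :: "nat \<Rightarrow> nat"
  have f1: "f u x * f u x \<le> 1" for u x
  proof -
    have "\<bar>f u x\<bar> \<le> 1" using assms by (auto simp: f_def)
    then show ?thesis by (simp add: abs_le_square_iff[of _ 1, simplified] flip: power2_eq_square)
  qed
  have off: "label_exp n k (\<lambda>x. f u x * f v x) = 0" if "u < n" "v < n" "u \<noteq> v" for u v
  proof -
    have "label_exp n k (\<lambda>x. f u x * f v x) = label_exp n k (\<lambda>x. (\<Sum>c<k. f u (x(u := c)) * f v (x(u := c))) / k)"
      using assms that by (intro label_exp_resample)
    also have "\<dots> = label_exp n k (\<lambda>x. 0)"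
    proof (rule label_exp_cong)
      fix x
      have "(\<Sum>c<k. f u (x(u := c)) * f v (x(u := c))) = (\<Sum>c<k. of_bool (c = i) - 1 / k) * f v x"
        unfolding sum_distrib_right using that by (intro sum.cong) (auto simp: f_def)
      also have "(\<Sum>c<k. of_bool (c = i) - 1 / k) = (0 :: real)"
        using assms by (simp only: sum_subtractf sum_of_bool_eq_lessThan) simp
      finally show "(\<Sum>c<k. f u (x(u := c)) * f v (x(u := c))) / k = 0"
        by (simp only: mult_zero_left div_0)
    qed
    finally show ?thesis using assms by (simp add: label_exp_const)
  qed
  have "class_size n x i - n / k = (\<Sum>u<n. f u x)" for x
    by (simp add: f_def class_size_eq_sum sum_subtractf del: sum_of_bool_eq)
  then have "label_exp n k (\<lambda>x. (class_size n x i - n / k)\<^sup>2) = (\<Sum>u<n. \<Sum>v<n. label_exp n k (\<lambda>x. f u x * f v x))"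
    by (simp only: power2_eq_square sum_product label_exp_sum)
  also have "\<dots> \<le> (\<Sum>u<n. \<Sum>v<n. if v = u then 1 else 0)"
  proof (intro sum_mono)
    fix u v assume uv: "u \<in> {..<n}" "v \<in> {..<n}"
    have "label_exp n k (\<lambda>x. f u x * f u x) \<le> label_exp n k (\<lambda>x. 1)"
      using f1 by (rule label_exp_mono)
    then show "label_exp n k (\<lambda>x. f u x * f v x) \<le> (if v = u then 1 else 0)"
      using off[of u v] uv assms by (cases "u = v") (auto simp: label_exp_const)
  qed
  also have "\<dots> = n" by simp
  finally show ?thesis .
qed

lemma label_exp_unbalanced_le:
  assumes "k > 0" "n > 0" "\<delta> > 0"
  shows "label_exp n k (\<lambda>x. of_bool (x \<notin> balanced n k \<delta>)) \<le> (k / \<delta>\<^sup>2) / n"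
proof -
  have "label_exp n k (\<lambda>x. of_bool (x \<notin> balanced n k \<delta>))
      \<le> label_exp n k (\<lambda>x. \<Sum>i<k. (1 / (\<delta> * n)\<^sup>2) * (class_size n x i - n / k)\<^sup>2)"
  proof (rule label_exp_mono)
    fix x assume x: "x \<in> labellings n k"
    show "of_bool (x \<notin> balanced n k \<delta>) \<le> (\<Sum>i<k. (1 / (\<delta> * n)\<^sup>2) * (class_size n x i - n / k)\<^sup>2)"
    proof (cases "x \<in> balanced n k \<delta>")
      case False
      then obtain i where i: "i < k" "\<not> (\<bar>class_size n x i / n - 1 / k\<bar> \<le> \<delta>)"
        using x by (force simp: balanced_def class_size_def abs_le_iff)
      have "class_size n x i - n / k = (class_size n x i / n - 1 / k) * n"
        using assms by (simp add: field_simps)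
      then have "\<bar>class_size n x i - n / k\<bar> \<ge> \<delta> * n"
        using i assms by (simp add: abs_mult mult_right_mono)
      then have "(\<delta> * n)\<^sup>2 \<le> \<bar>class_size n x i - n / k\<bar>\<^sup>2"
        using assms by (intro power_mono) auto
      then have "1 \<le> (1 / (\<delta> * n)\<^sup>2) * (class_size n x i - n / k)\<^sup>2"
        using assms by (simp add: field_simps)
      also have "\<dots> \<le> (\<Sum>i<k. (1 / (\<delta> * n)\<^sup>2) * (class_size n x i - n / k)\<^sup>2)"
        using i by (intro member_le_sum[of i]) auto
      finally show ?thesis using False by simp
    qed (auto intro!: sum_nonneg)
  qed
  also have "\<dots> \<le> (\<Sum>i<k. (1 / (\<delta> * n)\<^sup>2) * n)"
    unfolding label_exp_sum label_exp_cmult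
    using assms label_exp_class_size_variance by (intro sum_mono mult_left_mono) auto
  also have "\<dots> = (k / \<delta>\<^sup>2) / n"
    using assms by (simp add: power2_eq_square)
  finally show ?thesis .
qed

text \<open>The comparison function for vertex \<open>v\<close> may be any \<open>\<gamma> v\<close>
  that ignores the label of \<open>v\<close>; the application takes the likelihood with all edges at
  \<open>v\<close> deleted.\<close>

lemma label_exp_efron_stein:
  assumes k: "k > 0" and \<gamma>: "\<And>v x c. v < n \<Longrightarrow> \<gamma> v (x(v := c)) = \<gamma> v x"
  shows "label_exp n k (\<lambda>x. (\<phi> x)\<^sup>2) - (label_exp n k \<phi>)\<^sup>2
    \<le> (\<Sum>v<n. label_exp n k (\<lambda>x. (\<phi> x - \<gamma> v x)\<^sup>2))"
proof -
  \<comment> \<open>Averaging over the first \<open>m\<close> labels gives a reversed martingale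
    from \<open>\<phi>\<close> down to its mean, so the variance telescopes over
    \<open>m\<close>.\<close>
  define av where "av m \<psi> x = relabel_sum k {..<m} \<psi> x / real k ^ m" for m :: nat and \<psi> and x :: "nat \<Rightarrow> nat"
  have av_Suc: "av (Suc m) \<psi> x = (\<Sum>c<k. av m \<psi> (x(m := c))) / k" for m \<psi> x
    unfolding av_def lessThan_Suc by (simp add: relabel_sum_insert sum_divide_distrib mult.commute)
  have av_diff: "av m (\<lambda>x. \<psi> x - \<psi>' x) x = av m \<psi> x - av m \<psi>' x" for m \<psi> \<psi>' x
    by (simp add: av_def relabel_sum_def sum_subtractf diff_divide_distrib)
  have av_square: "(av m \<psi> x)\<^sup>2 \<le> av m (\<lambda>x. (\<psi> x)\<^sup>2) x" for m \<psi> x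
  proof -
    have card: "real (card ({..<m} \<rightarrow>\<^sub>E {..<k})) = real k ^ m" by (simp add: card_PiE)
    define R where "R = relabel_sum k {..<m} \<psi> x"
    define Q where "Q = relabel_sum k {..<m} (\<lambda>x. (\<psi> x)\<^sup>2) x"
    have RQ: "R\<^sup>2 \<le> Q * real k ^ m"
      unfolding R_def Q_def relabel_sum_def card[symmetric]
      using sum_squared_le_sum_of_squares[of "\<lambda>z. \<psi> (\<lambda>u. if u \<in> {..<m} then z u else x u)" "{..<m} \<rightarrow>\<^sub>E {..<k}"] by simp
    have km: "real k ^ m > 0" using k by simp
    have "(R / real k ^ m)\<^sup>2 = R\<^sup>2 / real k ^ m / real k ^ m"
      by (simp add: power2_eq_square)
    also have "\<dots> \<le> (Q * real k ^ m) / real k ^ m / real k ^ m"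
      using RQ km by (intro divide_right_mono) auto
    also have "\<dots> = Q / real k ^ m" using km by simp
    finally show ?thesis by (simp add: av_def R_def Q_def)
  qed
  have av_mean: "label_exp n k (av m \<psi>) = label_exp n k \<psi>" if "m \<le> n" for m \<psi>
  proof -
    have "(\<Sum>x\<in>labellings n k. relabel_sum k {..<m} \<psi> x * 1) = real k ^ card {..<m} * (\<Sum>x\<in>labellings n k. \<psi> x * 1)"
      by (rule sum_relabel_sum) (use that in auto)
    then show ?thesis using k by (simp add: av_def label_exp_def flip: sum_divide_distrib)
  qed
  have av_inv: "av m (\<gamma> v) (x(v := c)) = av m (\<gamma> v) x" if "m \<le> v" "v < n" for m v x c
    using that(1)
  proof (induction m arbitrary: x)
    case 0
    have "av 0 \<psi> y = \<psi> y" for \<psi> y by (simp add: av_def)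
    then show ?case using \<gamma>[OF that(2)] by (simp only:)
  next
    case (Suc m)
    have "av m (\<gamma> v) (x(v := c, m := c')) = av m (\<gamma> v) (x(m := c'))" for c'
    proof -
      have "x(v := c, m := c') = x(m := c', v := c)"
        using Suc.prems by (intro fun_upd_twist) simp
      moreover have "av m (\<gamma> v) (x(m := c', v := c)) = av m (\<gamma> v) (x(m := c'))"
        using Suc.prems by (intro Suc.IH) simp
      ultimately show ?thesis by (simp only:)
    qed
    then show ?case by (simp only: av_Suc)
  qed
  have step: "label_exp n k (\<lambda>x. (av m \<phi> x)\<^sup>2) - label_exp n k (\<lambda>x. (av (Suc m) \<phi> x)\<^sup>2)
      \<le> label_exp n k (\<lambda>x. (\<phi> x - \<gamma> m x)\<^sup>2)" if m: "m < n" for m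
  proof -
    \<comment> \<open>The averaged \<open>\<gamma> m\<close> is constant in the label of
      \<open>m\<close>. A variance over that label is at most the second moment about any such
      constant, and \<open>av_square\<close> then removes the averaging over the earlier
      labels.\<close>
    define h where "h x = av m \<phi> x - av m (\<gamma> m) x" for x
    have "label_exp n k (\<lambda>x. (av m \<phi> x)\<^sup>2) - label_exp n k (\<lambda>x. (av (Suc m) \<phi> x)\<^sup>2)
        = label_exp n k (\<lambda>x. (\<Sum>c<k. (av m \<phi> (x(m := c)))\<^sup>2) / k - (av (Suc m) \<phi> x)\<^sup>2)"
      unfolding label_exp_diff using label_exp_resample[OF k m, of "\<lambda>x. (av m \<phi> x)\<^sup>2"] by simp
    also have "\<dots> \<le> label_exp n k (\<lambda>x. (\<Sum>c<k. (h (x(m := c)))\<^sup>2) / k)"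
    proof (rule label_exp_mono)
      fix x
      define g where "g = av m (\<gamma> m) x"
      have hx: "h (x(m := c)) = av m \<phi> (x(m := c)) - g" for c
        unfolding h_def g_def using av_inv[of m m] m by simp
      define A where "A = av (Suc m) \<phi> x"
      have A: "(\<Sum>c<k. av m \<phi> (x(m := c))) = k * A" using k by (simp add: A_def av_Suc)
      have "(\<Sum>c<k. (h (x(m := c)))\<^sup>2) = (\<Sum>c<k. (av m \<phi> (x(m := c)))\<^sup>2) - 2 * g * (\<Sum>c<k. av m \<phi> (x(m := c))) + k * g\<^sup>2"
        unfolding hx power2_diff by (simp add: sum.distrib sum_subtractf sum_distrib_left mult_ac)
      also have "\<dots> = (\<Sum>c<k. (av m \<phi> (x(m := c)))\<^sup>2) - k * A\<^sup>2 + k * (A - g)\<^sup>2"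
        unfolding A by (simp add: power2_eq_square algebra_simps)
      finally have "(\<Sum>c<k. (h (x(m := c)))\<^sup>2) / k = (\<Sum>c<k. (av m \<phi> (x(m := c)))\<^sup>2) / k - A\<^sup>2 + (A - g)\<^sup>2"
        using k by (simp add: field_simps)
      then show "(\<Sum>c<k. (av m \<phi> (x(m := c)))\<^sup>2) / k - (av (Suc m) \<phi> x)\<^sup>2 \<le> (\<Sum>c<k. (h (x(m := c)))\<^sup>2) / k"
        by (simp add: A_def)
    qed
    also have "\<dots> = label_exp n k (\<lambda>x. (h x)\<^sup>2)"
      using label_exp_resample[OF k m, of "\<lambda>x. (h x)\<^sup>2"] by simp
    also have "\<dots> \<le> label_exp n k (av m (\<lambda>x. (\<phi> x - \<gamma> m x)\<^sup>2))"
      unfolding h_def av_diff[symmetric] by (intro label_exp_mono av_square)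
    also have "\<dots> = label_exp n k (\<lambda>x. (\<phi> x - \<gamma> m x)\<^sup>2)"
      using m by (intro av_mean) simp
    finally show ?thesis .
  qed
  have tele: "label_exp n k (\<lambda>x. (\<phi> x)\<^sup>2) - label_exp n k (\<lambda>x. (av m \<phi> x)\<^sup>2)
      \<le> (\<Sum>v<m. label_exp n k (\<lambda>x. (\<phi> x - \<gamma> v x)\<^sup>2))" if "m \<le> n" for m
    using that
  proof (induction m)
    case (Suc m)
    then show ?case using step[of m] by simp
  qed (simp add: av_def)
  have "label_exp n k (\<lambda>x. (av n \<phi> x)\<^sup>2) = label_exp n k (\<lambda>x. (label_exp n k \<phi>)\<^sup>2)"
    by (rule label_exp_cong) (simp add: av_def relabel_sum_all label_exp_def)
  then show ?thesis using tele[of n] k by (simp add: label_exp_const)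
qed

section \<open>The likelihood of the graph averaged over labellings\<close>

definition sbm_exp :: "nat \<Rightarrow> nat \<Rightarrow> real \<Rightarrow> real \<Rightarrow> ((nat \<Rightarrow> nat) \<Rightarrow> nat set set \<Rightarrow> real) \<Rightarrow> real" where
  "sbm_exp n k a b F = label_exp n k (\<lambda>x. bexp (vertex_pairs n) (edge_prob n a b x) (F x))"

definition graph_prob :: "nat \<Rightarrow> nat \<Rightarrow> real \<Rightarrow> real \<Rightarrow> nat set set \<Rightarrow> real" where
  "graph_prob n k a b G = label_exp n k (\<lambda>x. graph_weight n a b x G)"

text \<open>Dividing by a factor d/n per edge removes the order 1/n that each edge contributes to
  the probability, so that adding an edge changes the quotient by at most a constant factor.\<close>

definition log_likelihood :: "nat \<Rightarrow> nat \<Rightarrow> real \<Rightarrow> real \<Rightarrow> real \<Rightarrow> nat set set \<Rightarrow> real" where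
  "log_likelihood n k a b d G = ln (graph_prob n k a b G / (d / n) ^ card G)"

text \<open>The left-hand side of the hypothesis in terms of a/d and b/d, see
  \<open>kl_rate_eq\<close>. Half of it is the mean log-ratio of the edges per vertex, up to a
  factor tending to one.\<close>

definition kl_rate :: "nat \<Rightarrow> real \<Rightarrow> real \<Rightarrow> real \<Rightarrow> real" where
  "kl_rate k a b d = (a * ln (a / d) + (real k - 1) * b * ln (b / d)) / k"

lemma bexp_eq_graph_weight:
  "bexp (vertex_pairs n) (edge_prob n a b x) F = (\<Sum>G\<in>Pow (vertex_pairs n). graph_weight n a b x G * F G)"
  by (simp add: bexp_def graph_weight_def)

lemma sbm_exp_add: "sbm_exp n k a b (\<lambda>x G. F x G + F' x G) = sbm_exp n k a b F + sbm_exp n k a b F'"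
  by (simp add: sbm_exp_def bexp_add label_exp_add)

lemma sbm_exp_diff: "sbm_exp n k a b (\<lambda>x G. F x G - F' x G) = sbm_exp n k a b F - sbm_exp n k a b F'"
  by (simp add: sbm_exp_def bexp_diff label_exp_diff)

lemma sbm_exp_cmult: "sbm_exp n k a b (\<lambda>x G. t * F x G) = t * sbm_exp n k a b F"
  by (simp add: sbm_exp_def bexp_cmult label_exp_cmult)

lemma sbm_exp_const: "k > 0 \<Longrightarrow> sbm_exp n k a b (\<lambda>_ _. t) = t"
  by (simp add: sbm_exp_def bexp_const label_exp_const)

lemma sbm_exp_graph:
  "sbm_exp n k a b (\<lambda>_. F) = (\<Sum>G\<in>Pow (vertex_pairs n). graph_prob n k a b G * F G)"
  by (simp add: sbm_exp_def bexp_eq_graph_weight label_exp_sum label_exp_multc graph_prob_def)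

lemma sbm_exp_weight:
  "sbm_exp n k a b F = (\<Sum>G\<in>Pow (vertex_pairs n). label_exp n k (\<lambda>x. graph_weight n a b x G * F x G))"
  by (simp add: sbm_exp_def bexp_eq_graph_weight label_exp_sum)

lemma sum_Pow_split:
  assumes "A \<subseteq> P"
  shows "(\<Sum>G\<in>Pow P. g G) = (\<Sum>H\<in>Pow (P - A). \<Sum>N\<in>Pow A. g (H \<union> N))"
proof -
  have "(\<Sum>G\<in>Pow P. g G) = (\<Sum>(H, N)\<in>Pow (P - A) \<times> Pow A. g (H \<union> N))"
    by (rule sum.reindex_bij_witness[where i = "\<lambda>(H, N). H \<union> N" and j = "\<lambda>G. (G - A, G \<inter> A)"])
       (use assms in \<open>auto intro!: arg_cong[where f = g]\<close>)
  then show ?thesis by (simp add: sum.cartesian_product)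
qed

lemma sum_Pow_power_card:
  fixes t :: real
  assumes "finite A"
  shows "(\<Sum>N\<in>Pow A. t ^ card N) = (1 + t) ^ card A"
  using assms
proof induction
  case (insert e A)
  have inj: "inj_on (insert e) (Pow A)" using insert by (auto simp: inj_on_def)
  have "(\<Sum>N\<in>Pow (insert e A). t ^ card N) = (\<Sum>N\<in>Pow A. t ^ card N) + (\<Sum>N\<in>insert e ` Pow A. t ^ card N)"
    unfolding Pow_insert using insert by (intro sum.union_disjoint) auto
  also have "(\<Sum>N\<in>insert e ` Pow A. t ^ card N) = (\<Sum>N\<in>Pow A. t * t ^ card N)"
    using insert by (subst sum.reindex[OF inj]) (auto intro!: sum.cong simp: card_insert_if finite_subset)
  finally show ?case using insert by (simp add: sum_distrib_left[symmetric] algebra_simps)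
qed simp

text \<open>Above one, ln t is at most t. Below one, the substitution t = r^4 reduces the claim to -
  r^2 ln r <= r (1 - r) <= 1/4, by ln s <= s - 1 at s = 1/r.\<close>

lemma mult_ln_square_le:
  fixes t :: real
  assumes "t > 0"
  shows "t * (ln t)\<^sup>2 \<le> 1 + t ^ 3"
proof (cases "t \<le> 1")
  case True
  define s where "s = sqrt t"
  have s: "s > 0" "s \<le> 1" "t = s * s" using assms True by (auto simp: s_def real_sqrt_le_1_iff)
  have "t * (ln t)\<^sup>2 = (2 * (s * ln s))\<^sup>2"
    using s by (simp add: ln_mult power2_eq_square)
  also have "\<dots> = 4 * \<bar>s * ln s\<bar>\<^sup>2" by (simp add: power_mult_distrib)
  finally have eq: "t * (ln t)\<^sup>2 = 4 * \<bar>s * ln s\<bar>\<^sup>2" .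
  define r where "r = sqrt s"
  have r: "r > 0" "r \<le> 1" "s = r * r" using s by (auto simp: r_def real_sqrt_le_1_iff)
  have "- ln r = ln (1 / r)" using r by (simp add: ln_div)
  also have "\<dots> \<le> 1 / r - 1" using r by (intro ln_le_minus_one) auto
  finally have "- ln r * (r * r) \<le> (1 / r - 1) * (r * r)" using r by (intro mult_right_mono) auto
  also have "\<dots> = r * (1 - r)" using r by (simp add: field_simps)
  also have "\<dots> \<le> 1 / 4"
    using zero_le_square[of "r - 1 / 2"] by (simp add: algebra_simps)
  finally have le: "- ln r * (r * r) \<le> 1 / 4" .
  have "ln r \<le> 0" using r by simp
  then have "\<bar>s * ln s\<bar> = 2 * (- ln r * (r * r))"
    using r by (simp add: ln_mult abs_mult)
  with le have "\<bar>s * ln s\<bar> \<le> 1 / 2" by linarith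
  then have "\<bar>s * ln s\<bar>\<^sup>2 \<le> (1 / 2)\<^sup>2" by (intro power_mono) auto
  then have "t * (ln t)\<^sup>2 \<le> 1" unfolding eq by (simp add: power2_eq_square)
  then show ?thesis using assms by (smt (verit) zero_le_power)
next
  case False
  then have "0 \<le> ln t" "ln t \<le> t" using ln_le_minus_one[of t] by auto
  then have "(ln t)\<^sup>2 \<le> t\<^sup>2" by (intro power_mono) auto
  then have "t * (ln t)\<^sup>2 \<le> t * t\<^sup>2" using assms by (intro mult_left_mono) auto
  then show ?thesis by (simp add: power3_eq_cube power2_eq_square)
qed

context
  fixes n k :: nat and a b c d :: real
  assumes ab: "0 \<le> a" "0 \<le> b" "max a b \<le> c" and n: "2 * c \<le> n" "n > 0" "max a b < n" and k: "k > 0"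
    and d: "d = (a + (real k - 1) * b) / k" "d > 0"
begin

lemma edge_prob_01: "0 \<le> edge_prob n a b x e \<and> edge_prob n a b x e \<le> 1"
  using edge_prob_half(1,3)[OF ab n k d, of x e] by linarith

lemma weight_nonneg: "0 \<le> graph_weight n a b x G"
  using ab n by (intro graph_weight_nonneg) auto

lemma sbm_exp_mono:
  assumes "\<And>x G. x \<in> labellings n k \<Longrightarrow> G \<subseteq> vertex_pairs n \<Longrightarrow> graph_weight n a b x G > 0 \<Longrightarrow> F x G \<le> F' x G"
  shows "sbm_exp n k a b F \<le> sbm_exp n k a b F'"
  unfolding sbm_exp_def bexp_eq_graph_weight
proof (intro label_exp_mono sum_mono)
  fix x G assume "x \<in> labellings n k" "G \<in> Pow (vertex_pairs n)"
  then show "graph_weight n a b x G * F x G \<le> graph_weight n a b x G * F' x G"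
    using assms[of x G] weight_nonneg[of x G]
    by (cases "graph_weight n a b x G = 0") (auto intro!: mult_left_mono)
qed

lemma sbm_exp_cong:
  assumes "\<And>x G. x \<in> labellings n k \<Longrightarrow> G \<subseteq> vertex_pairs n \<Longrightarrow> graph_weight n a b x G > 0 \<Longrightarrow> F x G = F' x G"
  shows "sbm_exp n k a b F = sbm_exp n k a b F'"
  by (intro antisym sbm_exp_mono) (auto simp: assms)

lemma graph_prob_nonneg: "0 \<le> graph_prob n k a b G"
  unfolding graph_prob_def by (intro label_exp_nonneg weight_nonneg)

lemma sum_graph_prob: "(\<Sum>G\<in>Pow (vertex_pairs n). graph_prob n k a b G) = 1"
  using sbm_exp_graph[of n k a b "\<lambda>_. 1"] by (simp add: sbm_exp_const k)

lemma edge_odds_le: "edge_odds n a b x e \<le> 2 * c / n"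
proof -
  have "edge_odds n a b x e \<le> edge_prob n a b x e / (1 / 2)"
    unfolding edge_odds_def using edge_prob_half[OF ab n k d, of x e] by (intro divide_left_mono) auto
  also have "\<dots> \<le> 2 * c / n"
    using edge_prob_half[OF ab n k d, of x e] by simp
  finally show ?thesis .
qed

lemma graph_weight_union_le:
  assumes "H \<subseteq> vertex_pairs n" "N \<subseteq> vertex_pairs n" "H \<inter> N = {}"
  shows "graph_weight n a b x (H \<union> N) \<le> graph_weight n a b x H * (2 * c / n) ^ card N"
proof -
  have fin: "finite H" "finite N"
    using finite_subset[OF assms(1) finite_vertex_pairs] finite_subset[OF assms(2) finite_vertex_pairs] by auto
  have "graph_weight n a b x (H \<union> N) = graph_weight n a b x H * (\<Prod>e\<in>N. edge_odds n a b x e)"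
    using graph_weight_eq[OF ab(1,2) n(3), of "H \<union> N" x] graph_weight_eq[OF ab(1,2) n(3), of H x] assms fin
    by (simp add: prod.union_disjoint)
  also have "(\<Prod>e\<in>N. edge_odds n a b x e) \<le> (\<Prod>e\<in>N. 2 * c / n)"
    using edge_odds_le edge_odds_nonneg[OF ab n k d] by (intro prod_mono) auto
  finally show ?thesis using weight_nonneg[of x H] by (simp add: mult_left_mono)
qed

lemma graph_prob_union_le:
  assumes "H \<subseteq> vertex_pairs n" "N \<subseteq> vertex_pairs n" "H \<inter> N = {}"
  shows "graph_prob n k a b (H \<union> N) \<le> graph_prob n k a b H * (2 * c / n) ^ card N"
  unfolding graph_prob_def label_exp_multc[symmetric]
  by (intro label_exp_mono graph_weight_union_le assms)

text \<open>Split the graph into the part \<open>H\<close> off \<open>A\<close> and the part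
  \<open>N\<close> inside. The normalised ratio \<open>\<rho>\<close> is at most a constant per edge
  of \<open>N\<close>, but it has no lower bound, so its logarithm is not bounded. Averaging rescues
  this: the probability itself contains the factor \<open>\<rho>\<close>, and t (ln t)^2 stays
  bounded near zero. Summing over nonempty \<open>N\<close> gives the binomial expression.\<close>

lemma log_likelihood_difference:
  assumes A: "A \<subseteq> vertex_pairs n"
  defines "f \<equiv> log_likelihood n k a b d"
  defines "C \<equiv> max 1 ((2 * c / d) ^ 3)"
  shows "sbm_exp n k a b (\<lambda>_ G. (f G - f (G - A))\<^sup>2) \<le> 2 * ((1 + C * d / n) ^ card A - 1)"
proof -
  define P where "P = vertex_pairs n"
  define g where "g G = graph_prob n k a b G" for G
  have finA: "finite A" by (rule finite_subset[OF A finite_vertex_pairs])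
  have c0: "c \<ge> 0" using ab by linarith
  have C: "1 \<le> C" by (simp add: C_def)
  have each: "g (H \<union> N) * (f (H \<union> N) - f H)\<^sup>2 \<le> g H * (2 * ((C * d / n) ^ card N - of_bool (N = {})))"
    if H: "H \<subseteq> P - A" and N: "N \<subseteq> A" for H N
  proof (cases "N = {} \<or> g (H \<union> N) = 0")
    case True
    have "0 \<le> (C * d / n) ^ card N" using C d(2) n by simp
    then have "0 \<le> g H * (2 * ((C * d / n) ^ card N - of_bool (N = {})))"
      using graph_prob_nonneg[of H] by (intro mult_nonneg_nonneg) (auto simp: g_def)
    moreover have "g (H \<union> N) * (f (H \<union> N) - f H)\<^sup>2 = 0" using True by auto
    ultimately show ?thesis by linarith
  next
    case False
    have sub: "H \<subseteq> vertex_pairs n" "N \<subseteq> vertex_pairs n" "H \<inter> N = {}"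
      using H N A by (auto simp: P_def)
    have fin: "finite H" "finite N"
      using finite_subset[OF sub(1) finite_vertex_pairs] finite_subset[OF sub(2) finite_vertex_pairs] by auto
    have pos: "g (H \<union> N) > 0" using False graph_prob_nonneg[of "H \<union> N"] by (auto simp: g_def)
    have le: "g (H \<union> N) \<le> g H * (2 * c / n) ^ card N"
      unfolding g_def by (rule graph_prob_union_le[OF sub])
    have gH: "g H > 0" using pos le graph_prob_nonneg[of H] by (cases "g H = 0") (auto simp: g_def)
    have dn: "(d / n) ^ m > 0" for m using d(2) n(2) by simp
    \<comment> \<open>\<open>C\<close> is at least one and at least the cube of the bound per edge,
      so \<open>1 + \<rho> ^ 3\<close> is at most \<open>2 * C ^ card N\<close>.\<close>
    define \<rho> where "\<rho> = g (H \<union> N) / (g H * (d / n) ^ card N)"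
    have \<rho>: "\<rho> > 0" using pos gH dn by (simp add: \<rho>_def)
    have card: "card (H \<union> N) = card H + card N" using fin sub(3) by (simp add: card_Un_disjoint)
    have "f (H \<union> N) - f H = ln ((g (H \<union> N) / (d / n) ^ card (H \<union> N)) / (g H / (d / n) ^ card H))"
      unfolding f_def log_likelihood_def g_def[symmetric]
    using pos gH d(2) n(2) by (subst ln_div[of "_ / _" "_ / _"]) auto
    also have "(g (H \<union> N) / (d / n) ^ card (H \<union> N)) / (g H / (d / n) ^ card H) = \<rho>"
      unfolding \<rho>_def card power_add using d(2) n(2) gH by (simp add: field_simps)
    finally have lnr: "f (H \<union> N) - f H = ln \<rho>" .
    have "\<rho> \<le> (2 * c / d) ^ card N"
    proof -
      have "(2 * c / n) ^ card N = (2 * c / d) ^ card N * (d / n) ^ card N"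
        using d(2) by (simp flip: power_mult_distrib)
      then show ?thesis using le gH dn[of "card N"] by (simp add: \<rho>_def pos_divide_le_eq mult_ac)
    qed
    then have "\<rho> ^ 3 \<le> ((2 * c / d) ^ card N) ^ 3" using \<rho> by (intro power_mono) auto
    also have "\<dots> = ((2 * c / d) ^ 3) ^ card N" by (simp flip: power_mult add: mult.commute)
    also have "\<dots> \<le> C ^ card N" using c0 d(2) by (intro power_mono) (auto simp: C_def)
    finally have r3: "\<rho> ^ 3 \<le> C ^ card N" .
    have "g (H \<union> N) * (f (H \<union> N) - f H)\<^sup>2 = g H * (d / n) ^ card N * (\<rho> * (ln \<rho>)\<^sup>2)"
      unfolding lnr \<rho>_def using gH d(2) n(2) by simp
    also have "\<dots> \<le> g H * (d / n) ^ card N * (1 + \<rho> ^ 3)"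
      using mult_ln_square_le[OF \<rho>] gH dn[of "card N"] by (intro mult_left_mono) auto
    also have "\<dots> \<le> g H * (d / n) ^ card N * (2 * C ^ card N)"
    proof (rule mult_left_mono)
      have "1 \<le> C ^ card N" using C by simp
      then show "1 + \<rho> ^ 3 \<le> 2 * C ^ card N" using r3 by linarith
    qed (use gH dn[of "card N"] in auto)
    also have "\<dots> = g H * (2 * (C * d / n) ^ card N)"
      by (simp add: power_mult_distrib power_divide)
    finally show ?thesis using False by simp
  qed
  have "sbm_exp n k a b (\<lambda>_ G. (f G - f (G - A))\<^sup>2) = (\<Sum>G\<in>Pow P. g G * (f G - f (G - A))\<^sup>2)"
    by (simp add: sbm_exp_graph g_def P_def)
  also have "\<dots> = (\<Sum>H\<in>Pow (P - A). \<Sum>N\<in>Pow A. g (H \<union> N) * (f (H \<union> N) - f ((H \<union> N) - A))\<^sup>2)"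
    using A by (intro sum_Pow_split) (simp add: P_def)
  also have "\<dots> \<le> (\<Sum>H\<in>Pow (P - A). \<Sum>N\<in>Pow A. g H * (2 * ((C * d / n) ^ card N - of_bool (N = {}))))"
  proof (intro sum_mono)
    fix H N assume HN: "H \<in> Pow (P - A)" "N \<in> Pow A"
    then have "(H \<union> N) - A = H" by auto
    then show "g (H \<union> N) * (f (H \<union> N) - f ((H \<union> N) - A))\<^sup>2 \<le> g H * (2 * ((C * d / n) ^ card N - of_bool (N = {})))"
      using each HN by simp
  qed
  also have "\<dots> = (\<Sum>H\<in>Pow (P - A). g H) * (2 * ((1 + C * d / n) ^ card A - 1))"
  proof -
    have "Pow A \<inter> {N. N = {}} = {{}}" by auto
    then have "(\<Sum>N\<in>Pow A. of_bool (N = {}) :: real) = 1"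
      using finA by simp
    then have "(\<Sum>N\<in>Pow A. (C * d / n) ^ card N - of_bool (N = {})) = (1 + C * d / n) ^ card A - 1"
      using finA by (simp add: sum_subtractf sum_Pow_power_card)
    then show ?thesis
      by (simp only: sum_distrib_left[symmetric] sum_distrib_right[symmetric])
  qed
  also have "\<dots> \<le> 1 * (2 * ((1 + C * d / n) ^ card A - 1))"
  proof (rule mult_right_mono)
    have "(\<Sum>H\<in>Pow (P - A). g H) \<le> (\<Sum>H\<in>Pow P. g H)"
      using graph_prob_nonneg by (intro sum_mono2) (auto simp: P_def g_def)
    then show "(\<Sum>H\<in>Pow (P - A). g H) \<le> 1" using sum_graph_prob by (simp add: P_def g_def)
    have "0 \<le> C * d / n" using C d(2) n by simp
    then have "1 \<le> (1 + C * d / n) ^ card A" by (intro one_le_power) auto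
    then show "0 \<le> 2 * ((1 + C * d / n) ^ card A - 1)" by simp
  qed
  finally show ?thesis by simp
qed

text \<open>Total variance: first the edges given the labels, then the labels. Each of the order n^2
  pairs contributes O(1/n), and each of the n vertices contributes O(1), since (1 + C d/n)^n is at
  most exp (C d).\<close>

lemma log_likelihood_variance:
  defines "f \<equiv> log_likelihood n k a b d"
  defines "C \<equiv> max 1 ((2 * c / d) ^ 3)"
  shows "sbm_exp n k a b (\<lambda>_ G. (f G)\<^sup>2) - (sbm_exp n k a b (\<lambda>_. f))\<^sup>2 \<le> n * (C * d + 2 * exp (C * d))"
proof -
  define P where "P = vertex_pairs n"
  define E where "E x = bexp P (edge_prob n a b x)" for x
  define star where "star v = {e \<in> P. v \<in> e}" for v
  define \<phi> where "\<phi> x = E x f" for x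
  \<comment> \<open>After deletion of all edges at \<open>v\<close>, the law of the graph does not
    depend on the label of \<open>v\<close>, although \<open>f\<close> itself knows nothing of
    labels.\<close>
  define \<gamma> where "\<gamma> v x = E x (\<lambda>G. f (G - star v))" for v x
  have finP: "finite P" by (simp add: P_def)
  have C: "1 \<le> C" by (simp add: C_def)
  have Cd: "0 \<le> C * d / n" using C d(2) n by simp
  have inv: "\<gamma> v (x(v := i)) = \<gamma> v x" for v x i
  proof -
    have *: "\<gamma> v y = bexp (P - star v) (edge_prob n a b y) (\<lambda>G. f (G - star v))" for y
      unfolding \<gamma>_def E_def
    proof (rule bexp_marginal[OF finP])
      fix G assume "G \<subseteq> P"
      then have "G \<inter> (P - star v) - star v = G - star v" by auto
      then show "f (G - star v) = f (G \<inter> (P - star v) - star v)" by simp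
    qed auto
    show ?thesis
      unfolding *
    proof (rule bexp_cong_prob)
      fix e assume "e \<in> P - star v"
      then have "v \<notin> e" by (auto simp: star_def)
      then have "monochromatic (x(v := i)) e = monochromatic x e" by (auto simp: monochromatic_def)
      then show "edge_prob n a b (x(v := i)) e = edge_prob n a b x e" by (simp add: edge_prob_def)
    qed
  qed
  have "sbm_exp n k a b (\<lambda>_ G. (f G)\<^sup>2) - (sbm_exp n k a b (\<lambda>_. f))\<^sup>2
      = label_exp n k (\<lambda>x. E x (\<lambda>G. (f G)\<^sup>2) - (\<phi> x)\<^sup>2) + (label_exp n k (\<lambda>x. (\<phi> x)\<^sup>2) - (label_exp n k \<phi>)\<^sup>2)"
    unfolding sbm_exp_def label_exp_diff E_def \<phi>_def P_def by simp
  also have "label_exp n k (\<lambda>x. E x (\<lambda>G. (f G)\<^sup>2) - (\<phi> x)\<^sup>2) \<le> n * (C * d)"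
  proof -
    have "label_exp n k (\<lambda>x. E x (\<lambda>G. (f G)\<^sup>2) - (\<phi> x)\<^sup>2) \<le> label_exp n k (\<lambda>x. \<Sum>e\<in>P. E x (\<lambda>G. (f G - f (G - {e}))\<^sup>2))"
      unfolding E_def \<phi>_def using finP edge_prob_01 by (intro label_exp_mono bexp_efron_stein) auto
    also have "\<dots> = (\<Sum>e\<in>P. sbm_exp n k a b (\<lambda>_ G. (f G - f (G - {e}))\<^sup>2))"
      unfolding label_exp_sum sbm_exp_def E_def P_def ..
    also have "\<dots> \<le> (\<Sum>e\<in>P. 2 * (C * d / n))"
    proof (rule sum_mono)
      fix e assume "e \<in> P"
      then show "sbm_exp n k a b (\<lambda>_ G. (f G - f (G - {e}))\<^sup>2) \<le> 2 * (C * d / n)"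
        using log_likelihood_difference[of "{e}"] by (simp add: P_def f_def C_def)
    qed
    also have "\<dots> = (real n - 1) * (C * d)"
      using n by (simp add: P_def card_vertex_pairs field_simps)
    also have "\<dots> \<le> n * (C * d)" using C d(2) by (intro mult_right_mono) auto
    finally show ?thesis .
  qed
  also have "label_exp n k (\<lambda>x. (\<phi> x)\<^sup>2) - (label_exp n k \<phi>)\<^sup>2 \<le> n * (2 * exp (C * d))"
  proof -
    have "label_exp n k (\<lambda>x. (\<phi> x)\<^sup>2) - (label_exp n k \<phi>)\<^sup>2 \<le> (\<Sum>v<n. label_exp n k (\<lambda>x. (\<phi> x - \<gamma> v x)\<^sup>2))"
      by (rule label_exp_efron_stein[OF k]) (rule inv)
    also have "\<dots> \<le> (\<Sum>v<n. sbm_exp n k a b (\<lambda>_ G. (f G - f (G - star v))\<^sup>2))"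
    proof (intro sum_mono)
      fix v
      have "\<phi> x - \<gamma> v x = E x (\<lambda>G. f G - f (G - star v))" for x
        by (simp add: \<phi>_def \<gamma>_def E_def bexp_diff)
      then show "label_exp n k (\<lambda>x. (\<phi> x - \<gamma> v x)\<^sup>2) \<le> sbm_exp n k a b (\<lambda>_ G. (f G - f (G - star v))\<^sup>2)"
        unfolding sbm_exp_def P_def[symmetric] E_def[symmetric]
        using bexp_jensen_square[OF finP edge_prob_01] by (intro label_exp_mono) (simp add: E_def)
    qed
    also have "\<dots> \<le> (\<Sum>v<n. 2 * exp (C * d))"
    proof (rule sum_mono)
      fix v assume v: "v \<in> {..<n}"
      have "star v \<subseteq> (\<lambda>w. {v, w}) ` {..<n}"
      proof
        fix e assume e: "e \<in> star v"
        then obtain x y where "e = {x, y}" "x < y" "y < n" unfolding star_def P_def by (auto elim: vertex_pairsE)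
        then show "e \<in> (\<lambda>w. {v, w}) ` {..<n}" using e by (auto simp: star_def insert_commute)
      qed
      then have cs: "card (star v) \<le> n"
        using surj_card_le[of "{..<n}" "star v"] by simp
      have "sbm_exp n k a b (\<lambda>_ G. (f G - f (G - star v))\<^sup>2) \<le> 2 * ((1 + C * d / n) ^ card (star v) - 1)"
        unfolding f_def C_def by (rule log_likelihood_difference) (auto simp: star_def P_def)
      also have "\<dots> \<le> 2 * (1 + C * d / n) ^ n"
      proof -
        have "(1 + C * d / n) ^ card (star v) \<le> (1 + C * d / n) ^ n" using Cd cs by (intro power_increasing) auto
        then show ?thesis by simp
      qed
      also have "(1 + C * d / n) ^ n \<le> exp (C * d / n) ^ n"
        using Cd by (intro power_mono) auto
      also have "exp (C * d / n) ^ n = exp (C * d)"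
        using n by (simp flip: exp_of_nat_mult)
      finally show "sbm_exp n k a b (\<lambda>_ G. (f G - f (G - star v))\<^sup>2) \<le> 2 * exp (C * d)" by simp
    qed
    finally show ?thesis by simp
  qed
  finally show ?thesis by (simp add: algebra_simps)
qed

lemma log_likelihood_lower_tail:
  fixes \<eta> :: real
  assumes "\<eta> > 0"
  defines "f \<equiv> log_likelihood n k a b d"
  defines "C \<equiv> max 1 ((2 * c / d) ^ 3)"
  shows "sbm_exp n k a b (\<lambda>_ G. of_bool (f G < sbm_exp n k a b (\<lambda>_. f) - \<eta> * n)) \<le> (C * d + 2 * exp (C * d)) / \<eta>\<^sup>2 / n"
proof -
  define m where "m = sbm_exp n k a b (\<lambda>_. f)"
  have en: "\<eta> * n > 0" using assms n by simp
  have "sbm_exp n k a b (\<lambda>_ G. of_bool (f G < m - \<eta> * n)) \<le> sbm_exp n k a b (\<lambda>_ G. (1 / (\<eta> * n)\<^sup>2) * (f G - m)\<^sup>2)"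
  proof (rule sbm_exp_mono)
    fix G
    show "of_bool (f G < m - \<eta> * n) \<le> (1 / (\<eta> * n)\<^sup>2) * (f G - m)\<^sup>2"
    proof (cases "f G < m - \<eta> * n")
      case True
      then have "(\<eta> * n)\<^sup>2 \<le> (m - f G)\<^sup>2" using en by (intro power_mono) auto
      then have "1 \<le> (m - f G)\<^sup>2 / (\<eta> * n)\<^sup>2"
        using zero_less_power[OF en, of 2] by (subst pos_le_divide_eq) auto
      then show ?thesis using True by (simp add: power2_commute)
    qed simp
  qed
  also have "\<dots> = (1 / (\<eta> * n)\<^sup>2) * (sbm_exp n k a b (\<lambda>_ G. (f G)\<^sup>2) - m\<^sup>2)"
  proof -
    have "sbm_exp n k a b (\<lambda>_ G. (f G - m)\<^sup>2) = sbm_exp n k a b (\<lambda>_ G. (f G)\<^sup>2 + m\<^sup>2 - (2 * m) * f G)"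
      by (simp add: power2_diff mult_ac)
    also have "\<dots> = sbm_exp n k a b (\<lambda>_ G. (f G)\<^sup>2) - m\<^sup>2"
      unfolding sbm_exp_diff sbm_exp_add sbm_exp_cmult using k
      by (simp add: sbm_exp_const m_def[symmetric]) (simp add: power2_eq_square)
    finally show ?thesis by (simp only: sbm_exp_cmult)
  qed
  also have "\<dots> \<le> (1 / (\<eta> * n)\<^sup>2) * (n * (C * d + 2 * exp (C * d)))"
    using log_likelihood_variance unfolding m_def f_def C_def by (intro mult_left_mono) auto
  also have "\<dots> = (C * d + 2 * exp (C * d)) / \<eta>\<^sup>2 / n"
    using n by (simp add: power2_eq_square)
  finally show ?thesis by (simp add: m_def)
qed

end

section \<open>Near-typical labellings and the mean log-likelihood\<close>

lemma sum_edge_function: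
  "(\<Sum>e\<in>vertex_pairs n. if monochromatic x e then \<alpha> else \<beta>)
    = mono_pairs n x * \<alpha> + (real (card (vertex_pairs n)) - mono_pairs n x) * (\<beta> :: real)"
proof -
  have "(\<Sum>e\<in>vertex_pairs n. if monochromatic x e then \<alpha> else \<beta>)
      = (\<Sum>e\<in>vertex_pairs n. of_bool (monochromatic x e) * \<alpha> + (1 - of_bool (monochromatic x e)) * \<beta>)"
    by (intro sum.cong refl) auto
  also have "\<dots> = mono_pairs n x * \<alpha> + (real (card (vertex_pairs n)) - mono_pairs n x) * \<beta>"
    unfolding sum.distrib sum_distrib_right[symmetric] sum_subtractf mono_pairs_eq_sum by simp
  finally show ?thesis .
qed

text \<open>The deviations of the class sizes sum to zero, so only their squares remain and the
  error is quadratic in \<open>\<delta>\<close>.\<close>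

lemma balanced_mono_pairs:
  fixes \<delta> :: real
  assumes "x \<in> balanced n k \<delta>" "n > 0" "k > 0"
  shows "\<bar>mono_pairs n x - (real n)\<^sup>2 / (2 * real k)\<bar> \<le> (k * \<delta>\<^sup>2 * (real n)\<^sup>2 + 2 * real n) / 2"
    and "\<bar>(real (card (vertex_pairs n)) - mono_pairs n x) - (real n)\<^sup>2 * (real k - 1) / (2 * real k)\<bar> \<le> (k * \<delta>\<^sup>2 * (real n)\<^sup>2 + 2 * real n) / 2"
proof -
  have x: "x \<in> labellings n k" using assms(1) by (rule balanced_imp_labellings)
  define \<Delta> where "\<Delta> i = class_size n x i - n / k" for i
  have "(\<Sum>i<k. class_size n x i) = n"
    by (rule sum_class_size) (use x labellings_less in auto)
  then have \<Delta>0: "(\<Sum>i<k. \<Delta> i) = 0" using assms by (simp add: \<Delta>_def sum_subtractf)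
  have "(\<Sum>i<k. (class_size n x i)\<^sup>2) = (\<Sum>i<k. (n / k)\<^sup>2 + 2 * (n / k) * \<Delta> i + (\<Delta> i)\<^sup>2)"
    by (intro sum.cong refl) (simp add: \<Delta>_def power2_eq_square algebra_simps)
  also have "\<dots> = (real n)\<^sup>2 / k + (\<Sum>i<k. (\<Delta> i)\<^sup>2)"
    unfolding sum.distrib sum_distrib_left[symmetric] \<Delta>0 using assms by (simp add: power2_eq_square)
  finally have eq: "2 * mono_pairs n x = (real n)\<^sup>2 / k + (\<Sum>i<k. (\<Delta> i)\<^sup>2) - n"
    by (simp add: mono_pairs_formula[OF x])
  have "(\<Sum>i<k. (\<Delta> i)\<^sup>2) \<le> (\<Sum>i<k. (\<delta> * n)\<^sup>2)"
  proof (rule sum_mono)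
    fix i assume "i \<in> {..<k}"
    then have "\<bar>\<Delta> i\<bar> \<le> \<delta> * n" unfolding \<Delta>_def using balanced_class_size[OF assms(1) _ assms(2), of i] by simp
    then have "\<bar>\<Delta> i\<bar>\<^sup>2 \<le> (\<delta> * n)\<^sup>2" by (intro power_mono) auto
    then show "(\<Delta> i)\<^sup>2 \<le> (\<delta> * n)\<^sup>2" by simp
  qed
  then have up: "(\<Sum>i<k. (\<Delta> i)\<^sup>2) \<le> k * \<delta>\<^sup>2 * (real n)\<^sup>2" by (simp add: power_mult_distrib)
  have low: "0 \<le> (\<Sum>i<k. (\<Delta> i)\<^sup>2)" by (intro sum_nonneg) auto
  have aux: "\<bar>(S - N) / 2\<bar> \<le> (X + 2 * N) / 2" "\<bar>- ((S - N) / 2) - N / 2\<bar> \<le> (X + 2 * N) / 2"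
    if "0 \<le> S" "S \<le> X" "0 \<le> N" for S X N :: real
    unfolding abs_le_iff using that by (auto simp: field_simps)
  note aux = aux[OF low up of_nat_0_le_iff[of n]]
  have M: "mono_pairs n x - (real n)\<^sup>2 / (2 * real k) = ((\<Sum>i<k. (\<Delta> i)\<^sup>2) - n) / 2"
    using eq by (simp add: field_simps)
  show "\<bar>mono_pairs n x - (real n)\<^sup>2 / (2 * real k)\<bar> \<le> (k * \<delta>\<^sup>2 * (real n)\<^sup>2 + 2 * real n) / 2"
    unfolding M using aux(1) .
  have "(real (card (vertex_pairs n)) - mono_pairs n x) - (real n)\<^sup>2 * (real k - 1) / (2 * real k)
      = - (mono_pairs n x - (real n)\<^sup>2 / (2 * real k)) - n / 2"
    using assms by (simp add: card_vertex_pairs field_simps power2_eq_square)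
  then show "\<bar>(real (card (vertex_pairs n)) - mono_pairs n x) - (real n)\<^sup>2 * (real k - 1) / (2 * real k)\<bar> \<le> (k * \<delta>\<^sup>2 * (real n)\<^sup>2 + 2 * real n) / 2"
    unfolding M using aux(2) by (simp only:)
qed

lemma label_exp_edge_function:
  assumes "k > 0"
  shows "label_exp n k (\<lambda>x. \<Sum>e\<in>vertex_pairs n. if monochromatic x e then \<alpha> else \<beta>)
    = real n * (real n - 1) / 2 * ((\<alpha> + (real k - 1) * \<beta>) / k)"
proof -
  have "label_exp n k (\<lambda>x. \<Sum>e\<in>vertex_pairs n. if monochromatic x e then \<alpha> else \<beta>)
      = label_exp n k (\<lambda>x. (\<alpha> - \<beta>) * mono_pairs n x + real (card (vertex_pairs n)) * \<beta>)"
    by (simp add: sum_edge_function algebra_simps)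
  also have "\<dots> = (\<alpha> - \<beta>) * (real n * (real n - 1) / 2 / k) + real n * (real n - 1) / 2 * \<beta>"
    unfolding label_exp_add label_exp_cmult using assms
    by (simp add: label_exp_mono_pairs label_exp_const card_vertex_pairs)
  also have "\<dots> = real n * (real n - 1) / 2 * ((\<alpha> + (real k - 1) * \<beta>) / k)"
    using assms by (simp add: field_simps)
  finally show ?thesis .
qed

lemma E_in_eq:
  assumes "G \<subseteq> vertex_pairs n"
  shows "E_in G x = (\<Sum>e\<in>vertex_pairs n. of_bool (monochromatic x e) * of_bool (e \<in> G))"
proof -
  define S where "S = {e \<in> G. monochromatic x e}"
  have "(\<Sum>e\<in>vertex_pairs n. of_bool (monochromatic x e) * of_bool (e \<in> G))
      = (\<Sum>e\<in>vertex_pairs n. if e \<in> S then 1 else 0 :: real)"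
    by (intro sum.cong refl) (auto simp: S_def)
  also have "\<dots> = (\<Sum>e\<in>vertex_pairs n \<inter> S. 1)"
    by (rule sum.inter_restrict[symmetric]) simp
  also have "vertex_pairs n \<inter> S = S" using assms by (auto simp: S_def)
  finally show ?thesis by (simp add: E_in_def S_def)
qed

lemma E_out_eq:
  assumes "G \<subseteq> vertex_pairs n"
  shows "E_out G x = (\<Sum>e\<in>vertex_pairs n. of_bool (\<not> monochromatic x e) * of_bool (e \<in> G))"
proof -
  define S where "S = {e \<in> G. \<not> monochromatic x e}"
  have "(\<Sum>e\<in>vertex_pairs n. of_bool (\<not> monochromatic x e) * of_bool (e \<in> G))
      = (\<Sum>e\<in>vertex_pairs n. if e \<in> S then 1 else 0 :: real)"
    by (intro sum.cong refl) (auto simp: S_def)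
  also have "\<dots> = (\<Sum>e\<in>vertex_pairs n \<inter> S. 1)"
    by (rule sum.inter_restrict[symmetric]) simp
  also have "vertex_pairs n \<inter> S = S" using assms by (auto simp: S_def)
  finally show ?thesis by (simp add: E_out_def S_def)
qed

lemma E_in_E_out_sum:
  assumes "finite G"
  shows "(\<Sum>e\<in>G. if monochromatic x e then \<alpha> else \<beta>) = E_in G x * \<alpha> + E_out G x * (\<beta> :: real)"
proof -
  have "(\<Sum>e\<in>G. if monochromatic x e then \<alpha> else \<beta>)
      = (\<Sum>e\<in>G. of_bool (monochromatic x e) * \<alpha> + of_bool (\<not> monochromatic x e) * \<beta>)"
    by (intro sum.cong refl) auto
  then show ?thesis
    using assms by (simp only: sum.distrib sum_distrib_right[symmetric]) (simp add: E_in_def E_out_def Int_def)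
qed

text \<open>A two-sided variant of \<open>typical_set\<close> with an absolute tolerance. Both sides
  are needed to bound the weight of the planted labelling from above, whatever the order of
  \<open>a\<close> and \<open>b\<close>.\<close>

definition near_typical :: "nat \<Rightarrow> nat \<Rightarrow> real \<Rightarrow> real \<Rightarrow> real \<Rightarrow> real \<Rightarrow> (nat \<Rightarrow> nat) \<Rightarrow> nat set set \<Rightarrow> bool" where
  "near_typical n k a b \<delta> \<eta> x G \<longleftrightarrow> x \<in> balanced n k \<delta> \<and> \<bar>E_in G x - a * n / (2 * real k)\<bar> \<le> \<eta> * n
     \<and> \<bar>E_out G x - b * n * (real k - 1) / (2 * real k)\<bar> \<le> \<eta> * n"

text \<open>The posterior probability of \<open>x\<close> given \<open>G\<close> is its weight
  divided by \<open>real k ^ n * graph_prob n k a b G\<close>, so this is the conditional entropy of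
  the labels given the graph.\<close>

definition label_entropy :: "nat \<Rightarrow> nat \<Rightarrow> real \<Rightarrow> real \<Rightarrow> real" where
  "label_entropy n k a b = sbm_exp n k a b (\<lambda>x G. ln (real k ^ n * graph_prob n k a b G / graph_weight n a b x G))"

context
  fixes n k :: nat and a b c d :: real
  assumes ab: "0 \<le> a" "0 \<le> b" "max a b \<le> c" and n: "2 * c \<le> n" "n > 0" "max a b < n" and k: "k > 0"
    and d: "d = (a + (real k - 1) * b) / k" "d > 0"
begin

lemma log_weight_eq:
  assumes "graph_weight n a b x G > 0" "G \<subseteq> vertex_pairs n"
  shows "ln (graph_weight n a b x G / (d / n) ^ card G)
    = (\<Sum>e\<in>vertex_pairs n. if e \<in> G then log_ratio a b d x e else ln (1 - edge_prob n a b x e))"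
proof -
  have finG: "finite G" by (rule finite_subset[OF assms(2) finite_vertex_pairs])
  have "(d / n) ^ card G = (\<Prod>e\<in>vertex_pairs n. if e \<in> G then d / n else 1)"
    using assms(2) by (simp add: prod.inter_restrict[symmetric] Int_absorb1)
  then have "graph_weight n a b x G / (d / n) ^ card G
      = (\<Prod>e\<in>vertex_pairs n. (if e \<in> G then edge_prob n a b x e else 1 - edge_prob n a b x e) / (if e \<in> G then d / n else 1))"
    by (simp add: graph_weight_def bern_weight_def prod_dividef)
  also have "\<dots> = (\<Prod>e\<in>vertex_pairs n. if e \<in> G then (if monochromatic x e then a else b) / d else 1 - edge_prob n a b x e)"
    using n by (intro prod.cong refl) (auto simp: edge_prob_def)
  also have "ln \<dots> = (\<Sum>e\<in>vertex_pairs n. ln (if e \<in> G then (if monochromatic x e then a else b) / d else 1 - edge_prob n a b x e))"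
  proof (rule ln_prod)
    fix e assume e: "e \<in> vertex_pairs n"
    have nz: "(if e \<in> G then edge_prob n a b x e else 1 - edge_prob n a b x e) \<noteq> 0"
    proof
      assume "(if e \<in> G then edge_prob n a b x e else 1 - edge_prob n a b x e) = 0"
      then have "graph_weight n a b x G = 0"
        unfolding graph_weight_def bern_weight_def prod_zero_iff[OF finite_vertex_pairs] using e by blast
      then show False using assms(1) by simp
    qed
    have "0 < (if e \<in> G then (if monochromatic x e then a else b) / d else 1 - edge_prob n a b x e)"
    proof (cases "e \<in> G")
      case True
      then have "(if monochromatic x e then a else b) \<noteq> 0" using nz by (auto simp: edge_prob_def)
      then have "0 < (if monochromatic x e then a else b)" using ab by auto
      then show ?thesis using True d(2) by simp
    next
      case False
      then show ?thesis using edge_prob_half(3)[OF ab n k d, of x e] by simp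
    qed
    then show "(if e \<in> G then (if monochromatic x e then a else b) / d else 1 - edge_prob n a b x e) \<noteq> 0" by linarith
  qed simp
  finally show ?thesis by (simp add: log_ratio_def if_distrib[of ln] cong: if_cong)
qed

text \<open>Edges contribute the mean log-ratio, and for a non-edge (1 - p) ln (1 - p) >= - p, which
  sums to the term with \<open>d\<close>.\<close>

lemma mean_log_weight_ge:
  "sbm_exp n k a b (\<lambda>x G. ln (graph_weight n a b x G / (d / n) ^ card G)) \<ge> (real n - 1) * (kl_rate k a b d - d) / 2"
proof -
  define P where "P = vertex_pairs n"
  have finP: "finite P" by (simp add: P_def)
  have "sbm_exp n k a b (\<lambda>x G. ln (graph_weight n a b x G / (d / n) ^ card G))
      = sbm_exp n k a b (\<lambda>x G. \<Sum>e\<in>P. of_bool (e \<in> G) * log_ratio a b d x e + (1 - of_bool (e \<in> G)) * ln (1 - edge_prob n a b x e))"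
    by (rule sbm_exp_cong[OF ab n k d]) (auto simp: log_weight_eq P_def intro!: sum.cong)
  also have "\<dots> = label_exp n k (\<lambda>x. \<Sum>e\<in>P. edge_prob n a b x e * log_ratio a b d x e
      + (1 - edge_prob n a b x e) * ln (1 - edge_prob n a b x e))"
    unfolding sbm_exp_def P_def[symmetric] bexp_sum bexp_add bexp_multc bexp_diff
    using finP by (intro label_exp_cong sum.cong refl) (simp add: bexp_edge bexp_const)
  also have "\<dots> \<ge> label_exp n k (\<lambda>x. \<Sum>e\<in>P. if monochromatic x e then a / n * (ln (a / d) - 1) else b / n * (ln (b / d) - 1))"
  proof (intro label_exp_mono sum_mono)
    fix x e
    define p where "p = edge_prob n a b x e"
    have p: "0 \<le> p" "p \<le> 1 / 2" using edge_prob_half[OF ab n k d, of x e] by (auto simp: p_def)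
    have "- ln (1 - p) = ln (1 / (1 - p))" using p by (simp add: ln_div)
    also have "\<dots> \<le> 1 / (1 - p) - 1" using p by (intro ln_le_minus_one) auto
    finally have "- ln (1 - p) * (1 - p) \<le> (1 / (1 - p) - 1) * (1 - p)" using p by (intro mult_right_mono) auto
    also have "\<dots> = p" using p by (simp add: field_simps)
    finally have "(1 - p) * ln (1 - p) \<ge> - p" by (simp add: algebra_simps)
    then show "(if monochromatic x e then a / n * (ln (a / d) - 1) else b / n * (ln (b / d) - 1))
        \<le> edge_prob n a b x e * log_ratio a b d x e + (1 - edge_prob n a b x e) * ln (1 - edge_prob n a b x e)"
      unfolding p_def edge_prob_def log_ratio_def by (simp add: algebra_simps split: if_splits)
  qed
  also have "label_exp n k (\<lambda>x. \<Sum>e\<in>P. if monochromatic x e then a / n * (ln (a / d) - 1) else b / n * (ln (b / d) - 1))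
      = real n * (real n - 1) / 2 * ((a / n * (ln (a / d) - 1) + (real k - 1) * (b / n * (ln (b / d) - 1))) / k)"
    unfolding P_def by (rule label_exp_edge_function[OF k])
  also have "\<dots> = (real n - 1) * (kl_rate k a b d - d) / 2"
    unfolding kl_rate_def d(1) using n k by (simp add: field_simps)
  finally show ?thesis .
qed

lemma graph_weight_le_prob:
  assumes "x \<in> labellings n k"
  shows "graph_weight n a b x G \<le> real k ^ n * graph_prob n k a b G"
proof -
  have "graph_weight n a b x G \<le> (\<Sum>y\<in>labellings n k. graph_weight n a b y G)"
    using assms weight_nonneg[OF ab n k d] by (intro member_le_sum) auto
  then show ?thesis using k by (simp add: graph_prob_def label_exp_def)
qed

text \<open>Bayes' rule in logarithmic form: the likelihood of the graph is the weight of
  \<open>x\<close> divided by its posterior and by the number of labellings. The entropy thus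
  determines the mean that the variance bound concentrates around.\<close>

lemma mean_log_likelihood_ge:
  "sbm_exp n k a b (\<lambda>_. log_likelihood n k a b d)
    \<ge> label_entropy n k a b - n * ln k + (real n - 1) * (kl_rate k a b d - d) / 2"
proof -
  have "sbm_exp n k a b (\<lambda>_. log_likelihood n k a b d)
      = sbm_exp n k a b (\<lambda>x G. (ln (real k ^ n * graph_prob n k a b G / graph_weight n a b x G) - n * ln k)
          + ln (graph_weight n a b x G / (d / n) ^ card G))"
  proof (rule sbm_exp_cong[OF ab n k d])
    fix x G assume x: "x \<in> labellings n k" and w: "graph_weight n a b x G > 0"
    have "real k ^ n * graph_prob n k a b G > 0" using graph_weight_le_prob[OF x, of G] w by linarith
    then have g: "graph_prob n k a b G > 0" using k by (simp add: zero_less_mult_iff)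
    have dn: "(d / n) ^ card G > 0" using d(2) n by simp
    define D where "D = (d / n) ^ card G"
    have D: "D > 0" using dn by (simp add: D_def)
    show "log_likelihood n k a b d G = (ln (real k ^ n * graph_prob n k a b G / graph_weight n a b x G) - n * ln k)
          + ln (graph_weight n a b x G / (d / n) ^ card G)"
      unfolding log_likelihood_def D_def[symmetric] using g w k D by (simp add: ln_div ln_mult ln_realpow)
  qed
  also have "\<dots> = label_entropy n k a b - n * ln k + sbm_exp n k a b (\<lambda>x G. ln (graph_weight n a b x G / (d / n) ^ card G))"
    unfolding sbm_exp_add sbm_exp_diff label_entropy_def using k by (simp add: sbm_exp_const)
  finally show ?thesis using mean_log_weight_ge by linarith
qed

text \<open>Chebyshev's inequality for the two edge counts. Half of the tolerance
  \<open>\<eta> * n\<close> absorbs the bias caused by imbalance, the other half the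
  fluctuation.\<close>

lemma not_near_typical_le:
  fixes \<delta> \<eta> :: real
  assumes \<delta>: "\<delta> > 0" and \<eta>: "\<eta> > 0" and small: "2 * c * k * \<delta>\<^sup>2 \<le> \<eta>" "4 * c \<le> \<eta> * n"
  shows "sbm_exp n k a b (\<lambda>x G. of_bool (\<not> near_typical n k a b \<delta> \<eta> x G)) \<le> (k / \<delta>\<^sup>2 + 4 * c / \<eta>\<^sup>2) / n"
proof -
  define P where "P = vertex_pairs n"
  define E where "E x = bexp P (edge_prob n a b x)" for x
  have finP: "finite P" by (simp add: P_def)
  have c0: "0 \<le> c" using ab by linarith
  define Y where "Y h x G = (\<Sum>e\<in>P. h x e * (of_bool (e \<in> G) - edge_prob n a b x e))" for h :: "(nat \<Rightarrow> nat) \<Rightarrow> nat set \<Rightarrow> real" and x G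
  have cheb: "E x (\<lambda>G. (1 / (\<eta> * n / 2)\<^sup>2) * (Y h x G)\<^sup>2) \<le> 2 * c / \<eta>\<^sup>2 / n"
    if h: "\<And>e. (h x e)\<^sup>2 \<le> 1" for x h
  proof -
    have "E x (\<lambda>G. (Y h x G)\<^sup>2) = (\<Sum>e\<in>P. (h x e)\<^sup>2 * (edge_prob n a b x e * (1 - edge_prob n a b x e)))"
      unfolding E_def Y_def by (rule bexp_square_sum(2)[OF finP])
    also have "\<dots> \<le> (\<Sum>e\<in>P. 1 * (c / n))"
    proof (intro sum_mono mult_mono h)
      fix e
      show "edge_prob n a b x e * (1 - edge_prob n a b x e) \<le> c / n"
        using edge_prob_half[OF ab n k d, of x e] mult_left_le[of "1 - edge_prob n a b x e" "edge_prob n a b x e"] by linarith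
      show "0 \<le> edge_prob n a b x e * (1 - edge_prob n a b x e)"
        using edge_prob_half[OF ab n k d, of x e] by simp
    qed auto
    also have "\<dots> = (real n - 1) * c / 2" using n by (simp add: P_def card_vertex_pairs)
    also have "\<dots> \<le> n * c / 2" using c0 by (simp add: mult_right_mono)
    finally have "E x (\<lambda>G. (Y h x G)\<^sup>2) \<le> n * c / 2" .
    then have "(1 / (\<eta> * n / 2)\<^sup>2) * E x (\<lambda>G. (Y h x G)\<^sup>2) \<le> (1 / (\<eta> * n / 2)\<^sup>2) * (n * c / 2)"
      by (intro mult_left_mono) auto
    also have "\<dots> = 2 * c / \<eta>\<^sup>2 / n" using n \<eta> by (simp add: power2_eq_square field_simps)
    finally show ?thesis unfolding E_def bexp_cmult .
  qed
  define hi where "hi x e = (of_bool (monochromatic x e) :: real)" for x :: "nat \<Rightarrow> nat" and e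
  define ho where "ho x e = (of_bool (\<not> monochromatic x e) :: real)" for x :: "nat \<Rightarrow> nat" and e
  have dev: "1 \<le> (1 / (\<eta> * n / 2)\<^sup>2) * (Y hi x G)\<^sup>2 + (1 / (\<eta> * n / 2)\<^sup>2) * (Y ho x G)\<^sup>2"
    if x: "x \<in> balanced n k \<delta>" and nt: "\<not> near_typical n k a b \<delta> \<eta> x G" and G: "G \<subseteq> P" for x G
  proof -
    have pos: "\<eta> * n / 2 > 0" using \<eta> n by simp
    have big: "1 \<le> (1 / (\<eta> * n / 2)\<^sup>2) * y\<^sup>2" if "\<eta> * n / 2 \<le> \<bar>y\<bar>" for y :: real
    proof -
      have "(\<eta> * n / 2)\<^sup>2 \<le> \<bar>y\<bar>\<^sup>2" using that pos by (intro power_mono) auto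
      then show ?thesis using zero_less_power[OF pos, of 2] by (simp add: field_simps)
    qed
    have bias: "c / n * ((k * \<delta>\<^sup>2 * (real n)\<^sup>2 + 2 * real n) / 2) \<le> \<eta> * n / 2"
    proof -
      have "c / n * ((k * \<delta>\<^sup>2 * (real n)\<^sup>2 + 2 * real n) / 2) = (2 * c * k * \<delta>\<^sup>2) * n / 4 + c"
        using n by (simp add: field_simps power2_eq_square)
      also have "\<dots> \<le> \<eta> * n / 4 + \<eta> * n / 4"
        using small by (intro add_mono divide_right_mono mult_right_mono) auto
      finally show ?thesis by simp
    qed
    have an: "0 \<le> a / n" "a / n \<le> c / n" "0 \<le> b / n" "b / n \<le> c / n"
      using ab n by (auto intro!: divide_right_mono)
    have bal: "\<bar>mono_pairs n x - (real n)\<^sup>2 / (2 * real k)\<bar> \<le> (k * \<delta>\<^sup>2 * (real n)\<^sup>2 + 2 * real n) / 2"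
       "\<bar>(real (card (vertex_pairs n)) - mono_pairs n x) - (real n)\<^sup>2 * (real k - 1) / (2 * real k)\<bar> \<le> (k * \<delta>\<^sup>2 * (real n)\<^sup>2 + 2 * real n) / 2"
      by (fact balanced_mono_pairs[OF x n(2) k])+
    have mean: "\<bar>t * (s - r)\<bar> \<le> \<eta> * n / 2" if "0 \<le> t" "t \<le> c / n" "\<bar>s - r\<bar> \<le> (k * \<delta>\<^sup>2 * (real n)\<^sup>2 + 2 * real n) / 2" for t s r :: real
    proof -
      have "\<bar>t * (s - r)\<bar> \<le> c / n * ((k * \<delta>\<^sup>2 * (real n)\<^sup>2 + 2 * real n) / 2)"
        unfolding abs_mult using that by (intro mult_mono) auto
      then show ?thesis using bias by linarith
    qed
    have Yi: "Y hi x G = E_in G x - a / n * mono_pairs n x"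
    proof -
      have "Y hi x G = E_in G x - (\<Sum>e\<in>P. of_bool (monochromatic x e) * (a / n))"
        using G unfolding E_in_eq[OF G[unfolded P_def]] P_def[symmetric] sum_subtractf[symmetric] Y_def
        by (intro sum.cong refl) (simp add: hi_def edge_prob_def)
      then show ?thesis unfolding sum_distrib_right[symmetric] mono_pairs_eq_sum P_def by (simp only: mult.commute)
    qed
    have Yo: "Y ho x G = E_out G x - b / n * (real (card (vertex_pairs n)) - mono_pairs n x)"
    proof -
      have "Y ho x G = E_out G x - (\<Sum>e\<in>P. of_bool (\<not> monochromatic x e) * (b / n))"
        using G unfolding E_out_eq[OF G[unfolded P_def]] P_def[symmetric] sum_subtractf[symmetric] Y_def
        by (intro sum.cong refl) (simp add: ho_def edge_prob_def)
      also have "(\<Sum>e\<in>P. of_bool (\<not> monochromatic x e) * (b / n)) = (\<Sum>e\<in>P. if monochromatic x e then 0 else b / n)"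
        by (intro sum.cong refl) auto
      finally show ?thesis unfolding P_def sum_edge_function by simp
    qed
    have far: "h / 2 \<le> \<bar>y\<bar>" if "t = y + z" "h < \<bar>t\<bar>" "\<bar>z\<bar> \<le> h / 2" for t y z h :: real
      using that by linarith
    have "\<not> (\<bar>E_in G x - a * n / (2 * real k)\<bar> \<le> \<eta> * n \<and> \<bar>E_out G x - b * n * (real k - 1) / (2 * real k)\<bar> \<le> \<eta> * n)"
      using nt x by (simp add: near_typical_def)
    then consider "\<bar>E_in G x - a * n / (2 * real k)\<bar> > \<eta> * n" | "\<bar>E_out G x - b * n * (real k - 1) / (2 * real k)\<bar> > \<eta> * n"
      by linarith
    then have "\<eta> * n / 2 \<le> \<bar>Y hi x G\<bar> \<or> \<eta> * n / 2 \<le> \<bar>Y ho x G\<bar>"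
    proof cases
      case 1
      have "a / n * ((real n)\<^sup>2 / (2 * real k)) = a * n / (2 * real k)" using n by (simp add: power2_eq_square)
      then have "E_in G x - a * n / (2 * real k) = Y hi x G + a / n * (mono_pairs n x - (real n)\<^sup>2 / (2 * real k))"
        unfolding Yi by (simp only: right_diff_distrib)
      then show ?thesis using far[OF _ 1 mean[OF an(1,2) bal(1)]] by blast
    next
      case 2
      have "b / n * ((real n)\<^sup>2 * (real k - 1) / (2 * real k)) = b * n * (real k - 1) / (2 * real k)"
        using n by (simp add: power2_eq_square)
      then have "E_out G x - b * n * (real k - 1) / (2 * real k)
          = Y ho x G + b / n * ((real (card (vertex_pairs n)) - mono_pairs n x) - (real n)\<^sup>2 * (real k - 1) / (2 * real k))"
        unfolding Yo by (simp only: right_diff_distrib[of "b / n" _ "_ / (2 * real k)"])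
      then show ?thesis using far[OF _ 2 mean[OF an(3,4) bal(2)]] by blast
    qed
    moreover have nn: "0 \<le> (1 / (\<eta> * n / 2)\<^sup>2) * y\<^sup>2" for y :: real by simp
    ultimately show ?thesis using add_mono[OF big nn, of "Y hi x G" "Y ho x G"] add_mono[OF nn big, of "Y ho x G" "Y hi x G"]
      by (metis add_0 add.right_neutral)
  qed
  have "sbm_exp n k a b (\<lambda>x G. of_bool (\<not> near_typical n k a b \<delta> \<eta> x G))
      \<le> label_exp n k (\<lambda>x. of_bool (x \<notin> balanced n k \<delta>) + 4 * c / \<eta>\<^sup>2 / n)"
    unfolding sbm_exp_def P_def[symmetric] E_def[symmetric]
  proof (rule label_exp_mono)
    fix x
    have p01: "0 \<le> edge_prob n a b x e \<and> edge_prob n a b x e \<le> 1" for e by (rule edge_prob_01[OF ab n k d])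
    show "E x (\<lambda>G. of_bool (\<not> near_typical n k a b \<delta> \<eta> x G)) \<le> of_bool (x \<notin> balanced n k \<delta>) + 4 * c / \<eta>\<^sup>2 / n"
    proof (cases "x \<in> balanced n k \<delta>")
      case True
      have "E x (\<lambda>G. of_bool (\<not> near_typical n k a b \<delta> \<eta> x G))
          \<le> E x (\<lambda>G. (1 / (\<eta> * n / 2)\<^sup>2) * (Y hi x G)\<^sup>2 + (1 / (\<eta> * n / 2)\<^sup>2) * (Y ho x G)\<^sup>2)"
        unfolding E_def
      proof (rule bexp_mono[OF p01])
        fix G assume G: "G \<subseteq> P"
        have "0 \<le> (1 / (\<eta> * n / 2)\<^sup>2) * (Y hi x G)\<^sup>2 + (1 / (\<eta> * n / 2)\<^sup>2) * (Y ho x G)\<^sup>2" by simp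
        then show "of_bool (\<not> near_typical n k a b \<delta> \<eta> x G) \<le> (1 / (\<eta> * n / 2)\<^sup>2) * (Y hi x G)\<^sup>2 + (1 / (\<eta> * n / 2)\<^sup>2) * (Y ho x G)\<^sup>2"
          using dev[OF True _ G] by (cases "near_typical n k a b \<delta> \<eta> x G") simp_all
      qed
      also have "\<dots> = E x (\<lambda>G. (1 / (\<eta> * n / 2)\<^sup>2) * (Y hi x G)\<^sup>2) + E x (\<lambda>G. (1 / (\<eta> * n / 2)\<^sup>2) * (Y ho x G)\<^sup>2)"
        unfolding E_def by (rule bexp_add)
      also have "\<dots> \<le> 2 * c / \<eta>\<^sup>2 / n + 2 * c / \<eta>\<^sup>2 / n"
        by (intro add_mono cheb) (auto simp: hi_def ho_def)
      finally show ?thesis using True by (simp add: mult.commute)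
    next
      case False
      have "E x (\<lambda>G. of_bool (\<not> near_typical n k a b \<delta> \<eta> x G)) \<le> 1"
        unfolding E_def using finP p01 by (intro bexp_le_const) auto
      moreover have "0 \<le> 4 * c / \<eta>\<^sup>2 / n" using c0 by simp
      ultimately show ?thesis using False by simp
    qed
  qed
  also have "\<dots> \<le> (k / \<delta>\<^sup>2) / n + 4 * c / \<eta>\<^sup>2 / n"
    unfolding label_exp_add using label_exp_unbalanced_le[OF k n(2) \<delta>] k by (simp add: label_exp_const)
  finally show ?thesis by (simp add: add_divide_distrib)
qed

text \<open>Agrees with \<open>mean_log_weight_ge\<close> to leading order. Together with the
  concentrated likelihood it bounds the posterior weight of a near-typical planted
  labelling.\<close>

lemma near_typical_log_weight_le:
  fixes \<delta> \<eta> :: real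
  assumes nt: "near_typical n k a b \<delta> \<eta> x G" and w: "graph_weight n a b x G > 0" and G: "G \<subseteq> vertex_pairs n" and \<eta>: "0 \<le> \<eta>"
  shows "ln (graph_weight n a b x G / (d / n) ^ card G)
    \<le> n * (kl_rate k a b d - d) / 2 + n * (\<eta> * (\<bar>ln (a / d)\<bar> + \<bar>ln (b / d)\<bar>) + c * k * \<delta>\<^sup>2) + 2 * c + c * (c + 2 * \<eta>)"
proof -
  define P where "P = vertex_pairs n"
  have finG: "finite G" by (rule finite_subset[OF G finite_vertex_pairs])
  have c0: "0 \<le> c" using ab by linarith
  have x: "x \<in> balanced n k \<delta>" using nt by (simp add: near_typical_def)
  have Ei: "\<bar>E_in G x - a * n / (2 * real k)\<bar> \<le> \<eta> * n" and Eo: "\<bar>E_out G x - b * n * (real k - 1) / (2 * real k)\<bar> \<le> \<eta> * n"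
    using nt by (auto simp: near_typical_def)
  have "ln (graph_weight n a b x G / (d / n) ^ card G)
      = (\<Sum>e\<in>P. if e \<in> G then log_ratio a b d x e else ln (1 - edge_prob n a b x e))"
    unfolding P_def by (rule log_weight_eq[OF w G])
  also have "\<dots> \<le> (\<Sum>e\<in>P. (if e \<in> G then log_ratio a b d x e + edge_prob n a b x e else 0) - edge_prob n a b x e)"
  proof (rule sum_mono)
    fix e
    have "ln (1 - edge_prob n a b x e) \<le> - edge_prob n a b x e"
      using edge_prob_half[OF ab n k d, of x e] by (intro ln_one_minus_bounds) auto
    then show "(if e \<in> G then log_ratio a b d x e else ln (1 - edge_prob n a b x e))
      \<le> (if e \<in> G then log_ratio a b d x e + edge_prob n a b x e else 0) - edge_prob n a b x e" by simp
  qed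
  also have "\<dots> = (\<Sum>e\<in>G. log_ratio a b d x e) + (\<Sum>e\<in>G. edge_prob n a b x e) - (\<Sum>e\<in>P. edge_prob n a b x e)"
    using G unfolding sum_subtractf
    by (simp add: P_def sum.inter_restrict[symmetric] Int_absorb1 sum.distrib)
  finally have base: "ln (graph_weight n a b x G / (d / n) ^ card G)
      \<le> (\<Sum>e\<in>G. log_ratio a b d x e) + (\<Sum>e\<in>G. edge_prob n a b x e) - (\<Sum>e\<in>P. edge_prob n a b x e)" .
  have "(\<Sum>e\<in>G. log_ratio a b d x e) = (\<Sum>e\<in>G. if monochromatic x e then ln (a / d) else ln (b / d))"
    by (intro sum.cong refl) (simp add: log_ratio_def)
  also have "\<dots> = E_in G x * ln (a / d) + E_out G x * ln (b / d)"
    by (rule E_in_E_out_sum[OF finG])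
  finally have R: "(\<Sum>e\<in>G. log_ratio a b d x e) = E_in G x * ln (a / d) + E_out G x * ln (b / d)" .
  have Ri: "E_in G x * ln (a / d) \<le> a * n / (2 * real k) * ln (a / d) + \<eta> * n * \<bar>ln (a / d)\<bar>"
  proof -
    have "(E_in G x - a * n / (2 * real k)) * ln (a / d) \<le> \<bar>E_in G x - a * n / (2 * real k)\<bar> * \<bar>ln (a / d)\<bar>"
      by (metis abs_ge_self abs_mult)
    also have "\<dots> \<le> \<eta> * n * \<bar>ln (a / d)\<bar>" using Ei by (intro mult_right_mono) auto
    finally show ?thesis by (simp add: algebra_simps)
  qed
  have Ro: "E_out G x * ln (b / d) \<le> b * n * (real k - 1) / (2 * real k) * ln (b / d) + \<eta> * n * \<bar>ln (b / d)\<bar>"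
  proof -
    have "(E_out G x - b * n * (real k - 1) / (2 * real k)) * ln (b / d) \<le> \<bar>E_out G x - b * n * (real k - 1) / (2 * real k)\<bar> * \<bar>ln (b / d)\<bar>"
      by (metis abs_ge_self abs_mult)
    also have "\<dots> \<le> \<eta> * n * \<bar>ln (b / d)\<bar>" using Eo by (intro mult_right_mono) auto
    finally show ?thesis by (simp add: algebra_simps)
  qed
  have Q: "(\<Sum>e\<in>G. edge_prob n a b x e) \<le> c * (c + 2 * \<eta>)"
  proof -
    have "(\<Sum>e\<in>G. edge_prob n a b x e) = E_in G x * (a / n) + E_out G x * (b / n)"
      unfolding E_in_E_out_sum[OF finG, symmetric] by (intro sum.cong refl) (simp add: edge_prob_def)
    also have "\<dots> \<le> ((c / 2 + \<eta>) * n) * (c / n) + ((c / 2 + \<eta>) * n) * (c / n)"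
    proof (intro add_mono mult_mono)
      have "a * n / (2 * real k) \<le> c * n / 2" 
      proof -
        have "a * n / (2 * real k) \<le> a * n / 2" using ab k by (intro divide_left_mono mult_nonneg_nonneg) auto
        also have "\<dots> \<le> c * n / 2" using ab by (intro divide_right_mono mult_right_mono) auto
        finally show ?thesis .
      qed
      then show "E_in G x \<le> (c / 2 + \<eta>) * n" using Ei unfolding distrib_right by linarith
      have "b * n * (real k - 1) / (2 * real k) \<le> c * n / 2"
      proof -
        have "b * n * (real k - 1) / (2 * real k) = b * n / 2 * ((real k - 1) / k)" by simp
        also have "\<dots> \<le> b * n / 2 * 1" using ab k by (intro mult_left_mono) auto
        also have "\<dots> \<le> c * n / 2" using ab by (simp add: mult_right_mono)
        finally show ?thesis .
      qed
      then show "E_out G x \<le> (c / 2 + \<eta>) * n" using Eo unfolding distrib_right by linarith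
    qed (use ab n c0 \<eta> in \<open>auto intro!: divide_right_mono simp: E_in_def E_out_def\<close>)
    also have "\<dots> = c * (c + 2 * \<eta>)" using n by (simp add: field_simps)
    finally show ?thesis .
  qed
  have S: "- (\<Sum>e\<in>P. edge_prob n a b x e) \<le> - (n * d / 2) + n * (c * k * \<delta>\<^sup>2) + 2 * c"
  proof -
    define M where "M = mono_pairs n x"
    define M' where "M' = real (card (vertex_pairs n)) - mono_pairs n x"
    have an: "0 \<le> a / n" "a / n \<le> c / n" "0 \<le> b / n" "b / n \<le> c / n"
      using ab n by (auto intro!: divide_right_mono)
    have S: "(\<Sum>e\<in>P. edge_prob n a b x e) = M * (a / n) + M' * (b / n)"
      unfolding P_def edge_prob_def if_distrib[of "\<lambda>t. t / real n"] sum_edge_function M_def M'_def ..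
    have D: "a / n * ((real n)\<^sup>2 / (2 * real k)) + b / n * ((real n)\<^sup>2 * (real k - 1) / (2 * real k)) = n * d / 2"
      unfolding d(1) using n k by (simp add: power2_eq_square field_simps)
    have le: "t * s - r * t \<le> c / n * ((k * \<delta>\<^sup>2 * (real n)\<^sup>2 + 2 * real n) / 2)"
      if "0 \<le> t" "t \<le> c / n" "\<bar>r - s\<bar> \<le> (k * \<delta>\<^sup>2 * (real n)\<^sup>2 + 2 * real n) / 2" for t r s :: real
    proof -
      have "t * s - r * t = t * (s - r)" by (simp add: algebra_simps)
      also have "\<dots> \<le> t * \<bar>r - s\<bar>" using that(1) by (intro mult_left_mono) auto
      also have "\<dots> \<le> c / n * ((k * \<delta>\<^sup>2 * (real n)\<^sup>2 + 2 * real n) / 2)"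
        using that c0 by (intro mult_mono) auto
      finally show ?thesis .
    qed
    have Z: "c / n * ((k * \<delta>\<^sup>2 * (real n)\<^sup>2 + 2 * real n) / 2) = n * (c * k * \<delta>\<^sup>2) / 2 + c"
      using n by (simp add: field_simps power2_eq_square)
    have lin: "- s \<le> - t + R + 2 * c" if "s = p + q" "p' + q' = t" "p' - p \<le> z" "q' - q \<le> z" "z = R / 2 + c"
      for s p q p' q' t z R :: real using that by linarith
    show ?thesis
      by (rule lin[OF S D le[OF an(1,2)] le[OF an(3,4)] Z])
         (use balanced_mono_pairs[OF x n(2) k] in \<open>simp_all only: M_def M'_def\<close>)
  qed
  have I: "a * n / (2 * real k) * ln (a / d) + b * n * (real k - 1) / (2 * real k) * ln (b / d) = n * kl_rate k a b d / 2"
    unfolding kl_rate_def using k by (simp add: field_simps)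
  have lin: "L \<le> (K - D) + (u + v + w) + z + y"
    if "L \<le> r + q - s" "r = p + m" "p \<le> p' + u" "m \<le> m' + v" "q \<le> y" "- s \<le> - D + w + z" "p' + m' = K"
    for L K D u v w z y r q s p m p' m' :: real using that by linarith
  have split: "N * (K - D) / 2 + N * (h * (p + q) + r) + s + t = (N * K / 2 - N * D / 2) + (h * N * p + h * N * q + N * r) + s + t"
    for N K D h p q r s t :: real by (simp add: algebra_simps diff_divide_distrib)
  show ?thesis by (rule ord_le_eq_trans[OF lin[OF base R Ri Ro Q S I] split[symmetric]])
qed

end

lemma typical_subset_balanced: "x \<in> typical_set n k a b \<delta> G \<Longrightarrow> x \<in> balanced n k \<delta>"
  by (auto simp: typical_set_def split: if_splits)

lemma typical_subset_labellings: "typical_set n k a b \<delta> G \<subseteq> labellings n k"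
  using typical_subset_balanced balanced_imp_labellings by blast

lemma balanced_mono: "x \<in> balanced n k \<delta> \<Longrightarrow> \<delta> \<le> \<delta>' \<Longrightarrow> x \<in> balanced n k \<delta>'"
  by (auto simp: balanced_def)

lemma graph_weight_pos_imp:
  assumes "graph_weight n a b x G > 0" "G \<subseteq> vertex_pairs n"
  shows "a = 0 \<Longrightarrow> E_in G x = 0" "b = 0 \<Longrightarrow> E_out G x = 0"
proof -
  have nz: "edge_prob n a b x e \<noteq> 0" if e: "e \<in> G" for e
  proof
    assume "edge_prob n a b x e = 0"
    then have "graph_weight n a b x G = 0"
      unfolding graph_weight_def bern_weight_def prod_zero_iff[OF finite_vertex_pairs]
      using e assms(2) by (intro bexI[of _ e]) auto
    then show False using assms(1) by simp
  qed
  show "E_in G x = 0" if "a = 0"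
  proof -
    have "\<not> monochromatic x e" if "e \<in> G" for e
      using nz[OF that] \<open>a = 0\<close> by (auto simp: edge_prob_def split: if_splits)
    then have "{e \<in> G. monochromatic x e} = {}" by blast
    then show ?thesis by (simp only: E_in_def card.empty of_nat_0)
  qed
  show "E_out G x = 0" if "b = 0"
  proof -
    have "monochromatic x e" if "e \<in> G" for e
      using nz[OF that] \<open>b = 0\<close> by (auto simp: edge_prob_def split: if_splits)
    then have "{e \<in> G. \<not> monochromatic x e} = {}" by blast
    then show ?thesis by (simp only: E_out_def card.empty of_nat_0)
  qed
qed

text \<open>The tolerance of \<open>typical_set\<close> is relative and degenerates when
  \<open>a\<close> or \<open>b\<close> is zero; positive weight then forces the corresponding edge
  count to vanish exactly.\<close>

lemma near_typical_imp_typical: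
  fixes \<delta> \<delta>' \<eta> :: real
  assumes nt: "near_typical n k a b \<delta>' \<eta> x G" and \<delta>: "\<delta>' \<le> \<delta>" "0 < \<delta>" and ab: "0 \<le> a" "0 \<le> b" and k: "k > 0"
    and \<eta>: "a > 0 \<Longrightarrow> \<eta> \<le> \<delta> * (a / (2 * real k))" "b > 0 \<Longrightarrow> \<eta> \<le> \<delta> * (b * (real k - 1) / (2 * real k))"
    and w: "graph_weight n a b x G > 0" and G: "G \<subseteq> vertex_pairs n"
  shows "x \<in> typical_set n k a b \<delta> G"
proof -
  define A where "A = a * n / (2 * real k)"
  define B where "B = b * n * (real k - 1) / (2 * real k)"
  have x: "x \<in> balanced n k \<delta>" using nt balanced_mono[OF _ \<delta>(1)] by (simp add: near_typical_def)
  have Ei: "\<bar>E_in G x - A\<bar> \<le> \<delta> * A"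
  proof (cases "a = 0")
    case True
    then show ?thesis using graph_weight_pos_imp(1)[OF w G True] by (simp add: A_def)
  next
    case False
    then have "\<eta> * n \<le> \<delta> * (a / (2 * real k)) * n" using \<eta>(1) ab by (intro mult_right_mono) auto
    also have "\<dots> = \<delta> * A" by (simp add: A_def)
    finally show ?thesis using nt unfolding near_typical_def A_def by linarith
  qed
  have Eo: "\<bar>E_out G x - B\<bar> \<le> \<delta> * B"
  proof (cases "b = 0")
    case True
    then show ?thesis using graph_weight_pos_imp(2)[OF w G True] by (simp add: B_def)
  next
    case False
    then have "\<eta> * n \<le> \<delta> * (b * (real k - 1) / (2 * real k)) * n" using \<eta>(2) ab by (intro mult_right_mono) auto
    also have "\<dots> = \<delta> * B" by (simp add: B_def)
    finally show ?thesis using nt unfolding near_typical_def B_def by linarith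
  qed
  have "E_in G x \<ge> A * (1 - \<delta>)" "E_in G x \<le> A * (1 + \<delta>)" "E_out G x \<ge> B * (1 - \<delta>)" "E_out G x \<le> B * (1 + \<delta>)"
    using Ei Eo unfolding right_diff_distrib distrib_left mult.commute[of A \<delta>] mult.commute[of B \<delta>] by linarith+
  then show ?thesis using x unfolding typical_set_def A_def B_def by simp
qed

section \<open>Small sets and the chain rule graph by graph\<close>

context
  fixes n k :: nat and a b c d :: real
  assumes ab: "0 \<le> a" "0 \<le> b" "max a b \<le> c" and n: "2 * c \<le> n" "n > 0" "max a b < n" and k: "k > 0"
    and d: "d = (a + (real k - 1) * b) / k" "d > 0"
begin

text \<open>Given the graph, \<open>T G\<close> has fewer than \<open>M\<close> elements and each
  counted one has posterior probability at most \<open>t\<close>. So the planted labelling can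
  hardly lie in a small typical set while having small posterior weight.\<close>

lemma sbm_exp_small_set_le:
  fixes M t :: real
  assumes T: "\<And>G. T G \<subseteq> labellings n k" and t: "0 \<le> t" and M: "0 \<le> M"
  shows "sbm_exp n k a b (\<lambda>x G. of_bool (x \<in> T G \<and> real (card (T G)) < M
      \<and> graph_weight n a b x G \<le> t * (real k ^ n * graph_prob n k a b G))) \<le> M * t"
proof -
  let ?g = "\<lambda>G. graph_prob n k a b G"
  let ?Q = "\<lambda>x G. x \<in> T G \<and> real (card (T G)) < M \<and> graph_weight n a b x G \<le> t * (real k ^ n * ?g G)"
  have each: "label_exp n k (\<lambda>x. graph_weight n a b x G * of_bool (?Q x G)) \<le> M * t * ?g G" for G
  proof -
    have g0: "0 \<le> ?g G" by (rule graph_prob_nonneg[OF ab n k d])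
    have kn: "real k ^ n > 0" using k by simp
    have w0: "0 \<le> t * (real k ^ n * ?g G)" using t g0 kn by simp
    have finT: "finite (T G)" by (rule finite_subset[OF T finite_labellings])
    show ?thesis
    proof (cases "real (card (T G)) < M")
      case True
      have "(\<Sum>x\<in>labellings n k. graph_weight n a b x G * of_bool (?Q x G))
          \<le> (\<Sum>x\<in>labellings n k. if x \<in> T G then t * (real k ^ n * ?g G) else 0)"
        using w0 by (intro sum_mono) auto
      also have "\<dots> = (\<Sum>x\<in>T G. t * (real k ^ n * ?g G))"
        using T[of G] by (simp add: sum.inter_restrict[symmetric] Int_absorb1)
      also have "\<dots> = real (card (T G)) * (t * (real k ^ n * ?g G))" by simp
      also have "\<dots> \<le> M * (t * (real k ^ n * ?g G))" using True w0 by (intro mult_right_mono) auto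
      also have "\<dots> = M * t * ?g G * real k ^ n" by simp
      finally show ?thesis unfolding label_exp_def using kn by (simp add: pos_divide_le_eq)
    next
      case False
      then have "label_exp n k (\<lambda>x. graph_weight n a b x G * of_bool (?Q x G)) = 0"
        by (simp add: label_exp_def)
      then show ?thesis using t M g0 by simp
    qed
  qed
  have "sbm_exp n k a b (\<lambda>x G. of_bool (?Q x G)) \<le> (\<Sum>G\<in>Pow (vertex_pairs n). M * t * ?g G)"
    unfolding sbm_exp_weight by (intro sum_mono each)
  also have "\<dots> = M * t * (\<Sum>G\<in>Pow (vertex_pairs n). ?g G)" by (rule sum_distrib_left[symmetric])
  also have "\<dots> = M * t" using sum_graph_prob[OF ab n k d] by simp
  finally show ?thesis .
qed

text \<open>The graph is conditioned on, so the order and the sets may depend on it. The vertices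
  outside \<open>U G\<close> are dropped because the marginal over \<open>U G\<close> is at most the
  total weight.\<close>

lemma entropy_ge_chain:
  fixes key :: "nat set set \<Rightarrow> nat \<Rightarrow> nat"
  assumes U: "\<And>G. G \<subseteq> vertex_pairs n \<Longrightarrow> U G \<subseteq> {..<n} \<and> inj_on (key G) (U G)"
    and S: "\<And>G v. G \<subseteq> vertex_pairs n \<Longrightarrow> v \<in> U G \<Longrightarrow> v \<in> S G v \<and> S G v \<subseteq> {u \<in> U G. key G u \<le> key G v}"
  shows "sbm_exp n k a b (\<lambda>x G. \<Sum>v\<in>U G. ln (relabel_sum k (S G v) (\<lambda>y. graph_weight n a b y G) x
      / relabel_sum k (S G v - {v}) (\<lambda>y. graph_weight n a b y G) x)) \<le> label_entropy n k a b"
  unfolding label_entropy_def sbm_exp_weight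
proof (rule sum_mono)
  fix G assume "G \<in> Pow (vertex_pairs n)"
  then have G: "G \<subseteq> vertex_pairs n" by simp
  define p where "p y = graph_weight n a b y G" for y
  have p: "0 \<le> p y" for y unfolding p_def by (rule weight_nonneg[OF ab n k d])
  define V where "V = U G"
  define T where "T = S G"
  have V: "V \<subseteq> {..<n}" "inj_on (key G) V" using U[OF G] by (auto simp: V_def)
  have T: "v \<in> T v \<and> T v \<subseteq> {u \<in> V. key G u \<le> key G v}" if "v \<in> V" for v
    using S[OF G, of v] that by (simp add: V_def T_def)
  have all: "real k ^ n * graph_prob n k a b G = (\<Sum>y\<in>labellings n k. p y)"
    using k by (simp add: graph_prob_def label_exp_def p_def)
  have pos: "relabel_sum k D p x > 0" if "x \<in> labellings n k" "D \<subseteq> {..<n}" "p x > 0" for D x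
    using relabel_sum_ge[OF that(1,2), of p] p that(3) by (meson less_le_trans)
  have flip: "p x * ln (relabel_sum k (T v) p x / relabel_sum k (T v - {v}) p x)
      = - (p x * ln (relabel_sum k (T v - {v}) p x / relabel_sum k (T v) p x))"
    if x: "x \<in> labellings n k" and v: "v \<in> V" for x v
  proof (cases "p x = 0")
    case False
    then have px: "p x > 0" using p[of x] by simp
    have sub: "T v \<subseteq> {..<n}" "T v - {v} \<subseteq> {..<n}" using T[OF v] V by auto
    show ?thesis using pos[OF x sub(1) px] pos[OF x sub(2) px] by (simp add: ln_div algebra_simps)
  qed simp
  have "(\<Sum>x\<in>labellings n k. p x * (\<Sum>v\<in>V. ln (relabel_sum k (T v) p x / relabel_sum k (T v - {v}) p x)))
      = (\<Sum>x\<in>labellings n k. \<Sum>v\<in>V. - (p x * ln (relabel_sum k (T v - {v}) p x / relabel_sum k (T v) p x)))"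
    unfolding sum_distrib_left by (intro sum.cong refl flip)
  also have "\<dots> = - (\<Sum>v\<in>V. \<Sum>x\<in>labellings n k. p x * ln (relabel_sum k (T v - {v}) p x / relabel_sum k (T v) p x))"
    unfolding sum_negf by (subst sum.swap) (rule refl)
  also have "\<dots> \<le> - (\<Sum>x\<in>labellings n k. p x * ln (p x / relabel_sum k V p x))"
    unfolding neg_le_iff_le by (rule entropy_chain[OF k V T p])
  also have "\<dots> = (\<Sum>x\<in>labellings n k. - (p x * ln (p x / relabel_sum k V p x)))"
    by (rule sum_negf[symmetric])
  also have "\<dots> \<le> (\<Sum>x\<in>labellings n k. p x * ln (real k ^ n * graph_prob n k a b G / p x))"
  proof (rule sum_mono)
    fix x assume x: "x \<in> labellings n k"
    show "- (p x * ln (p x / relabel_sum k V p x)) \<le> p x * ln (real k ^ n * graph_prob n k a b G / p x)"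
    proof (cases "p x = 0")
      case False
      then have px: "p x > 0" using p[of x] by simp
      have rp: "relabel_sum k V p x > 0" by (rule pos[OF x V(1) px])
      have "relabel_sum k V p x \<le> relabel_sum k {..<n} p x"
        by (rule relabel_sum_subset_le[OF x V(1) subset_refl p])
      also have "\<dots> = real k ^ n * graph_prob n k a b G" unfolding all by (rule relabel_sum_all[OF x])
      finally have "ln (relabel_sum k V p x) \<le> ln (real k ^ n * graph_prob n k a b G)"
        using rp by (subst ln_le_cancel_iff) auto
      moreover have "real k ^ n * graph_prob n k a b G > 0"
        using \<open>relabel_sum k V p x \<le> relabel_sum k {..<n} p x\<close> rp unfolding all relabel_sum_all[OF x] by linarith
      ultimately have "- ln (p x / relabel_sum k V p x) \<le> ln (real k ^ n * graph_prob n k a b G / p x)"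
      proof -
        define N where "N = real k ^ n * graph_prob n k a b G"
        have "N > 0" "ln (relabel_sum k V p x) \<le> ln N"
          using \<open>real k ^ n * graph_prob n k a b G > 0\<close> \<open>ln (relabel_sum k V p x) \<le> _\<close> by (simp_all only: N_def)
        then show ?thesis unfolding N_def[symmetric] using rp px by (simp add: ln_div)
      qed
      then have "p x * - ln (p x / relabel_sum k V p x) \<le> p x * ln (real k ^ n * graph_prob n k a b G / p x)"
        using px by (intro mult_left_mono) auto
      then show ?thesis by simp
    qed simp
  qed
  finally show "label_exp n k (\<lambda>x. graph_weight n a b x G * (\<Sum>v\<in>U G. ln (relabel_sum k (S G v) (\<lambda>y. graph_weight n a b y G) x
      / relabel_sum k (S G v - {v}) (\<lambda>y. graph_weight n a b y G) x)))
    \<le> label_exp n k (\<lambda>x. graph_weight n a b x G * ln (real k ^ n * graph_prob n k a b G / graph_weight n a b x G))"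
    unfolding label_exp_def p_def V_def T_def by (intro divide_right_mono) auto
qed

end

section \<open>Lower bounds for the entropy\<close>

lemma bexp_indep:
  assumes "finite P" "A \<subseteq> P" "B \<subseteq> P" "A \<inter> B = {}"
    and F: "\<And>G. F G = F (G \<inter> A)" and H: "\<And>G. H G = H (G \<inter> B)"
  shows "bexp P p (\<lambda>G. F G * H G) = bexp P p F * bexp P p H"
proof -
  have fin: "finite A" "finite B" using finite_subset[OF assms(2,1)] finite_subset[OF assms(3,1)] by auto
  have "bexp P p (\<lambda>G. F G * H G) = bexp (A \<union> B) p (\<lambda>G. F G * H G)"
  proof (rule bexp_marginal[OF assms(1)])
    show "A \<union> B \<subseteq> P" using assms by auto
    fix G
    have "G \<inter> (A \<union> B) \<inter> A = G \<inter> A" "G \<inter> (A \<union> B) \<inter> B = G \<inter> B" by auto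
    then show "F G * H G = F (G \<inter> (A \<union> B)) * H (G \<inter> (A \<union> B))"
      using F[of G] H[of G] F[of "G \<inter> (A \<union> B)"] H[of "G \<inter> (A \<union> B)"] by metis
  qed
  also have "\<dots> = bexp A p (\<lambda>X. bexp B p (\<lambda>Y. F (X \<union> Y) * H (X \<union> Y)))"
    by (rule bexp_union[OF fin assms(4)])
  also have "\<dots> = bexp A p (\<lambda>X. bexp B p (\<lambda>Y. F X * H Y))"
  proof (intro bexp_cong)
    fix X Y assume "X \<subseteq> A" "Y \<subseteq> B"
    then have "(X \<union> Y) \<inter> A = X \<inter> A" "(X \<union> Y) \<inter> B = Y \<inter> B" using assms(4) by auto
    then show "F (X \<union> Y) * H (X \<union> Y) = F X * H Y"
      using F[of X] H[of Y] F[of "X \<union> Y"] H[of "X \<union> Y"] by metis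
  qed
  also have "\<dots> = bexp A p F * bexp B p H" by (simp add: bexp_cmult bexp_multc)
  also have "bexp A p F = bexp P p F" by (rule bexp_marginal[OF assms(1,2), symmetric]) (rule F)
  also have "bexp B p H = bexp P p H" by (rule bexp_marginal[OF assms(1,3), symmetric]) (rule H)
  finally show ?thesis .
qed

lemma bexp_prod_blocks:
  assumes "finite P" "finite I" "\<And>i. i \<in> I \<Longrightarrow> A i \<subseteq> P"
    "\<And>i j. i \<in> I \<Longrightarrow> j \<in> I \<Longrightarrow> i \<noteq> j \<Longrightarrow> A i \<inter> A j = {}"
    "\<And>i G. i \<in> I \<Longrightarrow> F i G = F i (G \<inter> A i)"
  shows "bexp P p (\<lambda>G. \<Prod>i\<in>I. F i G) = (\<Prod>i\<in>I. bexp P p (F i))"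
  using assms(2-)
proof (induction I)
  case empty
  show ?case using assms(1) by (simp add: bexp_const)
next
  case (insert i I)
  have IH: "bexp P p (\<lambda>G. \<Prod>i\<in>I. F i G) = (\<Prod>i\<in>I. bexp P p (F i))"
  proof (rule insert.IH)
    show "A j \<subseteq> P" if "j \<in> I" for j using insert.prems(1)[of j] that by blast
    show "A j \<inter> A j' = {}" if "j \<in> I" "j' \<in> I" "j \<noteq> j'" for j j' using insert.prems(2)[of j j'] that by blast
    show "F j G = F j (G \<inter> A j)" if "j \<in> I" for j G by (rule insert.prems(3)) (use that in blast)
  qed
  have "bexp P p (\<lambda>G. F i G * (\<Prod>j\<in>I. F j G)) = bexp P p (F i) * bexp P p (\<lambda>G. \<Prod>j\<in>I. F j G)"
  proof (rule bexp_indep[OF assms(1), where A = "A i" and B = "\<Union>j\<in>I. A j"])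
    show "A i \<subseteq> P" using insert.prems(1)[of i] by blast
    show "(\<Union>j\<in>I. A j) \<subseteq> P" using insert.prems(1) by blast
    have "A i \<inter> A j = {}" if "j \<in> I" for j
      using insert.prems(2)[of i j] that insert.hyps(2) by blast
    then show "A i \<inter> (\<Union>j\<in>I. A j) = {}" by blast
    show "F i G = F i (G \<inter> A i)" for G by (rule insert.prems(3)) blast
    show "(\<Prod>j\<in>I. F j G) = (\<Prod>j\<in>I. F j (G \<inter> (\<Union>j\<in>I. A j)))" for G
    proof (intro prod.cong refl)
      fix j assume j: "j \<in> I"
      have "G \<inter> (\<Union>j\<in>I. A j) \<inter> A j = G \<inter> A j" using j by auto
      then show "F j G = F j (G \<inter> (\<Union>j\<in>I. A j))"
        using insert.prems(3)[of j G] insert.prems(3)[of j "G \<inter> (\<Union>j\<in>I. A j)"] j by (metis insertI2)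
    qed
  qed
  then show ?case unfolding prod.insert[OF insert.hyps] IH .
qed

lemma bexp_no_edges:
  assumes "finite P" "A \<subseteq> P"
  shows "bexp P p (\<lambda>G. of_bool (G \<inter> A = {})) = (\<Prod>e\<in>A. 1 - p e)"
proof -
  have finA: "finite A" by (rule finite_subset[OF assms(2,1)])
  have "bexp P p (\<lambda>G. of_bool (G \<inter> A = {})) = bexp A p (\<lambda>G. of_bool (G \<inter> A = {}))"
    by (rule bexp_marginal[OF assms]) (simp add: Int_assoc)
  also have "\<dots> = bexp A p (\<lambda>G. \<Prod>e\<in>A. if e \<in> G then 0 else 1)"
  proof (rule bexp_cong)
    fix G assume "G \<subseteq> A"
    show "of_bool (G \<inter> A = {}) = (\<Prod>e\<in>A. if e \<in> G then 0 else 1 :: real)"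
    proof (cases "G \<inter> A = {}")
      case True
      then have "(\<Prod>e\<in>A. if e \<in> G then 0 else 1 :: real) = 1" by (intro prod.neutral) auto
      then show ?thesis using True by simp
    next
      case False
      then obtain e where "e \<in> A" "e \<in> G" by auto
      then have "(\<Prod>e\<in>A. if e \<in> G then 0 else 1 :: real) = 0" using finA by (intro prod_zero) auto
      then show ?thesis using False by simp
    qed
  qed
  also have "\<dots> = (\<Prod>e\<in>A. p e * 0 + (1 - p e) * 1)" by (rule bexp_prod[OF finA])
  finally show ?thesis by simp
qed

definition class_star :: "nat \<Rightarrow> (nat \<Rightarrow> nat) \<Rightarrow> nat \<Rightarrow> nat \<Rightarrow> nat set set" where
  "class_star n x v i = (\<lambda>u. {u, v}) ` {u \<in> {..<n}. u \<noteq> v \<and> x u = i}"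

text \<open>Such a vertex can take another label without changing the type of any edge, so the
  weights of the two labellings differ only through non-edges.\<close>

definition movable :: "nat \<Rightarrow> nat \<Rightarrow> (nat \<Rightarrow> nat) \<Rightarrow> nat \<Rightarrow> nat set set \<Rightarrow> bool" where
  "movable n k x v G \<longleftrightarrow> G \<inter> class_star n x v (x v) = {} \<and> (\<exists>i<k. i \<noteq> x v \<and> G \<inter> class_star n x v i = {})"

lemma class_star_subset: "v < n \<Longrightarrow> class_star n x v i \<subseteq> vertex_pairs n"
  by (auto simp: class_star_def)

lemma class_star_disjoint: "i \<noteq> j \<Longrightarrow> class_star n x v i \<inter> class_star n x v j = {}"
  by (auto simp: class_star_def doubleton_eq_iff)

text \<open>Subtracting the event that every other class is hit leaves products over disjoint stars,
  whose expectations factor.\<close>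

lemma movable_of_bool:
  assumes "x v < k"
  shows "(of_bool (movable n k x v G) :: real) = of_bool (G \<inter> class_star n x v (x v) = {})
    - (\<Prod>i<k. if i = x v then of_bool (G \<inter> class_star n x v i = {}) else 1 - of_bool (G \<inter> class_star n x v i = {}))"
proof -
  let ?z = "\<lambda>i. of_bool (G \<inter> class_star n x v i = {}) :: real"
  have "(\<Prod>i<k. if i = x v then ?z i else 1 - ?z i)
      = ?z (x v) * (\<Prod>i\<in>{..<k} - {x v}. if i = x v then ?z i else 1 - ?z i)"
    using assms by (subst prod.remove[of _ "x v"]) auto
  also have "(\<Prod>i\<in>{..<k} - {x v}. if i = x v then ?z i else 1 - ?z i) = (\<Prod>i\<in>{..<k} - {x v}. 1 - ?z i)"
    by (intro prod.cong refl) auto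
  finally have eq: "(\<Prod>i<k. if i = x v then ?z i else 1 - ?z i) = ?z (x v) * (\<Prod>i\<in>{..<k} - {x v}. 1 - ?z i)" .
  show ?thesis
  proof (cases "\<exists>i<k. i \<noteq> x v \<and> G \<inter> class_star n x v i = {}")
    case True
    then have "(\<Prod>i\<in>{..<k} - {x v}. 1 - ?z i) = 0" by (intro prod_zero) auto
    then show ?thesis unfolding eq movable_def using True by simp
  next
    case False
    then have "(\<Prod>i\<in>{..<k} - {x v}. 1 - ?z i) = 1" by (intro prod.neutral) auto
    then show ?thesis unfolding eq movable_def using False by simp
  qed
qed

context
  fixes n k :: nat and a b c d :: real
  assumes ab: "0 \<le> a" "0 \<le> b" "max a b \<le> c" and n: "2 * c \<le> n" "n > 0" "max a b < n" and k: "k > 0"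
    and d: "d = (a + (real k - 1) * b) / k" "d > 0"
begin

text \<open>\<open>\<theta>\<close> stands for slightly more than 1/k: it absorbs the imbalance and
  the passage from a product to an exponential.\<close>

lemma no_edge_prob_ge:
  fixes \<delta> \<theta> :: real
  assumes x: "x \<in> balanced n k \<delta>" and i: "i < k" and v: "v < n" and \<theta>: "(1 / k + \<delta>) * (1 + 2 * c / n) \<le> \<theta>"
  shows "exp (- ((if i = x v then a else b) * \<theta>)) \<le> (\<Prod>e\<in>class_star n x v i. 1 - edge_prob n a b x e)"
proof -
  define h where "h = (if i = x v then a else b)"
  define t where "t = h / n"
  have h: "0 \<le> h" "h \<le> c" using ab by (auto simp: h_def)
  have c0: "0 \<le> c" using ab by linarith
  have t: "0 \<le> t" "t \<le> c / n" using h n by (auto simp: t_def divide_right_mono)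
  have cn: "c / n \<le> 1 / 2" using n by (simp add: field_simps)
  have t2: "t \<le> 1 / 2" using t cn by linarith
  \<comment> \<open>Chosen so that \<open>(1 + s) * (1 - t)\<close> is at least one for
    \<open>t\<close> up to one half.\<close>
  define s where "s = t * (1 + 2 * t)"
  have s0: "0 \<le> s" using t by (simp add: s_def)
  have base: "exp (- s) \<le> 1 - t"
  proof -
    have "1 \<le> (1 + s) * (1 - t)"
    proof -
      have "(1 + s) * (1 - t) = 1 + t\<^sup>2 * (1 - 2 * t)" by (simp add: s_def algebra_simps power2_eq_square)
      moreover have "0 \<le> t\<^sup>2 * (1 - 2 * t)" using t2 by (intro mult_nonneg_nonneg) auto
      ultimately show ?thesis by linarith
    qed
    also have "\<dots> \<le> exp s * (1 - t)" using t2 by (intro mult_right_mono) auto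
    finally show ?thesis by (simp add: exp_minus field_simps)
  qed
  define m where "m = card (class_star n x v i)"
  have mle: "real m \<le> class_size n x i"
  proof -
    have "m \<le> card {u \<in> {..<n}. u \<noteq> v \<and> x u = i}" unfolding m_def class_star_def by (rule card_image_le) simp
    also have "\<dots> \<le> card {u \<in> {..<n}. x u = i}" by (rule card_mono) auto
    finally show ?thesis by (simp add: class_size_def)
  qed
  have "class_size n x i \<le> (1 / k + \<delta>) * n"
    using balanced_class_size[OF x i n(2)] by (simp add: abs_le_iff algebra_simps)
  then have mn: "real m \<le> (1 / k + \<delta>) * n" using mle by linarith
  have kd0: "0 \<le> 1 / k + \<delta>"
  proof -
    have "0 \<le> (1 / k + \<delta>) * n" using mn by (meson of_nat_0_le_iff order_trans)
    then show ?thesis using n by (simp add: zero_le_mult_iff)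
  qed
  have "s * m \<le> (h / n * (1 + 2 * (c / n))) * ((1 / k + \<delta>) * n)"
    unfolding s_def using t mn h by (intro mult_mono) (auto simp: t_def)
  also have "\<dots> = h * ((1 / k + \<delta>) * (1 + 2 * c / n))" using n by simp
  also have "\<dots> \<le> h * \<theta>" using \<theta> h by (intro mult_left_mono) auto
  finally have "exp (- (h * \<theta>)) \<le> exp (- s) ^ m" by (simp flip: exp_of_nat_mult add: mult.commute)
  also have "\<dots> \<le> (1 - t) ^ m" using base by (intro power_mono) auto
  also have "\<dots> = (\<Prod>e\<in>class_star n x v i. 1 - t)" by (simp add: m_def)
  also have "\<dots> = (\<Prod>e\<in>class_star n x v i. 1 - edge_prob n a b x e)"
    by (intro prod.cong refl) (auto simp: class_star_def edge_prob_def t_def h_def)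
  finally show ?thesis by (simp add: h_def)
qed

lemma movable_prob_ge:
  fixes \<delta> \<theta> :: real
  assumes x: "x \<in> balanced n k \<delta>" and v: "v < n" and \<theta>: "(1 / k + \<delta>) * (1 + 2 * c / n) \<le> \<theta>" "0 \<le> \<theta>"
  shows "exp (- (a * \<theta>)) * (1 - (1 - exp (- (b * \<theta>))) ^ (k - 1))
    \<le> bexp (vertex_pairs n) (edge_prob n a b x) (\<lambda>G. of_bool (movable n k x v G))"
proof -
  let ?P = "vertex_pairs n" and ?p = "edge_prob n a b x"
  let ?Z = "\<lambda>i G. of_bool (G \<inter> class_star n x v i = {}) :: real"
  define z where "z i = (\<Prod>e\<in>class_star n x v i. 1 - ?p e)" for i
  have xv: "x v < k" using labellings_less[OF balanced_imp_labellings[OF x] v] .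
  have Z: "bexp ?P ?p (?Z i) = z i" for i
    unfolding z_def by (rule bexp_no_edges) (use class_star_subset[OF v] in auto)
  have Z': "bexp ?P ?p (\<lambda>G. 1 - ?Z i G) = 1 - z i" for i
    unfolding bexp_diff Z by (simp add: bexp_const)
  have "bexp ?P ?p (\<lambda>G. \<Prod>i<k. if i = x v then ?Z i G else 1 - ?Z i G)
      = (\<Prod>i<k. bexp ?P ?p (\<lambda>G. if i = x v then ?Z i G else 1 - ?Z i G))"
    by (rule bexp_prod_blocks[where A = "class_star n x v"])
       (use class_star_subset[OF v] class_star_disjoint in \<open>auto simp: Int_assoc\<close>)
  also have "\<dots> = (\<Prod>i<k. if i = x v then z i else 1 - z i)"
    by (intro prod.cong refl) (simp add: Z Z')
  also have "\<dots> = z (x v) * (\<Prod>i\<in>{..<k} - {x v}. if i = x v then z i else 1 - z i)"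
    using xv by (subst prod.remove[of _ "x v"]) auto
  also have "(\<Prod>i\<in>{..<k} - {x v}. if i = x v then z i else 1 - z i) = (\<Prod>i\<in>{..<k} - {x v}. 1 - z i)"
    by (intro prod.cong refl) auto
  finally have prod: "bexp ?P ?p (\<lambda>G. \<Prod>i<k. if i = x v then ?Z i G else 1 - ?Z i G)
      = z (x v) * (\<Prod>i\<in>{..<k} - {x v}. 1 - z i)" .
  have zle: "z i \<le> 1" for i
    unfolding z_def using edge_prob_01[OF ab n k d] by (intro prod_le_1) auto
  have zge: "exp (- (b * \<theta>)) \<le> z i" if "i \<in> {..<k} - {x v}" for i
    using no_edge_prob_ge[OF x _ v \<theta>(1), of i] that by (simp add: z_def)
  have z0: "exp (- (a * \<theta>)) \<le> z (x v)"
    using no_edge_prob_ge[OF x xv v \<theta>(1)] by (simp add: z_def)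
  have "(\<Prod>i\<in>{..<k} - {x v}. 1 - z i) \<le> (\<Prod>i\<in>{..<k} - {x v}. 1 - exp (- (b * \<theta>)))"
    using zle zge by (intro prod_mono) auto
  also have "\<dots> = (1 - exp (- (b * \<theta>))) ^ (k - 1)" using xv by simp
  finally have q: "(\<Prod>i\<in>{..<k} - {x v}. 1 - z i) \<le> (1 - exp (- (b * \<theta>))) ^ (k - 1)" .
  have "(1 - exp (- (b * \<theta>))) ^ (k - 1) \<le> 1" using ab \<theta>(2) by (intro power_le_one) auto
  then have "exp (- (a * \<theta>)) * (1 - (1 - exp (- (b * \<theta>))) ^ (k - 1)) \<le> z (x v) * (1 - (\<Prod>i\<in>{..<k} - {x v}. 1 - z i))"
    using q z0 by (intro mult_mono) (auto intro: order_trans[OF exp_ge_zero])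
  also have "\<dots> = bexp ?P ?p (\<lambda>G. of_bool (movable n k x v G))"
    unfolding movable_of_bool[where x = x and v = v and k = k, OF xv] bexp_diff prod Z by (simp add: right_diff_distrib)
  finally show ?thesis .
qed

lemma log_move_ge:
  fixes \<delta> :: real
  assumes G: "G \<subseteq> vertex_pairs n" and x: "x \<in> balanced n k \<delta>" and w: "graph_weight n a b x G > 0"
    and v: "v < n" and mv: "movable n k x v G"
  defines "p \<equiv> (\<lambda>y. graph_weight n a b y G)"
  shows "ln 2 - c * k * (2 * \<delta> + 1 / n) \<le> ln (relabel_sum k {v} p x / relabel_sum k ({v} - {v}) p x)"
proof -
  have xl: "x \<in> labellings n k" by (rule balanced_imp_labellings[OF x])
  have xv: "x v < k" by (rule labellings_less[OF xl v])
  obtain i where i: "i < k" "i \<noteq> x v" "G \<inter> class_star n x v i = {}" using mv by (auto simp: movable_def)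
  define y where "y = x(v := i)"
  have yl: "y \<in> labellings n k" unfolding y_def by (rule labellings_update[OF xl v i(1)])
  have nb: "x u \<noteq> x v \<and> x u \<noteq> i" if "{u, v} \<in> G" "u < n" "u \<noteq> v" for u
  proof -
    have "{u, v} \<in> class_star n x v (x u)" using that by (auto simp: class_star_def)
    then show ?thesis using that(1) i(3) mv by (auto simp: movable_def)
  qed
  have mono: "monochromatic y {u, u'} = monochromatic x {u, u'}" if e: "{u, u'} \<in> G" "u < n" "u' < n" "u \<noteq> u'" for u u'
  proof (cases "u' = v")
    case True
    then show ?thesis using nb[of u] e by (simp add: y_def)
  next
    case u'v: False
    show ?thesis
    proof (cases "u = v")
      case True
      then show ?thesis using nb[of u'] e u'v by (auto simp: y_def insert_commute)
    qed (use u'v in \<open>simp add: y_def\<close>)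
  qed
  have odds: "(\<Prod>e\<in>G. edge_odds n a b y e) = (\<Prod>e\<in>G. edge_odds n a b x e)"
  proof (rule prod.cong[OF refl])
    fix e assume e: "e \<in> G"
    then have "e \<in> vertex_pairs n" using G by auto
    then obtain u u' where uu: "e = {u, u'}" "u < u'" "u' < n" by (rule vertex_pairsE)
    then have "monochromatic y e = monochromatic x e" using mono[of u u'] e by simp
    then show "edge_odds n a b y e = edge_odds n a b x e" by (simp add: edge_odds_def edge_prob_def)
  qed
  define \<beta> where "\<beta> = c * k * (2 * \<delta> + 1 / n)"
  have "\<bar>log_nonedges n a b y - log_nonedges n a b x\<bar> \<le> c * k * card {v} * (2 * \<delta> + card {v} / n)"
    by (rule log_nonedges_diff_le[OF ab n(1,2) k x yl]) (auto simp: y_def)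
  then have L: "log_nonedges n a b x - \<beta> \<le> log_nonedges n a b y" by (simp add: \<beta>_def)
  have px: "p x = exp (log_nonedges n a b x) * (\<Prod>e\<in>G. edge_odds n a b x e)"
    unfolding p_def by (rule graph_weight_eq[OF ab(1,2) n(3) G])
  have py: "p y = exp (log_nonedges n a b y) * (\<Prod>e\<in>G. edge_odds n a b x e)"
    unfolding p_def odds[symmetric] by (rule graph_weight_eq[OF ab(1,2) n(3) G])
  have odds0: "0 \<le> (\<Prod>e\<in>G. edge_odds n a b x e)" by (intro prod_nonneg) (auto intro: edge_odds_nonneg[OF ab n k d])
  have pos: "p x > 0" using w by (simp add: p_def)
  have "exp (- \<beta>) * p x = exp (log_nonedges n a b x - \<beta>) * (\<Prod>e\<in>G. edge_odds n a b x e)"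
    by (simp add: px exp_diff exp_minus field_simps)
  also have "\<dots> \<le> p y" unfolding py using L odds0 by (intro mult_right_mono) auto
  finally have pyge: "exp (- \<beta>) * p x \<le> p y" .
  have p0: "0 \<le> p z" for z unfolding p_def by (rule weight_nonneg[OF ab n k d])
  have "p x + p y = (\<Sum>j\<in>{x v, i}. p (x(v := j)))" using i(2) by (simp add: y_def)
  also have "\<dots> \<le> (\<Sum>j<k. p (x(v := j)))" using i(1) xv p0 by (intro sum_mono2) auto
  also have "\<dots> = relabel_sum k {v} p x" using relabel_sum_insert[of v "{}" k p x] by simp
  finally have rs: "p x + p y \<le> relabel_sum k {v} p x" .
  have \<beta>0: "0 \<le> \<beta>"
  proof -
    have "\<bar>log_nonedges n a b y - log_nonedges n a b x\<bar> \<le> \<beta>"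
      using \<open>_ \<le> c * k * card {v} * (2 * \<delta> + card {v} / n)\<close> by (simp add: \<beta>_def)
    then show ?thesis by linarith
  qed
  have "2 * exp (- \<beta>) * p x \<le> p x + p y"
  proof -
    have "exp (- \<beta>) * p x \<le> 1 * p x" using \<beta>0 pos by (intro mult_right_mono) auto
    then show ?thesis using pyge by simp
  qed
  then have ge: "2 * exp (- \<beta>) \<le> relabel_sum k {v} p x / p x" using rs pos by (simp add: pos_le_divide_eq)
  have "ln 2 - \<beta> = ln (2 * exp (- \<beta>))" by (simp add: ln_mult)
  also have "\<dots> \<le> ln (relabel_sum k {v} p x / p x)"
    using ge by (subst ln_le_cancel_iff) (auto intro: less_le_trans[OF _ ge])
  finally show ?thesis by (simp add: \<beta>_def)
qed

text \<open>The chain rule with singletons: each vertex is conditioned on all other labels. A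
  movable vertex contributes nearly \<open>ln 2\<close>, every other one at least zero. Unbalanced
  labellings are discarded.\<close>

lemma entropy_ge_movable:
  fixes \<delta> \<theta> :: real
  assumes \<delta>: "\<delta> > 0" and \<theta>: "(1 / k + \<delta>) * (1 + 2 * c / n) \<le> \<theta>" "0 \<le> \<theta>" and small: "c * k * (2 * \<delta> + 1 / n) \<le> ln 2"
  shows "n * (exp (- (a * \<theta>)) * (1 - (1 - exp (- (b * \<theta>))) ^ (k - 1)) * ln 2 - (k / \<delta>\<^sup>2) / n - c * k * (2 * \<delta> + 1 / n))
    \<le> label_entropy n k a b"
proof -
  define g where "g = exp (- (a * \<theta>)) * (1 - (1 - exp (- (b * \<theta>))) ^ (k - 1))"
  define \<beta> where "\<beta> = c * k * (2 * \<delta> + 1 / n)"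
  define W where "W = ln 2 - \<beta>"
  define u where "u = (k / \<delta>\<^sup>2) / n"
  let ?R = "\<lambda>x G v. ln (relabel_sum k {v} (\<lambda>y. graph_weight n a b y G) x
      / relabel_sum k ({v} - {v}) (\<lambda>y. graph_weight n a b y G) x)"
  have "0 \<le> c" using ab by linarith
  then have \<beta>0: "0 \<le> \<beta>" using \<delta> unfolding \<beta>_def by (intro mult_nonneg_nonneg) auto
  have W: "0 \<le> W" "W \<le> 1" using small \<beta>0 ln_le_minus_one[of 2] unfolding W_def \<beta>_def[symmetric] by auto
  have u0: "0 \<le> u" by (simp add: u_def)
  have q: "0 \<le> (1 - exp (- (b * \<theta>))) ^ (k - 1)" "(1 - exp (- (b * \<theta>))) ^ (k - 1) \<le> 1"
    using ab \<theta>(2) by (auto intro!: power_le_one zero_le_power)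
  have ea: "0 \<le> exp (- (a * \<theta>))" "exp (- (a * \<theta>)) \<le> 1" using ab \<theta>(2) by auto
  have g: "0 \<le> g" "g \<le> 1" unfolding g_def using q ea by (auto intro!: mult_nonneg_nonneg mult_le_one)
  have "n * (g * ln 2 - u - \<beta>) \<le> n * (W * g * (1 - u))"
  proof (rule mult_left_mono)
    have "W * g \<le> 1" using W g by (intro mult_le_one) auto
    then have "W * g * u \<le> u" using u0 mult_right_mono[of "W * g" 1 u] by simp
    moreover have "\<beta> * g \<le> \<beta>" using g \<beta>0 mult_left_mono[of g 1 \<beta>] by simp
    moreover have "W * g * (1 - u) = g * ln 2 - \<beta> * g - W * g * u" by (simp add: W_def algebra_simps)
    ultimately show "g * ln 2 - u - \<beta> \<le> W * g * (1 - u)" by linarith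
  qed simp
  also have "\<dots> \<le> label_exp n k (\<lambda>x. n * (W * g) * (1 - of_bool (x \<notin> balanced n k \<delta>)))"
  proof -
    have "label_exp n k (\<lambda>x. n * (W * g) * (1 - of_bool (x \<notin> balanced n k \<delta>)))
        = n * (W * g) * (1 - label_exp n k (\<lambda>x. of_bool (x \<notin> balanced n k \<delta>)))"
      unfolding label_exp_cmult label_exp_diff using k by (simp add: label_exp_const)
    moreover have "n * (W * g) * (1 - u) \<le> n * (W * g) * (1 - label_exp n k (\<lambda>x. of_bool (x \<notin> balanced n k \<delta>)))"
      using label_exp_unbalanced_le[OF k n(2) \<delta>] W g unfolding u_def by (intro mult_left_mono) auto
    ultimately show ?thesis by (simp add: mult.assoc)
  qed
  also have "\<dots> \<le> sbm_exp n k a b (\<lambda>x G. \<Sum>v<n. of_bool (x \<in> balanced n k \<delta>) * W * of_bool (movable n k x v G))"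
    unfolding sbm_exp_def bexp_sum bexp_cmult
  proof (rule label_exp_mono)
    fix x
    show "n * (W * g) * (1 - of_bool (x \<notin> balanced n k \<delta>)) \<le> (\<Sum>v<n. of_bool (x \<in> balanced n k \<delta>) * W
        * bexp (vertex_pairs n) (edge_prob n a b x) (\<lambda>G. of_bool (movable n k x v G)))"
    proof (cases "x \<in> balanced n k \<delta>")
      case True
      have "(\<Sum>v<n. W * g) \<le> (\<Sum>v<n. W * bexp (vertex_pairs n) (edge_prob n a b x) (\<lambda>G. of_bool (movable n k x v G)))"
        unfolding g_def using movable_prob_ge[OF True _ \<theta>] W by (intro sum_mono mult_left_mono) auto
      then show ?thesis using True by simp
    qed simp
  qed
  also have "\<dots> \<le> sbm_exp n k a b (\<lambda>x G. \<Sum>v<n. ?R x G v)"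
  proof (rule sbm_exp_mono[OF ab n k d], rule sum_mono)
    fix x G v assume x: "x \<in> labellings n k" and G: "G \<subseteq> vertex_pairs n" and w: "graph_weight n a b x G > 0" and "v \<in> {..<n}"
    then have v: "v < n" by simp
    show "of_bool (x \<in> balanced n k \<delta>) * W * of_bool (movable n k x v G) \<le> ?R x G v"
    proof (cases "x \<in> balanced n k \<delta> \<and> movable n k x v G")
      case True
      then show ?thesis using log_move_ge[OF G _ w v, of \<delta>] by (simp add: W_def \<beta>_def)
    next
      case False
      have "graph_weight n a b x G \<le> relabel_sum k {v} (\<lambda>y. graph_weight n a b y G) x"
        using v by (intro relabel_sum_ge[OF x]) (auto intro: weight_nonneg[OF ab n k d])
      then have "0 \<le> ?R x G v" using w by (intro ln_ge_zero) (simp add: pos_le_divide_eq)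
      then show ?thesis using False by auto
    qed
  qed
  also have "\<dots> \<le> label_entropy n k a b"
    by (rule entropy_ge_chain[OF ab n k d, of "\<lambda>_. {..<n}" "\<lambda>_. id" "\<lambda>_ v. {v}"]) auto
  finally show ?thesis by (simp add: g_def u_def \<beta>_def)
qed

end

lemma entropy_lower_singletons:
  fixes a b \<eta> :: real and k :: nat
  assumes ab: "0 \<le> a" "0 \<le> b" and k: "k > 0" and d: "(a + (real k - 1) * b) / k > 0" and \<eta>: "\<eta> > 0"
  shows "\<forall>\<^sub>F n in sequentially.
    n * (ln 2 * exp (- a / k) * (1 - (1 - exp (- b / k)) ^ (k - 1)) - \<eta>) \<le> label_entropy n k a b"
proof -
  define c where "c = max a b + 1"
  have c: "max a b \<le> c" "c > 0" using ab by (auto simp: c_def)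
  define g where "g \<theta> = exp (- (a * \<theta>)) * (1 - (1 - exp (- (b * \<theta>))) ^ (k - 1))" for \<theta> :: real
  have "isCont g (1 / k)" unfolding g_def by (intro continuous_intros)
  then have "(g \<longlongrightarrow> g (1 / k)) (at (1 / k))" by (simp add: isCont_def)
  then have "\<forall>\<^sub>F \<theta> in at (1 / k). dist (g \<theta>) (g (1 / k)) < \<eta> / 4" using \<eta> by (intro tendstoD) auto
  then obtain s where s: "s > 0" "\<And>\<theta>. \<theta> \<noteq> 1 / k \<Longrightarrow> dist \<theta> (1 / k) < s \<Longrightarrow> dist (g \<theta>) (g (1 / k)) < \<eta> / 4"
    unfolding eventually_at by auto
  define \<theta> where "\<theta> = 1 / k + s / 2"
  have g\<theta>: "g (1 / k) - \<eta> / 4 \<le> g \<theta>"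
  proof -
    have "dist (g \<theta>) (g (1 / k)) < \<eta> / 4" by (rule s(2)) (use s(1) in \<open>simp_all add: \<theta>_def dist_real_def\<close>)
    then show ?thesis unfolding dist_real_def by linarith
  qed
  have \<theta>0: "0 \<le> \<theta>" using s(1) by (simp add: \<theta>_def)
  define \<delta> where "\<delta> = min (s / 8) (min \<eta> 1 / (8 * c * k))"
  have \<delta>: "\<delta> > 0" "\<delta> \<le> s / 8" using s(1) \<eta> c k by (auto simp: \<delta>_def)
  have "\<delta> \<le> min \<eta> 1 / (8 * c * k)" by (simp add: \<delta>_def)
  then have ck: "c * k * (2 * \<delta>) \<le> min \<eta> 1 / 4" using c k by (simp add: pos_le_divide_eq mult_ac)
  have ln2: "1 / 2 \<le> ln (2 :: real)" using ln_le_minus_one[of "1 / 2"] by (simp add: ln_div)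
  have ln2': "ln (2 :: real) \<le> 1" using ln_le_minus_one[of "2"] by simp
  have e1: "\<forall>\<^sub>F n in sequentially. (1 / k + \<delta>) * (2 * c) / real n < s / 8"
    using s(1) by (intro eventually_const_over_n_less) auto
  have e2: "\<forall>\<^sub>F n in sequentially. (c * k) / real n < min \<eta> 1 / 4"
    using \<eta> by (intro eventually_const_over_n_less) auto
  have e3: "\<forall>\<^sub>F n in sequentially. (k / \<delta>\<^sup>2) / real n < \<eta> / 4"
    using \<eta> by (intro eventually_const_over_n_less) auto
  have e4: "\<forall>\<^sub>F n in sequentially. 2 * c \<le> real n"
    by (rule eventually_sequentiallyI[of "nat \<lceil>2 * c\<rceil>"]) linarith
  from e1 e2 e3 e4 show ?thesis
  proof eventually_elim
    case (elim n)
    have n: "2 * c \<le> n" "n > 0" "max a b < n" using elim(4) c by (auto simp: c_def)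
    have \<theta>': "(1 / k + \<delta>) * (1 + 2 * c / n) \<le> \<theta>"
    proof -
      have "(1 / k + \<delta>) * (1 + 2 * c / n) = 1 / k + \<delta> + (1 / k + \<delta>) * (2 * c) / n" by (simp add: algebra_simps)
      then show ?thesis using elim(1) \<delta>(2) s(1) unfolding \<theta>_def by linarith
    qed
    have \<beta>: "c * k * (2 * \<delta> + 1 / n) \<le> min \<eta> 1 / 2"
    proof -
      have "c * k * (2 * \<delta> + 1 / n) = c * k * (2 * \<delta>) + c * k / n" by (simp add: distrib_left)
      then show ?thesis using ck elim(2) by linarith
    qed
    have "g (1 / k) * ln 2 - \<eta> / 4 \<le> g \<theta> * ln 2"
    proof -
      have "(g (1 / k) - \<eta> / 4) * ln 2 \<le> g \<theta> * ln 2" using g\<theta> ln2 by (intro mult_right_mono) auto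
      moreover have "\<eta> / 4 * ln 2 \<le> \<eta> / 4 * 1" using \<eta> ln2' by (intro mult_left_mono) auto
      ultimately show ?thesis by (simp add: left_diff_distrib)
    qed
    moreover have "ln 2 * exp (- a / k) * (1 - (1 - exp (- b / k)) ^ (k - 1)) = g (1 / k) * ln 2"
      by (simp add: g_def mult_ac)
    ultimately have "ln 2 * exp (- a / k) * (1 - (1 - exp (- b / k)) ^ (k - 1)) - \<eta>
        \<le> g \<theta> * ln 2 - (k / \<delta>\<^sup>2) / n - c * k * (2 * \<delta> + 1 / n)"
      using \<beta> elim(3) by linarith
    then have "n * (ln 2 * exp (- a / k) * (1 - (1 - exp (- b / k)) ^ (k - 1)) - \<eta>)
        \<le> n * (g \<theta> * ln 2 - (k / \<delta>\<^sup>2) / n - c * k * (2 * \<delta> + 1 / n))"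
      by (intro mult_left_mono) auto
    also have "\<dots> \<le> label_entropy n k a b"
      unfolding g_def
      by (rule entropy_ge_movable[OF ab c(1) n k refl d \<delta>(1) \<theta>' \<theta>0]) (use \<beta> ln2 in linarith)
    finally show ?case .
  qed
qed

section \<open>The entropy bound from peeling\<close>

context
  fixes n k :: nat and a b c d :: real
  assumes ab: "0 \<le> a" "0 \<le> b" "max a b \<le> c" and n: "2 * c \<le> n" "n > 0" "max a b < n" and k: "k > 0"
    and d: "d = (a + (real k - 1) * b) / k" "d > 0"
begin

text \<open>The degree sum depends only on the size of the vertex's own class; the vertex itself
  accounts for \<open>c / n\<close>.\<close>

lemma balanced_imp_regular:
  fixes \<delta> \<delta>' :: real
  assumes x: "x \<in> balanced n k \<delta>" and \<delta>': "c * \<delta> + c / n \<le> \<delta>'"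
  shows "regular n c d \<delta>' (edge_prob n a b x)"
  unfolding regular_def
proof (intro conjI ballI allI impI)
  fix e
  show "0 \<le> edge_prob n a b x e" "edge_prob n a b x e \<le> c / n"
    by (rule edge_prob_half[OF ab n k d])+
next
  fix v assume v: "v < n"
  define s where "s = class_size n x (x v)"
  define h where "h w = (if x w = x v then a else b) / real n" for w
  have xv: "x v < k" using labellings_less[OF balanced_imp_labellings[OF x] v] .
  have "(\<Sum>w<n. h w) = h v + (\<Sum>w\<in>{..<n} - {v}. h w)" using v by (intro sum.remove) auto
  moreover have "(\<Sum>w\<in>{..<n} - {v}. edge_prob n a b x {v, w}) = (\<Sum>w\<in>{..<n} - {v}. h w)"
    by (intro sum.cong refl) (auto simp: edge_prob_def h_def)
  moreover have "h v = a / n" by (simp add: h_def)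
  moreover have "(\<Sum>w<n. h w) = (a - b) / n * s + b"
  proof -
    have "(\<Sum>w<n. h w) = (\<Sum>w<n. (a - b) / n * of_bool (x w = x v) + b / n)"
      by (intro sum.cong refl) (simp add: h_def diff_divide_distrib)
    also have "\<dots> = (a - b) / n * s + b"
      unfolding sum.distrib sum_distrib_left[symmetric] s_def class_size_eq_sum using n by simp
    finally show ?thesis .
  qed
  moreover have "(a - b) / n * s + b - d = (a - b) / n * (s - n / k)"
    unfolding d(1) using n k by (simp add: field_simps)
  ultimately have eq: "(\<Sum>w\<in>{..<n} - {v}. edge_prob n a b x {v, w}) - d = (a - b) / n * (s - n / k) - a / n"
    by linarith
  have "\<bar>(a - b) / n * (s - n / k)\<bar> \<le> c / n * (\<delta> * n)"
    unfolding abs_mult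
  proof (rule mult_mono)
    have "\<bar>a - b\<bar> \<le> c" using ab by linarith
    then show "\<bar>(a - b) / n\<bar> \<le> c / n" unfolding abs_divide by (simp add: divide_right_mono)
    show "\<bar>s - n / k\<bar> \<le> \<delta> * n" unfolding s_def by (rule balanced_class_size[OF x xv n(2)])
  qed (use ab in auto)
  also have "\<dots> = c * \<delta>" using n by simp
  finally have "\<bar>(a - b) / n * (s - n / k)\<bar> \<le> c * \<delta>" .
  moreover have "\<bar>a / n\<bar> \<le> c / n" using ab by (simp add: divide_right_mono)
  ultimately show "\<bar>(\<Sum>w\<in>{..<n} - {v}. edge_prob n a b x {v, w}) - d\<bar> \<le> \<delta>'"
    unfolding eq using \<delta>' by linarith
qed

lemma abs_log_ratio_le: "\<bar>log_ratio a b d x e\<bar> \<le> \<bar>ln (a / d)\<bar> + \<bar>ln (b / d)\<bar>"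
  by (simp add: log_ratio_def)

text \<open>A branch of at most \<open>\<delta> * n\<close> vertices is handled by
  \<open>log_marginal_ratio_branch\<close>. For a larger one the trivial bound zero is used, and the
  loss of at most \<open>ln k + M\<close> is spread over its more than \<open>\<delta> * n\<close>
  vertices. Both errors are then linear in the size of the branch, so
  \<open>sum_card_branch_le\<close> controls the total.\<close>

lemma sum_log_branch_ge:
  fixes \<delta> :: real
  assumes G: "G \<subseteq> vertex_pairs n" and x: "x \<in> balanced n k \<delta>" and w: "graph_weight n a b x G > 0" and \<delta>: "\<delta> > 0"
  defines "M \<equiv> \<bar>ln (a / d)\<bar> + \<bar>ln (b / d)\<bar>"
  defines "p \<equiv> (\<lambda>y. graph_weight n a b y G)"
  shows "ln k * card (peeled n G r) - (\<Sum>e\<in>{e \<in> G. \<not> e \<subseteq> core n G r}. log_ratio a b d x e)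
      - (2 * c + (6 * c * k * \<delta> + (ln k + M) / (\<delta> * n)) * (n * (real r + 1)))
    \<le> (\<Sum>v\<in>peeled n G r. ln (relabel_sum k (branch n G r v) p x / relabel_sum k (branch n G r v - {v}) p x))"
proof -
  define U where "U = peeled n G r"
  define \<gamma> where "\<gamma> = 6 * c * k * \<delta> + (ln k + M) / (\<delta> * n)"
  define T where "T v = (\<Sum>w\<in>later n G r v. log_ratio a b d x {v, w})" for v
  have xl: "x \<in> labellings n k" by (rule balanced_imp_labellings[OF x])
  have c0: "0 \<le> c" using ab by linarith
  have lnk: "0 \<le> ln k" using k by simp
  have M0: "0 \<le> M" by (simp add: M_def)
  have dn: "0 < \<delta> * n" using \<delta> n by simp
  have \<gamma>12: "0 \<le> 6 * c * k * \<delta>" "0 \<le> (ln k + M) / (\<delta> * n)" using c0 \<delta> lnk M0 dn by auto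
  have p0: "0 \<le> p y" for y unfolding p_def by (rule weight_nonneg[OF ab n k d])
  have Uf: "finite U" "card U \<le> n" unfolding U_def peeled_def by (auto intro: order_trans[OF card_mono[of "{..<n}"]])
  have each: "ln k - T v - 2 * c / n - \<gamma> * card (branch n G r v)
      \<le> ln (relabel_sum k (branch n G r v) p x / relabel_sum k (branch n G r v - {v}) p x)" if v: "v \<in> U" for v
  proof -
    define m where "m = real (card (branch n G r v))"
    have m0: "0 \<le> m" by (simp add: m_def)
    have vU: "v \<in> peeled n G r" using v by (simp add: U_def)
    have cn: "0 \<le> 2 * c / n" using c0 by simp
    show ?thesis
    proof (cases "m \<le> \<delta> * n")
      case True
      then have "m / n \<le> \<delta>" using n by (simp add: pos_divide_le_eq)
      then have "c * k * m * (2 * \<delta> + m / n) \<le> c * k * m * (3 * \<delta>)"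
        using c0 m0 by (intro mult_left_mono) auto
      then have "2 * (c * k * m * (2 * \<delta> + m / n)) \<le> 2 * (c * k * m * (3 * \<delta>))" by (rule mult_left_mono) simp
      also have "\<dots> = 6 * c * k * \<delta> * m" by simp
      finally have "2 * (c * k * m * (2 * \<delta> + m / n)) \<le> 6 * c * k * \<delta> * m" .
      moreover have "0 \<le> (ln k + M) / (\<delta> * n) * m" using \<gamma>12 m0 by (intro mult_nonneg_nonneg)
      ultimately have "2 * (c * k * m * (2 * \<delta> + m / n)) \<le> \<gamma> * m" unfolding \<gamma>_def distrib_right by linarith
      then show ?thesis
        using log_marginal_ratio_branch[OF ab n k d G x w vU] unfolding T_def m_def p_def by linarith
    next
      case False
      have card: "card (later n G r v) \<le> 1" "finite (later n G r v)" using card_later_le[OF G vU] by auto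
      have "\<bar>T v\<bar> \<le> (\<Sum>w\<in>later n G r v. \<bar>log_ratio a b d x {v, w}\<bar>)" unfolding T_def by (rule sum_abs)
      also have "\<dots> \<le> (\<Sum>w\<in>later n G r v. M)" unfolding M_def by (intro sum_mono abs_log_ratio_le)
      also have "\<dots> \<le> 1 * M" unfolding sum_constant using card(1) M0 by (intro mult_right_mono) auto
      finally have T: "- T v \<le> M" by linarith
      have "(ln k + M) / (\<delta> * n) * (\<delta> * n) \<le> (ln k + M) / (\<delta> * n) * m"
        using False \<gamma>12 by (intro mult_left_mono) auto
      moreover have cancel: "t / D * D = t" if "D > 0" for t D :: real using that by simp
      ultimately have "ln k + M \<le> (ln k + M) / (\<delta> * n) * m" unfolding cancel[OF dn] by blast
      moreover have "0 \<le> 6 * c * k * \<delta> * m" by (rule mult_nonneg_nonneg[OF \<gamma>12(1) m0])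
      ultimately have "ln k + M \<le> \<gamma> * m" unfolding \<gamma>_def distrib_right by linarith
      then have "ln k - T v - 2 * c / n - \<gamma> * m \<le> 0" using T cn by linarith
      also have "0 \<le> ln (relabel_sum k (branch n G r v) p x / relabel_sum k (branch n G r v - {v}) p x)"
      proof (rule ln_ge_zero)
        have sub: "branch n G r v - {v} \<subseteq> {..<n}" using branch_subset[of n G r v] by blast
        have "p x \<le> relabel_sum k (branch n G r v - {v}) p x" by (rule relabel_sum_ge[OF xl sub p0])
        then have "0 < relabel_sum k (branch n G r v - {v}) p x" using w by (simp add: p_def)
        moreover have "relabel_sum k (branch n G r v - {v}) p x \<le> relabel_sum k (branch n G r v) p x"
          by (rule relabel_sum_subset_le[OF xl _ branch_subset p0]) auto
        ultimately show "1 \<le> relabel_sum k (branch n G r v) p x / relabel_sum k (branch n G r v - {v}) p x"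
          by (simp add: pos_le_divide_eq)
      qed
      finally show ?thesis by (simp add: m_def)
    qed
  qed
  have T: "(\<Sum>v\<in>U. T v) = (\<Sum>e\<in>{e \<in> G. \<not> e \<subseteq> core n G r}. log_ratio a b d x e)"
    unfolding U_def T_def by (rule sum_later_edges[OF G])
  have "(\<Sum>v\<in>U. real (card (branch n G r v))) \<le> n * (real r + 1)"
    unfolding U_def by (rule sum_card_branch_le[OF G])
  then have "\<gamma> * (\<Sum>v\<in>U. real (card (branch n G r v))) \<le> \<gamma> * (n * (real r + 1))"
    using \<gamma>12 unfolding \<gamma>_def by (intro mult_left_mono) auto
  moreover have "card U * (2 * c / n) \<le> 2 * c"
  proof -
    have "card U * (2 * c / n) \<le> n * (2 * c / n)" using Uf(2) c0 by (intro mult_right_mono) auto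
    then show ?thesis using n by simp
  qed
  moreover have "(\<Sum>v\<in>U. ln k - T v - 2 * c / n - \<gamma> * card (branch n G r v))
      = ln k * card U - (\<Sum>v\<in>U. T v) - card U * (2 * c / n) - \<gamma> * (\<Sum>v\<in>U. real (card (branch n G r v)))"
    by (simp add: sum_subtractf sum_distrib_left mult.commute)
  moreover have "(\<Sum>v\<in>U. ln k - T v - 2 * c / n - \<gamma> * card (branch n G r v))
      \<le> (\<Sum>v\<in>U. ln (relabel_sum k (branch n G r v) p x / relabel_sum k (branch n G r v - {v}) p x))"
    by (intro sum_mono each)
  ultimately show ?thesis unfolding T U_def[symmetric] \<gamma>_def[symmetric] by linarith
qed

text \<open>\<open>K\<close> and \<open>s\<close> abstract from the core: a vertex is peeled with
  probability nearly \<open>K\<close> or more, an edge survives with conditional probability near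
  \<open>s\<close>. A peeled vertex brings \<open>ln k\<close> and a removed edge costs its
  log-ratio; averaged over labels, the edges cost \<open>(1 - s) * I / 2\<close> per vertex.\<close>

lemma entropy_ge_peeling:
  fixes \<delta> \<eta> s K :: real and r :: nat
  assumes \<delta>: "\<delta> > 0" and \<eta>: "0 \<le> \<eta>" and s: "0 \<le> s" "s \<le> 1" and K: "K \<le> 1"
    and V: "\<And>x v. x \<in> balanced n k \<delta> \<Longrightarrow> v < n \<Longrightarrow>
      bexp (vertex_pairs n) (edge_prob n a b x) (\<lambda>G. of_bool (v \<in> core n G r)) \<le> 1 - K + \<eta>"
    and E: "\<And>x e. x \<in> balanced n k \<delta> \<Longrightarrow> e \<in> vertex_pairs n \<Longrightarrow>
      \<bar>bexp (vertex_pairs n) (edge_prob n a b x) (\<lambda>G. of_bool (e \<in> G \<and> e \<subseteq> core n G r)) - edge_prob n a b x e * s\<bar>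
        \<le> edge_prob n a b x e * \<eta>"
  defines "I \<equiv> kl_rate k a b d" and "M \<equiv> \<bar>ln (a / d)\<bar> + \<bar>ln (b / d)\<bar>"
  shows "n * (ln k * (K - \<eta>) - (1 - s) * I / 2 - M * \<eta> * c / 2) - \<bar>I\<bar> / 2
      - (2 * c + (6 * c * k * \<delta> + (ln k + M) / (\<delta> * n)) * (n * (real r + 1))) - (ln k + M * c / 2) * (k / \<delta>\<^sup>2)
    \<le> label_entropy n k a b"
proof -
  define P where "P = vertex_pairs n"
  define err where "err = 2 * c + (6 * c * k * \<delta> + (ln k + M) / (\<delta> * n)) * (n * (real r + 1))"
  define Lam where "Lam x = (\<Sum>e\<in>P. edge_prob n a b x e * log_ratio a b d x e)" for x
  define br where "br x = n * (ln k * (K - \<eta>)) - (1 - s) * Lam x - M * \<eta> * (n * c / 2)" for x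
  define Q where "Q x G = ln k * card (peeled n G r) - (\<Sum>e\<in>{e \<in> G. \<not> e \<subseteq> core n G r}. log_ratio a b d x e) - err" for x G
  let ?bal = "\<lambda>x. x \<in> balanced n k \<delta>"
  let ?R = "\<lambda>x G v. ln (relabel_sum k (branch n G r v) (\<lambda>y. graph_weight n a b y G) x
      / relabel_sum k (branch n G r v - {v}) (\<lambda>y. graph_weight n a b y G) x)"
  have finP: "finite P" by (simp add: P_def)
  have c0: "0 \<le> c" using ab by linarith
  have lnk: "0 \<le> ln k" using k by simp
  have M0: "0 \<le> M" by (simp add: M_def)
  have err0: "0 \<le> err" unfolding err_def using c0 \<delta> lnk M0 by (intro add_nonneg_nonneg mult_nonneg_nonneg divide_nonneg_nonneg) auto
  have pe: "0 \<le> edge_prob n a b x e" "edge_prob n a b x e \<le> c / n" for x e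
    by (rule edge_prob_half[OF ab n k d])+
  have lr: "\<bar>log_ratio a b d x e\<bar> \<le> M" for x e unfolding M_def by (rule abs_log_ratio_le)
  have sump: "(\<Sum>e\<in>P. edge_prob n a b x e) \<le> n * c / 2" for x
  proof -
    have "(\<Sum>e\<in>P. edge_prob n a b x e) \<le> (\<Sum>e\<in>P. c / n)" by (intro sum_mono pe)
    also have "\<dots> = (real n - 1) * c / 2" using n by (simp add: P_def card_vertex_pairs)
    also have "\<dots> \<le> n * c / 2" using c0 by (intro divide_right_mono mult_right_mono) auto
    finally show ?thesis .
  qed
  have Lam_abs: "\<bar>Lam x\<bar> \<le> M * (n * c / 2)" for x
  proof -
    have "\<bar>Lam x\<bar> \<le> (\<Sum>e\<in>P. \<bar>edge_prob n a b x e * log_ratio a b d x e\<bar>)" unfolding Lam_def by (rule sum_abs)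
    also have "\<dots> \<le> (\<Sum>e\<in>P. edge_prob n a b x e * M)"
      unfolding abs_mult using pe lr by (intro sum_mono mult_mono) auto
    also have "\<dots> = M * (\<Sum>e\<in>P. edge_prob n a b x e)" by (simp add: sum_distrib_left mult.commute)
    also have "\<dots> \<le> M * (n * c / 2)" using sump M0 by (intro mult_left_mono)
    finally show ?thesis .
  qed
  have Qge: "br x - err \<le> bexp P (edge_prob n a b x) (Q x)" if x: "?bal x" for x
  proof -
    let ?E = "bexp P (edge_prob n a b x)"
    define pv where "pv v = ?E (\<lambda>G. of_bool (v \<in> core n G r))" for v
    define ka where "ka e = ?E (\<lambda>G. of_bool (e \<in> G \<and> e \<subseteq> core n G r))" for e
    have "?E (Q x) = ?E (\<lambda>G. ln k * (\<Sum>v<n. 1 - of_bool (v \<in> core n G r))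
        - ((\<Sum>e\<in>P. log_ratio a b d x e * of_bool (e \<in> G)) - (\<Sum>e\<in>P. log_ratio a b d x e * of_bool (e \<in> G \<and> e \<subseteq> core n G r))) - err)"
    proof (rule bexp_cong)
      fix G assume G: "G \<subseteq> P"
      have "real (card (peeled n G r)) = (\<Sum>v<n. 1 - of_bool (v \<in> core n G r))"
      proof -
        have "(\<Sum>v<n. 1 - of_bool (v \<in> core n G r) :: real) = (\<Sum>v<n. if v \<in> peeled n G r then 1 else 0)"
          by (intro sum.cong refl) (auto simp: peeled_def)
        also have "\<dots> = (\<Sum>v\<in>{..<n} \<inter> peeled n G r. 1)" by (rule sum.inter_restrict[symmetric]) simp
        also have "{..<n} \<inter> peeled n G r = peeled n G r" by (auto simp: peeled_def)
        finally show ?thesis by simp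
      qed
      moreover have "(\<Sum>e\<in>{e \<in> G. \<not> e \<subseteq> core n G r}. log_ratio a b d x e)
          = (\<Sum>e\<in>P. log_ratio a b d x e * of_bool (e \<in> G)) - (\<Sum>e\<in>P. log_ratio a b d x e * of_bool (e \<in> G \<and> e \<subseteq> core n G r))"
      proof -
        have "(\<Sum>e\<in>P. log_ratio a b d x e * of_bool (e \<in> G)) - (\<Sum>e\<in>P. log_ratio a b d x e * of_bool (e \<in> G \<and> e \<subseteq> core n G r))
            = (\<Sum>e\<in>P. if e \<in> {e \<in> G. \<not> e \<subseteq> core n G r} then log_ratio a b d x e else 0)"
          unfolding sum_subtractf[symmetric] by (intro sum.cong refl) auto
        also have "\<dots> = (\<Sum>e\<in>P \<inter> {e \<in> G. \<not> e \<subseteq> core n G r}. log_ratio a b d x e)"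
          by (rule sum.inter_restrict[symmetric]) (rule finP)
        also have "P \<inter> {e \<in> G. \<not> e \<subseteq> core n G r} = {e \<in> G. \<not> e \<subseteq> core n G r}" using G by auto
        finally show ?thesis ..
      qed
      ultimately show "Q x G = ln k * (\<Sum>v<n. 1 - of_bool (v \<in> core n G r))
        - ((\<Sum>e\<in>P. log_ratio a b d x e * of_bool (e \<in> G)) - (\<Sum>e\<in>P. log_ratio a b d x e * of_bool (e \<in> G \<and> e \<subseteq> core n G r))) - err"
        by (simp add: Q_def)
    qed
    also have "\<dots> = ln k * (\<Sum>v<n. 1 - pv v) - ((\<Sum>e\<in>P. log_ratio a b d x e * edge_prob n a b x e) - (\<Sum>e\<in>P. log_ratio a b d x e * ka e)) - err"
    proof -
      have ce: "?E (\<lambda>_. t) = t" for t :: real by (rule bexp_const[OF finP])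
      have "(\<Sum>e\<in>P. log_ratio a b d x e * ?E (\<lambda>G. of_bool (e \<in> G))) = (\<Sum>e\<in>P. log_ratio a b d x e * edge_prob n a b x e)"
        by (intro sum.cong refl) (simp add: bexp_edge[OF finP])
      then show ?thesis unfolding bexp_diff bexp_cmult bexp_sum ce pv_def ka_def by simp
    qed
    finally have eq: "?E (Q x) = ln k * (\<Sum>v<n. 1 - pv v) - (\<Sum>e\<in>P. log_ratio a b d x e * (edge_prob n a b x e - ka e)) - err"
      by (simp add: sum_subtractf right_diff_distrib)
    have "(\<Sum>v<n. K - \<eta>) \<le> (\<Sum>v<n. 1 - pv v)"
    proof (rule sum_mono)
      fix v assume "v \<in> {..<n}"
      then have "pv v \<le> 1 - K + \<eta>" using V[OF x, of v] by (simp add: pv_def P_def)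
      then show "K - \<eta> \<le> 1 - pv v" by linarith
    qed
    then have "ln k * (n * (K - \<eta>)) \<le> ln k * (\<Sum>v<n. 1 - pv v)" using lnk by (intro mult_left_mono) auto
    moreover have "(\<Sum>e\<in>P. log_ratio a b d x e * (edge_prob n a b x e - ka e)) \<le> (1 - s) * Lam x + M * \<eta> * (n * c / 2)"
    proof -
      have "(\<Sum>e\<in>P. log_ratio a b d x e * (edge_prob n a b x e - ka e))
          \<le> (\<Sum>e\<in>P. (1 - s) * (edge_prob n a b x e * log_ratio a b d x e) + M * \<eta> * edge_prob n a b x e)"
      proof (rule sum_mono)
        fix e assume e: "e \<in> P"
        have "\<bar>ka e - edge_prob n a b x e * s\<bar> \<le> edge_prob n a b x e * \<eta>"
          using E[OF x, of e] e by (simp add: ka_def P_def)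
        then have "\<bar>log_ratio a b d x e * (edge_prob n a b x e * s - ka e)\<bar> \<le> M * (edge_prob n a b x e * \<eta>)"
          unfolding abs_mult using lr M0 by (intro mult_mono) (auto simp: abs_minus_commute)
        moreover have "log_ratio a b d x e * (edge_prob n a b x e - ka e)
            = (1 - s) * (edge_prob n a b x e * log_ratio a b d x e) + log_ratio a b d x e * (edge_prob n a b x e * s - ka e)"
          by (simp add: algebra_simps)
        moreover have "M * (edge_prob n a b x e * \<eta>) = M * \<eta> * edge_prob n a b x e" by simp
        ultimately show "log_ratio a b d x e * (edge_prob n a b x e - ka e)
            \<le> (1 - s) * (edge_prob n a b x e * log_ratio a b d x e) + M * \<eta> * edge_prob n a b x e" by linarith
      qed
      also have "\<dots> = (1 - s) * Lam x + M * \<eta> * (\<Sum>e\<in>P. edge_prob n a b x e)"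
        by (simp add: sum.distrib sum_distrib_left Lam_def)
      also have "\<dots> \<le> (1 - s) * Lam x + M * \<eta> * (n * c / 2)"
        using sump M0 \<eta> by (intro add_left_mono mult_left_mono) auto
      finally show ?thesis .
    qed
    moreover have "ln k * (n * (K - \<eta>)) = n * (ln k * (K - \<eta>))" by simp
    ultimately show ?thesis unfolding eq br_def by linarith
  qed
  have br_le: "br x \<le> n * (ln k + M * c / 2)" for x
  proof -
    have "n * (ln k * (K - \<eta>)) \<le> n * (ln k * 1)" using K \<eta> lnk by (intro mult_left_mono) auto
    moreover have "- ((1 - s) * Lam x) \<le> 1 * (M * (n * c / 2))"
    proof -
      have "- ((1 - s) * Lam x) = (1 - s) * - Lam x" by simp
      also have "\<dots> \<le> (1 - s) * (M * (n * c / 2))" using Lam_abs[of x] s by (intro mult_left_mono) auto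
      also have "\<dots> \<le> 1 * (M * (n * c / 2))" using s M0 c0 by (intro mult_right_mono) auto
      finally show ?thesis .
    qed
    moreover have "0 \<le> M * \<eta> * (n * c / 2)" using M0 \<eta> c0 by simp
    moreover have "n * (ln k + M * c / 2) = n * (ln k * 1) + 1 * (M * (n * c / 2))" by (simp add: algebra_simps)
    ultimately show ?thesis unfolding br_def by linarith
  qed
  \<comment> \<open>Bounds the estimate \<open>br x\<close> per vertex. Subtracting
    \<open>n * C3\<close> on unbalanced labellings makes the estimate valid there, and costs only a
    constant because their probability is O(1/n).\<close>
  define C3 where "C3 = ln k + M * c / 2"
  have C3: "0 \<le> C3" using lnk M0 c0 by (simp add: C3_def)
  have LamE: "label_exp n k Lam = (real n - 1) / 2 * I"
  proof -
    have "label_exp n k Lam = label_exp n k (\<lambda>x. \<Sum>e\<in>P. if monochromatic x e then a / n * ln (a / d) else b / n * ln (b / d))"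
      unfolding Lam_def by (intro label_exp_cong sum.cong refl) (simp add: edge_prob_def log_ratio_def)
    also have "\<dots> = real n * (real n - 1) / 2 * ((a / n * ln (a / d) + (real k - 1) * (b / n * ln (b / d))) / k)"
      unfolding P_def by (rule label_exp_edge_function[OF k])
    also have "\<dots> = (real n - 1) / 2 * I" unfolding I_def kl_rate_def using n k by (simp add: field_simps)
    finally show ?thesis .
  qed
  have "(1 - s) * ((real n - 1) / 2 * I) \<le> n * ((1 - s) * I / 2) + \<bar>I\<bar> / 2"
  proof -
    have "(1 - s) * ((real n - 1) / 2 * I) = n * ((1 - s) * I / 2) + (1 - s) * (- I / 2)" by (simp add: algebra_simps diff_divide_distrib)
    also have "(1 - s) * (- I / 2) \<le> (1 - s) * (\<bar>I\<bar> / 2)" using s by (intro mult_left_mono) auto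
    also have "(1 - s) * (\<bar>I\<bar> / 2) \<le> 1 * (\<bar>I\<bar> / 2)" using s by (intro mult_right_mono) auto
    finally show ?thesis by simp
  qed
  then have "n * (ln k * (K - \<eta>) - (1 - s) * I / 2 - M * \<eta> * c / 2) - \<bar>I\<bar> / 2 - err - C3 * (k / \<delta>\<^sup>2)
      \<le> n * (ln k * (K - \<eta>)) - (1 - s) * ((real n - 1) / 2 * I) - M * \<eta> * (n * c / 2) - err - n * C3 * ((k / \<delta>\<^sup>2) / n)"
    using n by (simp add: algebra_simps)
  also have "\<dots> \<le> n * (ln k * (K - \<eta>)) - (1 - s) * ((real n - 1) / 2 * I) - M * \<eta> * (n * c / 2) - err
      - n * C3 * label_exp n k (\<lambda>x. of_bool (x \<notin> balanced n k \<delta>))"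
    using label_exp_unbalanced_le[OF k n(2) \<delta>] C3 by (intro diff_left_mono mult_left_mono) auto
  also have "\<dots> = label_exp n k (\<lambda>x. br x - err - n * C3 * of_bool (x \<notin> balanced n k \<delta>))"
    unfolding br_def label_exp_diff label_exp_cmult LamE using k by (simp add: label_exp_const)
  also have "\<dots> \<le> label_exp n k (\<lambda>x. of_bool (?bal x) * bexp P (edge_prob n a b x) (Q x))"
  proof (rule label_exp_mono)
    fix x
    show "br x - err - n * C3 * of_bool (x \<notin> balanced n k \<delta>) \<le> of_bool (?bal x) * bexp P (edge_prob n a b x) (Q x)"
      using Qge[of x] br_le[of x] err0 by (cases "?bal x") (auto simp: C3_def)
  qed
  also have "\<dots> = sbm_exp n k a b (\<lambda>x G. of_bool (?bal x) * Q x G)"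
    by (simp add: sbm_exp_def bexp_cmult P_def)
  \<comment> \<open>For unbalanced labellings the left side is zero, and each log-ratio of marginals
    is nonnegative since the sets are nested.\<close>
  also have "\<dots> \<le> sbm_exp n k a b (\<lambda>x G. \<Sum>v\<in>peeled n G r. ?R x G v)"
  proof (rule sbm_exp_mono[OF ab n k d])
    fix x G assume x: "x \<in> labellings n k" and G: "G \<subseteq> vertex_pairs n" and w: "graph_weight n a b x G > 0"
    show "of_bool (?bal x) * Q x G \<le> (\<Sum>v\<in>peeled n G r. ?R x G v)"
    proof (cases "?bal x")
      case True
      then show ?thesis using sum_log_branch_ge[OF G True w \<delta>, of r] by (simp add: Q_def err_def M_def)
    next
      case False
      have "0 \<le> ?R x G v" for v
      proof (rule ln_ge_zero)
        let ?p = "\<lambda>y. graph_weight n a b y G"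
        have p0: "0 \<le> ?p y" for y by (rule weight_nonneg[OF ab n k d])
        have sub: "branch n G r v - {v} \<subseteq> {..<n}" using branch_subset[of n G r v] by blast
        have "?p x \<le> relabel_sum k (branch n G r v - {v}) ?p x" by (rule relabel_sum_ge[OF x sub p0])
        then have "0 < relabel_sum k (branch n G r v - {v}) ?p x" using w by linarith
        moreover have "relabel_sum k (branch n G r v - {v}) ?p x \<le> relabel_sum k (branch n G r v) ?p x"
          by (rule relabel_sum_subset_le[OF x _ branch_subset p0]) auto
        ultimately show "1 \<le> relabel_sum k (branch n G r v) ?p x / relabel_sum k (branch n G r v - {v}) ?p x"
          by (simp add: pos_le_divide_eq)
      qed
      then show ?thesis using False by (simp add: sum_nonneg)
    qed
  qed
  also have "\<dots> \<le> label_entropy n k a b"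
  proof (rule entropy_ge_chain[OF ab n k d, of "\<lambda>G. peeled n G r" "\<lambda>G. peel_key n G r" "\<lambda>G. branch n G r"])
    fix G
    show "peeled n G r \<subseteq> {..<n} \<and> inj_on (peel_key n G r) (peeled n G r)"
      using inj_on_subset[OF inj_on_peel_key] by (auto simp: peeled_def)
  next
    fix G v assume "v \<in> peeled n G r"
    then show "v \<in> branch n G r v \<and> branch n G r v \<subseteq> {u \<in> peeled n G r. peel_key n G r u \<le> peel_key n G r v}"
      by (rule branch_key)
  qed
  finally show ?thesis unfolding C3_def err_def .
qed

end

lemma one_add_times_exp_minus_le: "(1 + x) * exp (- x) \<le> (1 :: real)"
  using exp_ge_add_one_self[of x] by (simp add: exp_minus field_simps)

text \<open>Both proportions concern \<open>core n G (Suc r)\<close>. A vertex survives round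
  \<open>r + 1\<close> through two neighbours with walks of \<open>r\<close> steps, which gives
  \<open>\<mu>\<close> with index \<open>r\<close>; an edge survives through walks of
  \<open>r + 1\<close> steps from both ends, which gives index \<open>Suc r\<close>.\<close>

lemma entropy_lower_peeling:
  fixes a b d \<eta> :: real and k r :: nat
  assumes ab: "0 \<le> a" "0 \<le> b" and k: "k > 0" and d: "d = (a + (real k - 1) * b) / k" "d > 0" and \<eta>: "\<eta> > 0"
  defines "\<mu> \<equiv> d * (1 - ext_prob d r)"
  shows "\<forall>\<^sub>F n in sequentially.
    n * (ln k * ((1 + \<mu>) * exp (- \<mu>)) - kl_rate k a b d / 2 * (1 - (1 - ext_prob d (Suc r))\<^sup>2) - \<eta>) \<le> label_entropy n k a b"
proof -
  define c where "c = max a b + 1"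
  have c: "max a b \<le> c" "c > 0" using ab by (auto simp: c_def)
  define M where "M = \<bar>ln (a / d)\<bar> + \<bar>ln (b / d)\<bar>"
  define I where "I = kl_rate k a b d"
  define K where "K = (1 + \<mu>) * exp (- \<mu>)"
  define s where "s = (1 - ext_prob d (Suc r))\<^sup>2"
  have lnk: "0 \<le> ln k" using k by simp
  have M0: "0 \<le> M" by (simp add: M_def)
  have q: "0 \<le> ext_prob d (Suc r)" "ext_prob d (Suc r) \<le> 1"
    using ext_prob_bounds[of d "Suc r"] d(2) by auto
  have s: "0 \<le> s" "s \<le> 1" unfolding s_def using q by (auto intro: power_le_one)
  have K: "K \<le> 1" unfolding K_def by (rule one_add_times_exp_minus_le)
  define D where "D = ln k + M * c / 2 + 1"
  have D: "D > 0" using lnk M0 c by (simp add: D_def add_nonneg_pos)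
  define \<eta>' where "\<eta>' = \<eta> / (4 * D)"
  have \<eta>': "\<eta>' > 0" using \<eta> D by (simp add: \<eta>'_def)
  have \<eta>'D: "ln k * \<eta>' + M * \<eta>' * c / 2 \<le> \<eta> / 4"
  proof -
    have "ln k * \<eta>' + M * \<eta>' * c / 2 = (ln k + M * c / 2) * \<eta>'" by (simp add: algebra_simps)
    also have "\<dots> \<le> D * \<eta>'" using \<eta>' by (intro mult_right_mono) (auto simp: D_def)
    also have "\<dots> = \<eta> / 4" using D by (simp add: \<eta>'_def)
    finally show ?thesis .
  qed
  have c0: "0 \<le> c" "0 \<le> d" using c d(2) by auto
  obtain \<delta>1 where \<delta>1: "\<delta>1 > 0" and ev1: "\<forall>\<^sub>F n in sequentially. \<forall>p. regular n c d \<delta>1 p \<longrightarrow> (\<forall>v<n.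
      bexp (vertex_pairs n) p (\<lambda>G. of_bool (v \<in> core n G (Suc r))) \<le> 1 - (1 + \<mu>) * exp (- \<mu>) + \<eta>')"
    using core_vertex_limit[OF c0 \<eta>', of r] unfolding \<mu>_def by blast
  obtain \<delta>2 where \<delta>2: "\<delta>2 > 0" and ev2: "\<forall>\<^sub>F n in sequentially. \<forall>p. regular n c d \<delta>2 p \<longrightarrow> (\<forall>e\<in>vertex_pairs n.
      \<bar>bexp (vertex_pairs n) p (\<lambda>G. of_bool (e \<in> G \<and> e \<subseteq> core n G (Suc r))) - p e * (1 - ext_prob d (Suc r))\<^sup>2\<bar> \<le> p e * \<eta>')"
    using core_edge_limit[OF c0 \<eta>', of "Suc r"] by blast
  define \<delta>0 where "\<delta>0 = min \<delta>1 \<delta>2"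
  have \<delta>0: "\<delta>0 > 0" "\<delta>0 \<le> \<delta>1" "\<delta>0 \<le> \<delta>2" using \<delta>1 \<delta>2 by (auto simp: \<delta>0_def)
  define R where "R = real (Suc r) + 1"
  have R: "R > 0" by (simp add: R_def)
  \<comment> \<open>The first bound makes balanced labellings regular, the second keeps the error
    from small branches below a quarter of \<open>\<eta>\<close>.\<close>
  define \<delta> where "\<delta> = min (\<delta>0 / (2 * c)) (\<eta> / (24 * c * k * R))"
  have \<delta>: "\<delta> > 0" using \<delta>0 c \<eta> k R by (simp add: \<delta>_def)
  have "\<delta> \<le> \<delta>0 / (2 * c)" by (simp add: \<delta>_def)
  then have c\<delta>: "c * \<delta> \<le> \<delta>0 / 2" using c by (simp add: pos_le_divide_eq mult_ac)
  have "\<delta> \<le> \<eta> / (24 * c * k * R)" by (simp add: \<delta>_def)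
  then have cR: "6 * c * k * \<delta> * R \<le> \<eta> / 4" using c k R by (simp add: pos_le_divide_eq mult_ac)
  define Z where "Z = \<bar>I\<bar> / 2 + 2 * c + (ln k + M) / \<delta> * R + (ln k + M * c / 2) * (k / \<delta>\<^sup>2)"
  have e1: "\<forall>\<^sub>F n in sequentially. c / real n < \<delta>0 / 2"
    using \<delta>0 by (intro eventually_const_over_n_less) auto
  have e2: "\<forall>\<^sub>F n in sequentially. Z / real n < \<eta> / 4"
    using \<eta> by (intro eventually_const_over_n_less) auto
  have e3: "\<forall>\<^sub>F n in sequentially. 2 * c \<le> real n"
    by (rule eventually_sequentiallyI[of "nat \<lceil>2 * c\<rceil>"]) linarith
  from ev1 ev2 e1 e2 e3 show ?thesis
  proof eventually_elim
    case (elim n)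
    have n: "2 * c \<le> n" "n > 0" "max a b < n" using elim(5) c by (auto simp: c_def)
    have reg: "regular n c d \<delta>0 (edge_prob n a b x)" if "x \<in> balanced n k \<delta>" for x
      by (rule balanced_imp_regular[OF ab c(1) n k d that]) (use c\<delta> elim(3) in linarith)
    have V: "bexp (vertex_pairs n) (edge_prob n a b x) (\<lambda>G. of_bool (v \<in> core n G (Suc r))) \<le> 1 - K + \<eta>'"
      if "x \<in> balanced n k \<delta>" "v < n" for x v
      using elim(1) regular_mono[OF reg[OF that(1)] \<delta>0(2)] that(2) unfolding K_def by blast
    have E: "\<bar>bexp (vertex_pairs n) (edge_prob n a b x) (\<lambda>G. of_bool (e \<in> G \<and> e \<subseteq> core n G (Suc r))) - edge_prob n a b x e * s\<bar>
        \<le> edge_prob n a b x e * \<eta>'" if "x \<in> balanced n k \<delta>" "e \<in> vertex_pairs n" for x e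
      using elim(2) regular_mono[OF reg[OF that(1)] \<delta>0(3)] that(2) unfolding s_def by blast
    have "Z \<le> n * (\<eta> / 4)" using elim(4) n by (simp add: pos_divide_less_eq mult.commute)
    moreover have "n * (6 * c * k * \<delta> * R) \<le> n * (\<eta> / 4)" using cR by (intro mult_left_mono) auto
    moreover have "n * (ln k * \<eta>' + M * \<eta>' * c / 2) \<le> n * (\<eta> / 4)" using \<eta>'D by (intro mult_left_mono) auto
    moreover have "0 \<le> n * (\<eta> / 4)" using \<eta> by simp
    moreover have "(6 * c * k * \<delta> + (ln k + M) / (\<delta> * n)) * (n * R) = n * (6 * c * k * \<delta> * R) + (ln k + M) / \<delta> * R"
    proof -
      have "6 * c * k * \<delta> * (n * R) = n * (6 * c * k * \<delta> * R)" by simp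
      moreover have "(ln k + M) / (\<delta> * n) * (n * R) = (ln k + M) / \<delta> * R" using n by simp
      ultimately show ?thesis by (simp only: distrib_right[of "6 * c * k * \<delta>" "(ln k + M) / (\<delta> * n)"])
    qed
    moreover have "n * (ln k * K - I / 2 * (1 - s) - \<eta>) = n * (ln k * (K - \<eta>') - (1 - s) * I / 2 - M * \<eta>' * c / 2)
        + n * (ln k * \<eta>' + M * \<eta>' * c / 2) - 4 * (n * (\<eta> / 4))"
      by (simp add: algebra_simps diff_divide_distrib)
    ultimately have "n * (ln k * K - I / 2 * (1 - s) - \<eta>)
        \<le> n * (ln k * (K - \<eta>') - (1 - s) * I / 2 - M * \<eta>' * c / 2) - \<bar>I\<bar> / 2
          - (2 * c + (6 * c * k * \<delta> + (ln k + M) / (\<delta> * n)) * (n * R)) - (ln k + M * c / 2) * (k / \<delta>\<^sup>2)"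
      unfolding Z_def by linarith
    also have "\<dots> \<le> label_entropy n k a b"
      unfolding R_def I_def M_def
      by (rule entropy_ge_peeling[OF ab c(1) n k d \<delta> less_imp_le[OF \<eta>'] s K V E])
    finally show ?case unfolding K_def I_def s_def .
  qed
qed

section \<open>Labellings with small agreement\<close>

definition overlap :: "nat \<Rightarrow> (nat \<Rightarrow> nat) \<Rightarrow> (nat \<Rightarrow> nat) \<Rightarrow> nat \<Rightarrow> nat \<Rightarrow> real" where
  "overlap n x y i j = real (card {u \<in> {..<n}. x u = i \<and> y u = j})"

lemma overlap_eq_sum: "overlap n x y i j = (\<Sum>u<n. of_bool (x u = i) * of_bool (y u = j))"
  unfolding of_bool_conj[symmetric] by (simp add: overlap_def Int_def)

lemma sum_of_bool_mult_eq:
  fixes f :: "nat \<Rightarrow> real"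
  assumes "i < k"
  shows "(\<Sum>j<k. f j * of_bool (i = j)) = f i"
proof -
  have "(\<Sum>j<k. f j * of_bool (i = j)) = (\<Sum>j<k. if i = j then f j else 0)" by (intro sum.cong refl) auto
  also have "\<dots> = f i" using assms by simp
  finally show ?thesis .
qed

lemma sum_overlap_permuted:
  assumes "\<And>u. u < n \<Longrightarrow> y u < k"
  shows "(\<Sum>j<k. overlap n x y (\<pi> j) j) = real (card {u \<in> {..<n}. x u = \<pi> (y u)})"
proof -
  have "(\<Sum>j<k. overlap n x y (\<pi> j) j) = (\<Sum>u<n. \<Sum>j<k. of_bool (x u = \<pi> j) * of_bool (y u = j))"
    unfolding overlap_eq_sum by (rule sum.swap)
  also have "\<dots> = (\<Sum>u<n. of_bool (x u = \<pi> (y u)))"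
    using assms by (intro sum.cong refl) (simp add: sum_of_bool_mult_eq)
  also have "\<dots> = real (card {u \<in> {..<n}. x u = \<pi> (y u)})" by (simp add: Int_def)
  finally show ?thesis .
qed

lemma sum_overlap_right:
  assumes "\<And>u. u < n \<Longrightarrow> y u < k"
  shows "(\<Sum>j<k. overlap n x y i j) = class_size n x i"
  using sum_overlap_permuted[OF assms, where \<pi> = "\<lambda>_. i" and x = x] by (simp add: class_size_def)

lemma overlap_commute: "overlap n x y i j = overlap n y x j i"
  by (simp add: overlap_def conj_commute)

lemma sum_overlap_left:
  assumes "\<And>u. u < n \<Longrightarrow> x u < k"
  shows "(\<Sum>i<k. overlap n x y i j) = class_size n y j"
  unfolding overlap_commute[of n x y] by (rule sum_overlap_right[OF assms])

lemma agreement_ge: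
  assumes "\<pi> permutes {..<k}"
  shows "real (card {u \<in> {..<n}. x u = \<pi> (y u)}) / n \<le> agreement n k x y"
  unfolding agreement_def using assms by (intro Max_ge) (auto simp: finite_permutations)

lemma bij_betw_add_mod:
  fixes K t :: nat
  assumes "K > 0"
  shows "bij_betw (\<lambda>m. (m + t) mod K) {..<K} {..<K}"
proof -
  have ne: "(m + t) mod K \<noteq> (m' + t) mod K" if m: "m < m'" "m' < K" for m m'
  proof
    assume eq: "(m + t) mod K = (m' + t) mod K"
    have "m + t \<le> m' + t" using m by simp
    from mod_eq_nat1E[OF eq[symmetric] this] obtain s where "m' + t = m + t + K * s" .
    then show False using m by (cases s) auto
  qed
  have inj: "inj_on (\<lambda>m. (m + t) mod K) {..<K}"
  proof (rule inj_onI)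
    fix m m' assume "m \<in> {..<K}" "m' \<in> {..<K}" "(m + t) mod K = (m' + t) mod K"
    then show "m = m'" using ne[of m m'] ne[of m' m] by (cases m m' rule: linorder_cases) auto
  qed
  moreover have "(\<lambda>m. (m + t) mod K) ` {..<K} \<subseteq> {..<K}" using assms by auto
  ultimately show ?thesis unfolding bij_betw_def using endo_inj_surj[OF finite_lessThan] by blast
qed

text \<open>A permutation sending \<open>j\<close> to \<open>i\<close> cannot agree too often; averaging over \<open>k - 1\<close> such
  permutations that together cover every other pair of classes exactly once bounds the overlap.\<close>

lemma overlap_le_of_agreement:
  fixes \<delta> \<epsilon> :: real
  assumes x: "x \<in> balanced n k \<delta>" and y: "y \<in> balanced n k \<delta>" and k: "k \<ge> 2" and n: "n > 0"
    and agr: "agreement n k x y < 1 / k + \<epsilon>" and ij: "i < k" "j < k" and \<epsilon>: "\<epsilon> \<ge> 0"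
  shows "overlap n x y i j \<le> n * (1 / (real k)\<^sup>2 + (2 * \<delta> / k + \<epsilon>))"
proof -
  define K where "K = k - 1"
  have K: "k = Suc K" "K > 0" using k by (auto simp: K_def)
  have xl: "x u < k" if "u < n" for u using labellings_less[OF balanced_imp_labellings[OF x] that] .
  have yl: "y u < k" if "u < n" for u using labellings_less[OF balanced_imp_labellings[OF y] that] .
  \<comment> \<open>The transpositions move \<open>i\<close> and \<open>j\<close> to the last index
    \<open>K\<close>, which every shift \<open>sh t\<close> fixes; so
    \<open>\<rho> \<circ> (sh t \<circ> \<kappa>)\<close> sends \<open>j\<close> to \<open>i\<close>
    for each \<open>t\<close>.\<close>
  define \<rho> where "\<rho> = Transposition.transpose K i"
  define \<kappa> where "\<kappa> = Transposition.transpose K j"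
  define sh where "sh t m = (if m < K then (m + t) mod K else m)" for t m
  have \<rho>: "\<rho> permutes {..<k}" unfolding \<rho>_def using ij K by (intro permutes_swap_id) auto
  have \<kappa>: "\<kappa> permutes {..<k}" unfolding \<kappa>_def using ij K by (intro permutes_swap_id) auto
  have \<kappa>\<kappa>: "\<kappa> (\<kappa> m) = m" for m unfolding \<kappa>_def by simp
  have sh: "sh t permutes {..<k}" for t
  proof -
    have "bij_betw (sh t) {..<K} {..<K} \<longleftrightarrow> bij_betw (\<lambda>m. (m + t) mod K) {..<K} {..<K}"
      by (rule bij_betw_cong) (simp add: sh_def)
    then have "sh t permutes {..<K}"
      using bij_betw_add_mod[OF K(2)] by (intro bij_imp_permutes) (auto simp: sh_def)
    then show ?thesis by (rule permutes_subset) (use K in auto)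
  qed
  define be where "be m' m = overlap n x y (\<rho> m') (\<kappa> m)" for m' m
  define A where "A = (\<Sum>m<K. \<Sum>m'<K. be m' m)"
  define r where "r = (\<Sum>m<K. be K m)"
  define q where "q = (\<Sum>m'<K. be m' K)"
  have beKK: "be K K = overlap n x y i j" by (simp add: be_def \<rho>_def \<kappa>_def)
  have shift: "(\<Sum>m<K. be ((m + t) mod K) m) + be K K \<le> n * (1 / k + \<epsilon>)" for t
  proof -
    define \<pi> where "\<pi> = \<rho> \<circ> (sh t \<circ> \<kappa>)"
    have \<pi>: "\<pi> permutes {..<k}" unfolding \<pi>_def by (intro permutes_compose \<rho> \<kappa> sh)
    have "(\<Sum>m<K. be ((m + t) mod K) m) + be K K = (\<Sum>m<k. be (sh t m) m)"
      unfolding K(1) sum.lessThan_Suc by (simp add: sh_def)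
    also have "\<dots> = (\<Sum>m<k. overlap n x y (\<pi> (\<kappa> m)) (\<kappa> m))"
      by (simp add: be_def \<pi>_def \<kappa>\<kappa>)
    also have "\<dots> = (\<Sum>m<k. overlap n x y (\<pi> m) m)"
      using sum.permute[OF \<kappa>, of "\<lambda>m. overlap n x y (\<pi> m) m"] by (simp add: o_def)
    also have "\<dots> = real (card {u \<in> {..<n}. x u = \<pi> (y u)})" by (rule sum_overlap_permuted[OF yl])
    also have "\<dots> \<le> n * (1 / k + \<epsilon>)"
    proof -
      have "real (card {u \<in> {..<n}. x u = \<pi> (y u)}) / n \<le> 1 / k + \<epsilon>"
        using agreement_ge[OF \<pi>, of n x y] agr by linarith
      then show ?thesis using n by (simp only: pos_divide_le_eq of_nat_0_less_iff mult.commute)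
    qed
    finally show ?thesis .
  qed
  \<comment> \<open>For fixed \<open>m\<close> the shifted index runs through all of
    \<open>{..<K}\<close> as \<open>t\<close> does, so the \<open>K\<close> shifts cover the
    remaining square exactly once.\<close>
  have "(\<Sum>t<K. \<Sum>m<K. be ((m + t) mod K) m) = A"
  proof -
    have "(\<Sum>t<K. \<Sum>m<K. be ((m + t) mod K) m) = (\<Sum>m<K. \<Sum>t<K. be ((t + m) mod K) m)"
      by (subst sum.swap) (simp add: add.commute)
    also have "\<dots> = A" unfolding A_def
      by (intro sum.cong refl sum.reindex_bij_betw bij_betw_add_mod K(2))
    finally show ?thesis .
  qed
  moreover have "(\<Sum>t<K. (\<Sum>m<K. be ((m + t) mod K) m) + be K K) \<le> (\<Sum>t<K. n * (1 / k + \<epsilon>))"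
    by (intro sum_mono shift)
  ultimately have avg: "A + K * be K K \<le> K * (n * (1 / k + \<epsilon>))" by (simp add: sum.distrib)
  have row: "r + be K K \<le> n / k + \<delta> * n"
  proof -
    have "r + be K K = (\<Sum>m<k. overlap n x y i (\<kappa> m))"
      unfolding r_def K(1) sum.lessThan_Suc by (simp add: be_def \<rho>_def)
    also have "\<dots> = (\<Sum>m<k. overlap n x y i m)"
      using sum.permute[OF \<kappa>, of "overlap n x y i"] by (simp add: o_def)
    also have "\<dots> = class_size n x i" by (rule sum_overlap_right[OF yl])
    finally show ?thesis using balanced_class_size[OF x ij(1) n] by linarith
  qed
  have col: "q + be K K \<le> n / k + \<delta> * n"
  proof -
    have "q + be K K = (\<Sum>m<k. overlap n x y (\<rho> m) j)"
      unfolding q_def K(1) sum.lessThan_Suc by (simp add: be_def \<kappa>_def)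
    also have "\<dots> = (\<Sum>m<k. overlap n x y m j)"
      using sum.permute[OF \<rho>, of "\<lambda>m. overlap n x y m j"] by (simp add: o_def)
    also have "\<dots> = class_size n y j" by (rule sum_overlap_left[OF xl])
    finally show ?thesis using balanced_class_size[OF y ij(2) n] by linarith
  qed
  have total: "A + r + q + be K K = n"
  proof -
    have "A + r + q + be K K = (\<Sum>m<k. \<Sum>m'<k. be m' m)"
      unfolding K(1) sum.lessThan_Suc sum.distrib A_def r_def q_def by simp
    also have "\<dots> = (\<Sum>m<k. \<Sum>m'<k. overlap n x y m' (\<kappa> m))"
    proof (rule sum.cong[OF refl])
      fix m
      show "(\<Sum>m'<k. be m' m) = (\<Sum>m'<k. overlap n x y m' (\<kappa> m))"
        unfolding be_def using sum.permute[OF \<rho>, of "\<lambda>m'. overlap n x y m' (\<kappa> m)"] by (simp add: o_def)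
    qed
    also have "\<dots> = (\<Sum>m<k. class_size n y (\<kappa> m))" by (intro sum.cong refl sum_overlap_left xl)
    also have "\<dots> = (\<Sum>m<k. class_size n y m)"
      using sum.permute[OF \<kappa>, of "class_size n y"] by (simp add: o_def)
    also have "\<dots> = n" by (rule sum_class_size) (use yl in auto)
    finally show ?thesis .
  qed
  define z where "z = be K K"
  \<comment> \<open>The averaged bound controls \<open>A + K * z\<close> from above; the total with
    the row and column bounds controls \<open>A\<close> from below. Eliminating \<open>A\<close>
    leaves \<open>k * z\<close>.\<close>
  have lin: "t + z \<le> B - N + 2 * X" if "A + t \<le> B" "r + z \<le> X" "q + z \<le> X" "A + r + q + z = N"
    for t B X N :: real using that by linarith
  have "(real K + 1) * z = K * z + z" by (simp add: distrib_right)
  also have "\<dots> \<le> K * (n * (1 / k + \<epsilon>)) - n + 2 * (n / k + \<delta> * n)"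
    by (rule lin) (use avg row col total in \<open>simp_all only: z_def\<close>)
  also have "K * (n * (1 / k + \<epsilon>)) = n - n / k + (real k - 1) * \<epsilon> * n"
    unfolding K(1) by (simp add: field_simps)
  finally have kz: "(real K + 1) * z \<le> n - n / k + (real k - 1) * \<epsilon> * n - n + 2 * (n / k + \<delta> * n)" .
  have lin2: "t \<le> X + 2 * D + E" if "t \<le> N - X + E' - N + 2 * (X + D)" "E' \<le> E" for t X D E E' N :: real
    using that by (simp add: algebra_simps)
  have "(real k - 1) * \<epsilon> * n \<le> k * \<epsilon> * n" using \<epsilon> by (intro mult_right_mono) auto
  with kz have "(real K + 1) * z \<le> n / k + 2 * (\<delta> * n) + k * \<epsilon> * n" by (rule lin2)
  then have "z * k \<le> n / k + 2 * (\<delta> * n) + k * \<epsilon> * n" by (simp add: K(1) mult.commute add.commute)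
  then have "z \<le> (n / k + 2 * (\<delta> * n) + k * \<epsilon> * n) / k" using k by (subst pos_le_divide_eq) auto
  also have "\<dots> = n * (1 / (real k)\<^sup>2 + (2 * \<delta> / k + \<epsilon>))"
    using k by (simp add: field_simps power2_eq_square)
  finally show ?thesis by (simp add: z_def beKK)
qed

text \<open>Labelling by the pair \<open>(x u, y u)\<close> turns doubly monochromatic pairs into
  squared overlaps, and a sum of squares is at most the largest term times the total
  \<open>n\<close>. Upper bounds on the overlaps are therefore enough.\<close>

lemma sum_overlap_squares_le:
  fixes \<beta> :: real
  assumes x: "x \<in> labellings n k" and y: "y \<in> labellings n k"
    and le: "\<And>i j. i < k \<Longrightarrow> j < k \<Longrightarrow> overlap n x y i j \<le> n * \<beta>"
  shows "2 * (\<Sum>e\<in>vertex_pairs n. of_bool (monochromatic x e) * of_bool (monochromatic y e)) \<le> (real n)\<^sup>2 * \<beta> - n"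
proof -
  define z where "z u = (x u, y u)" for u
  have cs: "class_size n z (i, j) = overlap n x y i j" for i j
    by (simp add: class_size_def overlap_def z_def)
  have sub: "z ` {..<n} \<subseteq> {..<k} \<times> {..<k}"
    using labellings_less[OF x] labellings_less[OF y] by (auto simp: z_def)
  have "(\<Sum>e\<in>vertex_pairs n. of_bool (monochromatic x e) * of_bool (monochromatic y e))
      = (\<Sum>v<n. \<Sum>u<v. of_bool (z u = z v) :: real)"
    unfolding sum_vertex_pairs by (intro sum.cong refl) (simp add: z_def)
  then have "2 * (\<Sum>e\<in>vertex_pairs n. of_bool (monochromatic x e) * of_bool (monochromatic y e) :: real)
      = (\<Sum>ij\<in>{..<k} \<times> {..<k}. (class_size n z ij)\<^sup>2) - n"
    using sum_vertex_pairs_equal[OF _ sub] by simp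
  also have "(\<Sum>ij\<in>{..<k} \<times> {..<k}. (class_size n z ij)\<^sup>2) \<le> (\<Sum>ij\<in>{..<k} \<times> {..<k}. n * \<beta> * class_size n z ij)"
  proof (rule sum_mono)
    fix ij assume "ij \<in> {..<k} \<times> {..<k}"
    then obtain i j where "ij = (i, j)" "i < k" "j < k" by auto
    then have "class_size n z ij \<le> n * \<beta>" using le cs by simp
    then show "(class_size n z ij)\<^sup>2 \<le> n * \<beta> * class_size n z ij"
      unfolding power2_eq_square by (intro mult_right_mono) (auto simp: class_size_def)
  qed
  also have "\<dots> = n * \<beta> * n"
    unfolding sum_distrib_left[symmetric] by (subst sum_class_size[OF _ sub]) auto
  finally show ?thesis by (simp add: power2_eq_square mult_ac)
qed

text \<open>The disjunction follows the sign of \<open>ln t\<close>: a lower bound on the count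
  helps when it is nonnegative, an upper bound when it is not. For \<open>t = 0\<close> the
  condition \<open>s = 0\<close> forces \<open>m = 0\<close>.\<close>

lemma power_ge_exp:
  fixes t s \<delta> :: real and m :: nat
  assumes t: "0 \<le> t" and s: "0 \<le> s" "t = 0 \<Longrightarrow> s = 0" and \<delta>: "0 \<le> \<delta>"
    and m: "(1 \<le> t \<and> s * (1 - \<delta>) \<le> m) \<or> (t \<le> 1 \<and> m \<le> s * (1 + \<delta>))"
  shows "exp (s * ln t - \<delta> * (s * \<bar>ln t\<bar>)) \<le> t ^ m"
proof (cases "t = 0")
  case True
  then have "m = 0" using m s by auto
  then show ?thesis using True by simp
next
  case False
  then have t0: "t > 0" using t by simp
  have "s * ln t - \<delta> * (s * \<bar>ln t\<bar>) \<le> m * ln t"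
    using m
  proof
    assume m: "1 \<le> t \<and> s * (1 - \<delta>) \<le> m"
    then have l: "0 \<le> ln t" by simp
    have "s * ln t - \<delta> * (s * \<bar>ln t\<bar>) = s * (1 - \<delta>) * ln t" using l by (simp add: algebra_simps)
    also have "\<dots> \<le> m * ln t" using m l by (intro mult_right_mono) auto
    finally show ?thesis .
  next
    assume m: "t \<le> 1 \<and> m \<le> s * (1 + \<delta>)"
    then have l: "ln t \<le> 0" using t0 by simp
    have "s * ln t - \<delta> * (s * \<bar>ln t\<bar>) = s * (1 + \<delta>) * ln t" using l by (simp add: algebra_simps)
    also have "\<dots> \<le> m * ln t" using m l by (intro mult_right_mono_neg) auto
    finally show ?thesis .
  qed
  then have "exp (s * ln t - \<delta> * (s * \<bar>ln t\<bar>)) \<le> exp (m * ln t)" by simp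
  also have "\<dots> = t ^ m" using t0 by (simp add: exp_of_nat_mult)
  finally show ?thesis .
qed

section \<open>Exponential tilting against typical labellings\<close>

lemma bexp_weights_le:
  assumes P: "finite P" and p: "\<And>e. e \<in> P \<Longrightarrow> 0 \<le> p e \<and> p e \<le> 1" and w: "\<And>e. 0 \<le> w e"
  shows "bexp P p (\<lambda>G. \<Prod>e\<in>G. w e) \<le> exp (\<Sum>e\<in>P. p e * (w e - 1))"
proof -
  have "bexp P p (\<lambda>G. \<Prod>e\<in>G. w e) = bexp P p (\<lambda>G. \<Prod>e\<in>P. if e \<in> G then w e else 1)"
  proof (rule bexp_cong)
    fix G assume "G \<subseteq> P"
    then have "P \<inter> G = G" by auto
    then show "(\<Prod>e\<in>G. w e) = (\<Prod>e\<in>P. if e \<in> G then w e else 1)"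
      using prod.inter_restrict[OF P, of w G] by simp
  qed
  also have "\<dots> = (\<Prod>e\<in>P. p e * w e + (1 - p e) * 1)" by (rule bexp_prod[OF P])
  also have "\<dots> \<le> (\<Prod>e\<in>P. exp (p e * (w e - 1)))"
  proof (intro prod_mono conjI)
    fix e assume e: "e \<in> P"
    show "0 \<le> p e * w e + (1 - p e) * 1" using p[OF e] w[of e] by simp
    have "p e * w e + (1 - p e) * 1 = 1 + p e * (w e - 1)" by (simp add: algebra_simps)
    also have "\<dots> \<le> exp (p e * (w e - 1))" by (rule exp_ge_add_one_self)
    finally show "p e * w e + (1 - p e) * 1 \<le> exp (p e * (w e - 1))" .
  qed
  also have "\<dots> = exp (\<Sum>e\<in>P. p e * (w e - 1))" by (rule exp_sum[OF P, symmetric])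
  finally show ?thesis .
qed

context
  fixes n k :: nat and a b c d :: real
  assumes ab: "0 \<le> a" "0 \<le> b" "max a b \<le> c" and n: "2 * c \<le> n" "n > 0" "max a b < n" and k: "k > 0"
    and d: "d = (a + (real k - 1) * b) / k" "d > 0"
begin

lemma d_between: "min a b \<le> d" "d \<le> max a b"
proof -
  have k1: "0 \<le> real k - 1" using k by simp
  have "k * min a b = min a b + (real k - 1) * min a b" by (simp add: algebra_simps)
  also have "\<dots> \<le> a + (real k - 1) * b" using k1 by (intro add_mono mult_left_mono) auto
  finally show "min a b \<le> d" unfolding d(1) using k by (simp add: pos_le_divide_eq mult.commute)
  have "a + (real k - 1) * b \<le> max a b + (real k - 1) * max a b" using k1 by (intro add_mono mult_left_mono) auto
  also have "\<dots> = k * max a b" by (simp add: algebra_simps)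
  finally show "d \<le> max a b" unfolding d(1) using k by (simp add: pos_divide_le_eq mult.commute)
qed

text \<open>Expanded in the two monochromaticity indicators, the sum is linear in the numbers of
  pairs monochromatic for \<open>x\<close>, for \<open>y\<close> and for both. At exact balance and
  overlaps n/k^2 its leading part vanishes because \<open>d\<close> is the mean edge parameter;
  imbalance and the overlap excess \<open>\<zeta>\<close> are what is left.\<close>

lemma tilt_sum_le:
  fixes \<delta> \<zeta> :: real
  assumes x: "x \<in> balanced n k \<delta>" and y: "y \<in> balanced n k \<delta>"
    and ov: "\<And>i j. i < k \<Longrightarrow> j < k \<Longrightarrow> overlap n x y i j \<le> n * (1 / (real k)\<^sup>2 + \<zeta>)"
  shows "(\<Sum>e\<in>vertex_pairs n. edge_prob n a b x e * ((if monochromatic y e then a else b) / d - 1))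
    \<le> c\<^sup>2 / d * (n * (k * \<delta>\<^sup>2 + \<zeta> / 2) + 3)"
proof -
  let ?P = "vertex_pairs n"
  define N where "N = real (card ?P)"
  define X where "X = mono_pairs n x"
  define Y where "Y = mono_pairs n y"
  define Z where "Z = (\<Sum>e\<in>?P. of_bool (monochromatic x e) * of_bool (monochromatic y e) :: real)"
  define D where "D = (k * \<delta>\<^sup>2 * (real n)\<^sup>2 + 2 * real n) / 2"
  have dc: "0 \<le> d" "d \<le> c" "0 \<le> c" using d(2) d_between ab by linarith+
  have "(\<Sum>e\<in>?P. edge_prob n a b x e * ((if monochromatic y e then a else b) / d - 1))
      = (\<Sum>e\<in>?P. (b * (b - d) + b * (a - b) * of_bool (monochromatic y e) + (a - b) * (b - d) * of_bool (monochromatic x e)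
          + (a - b)\<^sup>2 * (of_bool (monochromatic x e) * of_bool (monochromatic y e))) / (n * d))"
    using d(2) n(2) by (intro sum.cong refl) (auto simp: edge_prob_def field_simps power2_eq_square)
  also have "\<dots> = (b * (b - d) * N + b * (a - b) * Y + (a - b) * (b - d) * X + (a - b)\<^sup>2 * Z) / (n * d)"
    unfolding sum_divide_distrib[symmetric] sum.distrib sum_distrib_left[symmetric] X_def Y_def Z_def N_def mono_pairs_eq_sum
    by (simp add: mult.commute)
  also have "\<dots> \<le> c\<^sup>2 * (n / 2 + 2 * D + (real n)\<^sup>2 * \<zeta> / 2) / (n * d)"
  proof (rule divide_right_mono)
    define N0 where "N0 = (real n)\<^sup>2 / 2"
    \<comment> \<open>The expression factors, and one factor is the difference between the mean
      parameter b + (a - b)/k and \<open>d\<close>.\<close>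
    have zero: "b * (b - d) * N0 + b * (a - b) * (N0 / k) + (a - b) * (b - d) * (N0 / k) + (a - b)\<^sup>2 * (N0 / (real k)\<^sup>2) = 0"
    proof -
      have "d = b + (a - b) / k" unfolding d(1) using k by (simp add: field_simps)
      then have e0: "b - d + (a - b) / k = 0" by simp
      have "b * (b - d) * N0 + b * (a - b) * (N0 / k) + (a - b) * (b - d) * (N0 / k) + (a - b)\<^sup>2 * (N0 / (real k)\<^sup>2)
          = N0 * ((b + (a - b) / k) * (b - d + (a - b) / k))"
        using k by (simp add: field_simps power2_eq_square)
      then show ?thesis unfolding e0 by simp
    qed
    have bd: "\<bar>b * (b - d)\<bar> \<le> c\<^sup>2" "\<bar>b * (a - b)\<bar> \<le> c\<^sup>2" "\<bar>(a - b) * (b - d)\<bar> \<le> c\<^sup>2" "\<bar>(a - b)\<^sup>2\<bar> \<le> c\<^sup>2"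
      unfolding abs_mult power2_eq_square using ab dc d_between by (intro mult_mono; linarith)+
    have "\<bar>N - N0\<bar> \<le> n / 2" unfolding N_def N0_def card_vertex_pairs by (simp add: power2_eq_square field_simps)
    moreover have "\<bar>Y - N0 / k\<bar> \<le> D" "\<bar>X - N0 / k\<bar> \<le> D"
      using balanced_mono_pairs(1)[OF y n(2) k] balanced_mono_pairs(1)[OF x n(2) k]
      by (simp_all add: X_def Y_def D_def N0_def)
    moreover have "Z - N0 / (real k)\<^sup>2 \<le> (real n)\<^sup>2 * \<zeta> / 2"
    proof -
      have "2 * Z \<le> (real n)\<^sup>2 * (1 / (real k)\<^sup>2 + \<zeta>) - n" unfolding Z_def
        by (rule sum_overlap_squares_le[OF balanced_imp_labellings[OF x] balanced_imp_labellings[OF y] ov])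
      then show ?thesis by (simp add: N0_def algebra_simps)
    qed
    moreover have le: "p * (u - u') \<le> c\<^sup>2 * v" if "\<bar>p\<bar> \<le> c\<^sup>2" "\<bar>u - u'\<bar> \<le> v" for p u u' v :: real
    proof -
      have "p * (u - u') \<le> \<bar>p\<bar> * \<bar>u - u'\<bar>" by (metis abs_ge_self abs_mult)
      also have "\<dots> \<le> c\<^sup>2 * v" using that by (intro mult_mono) auto
      finally show ?thesis .
    qed
    \<comment> \<open>Nonnegative \<open>\<zeta>\<close> is forced: the k^2 overlaps sum to
      \<open>n\<close>, so they cannot all lie below n/k^2.\<close>
    moreover have "0 \<le> (real n)\<^sup>2 * \<zeta> / 2"
    proof -
      have i0: "0 < k" by (rule k)
      show ?thesis
      proof (rule ccontr)
        assume "\<not> ?thesis"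
        then have "\<zeta> < 0" using n by (simp add: zero_le_mult_iff)
        have "(\<Sum>i<k. \<Sum>j<k. overlap n x y i j) \<le> (\<Sum>i<k. \<Sum>j<k. n * (1 / (real k)\<^sup>2 + \<zeta>))"
          using ov by (intro sum_mono) auto
        moreover have "(\<Sum>i<k. \<Sum>j<k. overlap n x y i j) = n"
        proof -
          have "(\<Sum>i<k. \<Sum>j<k. overlap n x y i j) = (\<Sum>i<k. class_size n x i)"
            by (intro sum.cong refl sum_overlap_right) (rule labellings_less[OF balanced_imp_labellings[OF y]])
          also have "\<dots> = n" by (rule sum_class_size) (use labellings_less[OF balanced_imp_labellings[OF x]] in auto)
          finally show ?thesis .
        qed
        moreover have "(\<Sum>i<k. \<Sum>j<k. n * (1 / (real k)\<^sup>2 + \<zeta>)) = n + n * (real k)\<^sup>2 * \<zeta>"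
          using k by (simp add: power2_eq_square field_simps)
        moreover have "n * (real k)\<^sup>2 * \<zeta> < 0" using \<open>\<zeta> < 0\<close> n k by (intro mult_pos_neg) auto
        ultimately show False by linarith
      qed
    qed
    ultimately have
      "b * (b - d) * (N - N0) \<le> c\<^sup>2 * (n / 2)" "b * (a - b) * (Y - N0 / k) \<le> c\<^sup>2 * D"
      "(a - b) * (b - d) * (X - N0 / k) \<le> c\<^sup>2 * D" "(a - b)\<^sup>2 * (Z - N0 / (real k)\<^sup>2) \<le> c\<^sup>2 * ((real n)\<^sup>2 * \<zeta> / 2)"
    proof -
      assume h: "\<bar>N - N0\<bar> \<le> n / 2" "\<bar>Y - N0 / k\<bar> \<le> D" "\<bar>X - N0 / k\<bar> \<le> D" "Z - N0 / (real k)\<^sup>2 \<le> (real n)\<^sup>2 * \<zeta> / 2"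
        "0 \<le> (real n)\<^sup>2 * \<zeta> / 2"
      show "b * (b - d) * (N - N0) \<le> c\<^sup>2 * (n / 2)" by (rule le[OF bd(1) h(1)])
      show "b * (a - b) * (Y - N0 / k) \<le> c\<^sup>2 * D" by (rule le[OF bd(2) h(2)])
      show "(a - b) * (b - d) * (X - N0 / k) \<le> c\<^sup>2 * D" by (rule le[OF bd(3) h(3)])
      have "(a - b)\<^sup>2 * (Z - N0 / (real k)\<^sup>2) \<le> (a - b)\<^sup>2 * ((real n)\<^sup>2 * \<zeta> / 2)" using h(4) by (intro mult_left_mono) auto
      also have "\<dots> \<le> c\<^sup>2 * ((real n)\<^sup>2 * \<zeta> / 2)" using bd(4) h(5) by (intro mult_right_mono) auto
      finally show "(a - b)\<^sup>2 * (Z - N0 / (real k)\<^sup>2) \<le> c\<^sup>2 * ((real n)\<^sup>2 * \<zeta> / 2)" .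
    qed
    then have "b * (b - d) * (N - N0) + b * (a - b) * (Y - N0 / k) + (a - b) * (b - d) * (X - N0 / k) + (a - b)\<^sup>2 * (Z - N0 / (real k)\<^sup>2)
        \<le> c\<^sup>2 * (n / 2) + c\<^sup>2 * D + c\<^sup>2 * D + c\<^sup>2 * ((real n)\<^sup>2 * \<zeta> / 2)" by (intro add_mono)
    then show "b * (b - d) * N + b * (a - b) * Y + (a - b) * (b - d) * X + (a - b)\<^sup>2 * Z
        \<le> c\<^sup>2 * (n / 2 + 2 * D + (real n)\<^sup>2 * \<zeta> / 2)"
      using zero unfolding right_diff_distrib distrib_left by linarith
  qed (use d(2) in auto)
  also have "\<dots> = c\<^sup>2 / d * (n * (k * \<delta>\<^sup>2 + \<zeta> / 2) + 5 / 2)"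
    using n(2) d(2) unfolding D_def by (simp add: field_simps power2_eq_square)
  also have "\<dots> \<le> c\<^sup>2 / d * (n * (k * \<delta>\<^sup>2 + \<zeta> / 2) + 3)" using d(2) by (intro mult_left_mono) auto
  finally show ?thesis .
qed

text \<open>\<open>d\<close> lies between \<open>a\<close> and \<open>b\<close>, so in either case
  the inequalities of \<open>typical_set\<close> point in the direction that makes the tilted weight
  large.\<close>

lemma typical_weight_ge:
  fixes \<delta> :: real
  assumes x: "x \<in> typical_set n k a b \<delta> G" and G: "G \<subseteq> vertex_pairs n" and \<delta>: "\<delta> > 0"
  defines "L \<equiv> (a * \<bar>ln (a / d)\<bar> + (real k - 1) * b * \<bar>ln (b / d)\<bar>) / (2 * real k)"
  shows "exp (n * (kl_rate k a b d / 2 - \<delta> * L)) \<le> (\<Prod>e\<in>G. (if monochromatic x e then a else b) / d)"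
proof -
  have finG: "finite G" by (rule finite_subset[OF G finite_vertex_pairs])
  define A where "A = a * n / (2 * real k)"
  define B where "B = b * n * (real k - 1) / (2 * real k)"
  define i where "i = card {e \<in> G. monochromatic x e}"
  define j where "j = card {e \<in> G. \<not> monochromatic x e}"
  have AB: "0 \<le> A" "0 \<le> B" using ab k by (auto simp: A_def B_def)
  have i: "E_in G x = i" and j: "E_out G x = j" by (simp_all add: E_in_def E_out_def i_def j_def)
  have "(\<Prod>e\<in>G. (if monochromatic x e then a else b) / d) = (\<Prod>e\<in>G. if monochromatic x e then a / d else b / d)"
    by (intro prod.cong refl) auto
  also have "\<dots> = (a / d) ^ i * (b / d) ^ j"
    using finG by (simp add: prod.If_cases i_def j_def Int_def)
  finally have eq: "(\<Prod>e\<in>G. (if monochromatic x e then a else b) / d) = (a / d) ^ i * (b / d) ^ j" .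
  have cases: "((1 \<le> a / d \<and> A * (1 - \<delta>) \<le> i) \<or> (a / d \<le> 1 \<and> i \<le> A * (1 + \<delta>)))
      \<and> ((1 \<le> b / d \<and> B * (1 - \<delta>) \<le> j) \<or> (b / d \<le> 1 \<and> j \<le> B * (1 + \<delta>)))"
  proof (cases "a \<ge> b")
    case True
    then have "b \<le> d" "d \<le> a" using d_between by auto
    then have "1 \<le> a / d" "b / d \<le> 1" using d(2) by (auto simp: pos_le_divide_eq pos_divide_le_eq)
    then show ?thesis using x True unfolding typical_set_def A_def B_def by (auto simp: i j)
  next
    case False
    then have "a \<le> d" "d \<le> b" using d_between by auto
    then have "1 \<le> b / d" "a / d \<le> 1" using d(2) by (auto simp: pos_le_divide_eq pos_divide_le_eq)
    then show ?thesis using x False unfolding typical_set_def A_def B_def by (auto simp: i j)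
  qed
  have "exp (A * ln (a / d) - \<delta> * (A * \<bar>ln (a / d)\<bar>)) \<le> (a / d) ^ i"
    by (rule power_ge_exp) (use ab d(2) AB \<delta> cases in \<open>auto simp: A_def\<close>)
  moreover have "exp (B * ln (b / d) - \<delta> * (B * \<bar>ln (b / d)\<bar>)) \<le> (b / d) ^ j"
    by (rule power_ge_exp) (use ab d(2) AB \<delta> cases in \<open>auto simp: B_def\<close>)
  ultimately have "exp (A * ln (a / d) - \<delta> * (A * \<bar>ln (a / d)\<bar>)) * exp (B * ln (b / d) - \<delta> * (B * \<bar>ln (b / d)\<bar>))
      \<le> (a / d) ^ i * (b / d) ^ j"
    using ab d(2) by (intro mult_mono) auto
  moreover have "n * (kl_rate k a b d / 2 - \<delta> * L)
      = (A * ln (a / d) - \<delta> * (A * \<bar>ln (a / d)\<bar>)) + (B * ln (b / d) - \<delta> * (B * \<bar>ln (b / d)\<bar>))"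
    unfolding A_def B_def L_def kl_rate_def using k by (simp add: field_simps)
  ultimately show ?thesis unfolding eq by (simp add: exp_add)
qed

text \<open>For a fixed candidate \<open>y\<close>, Markov's inequality for the tilted weight under
  the law planted by \<open>x\<close>; the sum over all candidates contributes
  \<open>real k ^ n\<close>.\<close>

lemma bad_typical_expectation_le:
  fixes \<delta> \<epsilon> :: real
  assumes k2: "k \<ge> 2" and \<delta>: "\<delta> > 0" and \<epsilon>: "\<epsilon> > 0"
  defines "L \<equiv> (a * \<bar>ln (a / d)\<bar> + (real k - 1) * b * \<bar>ln (b / d)\<bar>) / (2 * real k)"
  defines "\<theta> \<equiv> \<delta> * L + c\<^sup>2 / d * (k * \<delta>\<^sup>2 + (2 * \<delta> / k + \<epsilon>) / 2)"
  shows "sbm_exp n k a b (\<lambda>x G. \<Sum>y\<in>labellings n k. of_bool (x \<in> balanced n k \<delta> \<and> y \<in> typical_set n k a b \<delta> G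
      \<and> agreement n k x y < 1 / k + \<epsilon>))
    \<le> real k ^ n * exp (n * (\<theta> - kl_rate k a b d / 2) + 3 * c\<^sup>2 / d)"
proof -
  define B where "B = exp (n * (\<theta> - kl_rate k a b d / 2) + 3 * c\<^sup>2 / d)"
  have each: "bexp (vertex_pairs n) (edge_prob n a b x) (\<lambda>G. of_bool (x \<in> balanced n k \<delta> \<and> y \<in> typical_set n k a b \<delta> G
      \<and> agreement n k x y < 1 / k + \<epsilon>)) \<le> B" for x y
  proof (cases "x \<in> balanced n k \<delta> \<and> y \<in> balanced n k \<delta> \<and> agreement n k x y < 1 / k + \<epsilon>")
    case True
    let ?E = "bexp (vertex_pairs n) (edge_prob n a b x)"
    let ?w = "\<lambda>e. (if monochromatic y e then a else b) / d"
    define Y where "Y = n * (kl_rate k a b d / 2 - \<delta> * L)"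
    have ov: "overlap n x y i j \<le> n * (1 / (real k)\<^sup>2 + (2 * \<delta> / k + \<epsilon>))" if "i < k" "j < k" for i j
      using True \<epsilon> that by (intro overlap_le_of_agreement[OF _ _ k2 n(2)]) auto
    have "?E (\<lambda>G. of_bool (x \<in> balanced n k \<delta> \<and> y \<in> typical_set n k a b \<delta> G \<and> agreement n k x y < 1 / k + \<epsilon>))
        \<le> ?E (\<lambda>G. exp (- Y) * (\<Prod>e\<in>G. ?w e))"
    proof (rule bexp_mono)
      fix G assume G: "G \<subseteq> vertex_pairs n"
      have nn: "0 \<le> (\<Prod>e\<in>G. ?w e)" using ab d(2) by (intro prod_nonneg) auto
      show "of_bool (x \<in> balanced n k \<delta> \<and> y \<in> typical_set n k a b \<delta> G \<and> agreement n k x y < 1 / k + \<epsilon>)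
          \<le> exp (- Y) * (\<Prod>e\<in>G. ?w e)"
      proof (cases "y \<in> typical_set n k a b \<delta> G")
        case T: True
        have "exp Y \<le> (\<Prod>e\<in>G. ?w e)" unfolding Y_def L_def by (rule typical_weight_ge[OF T G \<delta>])
        then have "exp (- Y) * exp Y \<le> exp (- Y) * (\<Prod>e\<in>G. ?w e)" by (intro mult_left_mono) auto
        then show ?thesis using True T by (simp add: exp_minus)
      qed (use nn in auto)
    qed (rule edge_prob_01[OF ab n k d])
    also have "\<dots> = exp (- Y) * ?E (\<lambda>G. \<Prod>e\<in>G. ?w e)" by (rule bexp_cmult)
    also have "\<dots> \<le> exp (- Y) * exp (\<Sum>e\<in>vertex_pairs n. edge_prob n a b x e * (?w e - 1))"
    proof (intro mult_left_mono bexp_weights_le)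
      show "0 \<le> ?w e" for e using ab d(2) by auto
    qed (use edge_prob_01[OF ab n k d] in auto)
    also have "\<dots> \<le> exp (- Y) * exp (c\<^sup>2 / d * (n * (k * \<delta>\<^sup>2 + (2 * \<delta> / k + \<epsilon>) / 2) + 3))"
      using True tilt_sum_le[of x \<delta> y "2 * \<delta> / k + \<epsilon>"] ov by (intro mult_left_mono) auto
    also have "\<dots> = B"
      unfolding B_def Y_def \<theta>_def exp_add[symmetric] by (simp add: algebra_simps)
    finally show ?thesis .
  next
    case False
    then have "bexp (vertex_pairs n) (edge_prob n a b x) (\<lambda>G. of_bool (x \<in> balanced n k \<delta> \<and> y \<in> typical_set n k a b \<delta> G
        \<and> agreement n k x y < 1 / k + \<epsilon>)) = bexp (vertex_pairs n) (edge_prob n a b x) (\<lambda>_. 0)"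
      using typical_subset_balanced by (intro bexp_cong) fastforce
    then show ?thesis by (simp add: bexp_const B_def)
  qed
  have "sbm_exp n k a b (\<lambda>x G. \<Sum>y\<in>labellings n k. of_bool (x \<in> balanced n k \<delta> \<and> y \<in> typical_set n k a b \<delta> G
      \<and> agreement n k x y < 1 / k + \<epsilon>)) \<le> label_exp n k (\<lambda>x. \<Sum>y\<in>labellings n k. B)"
    unfolding sbm_exp_def bexp_sum by (intro label_exp_mono sum_mono each)
  also have "\<dots> = real k ^ n * B" using k by (simp add: label_exp_const card_labellings)
  finally show ?thesis by (simp add: B_def)
qed

end

section \<open>The dual root\<close>

text \<open>The iteration increases to a fixed point of t = exp (- d (1 - t)). Staying below tau/d
  excludes the fixed point 1, and \<open>d\<close> times the limit then solves the equation that
  defines \<open>dual_root\<close>.\<close>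

lemma ext_prob_tendsto:
  assumes d: "d > 1"
  shows "ext_prob d \<longlonglongrightarrow> dual_root d / d"
proof -
  define q where "q = dual_root d / d"
  define f where "f t = exp (- (d * (1 - t)))" for t :: real
  have ext: "ext_prob d (Suc r) = f (ext_prob d r)" for r by (simp add: f_def)
  have mono: "f s \<le> f t" if "s \<le> t" for s t using that d by (simp add: f_def)
  have q: "0 < q" "q < 1" using dual_root_pos[OF d] dual_root_less_1[OF d] d by (auto simp: q_def)
  have fq: "f q = q"
  proof -
    have "exp (- d) * exp (dual_root d) * d = dual_root d * exp (- dual_root d) * exp (dual_root d)"
      using dual_root_eq[OF d] by simp
    also have "\<dots> = dual_root d" by (simp add: exp_minus)
    finally have "exp (- d) * exp (dual_root d) = q" using d by (simp add: q_def field_simps)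
    moreover have "f q = exp (- d) * exp (dual_root d)"
      unfolding f_def exp_add[symmetric] q_def using d by (simp add: algebra_simps)
    ultimately show ?thesis by simp
  qed
  have le_q: "ext_prob d r \<le> q" for r
  proof (induction r)
    case (Suc r)
    then show ?case unfolding ext using mono[of "ext_prob d r" q] fq by simp
  qed (use q in simp)
  have inc: "ext_prob d r \<le> ext_prob d (Suc r)" for r
  proof (induction r)
    case 0
    show ?case by simp
  next
    case (Suc r)
    then show ?case unfolding ext by (rule mono)
  qed
  have incs: "incseq (ext_prob d)" by (rule incseq_SucI) (rule inc)
  obtain l where l: "ext_prob d \<longlonglongrightarrow> l" "\<And>r. ext_prob d r \<le> l"
    using incseq_convergent[OF incs, of q] le_q by blast
  have lq: "l \<le> q" by (rule LIMSEQ_le_const2[OF l(1)]) (use le_q in auto)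
  have l0: "0 < l" using less_le_trans[OF _ l(2)[of "Suc 0"], of 0] by simp
  have "(\<lambda>r. f (ext_prob d r)) \<longlonglongrightarrow> f l" unfolding f_def by (intro tendsto_intros l(1))
  moreover have "(\<lambda>r. f (ext_prob d r)) \<longlonglongrightarrow> l" using LIMSEQ_Suc[OF l(1)] by (simp only: ext)
  ultimately have fl: "f l = l" by (rule LIMSEQ_unique)
  have "l * exp (- (d * l)) = exp (- d)"
  proof -
    have "l * exp (- (d * l)) = f l * exp (- (d * l))" using fl by simp
    also have "\<dots> = exp (- d)" unfolding f_def exp_add[symmetric] by (simp add: algebra_simps)
    finally show ?thesis .
  qed
  then have "d * l * exp (- (d * l)) = d * exp (- d)" by simp
  moreover have "0 < d * l" using d l0 by simp
  moreover have "d * l < 1"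
  proof -
    have "d * l \<le> d * q" using lq d by (intro mult_left_mono) auto
    also have "\<dots> = dual_root d" using d by (simp add: q_def)
    finally show ?thesis using dual_root_less_1[OF d] by simp
  qed
  ultimately have "d * l = dual_root d"
    using dual_root_ex1[OF d] dual_root_pos[OF d] dual_root_less_1[OF d] dual_root_eq[OF d] by blast
  then have "l = dual_root d / d" using d by (simp add: field_simps)
  then show ?thesis using l(1) by simp
qed

lemma exp_minus_one_minus_dual_root:
  assumes d: "d > 1"
  defines "q \<equiv> dual_root d / d"
  shows "exp (- (d * (1 - q))) = q"
proof -
  have "(\<lambda>r. exp (- (d * (1 - ext_prob d r)))) \<longlonglongrightarrow> exp (- (d * (1 - q)))"
    unfolding q_def by (intro tendsto_intros ext_prob_tendsto[OF d])
  then have "(\<lambda>r. ext_prob d (Suc r)) \<longlonglongrightarrow> exp (- (d * (1 - q)))" by (simp only: ext_prob.simps)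
  then show ?thesis by (rule LIMSEQ_unique) (unfold q_def, rule LIMSEQ_Suc[OF ext_prob_tendsto[OF d]])
qed

text \<open>In the limit of many rounds the inequality is the hypothesis multiplied by a positive
  factor; being strict, it already holds for some finite \<open>r\<close>.\<close>

lemma peeling_gap:
  fixes d I lk :: real
  assumes d: "d > 1" and lk: "0 \<le> lk" and I: "I > (1 - dual_root d) / (1 - dual_root d / d) * (2 * lk)"
  shows "\<exists>r. let \<mu> = d * (1 - ext_prob d r) in
    lk - I / 2 < lk * ((1 + \<mu>) * exp (- \<mu>)) - I / 2 * (1 - (1 - ext_prob d (Suc r))\<^sup>2)"
proof -
  define \<tau> where "\<tau> = dual_root d"
  define q where "q = \<tau> / d"
  have q: "0 < q" "q < 1" using dual_root_pos[OF d] dual_root_less_1[OF d] d by (auto simp: q_def \<tau>_def)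
  have dq: "d * q = \<tau>" using d by (simp add: q_def)
  define \<mu> where "\<mu> = d * (1 - q)"
  have e: "exp (- \<mu>) = q" unfolding \<mu>_def q_def \<tau>_def by (rule exp_minus_one_minus_dual_root[OF d])
  define K where "K = lk * ((1 + \<mu>) * exp (- \<mu>)) - I / 2 * (1 - (1 - q)\<^sup>2)"
  have "(1 + \<mu>) * q = 1 - (1 - q) * (1 - \<tau>)"
    unfolding \<mu>_def dq[symmetric] by (simp add: algebra_simps)
  then have ke: "(1 + \<mu>) * exp (- \<mu>) = 1 - (1 - q) * (1 - \<tau>)" unfolding e .
  have "K - (lk - I / 2) = (1 - q) * ((1 - q) * (I / 2) - (1 - \<tau>) * lk)"
    unfolding K_def ke by (simp add: field_simps power2_eq_square)
  moreover have "(1 - q) * (I / 2) > (1 - \<tau>) * lk"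
  proof -
    have "I > (1 - \<tau>) / (1 - q) * (2 * lk)" using I by (simp add: \<tau>_def q_def)
    then have "(1 - q) * I > (1 - q) * ((1 - \<tau>) / (1 - q) * (2 * lk))" using q by (intro mult_strict_left_mono) auto
    also have "(1 - q) * ((1 - \<tau>) / (1 - q) * (2 * lk)) = (1 - \<tau>) * (2 * lk)" using q by simp
    finally show ?thesis by simp
  qed
  ultimately have gap: "lk - I / 2 < K" using mult_pos_pos[of "1 - q" "(1 - q) * (I / 2) - (1 - \<tau>) * lk"] q by linarith
  have "(\<lambda>r. lk * ((1 + d * (1 - ext_prob d r)) * exp (- (d * (1 - ext_prob d r)))) - I / 2 * (1 - (1 - ext_prob d (Suc r))\<^sup>2))
      \<longlonglongrightarrow> lk * ((1 + d * (1 - q)) * exp (- (d * (1 - q)))) - I / 2 * (1 - (1 - q)\<^sup>2)"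
    unfolding q_def \<tau>_def by (intro tendsto_intros ext_prob_tendsto[OF d] LIMSEQ_Suc[OF ext_prob_tendsto[OF d]])
  then have "\<forall>\<^sub>F r in sequentially. lk - I / 2 <
      lk * ((1 + d * (1 - ext_prob d r)) * exp (- (d * (1 - ext_prob d r)))) - I / 2 * (1 - (1 - ext_prob d (Suc r))\<^sup>2)"
    by (rule order_tendstoD) (use gap in \<open>simp add: K_def \<mu>_def\<close>)
  then obtain r where "lk - I / 2 <
      lk * ((1 + d * (1 - ext_prob d r)) * exp (- (d * (1 - ext_prob d r)))) - I / 2 * (1 - (1 - ext_prob d (Suc r))\<^sup>2)"
    using eventually_happens'[OF sequentially_bot] by blast
  then show ?thesis unfolding Let_def by blast
qed

lemma kl_rate_eq:
  fixes a b d :: real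
  assumes ab: "0 \<le> a" "0 \<le> b" and k: "k > 0" and d: "d = (a + (real k - 1) * b) / k" "d > 0"
  shows "kl_rate k a b d = (a * ln a + (real k - 1) * b * ln b) / k - d * ln d"
proof -
  have *: "t * ln (t / d) = t * ln t - t * ln d" if "0 \<le> t" for t
    using that d(2) by (cases "t = 0") (auto simp: ln_div algebra_simps)
  have "kl_rate k a b d = (a * ln (a / d) + (real k - 1) * (b * ln (b / d))) / k" by (simp add: kl_rate_def mult.assoc)
  also have "\<dots> = (a * ln a + (real k - 1) * b * ln b) / k - (a + (real k - 1) * b) / k * ln d"
    unfolding *[OF ab(1)] *[OF ab(2)] using k by (simp add: field_simps)
  finally show ?thesis using d(1) by simp
qed

section \<open>The sampling algorithm\<close>

lemma measure_bind_pmf: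
  "measure_pmf.prob (bind_pmf p f) X = measure_pmf.expectation p (\<lambda>x. measure_pmf.prob (f x) X)"
proof -
  have "ennreal (measure_pmf.prob (bind_pmf p f) X) = (\<integral>\<^sup>+x. ennreal (measure_pmf.prob (f x) X) \<partial>measure_pmf p)"
    unfolding measure_pmf.emeasure_eq_measure[symmetric] by (rule emeasure_bind_pmf)
  also have "\<dots> = ennreal (measure_pmf.expectation p (\<lambda>x. measure_pmf.prob (f x) X))"
    by (intro nn_integral_eq_integral measure_pmf.integrable_const_bound[of _ 1] AE_I2) auto
  finally show ?thesis by (subst (asm) ennreal_inj) (auto intro!: integral_nonneg_AE)
qed

text \<open>The default value \<open>False\<close> makes the random predicate the indicator of a
  subset of \<open>P\<close>, so the integral reduces to the finite sum.\<close>

lemma expectation_random_edges: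
  assumes P: "finite P" and p: "\<And>e. e \<in> P \<Longrightarrow> 0 \<le> p e \<and> p e \<le> 1"
  shows "measure_pmf.expectation (Pi_pmf P False (\<lambda>e. bernoulli_pmf (p e))) (\<lambda>g. F {e. g e}) = bexp P p F"
proof -
  define I where "I G = (\<lambda>e. e \<in> G)" for G :: "'a set"
  have inj: "inj_on I (Pow P)" by (rule inj_onI) (auto simp: I_def fun_eq_iff)
  have pmf: "pmf (Pi_pmf P False (\<lambda>e. bernoulli_pmf (p e))) (I G) = bern_weight P p G" if "G \<subseteq> P" for G
  proof -
    have "pmf (Pi_pmf P False (\<lambda>e. bernoulli_pmf (p e))) (I G) = (\<Prod>e\<in>P. pmf (bernoulli_pmf (p e)) (I G e))"
      by (rule pmf_Pi'[OF P]) (use that in \<open>auto simp: I_def\<close>)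
    also have "\<dots> = bern_weight P p G"
      unfolding bern_weight_def using p by (intro prod.cong refl) (auto simp: I_def)
    finally show ?thesis .
  qed
  have "measure_pmf.expectation (Pi_pmf P False (\<lambda>e. bernoulli_pmf (p e))) (\<lambda>g. F {e. g e})
      = (\<Sum>g\<in>I ` Pow P. F {e. g e} * pmf (Pi_pmf P False (\<lambda>e. bernoulli_pmf (p e))) g)"
  proof (rule integral_measure_pmf_real)
    show "finite (I ` Pow P)" using P by simp
    fix g assume "g \<in> set_pmf (Pi_pmf P False (\<lambda>e. bernoulli_pmf (p e)))"
    then have "\<not> g e" if "e \<notin> P" for e using set_Pi_pmf_subset[OF P] that by fastforce
    then have "g = I {e. g e}" "{e. g e} \<subseteq> P" by (auto simp: I_def)
    then show "g \<in> I ` Pow P" by blast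
  qed
  also have "\<dots> = (\<Sum>G\<in>Pow P. F {e. I G e} * pmf (Pi_pmf P False (\<lambda>e. bernoulli_pmf (p e))) (I G))"
    by (simp add: sum.reindex[OF inj])
  also have "\<dots> = bexp P p F"
    unfolding bexp_def using pmf by (intro sum.cong refl) (simp add: I_def)
  finally show ?thesis .
qed

lemma expectation_random_labels:
  assumes k: "k > 0"
  shows "measure_pmf.expectation (Pi_pmf {..<n} undefined (\<lambda>_. pmf_of_set {..<k})) F = label_exp n k F"
proof -
  have ne: "{..<k} \<noteq> {}" using k by auto
  let ?p = "Pi_pmf {..<n} undefined (\<lambda>_. pmf_of_set {..<k})"
  have pmf: "pmf ?p x = 1 / real k ^ n" if x: "x \<in> labellings n k" for x
  proof -
    have "pmf ?p x = (\<Prod>u\<in>{..<n}. pmf (pmf_of_set {..<k}) (x u))"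
      using x by (intro pmf_Pi') (auto simp: labellings_def)
    also have "\<dots> = (\<Prod>u\<in>{..<n}. 1 / real k)"
      using labellings_less[OF x] ne by (intro prod.cong refl) (simp add: pmf_of_set)
    finally show ?thesis by (simp add: power_divide)
  qed
  have "measure_pmf.expectation ?p F = (\<Sum>x\<in>labellings n k. F x * pmf ?p x)"
  proof (rule integral_measure_pmf_real[OF finite_labellings])
    fix x assume "x \<in> set_pmf ?p"
    then have "x \<in> PiE_dflt {..<n} undefined (set_pmf \<circ> (\<lambda>_. pmf_of_set {..<k}))"
      using set_Pi_pmf_subset'[OF finite_lessThan[of n], of undefined "\<lambda>_. pmf_of_set {..<k}"] by blast
    then show "x \<in> labellings n k"
      using ne by (auto simp: PiE_dflt_def labellings_def PiE_def extensional_def)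
  qed
  also have "\<dots> = label_exp n k F" by (simp add: pmf label_exp_def sum_divide_distrib)
  finally show ?thesis .
qed

lemma prob_planted_and_output:
  fixes a b :: real
  assumes k: "k > 0" and p: "\<And>x e. 0 \<le> edge_prob n a b x e \<and> edge_prob n a b x e \<le> 1"
  shows "measure_pmf.prob (planted_and_output n k a b alg) {(x, y). Q x y}
    = sbm_exp n k a b (\<lambda>x G. measure_pmf.prob (alg G) {y. Q x y})"
proof -
  let ?L = "Pi_pmf {..<n} undefined (\<lambda>_. pmf_of_set {..<k})"
  let ?B = "\<lambda>x. Pi_pmf (vertex_pairs n) False (\<lambda>e. bernoulli_pmf (edge_prob n a b x e))"
  have "planted_and_output n k a b alg
      = bind_pmf ?L (\<lambda>x. bind_pmf (?B x) (\<lambda>g. map_pmf (Pair x) (alg {e. g e})))"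
    unfolding planted_and_output_def sbm_def edge_prob_def map_pmf_def
    by (simp add: bind_assoc_pmf bind_return_pmf)
  then have "measure_pmf.prob (planted_and_output n k a b alg) {(x, y). Q x y}
      = measure_pmf.expectation ?L (\<lambda>x. measure_pmf.expectation (?B x) (\<lambda>g. measure_pmf.prob (alg {e. g e}) {y. Q x y}))"
    by (simp add: measure_bind_pmf vimage_def)
  also have "\<dots> = sbm_exp n k a b (\<lambda>x G. measure_pmf.prob (alg G) {y. Q x y})"
    unfolding expectation_random_labels[OF k] sbm_exp_def
    by (intro label_exp_cong expectation_random_edges[where F = "\<lambda>G. measure_pmf.prob (alg G) _"]) (use p in auto)
  finally show ?thesis .
qed

section \<open>Failure events and choice of parameters\<close>

context
  fixes n k :: nat and a b c d :: real
  assumes ab: "0 \<le> a" "0 \<le> b" "max a b \<le> c" and n: "2 * c \<le> n" "n > 0" "max a b < n" and k: "k > 0"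
    and d: "d = (a + (real k - 1) * b) / k" "d > 0"
begin

text \<open>Four ways to fail: the planted labelling is not near-typical, the likelihood falls below
  its mean, fewer than \<open>M\<close> labellings are typical, or too many of them are bad. In the
  third case \<open>S\<close> bounds the log posterior and \<open>sbm_exp_small_set_le\<close>
  applies; the fourth is bounded by the expected number of bad labellings over
  \<open>M\<close>.\<close>

lemma success_probability_ge:
  fixes \<delta> \<delta>' \<epsilon> \<eta> M S :: real and fallback :: "nat \<Rightarrow> nat set set \<Rightarrow> nat \<Rightarrow> nat"
  assumes k2: "k \<ge> 2" and \<delta>: "\<delta> > 0" "0 < \<delta>'" "\<delta>' \<le> \<delta>" and \<epsilon>: "\<epsilon> > 0" and \<eta>: "\<eta> > 0"
    and \<eta>a: "a > 0 \<Longrightarrow> \<eta> \<le> \<delta> * (a / (2 * real k))" and \<eta>b: "b > 0 \<Longrightarrow> \<eta> \<le> \<delta> * (b * (real k - 1) / (2 * real k))"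
    and small: "2 * c * k * \<delta>'\<^sup>2 \<le> \<eta>" "4 * c \<le> \<eta> * n" and M: "M > 0"
    and S: "n * (kl_rate k a b d - d) / 2 + n * (\<eta> * (\<bar>ln (a / d)\<bar> + \<bar>ln (b / d)\<bar>) + c * k * \<delta>'\<^sup>2) + 2 * c + c * (c + 2 * \<eta>)
      - (label_entropy n k a b - n * ln k + (real n - 1) * (kl_rate k a b d - d) / 2 - \<eta> * n) - n * ln k \<le> S"
  defines "C \<equiv> max 1 ((2 * c / d) ^ 3)"
  defines "L \<equiv> (a * \<bar>ln (a / d)\<bar> + (real k - 1) * b * \<bar>ln (b / d)\<bar>) / (2 * real k)"
  defines "\<theta> \<equiv> \<delta> * L + c\<^sup>2 / d * (k * \<delta>\<^sup>2 + (2 * \<delta> / k + \<epsilon>) / 2)"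
  shows "1 - ((k / \<delta>'\<^sup>2 + 4 * c / \<eta>\<^sup>2) / n + (C * d + 2 * exp (C * d)) / \<eta>\<^sup>2 / n + M * exp S
      + 1 / M * (real k ^ n * exp (n * (\<theta> - kl_rate k a b d / 2) + 3 * c\<^sup>2 / d)))
    \<le> sbm_exp n k a b (\<lambda>x G. measure_pmf.prob (typicality_sampling fallback n k a b \<delta> G)
        {y. agreement n k x y \<ge> 1 / k + \<epsilon>})"
proof -
  define f where "f = log_likelihood n k a b d"
  define m where "m = sbm_exp n k a b (\<lambda>_. f)"
  define T where "T G = typical_set n k a b \<delta> G" for G
  let ?succ = "\<lambda>x G. measure_pmf.prob (typicality_sampling fallback n k a b \<delta> G) {y. agreement n k x y \<ge> 1 / k + \<epsilon>}"
  let ?F1 = "\<lambda>x G. of_bool (\<not> near_typical n k a b \<delta>' \<eta> x G) :: real"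
  let ?F2 = "\<lambda>G. of_bool (f G < m - \<eta> * n) :: real"
  let ?F3 = "\<lambda>x G. of_bool (x \<in> T G \<and> real (card (T G)) < M
      \<and> graph_weight n a b x G \<le> exp S * (real k ^ n * graph_prob n k a b G)) :: real"
  let ?F4 = "\<lambda>x G. (\<Sum>y\<in>labellings n k. of_bool (x \<in> balanced n k \<delta> \<and> y \<in> T G \<and> agreement n k x y < 1 / k + \<epsilon>)) :: real"
  have finT: "finite (T G)" for G
    unfolding T_def by (rule finite_subset[OF typical_subset_labellings finite_labellings])
  have point: "1 - ?succ x G \<le> ?F1 x G + ?F2 G + ?F3 x G + 1 / M * ?F4 x G"
    if x: "x \<in> labellings n k" and G: "G \<subseteq> vertex_pairs n" and w: "graph_weight n a b x G > 0" for x G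
  proof -
    have F4: "0 \<le> 1 / M * ?F4 x G" using M by (intro mult_nonneg_nonneg sum_nonneg) auto
    have le1: "1 - ?succ x G \<le> 1" by simp
    have nn: "0 \<le> ?F1 x G" "0 \<le> ?F2 G" "0 \<le> ?F3 x G" by simp_all
    consider "\<not> near_typical n k a b \<delta>' \<eta> x G" | "f G < m - \<eta> * n" | "real (card (T G)) < M" "near_typical n k a b \<delta>' \<eta> x G" "\<not> f G < m - \<eta> * n"
      | "\<not> real (card (T G)) < M" "near_typical n k a b \<delta>' \<eta> x G" by blast
    then show ?thesis
    proof cases
      case 1
      then have "?F1 x G = 1" by simp
      then show ?thesis using le1 nn F4 by linarith
    next
      case 2
      then have "?F2 G = 1" by simp
      then show ?thesis using le1 nn F4 by linarith
    next
      case 3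
      have xT: "x \<in> T G" unfolding T_def
        by (rule near_typical_imp_typical[OF 3(2) \<delta>(3,1) ab(1,2) k \<eta>a \<eta>b w G])
      define \<nu> where "\<nu> = (d / n) ^ card G"
      have \<nu>: "\<nu> > 0" using d(2) n by (simp add: \<nu>_def)
      have g: "graph_prob n k a b G > 0"
      proof -
        have "0 < real k ^ n * graph_prob n k a b G"
          using graph_weight_le_prob[OF ab n k d x, of G] w by linarith
        then show ?thesis using k by (simp add: zero_less_mult_iff)
      qed
      define u where "u = ln (graph_weight n a b x G / \<nu>)"
      have u: "u \<le> n * (kl_rate k a b d - d) / 2 + n * (\<eta> * (\<bar>ln (a / d)\<bar> + \<bar>ln (b / d)\<bar>) + c * k * \<delta>'\<^sup>2) + 2 * c + c * (c + 2 * \<eta>)"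
        unfolding u_def \<nu>_def using near_typical_log_weight_le[OF ab n k d 3(2) w G] \<eta> by simp
      have "label_entropy n k a b - n * ln k + (real n - 1) * (kl_rate k a b d - d) / 2 - \<eta> * n \<le> f G"
        using mean_log_likelihood_ge[OF ab n k d] 3(3) unfolding m_def f_def by linarith
      \<comment> \<open>This is the log posterior of \<open>x\<close>: the reference weight
        \<open>\<nu>\<close> cancels between \<open>u\<close> and \<open>f G\<close>.\<close>
      then have uS: "u - f G - n * ln k \<le> S" using u S by linarith
      have fG: "exp (f G) = graph_prob n k a b G / \<nu>"
        unfolding f_def log_likelihood_def \<nu>_def[symmetric] using g \<nu> by simp
      have "graph_weight n a b x G = \<nu> * exp u" unfolding u_def using w \<nu> by simp
      also have "\<dots> = \<nu> * exp (f G) * (exp (n * ln k) * exp (u - f G - n * ln k))"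
        unfolding exp_add[symmetric] mult.assoc by simp
      also have "\<dots> = graph_prob n k a b G * (real k ^ n * exp (u - f G - n * ln k))"
        unfolding fG using \<nu> k by (simp add: exp_of_nat_mult)
      also have "\<dots> \<le> graph_prob n k a b G * (real k ^ n * exp S)"
        using uS g by (intro mult_left_mono) auto
      finally have "graph_weight n a b x G \<le> exp S * (real k ^ n * graph_prob n k a b G)" by (simp add: mult_ac)
      then have "?F3 x G = 1" using xT 3(1) by simp
      then show ?thesis using le1 nn F4 by linarith
    next
      case 4
      have xT: "x \<in> T G" unfolding T_def
        by (rule near_typical_imp_typical[OF 4(2) \<delta>(3,1) ab(1,2) k \<eta>a \<eta>b w G])
      then have xb: "x \<in> balanced n k \<delta>" unfolding T_def by (rule typical_subset_balanced)
      have ne: "T G \<noteq> {}" using xT by auto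
      define good where "good = {y. agreement n k x y \<ge> 1 / k + \<epsilon>}"
      have cT: "real (card (T G)) > 0" using ne finT[of G] by (simp add: card_gt_0_iff)
      have succ: "?succ x G = card (T G \<inter> good) / card (T G)"
        using ne finT[of G] unfolding typicality_sampling_def T_def[symmetric] good_def[symmetric] by (simp add: measure_pmf_of_set)
      have "card (T G) = card (T G \<inter> good) + card (T G - good)"
        using card_Int_Diff[OF finT] by blast
      \<comment> \<open>Given the graph, the sampler fails with the fraction of bad elements in the
        typical set.\<close>
      then have "1 - ?succ x G = card (T G - good) / card (T G)"
        unfolding succ using cT by (simp add: field_simps)
      also have "\<dots> \<le> card (T G - good) / M" using 4(1) M cT by (intro divide_left_mono) auto
      also have "real (card (T G - good)) = ?F4 x G"
      proof -
        have "?F4 x G = (\<Sum>y\<in>labellings n k. if y \<in> T G - good then 1 else 0)"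
          using xb by (intro sum.cong refl) (auto simp: good_def)
        also have "\<dots> = (\<Sum>y\<in>labellings n k \<inter> (T G - good). 1)" by (rule sum.inter_restrict[symmetric]) simp
        also have "labellings n k \<inter> (T G - good) = T G - good"
          using typical_subset_labellings[of n k a b \<delta> G] by (auto simp: T_def)
        finally show ?thesis by simp
      qed
      finally have "1 - ?succ x G \<le> 1 / M * ?F4 x G" by simp
      then show ?thesis using nn by linarith
    qed
  qed
  have "1 - sbm_exp n k a b ?succ = sbm_exp n k a b (\<lambda>x G. 1 - ?succ x G)"
    unfolding sbm_exp_diff using k by (simp add: sbm_exp_const)
  also have "\<dots> \<le> sbm_exp n k a b (\<lambda>x G. ?F1 x G + ?F2 G + ?F3 x G + 1 / M * ?F4 x G)"
    by (rule sbm_exp_mono[OF ab n k d]) (rule point)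
  also have "\<dots> = sbm_exp n k a b ?F1 + sbm_exp n k a b (\<lambda>_. ?F2) + sbm_exp n k a b ?F3 + 1 / M * sbm_exp n k a b ?F4"
    unfolding sbm_exp_add sbm_exp_cmult ..
  also have "\<dots> \<le> (k / \<delta>'\<^sup>2 + 4 * c / \<eta>\<^sup>2) / n + (C * d + 2 * exp (C * d)) / \<eta>\<^sup>2 / n + M * exp S
      + 1 / M * (real k ^ n * exp (n * (\<theta> - kl_rate k a b d / 2) + 3 * c\<^sup>2 / d))"
  proof (intro add_mono mult_left_mono)
    show "sbm_exp n k a b ?F1 \<le> (k / \<delta>'\<^sup>2 + 4 * c / \<eta>\<^sup>2) / n"
      by (rule not_near_typical_le[OF ab n k d \<delta>(2) \<eta> small])
    show "sbm_exp n k a b (\<lambda>_. ?F2) \<le> (C * d + 2 * exp (C * d)) / \<eta>\<^sup>2 / n"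
      unfolding C_def m_def f_def by (rule log_likelihood_lower_tail[OF ab n k d \<eta>])
    show "sbm_exp n k a b ?F3 \<le> M * exp S"
      by (rule sbm_exp_small_set_le[OF ab n k d]) (use M in \<open>simp_all add: T_def typical_subset_labellings\<close>)
    show "sbm_exp n k a b ?F4 \<le> real k ^ n * exp (n * (\<theta> - kl_rate k a b d / 2) + 3 * c\<^sup>2 / d)"
      unfolding T_def \<theta>_def L_def by (rule bad_typical_expectation_le[OF ab n k d k2 \<delta>(1) \<epsilon>])
  qed (use M in simp)
  finally show ?thesis by linarith
qed

end

text \<open>Depends on the entropy only through its rate \<open>\<kappa>\<close>, so that both
  entropy bounds can be fed into it. The excess \<open>g\<close> over \<open>ln k - I / 2\<close> is
  the budget for all errors.\<close>

lemma typicality_sampling_succeeds: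
  fixes a b d \<kappa> :: real and k :: nat
  assumes ab: "0 \<le> a" "0 \<le> b" and k2: "k \<ge> 2" and d: "d = (a + (real k - 1) * b) / k" "d > 0"
    and gap: "\<kappa> > ln k - kl_rate k a b d / 2"
    and entropy: "\<And>\<eta>. \<eta> > 0 \<Longrightarrow> \<forall>\<^sub>F n in sequentially. n * (\<kappa> - \<eta>) \<le> label_entropy n k a b"
  shows "\<exists>\<delta>\<^sub>0>0. \<forall>\<delta>. 0 < \<delta> \<and> \<delta> < \<delta>\<^sub>0 \<longrightarrow> (\<exists>\<epsilon>>0. \<forall>fallback. (\<forall>n G. fallback n G \<in> labellings n k) \<longrightarrow>
    (\<lambda>n. measure_pmf.prob (planted_and_output n k a b (typicality_sampling fallback n k a b \<delta>))
       {(\<sigma>, \<sigma>'). agreement n k \<sigma> \<sigma>' \<ge> 1 / real k + \<epsilon>}) \<longlonglongrightarrow> 1)"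
proof -
  have k: "k > 0" using k2 by simp
  define c where "c = max a b + 1"
  have c: "max a b \<le> c" "c > 0" using ab by (auto simp: c_def)
  define I where "I = kl_rate k a b d"
  define L where "L = (a * \<bar>ln (a / d)\<bar> + (real k - 1) * b * \<bar>ln (b / d)\<bar>) / (2 * real k)"
  define lnM where "lnM = \<bar>ln (a / d)\<bar> + \<bar>ln (b / d)\<bar>"
  define g where "g = \<kappa> - (ln k - I / 2)"
  have g: "g > 0" using gap by (simp add: g_def I_def)
  have L0: "0 \<le> L" unfolding L_def using ab k by (intro divide_nonneg_nonneg add_nonneg_nonneg mult_nonneg_nonneg) auto
  define CC where "CC = L + c\<^sup>2 / d * (real k + 2)"
  have CC: "0 \<le> CC" unfolding CC_def using L0 d(2) by simp
  \<comment> \<open>\<open>\<theta>\<close> is at most \<open>\<delta> * CC\<close>, so this bound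
    keeps it below an eighth of the gap.\<close>
  define \<delta>0 where "\<delta>0 = min 1 (g / (8 * (CC + 1)))"
  have \<delta>0: "\<delta>0 > 0" using g CC by (simp add: \<delta>0_def)
  have key: "\<exists>\<epsilon>>0. \<forall>fallback. (\<forall>n G. fallback n G \<in> labellings n k) \<longrightarrow>
    (\<lambda>n. measure_pmf.prob (planted_and_output n k a b (typicality_sampling fallback n k a b \<delta>))
       {(\<sigma>, \<sigma>'). agreement n k \<sigma> \<sigma>' \<ge> 1 / real k + \<epsilon>}) \<longlonglongrightarrow> 1"
    if \<delta>: "0 < \<delta>" "\<delta> < \<delta>0" for \<delta>
  proof (intro exI[of _ \<delta>] conjI allI impI)
    \<comment> \<open>The agreement margin is taken equal to the typicality parameter; both enter
      \<open>\<theta>\<close> linearly.\<close>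
    show "\<delta> > 0" by (rule \<delta>(1))
    fix fallback :: "nat \<Rightarrow> nat set set \<Rightarrow> nat \<Rightarrow> nat"
    define \<theta> where "\<theta> = \<delta> * L + c\<^sup>2 / d * (k * \<delta>\<^sup>2 + (2 * \<delta> / k + \<delta>) / 2)"
    have \<delta>1: "\<delta> \<le> 1" using \<delta> by (simp add: \<delta>0_def)
    have \<theta>: "\<theta> \<le> g / 8"
    proof -
      have "\<delta>\<^sup>2 \<le> \<delta> * 1" unfolding power2_eq_square using \<delta> \<delta>1 by (intro mult_left_mono) auto
      then have "k * \<delta>\<^sup>2 \<le> k * \<delta>" by (intro mult_left_mono) auto
      moreover have "2 * \<delta> / k \<le> 2 * \<delta>" using \<delta> k by (simp add: field_simps)
      moreover have "\<delta> * (real k + 2) = k * \<delta> + 2 * \<delta>" by (simp add: algebra_simps)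
      moreover have "A + (t + s) / 2 \<le> r" if "A \<le> B" "t \<le> 2 * s" "r = B + 2 * s" "0 < s" for A B t s r :: real
        using that by (simp add: field_simps)
      ultimately have "k * \<delta>\<^sup>2 + (2 * \<delta> / k + \<delta>) / 2 \<le> \<delta> * (real k + 2)" using \<delta>(1) by blast
      then have "\<theta> \<le> \<delta> * L + c\<^sup>2 / d * (\<delta> * (real k + 2))"
        unfolding \<theta>_def using d(2) by (intro add_left_mono mult_left_mono) auto
      also have "\<dots> = \<delta> * CC" by (simp add: CC_def algebra_simps add_divide_distrib)
      also have "\<dots> \<le> \<delta> * (CC + 1)" using \<delta> by simp
      also have "\<dots> \<le> g / (8 * (CC + 1)) * (CC + 1)" using \<delta> CC by (intro mult_right_mono) (auto simp: \<delta>0_def)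
      also have "\<dots> = g / 8"
      proof -
        have "g / (8 * t) * t = g / 8" if "t > 0" for t :: real using that by simp
        then show ?thesis using CC by (metis add_nonneg_pos zero_less_one)
      qed
      finally show ?thesis .
    qed
    \<comment> \<open>When the parameter vanishes there is no constraint from it, and any positive
      value serves.\<close>
    define \<eta>a where "\<eta>a = (if a > 0 then \<delta> * (a / (2 * real k)) else 1)"
    define \<eta>b where "\<eta>b = (if b > 0 then \<delta> * (b * (real k - 1) / (2 * real k)) else 1)"
    define \<eta> where "\<eta> = min (min \<eta>a \<eta>b) (g / (8 * (lnM + 2)))"
    have lnM: "0 \<le> lnM" by (simp add: lnM_def)
    have "\<eta>a > 0" "\<eta>b > 0" using \<delta> k2 by (auto simp: \<eta>a_def \<eta>b_def)
    then have \<eta>: "\<eta> > 0" using g lnM by (simp add: \<eta>_def)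
    have \<eta>_ab: "a > 0 \<Longrightarrow> \<eta> \<le> \<delta> * (a / (2 * real k))" "b > 0 \<Longrightarrow> \<eta> \<le> \<delta> * (b * (real k - 1) / (2 * real k))"
      unfolding \<eta>_def \<eta>a_def \<eta>b_def by auto
    have "\<eta> \<le> g / (8 * (lnM + 2))" by (simp add: \<eta>_def)
    then have "\<eta> * (8 * (lnM + 2)) \<le> g" using lnM by (subst (asm) pos_le_divide_eq) auto
    then have \<eta>g: "\<eta> * (lnM + 2) \<le> g / 8" by (simp add: field_simps)
    \<comment> \<open>The planted labelling is tested with its own smaller imbalance, which keeps
      its log-weight within the budget while the algorithm uses \<open>\<delta>\<close>.\<close>
    define \<delta>' where "\<delta>' = min (min \<delta> 1) (min (g / (8 * c * k)) (\<eta> / (2 * c * k)))"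
    have \<delta>': "0 < \<delta>'" "\<delta>' \<le> \<delta>" using \<delta> g \<eta> c k by (auto simp: \<delta>'_def)
    have sq: "\<delta>'\<^sup>2 \<le> \<delta>'"
    proof -
      have "\<delta>' * \<delta>' \<le> \<delta>' * 1" using \<delta>'(1) by (intro mult_left_mono) (auto simp: \<delta>'_def)
      then show ?thesis by (simp add: power2_eq_square)
    qed
    have "\<delta>'\<^sup>2 \<le> g / (8 * c * k)" "\<delta>'\<^sup>2 \<le> \<eta> / (2 * c * k)" by (rule order_trans[OF sq]; simp add: \<delta>'_def)+
    then have ck: "c * k * \<delta>'\<^sup>2 \<le> g / 8" and small: "2 * c * k * \<delta>'\<^sup>2 \<le> \<eta>"
      using c k by (simp_all add: pos_le_divide_eq mult_ac)
    define C where "C = max 1 ((2 * c / d) ^ 3)"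
    define Z where "Z = 2 * c + c * (c + 2 * \<eta>) + (I - d) / 2"
    \<comment> \<open>The threshold lies midway between the exponents \<open>ln k - I / 2\<close>
      and \<open>\<kappa>\<close>. The bad count falls below it by at least 3 g/8 in the exponent,
      and with \<open>Sn\<close> a margin of g/8 remains on the other side.\<close>
    define Mn where "Mn n = exp (n * (ln k - I / 2 + g / 2))" for n :: nat
    define Sn where "Sn n = n * (g / 4 + g / 8 - \<kappa>) + Z" for n :: nat
    define bd where "bd n = (k / \<delta>'\<^sup>2 + 4 * c / \<eta>\<^sup>2) / n + (C * d + 2 * exp (C * d)) / \<eta>\<^sup>2 / n + exp (- (g / 8) * n + Z)
      + exp (- (3 * g / 8) * n + 3 * c\<^sup>2 / d)" for n :: nat
    let ?P = "\<lambda>n. measure_pmf.prob (planted_and_output n k a b (typicality_sampling fallback n k a b \<delta>))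
       {(\<sigma>, \<sigma>'). agreement n k \<sigma> \<sigma>' \<ge> 1 / real k + \<delta>}"
    have e1: "\<forall>\<^sub>F n in sequentially. n * (\<kappa> - g / 8) \<le> label_entropy n k a b" using g by (intro entropy) auto
    have e2: "\<forall>\<^sub>F n in sequentially. (4 * c) / real n < \<eta>" using \<eta> by (rule eventually_const_over_n_less)
    have e3: "\<forall>\<^sub>F n in sequentially. 2 * c \<le> real n"
      by (rule eventually_sequentiallyI[of "nat \<lceil>2 * c\<rceil>"]) linarith
    from e1 e2 e3 have lower: "\<forall>\<^sub>F n in sequentially. 1 - bd n \<le> ?P n"
    proof eventually_elim
      case (elim n)
      have n: "2 * c \<le> n" "n > 0" "max a b < n" using elim(3) c by (auto simp: c_def)
      have c4: "4 * c \<le> \<eta> * n" using elim(2) n by (simp add: pos_divide_less_eq)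
      have "n * (\<eta> * lnM + c * k * \<delta>'\<^sup>2 + 2 * \<eta>) \<le> n * (g / 8 + g / 8)"
        using \<eta>g ck by (intro mult_left_mono) (simp_all add: algebra_simps)
      moreover have "n * (\<eta> * lnM + c * k * \<delta>'\<^sup>2 + 2 * \<eta>) = n * (\<eta> * lnM + c * k * \<delta>'\<^sup>2) + 2 * (\<eta> * n)"
        by (simp add: algebra_simps)
      ultimately have s1: "n * (\<eta> * lnM + c * k * \<delta>'\<^sup>2) + 2 * (\<eta> * n) \<le> n * (g / 8 + g / 8)" by (simp only:)
      have s2: "0 \<le> \<eta> * n" using \<eta> by simp
      have s3: "n * (I - d) / 2 - (real n - 1) * (I - d) / 2 = (I - d) / 2" by (simp add: field_simps)
      have s4: "n * (\<kappa> - g / 8) = - (n * (g / 4 + g / 8 - \<kappa>)) + n * (g / 8 + g / 8)" by (simp add: algebra_simps)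
      have lin: "X + p + q + r - (H - l + Y - E) - l \<le> B + (q + r + F)"
        if "p + 2 * E \<le> G" "0 \<le> E" "X - Y = F" "V = - B + G" "V \<le> H" for X p q r H l Y E B F G V :: real
        using that by linarith
      have S: "n * (I - d) / 2 + n * (\<eta> * lnM + c * k * \<delta>'\<^sup>2) + 2 * c + c * (c + 2 * \<eta>)
          - (label_entropy n k a b - n * ln k + (real n - 1) * (I - d) / 2 - \<eta> * n) - n * ln k \<le> Sn n"
        unfolding Sn_def Z_def by (rule lin[OF s1 s2 s3 s4 elim(1)])
      have "1 - ((k / \<delta>'\<^sup>2 + 4 * c / \<eta>\<^sup>2) / n + (C * d + 2 * exp (C * d)) / \<eta>\<^sup>2 / n + Mn n * exp (Sn n)
          + 1 / Mn n * (real k ^ n * exp (n * (\<theta> - I / 2) + 3 * c\<^sup>2 / d))) \<le> ?P n"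
      proof -
        have "?P n = sbm_exp n k a b (\<lambda>x G. measure_pmf.prob (typicality_sampling fallback n k a b \<delta> G)
            {y. agreement n k x y \<ge> 1 / k + \<delta>})"
          by (rule prob_planted_and_output[OF k]) (rule edge_prob_01[OF ab c(1) n k d])
        moreover have "Mn n > 0" by (simp add: Mn_def)
        ultimately show ?thesis
          using success_probability_ge[OF ab c(1) n k d k2 \<delta>(1) \<delta>' \<delta>(1) \<eta> \<eta>_ab small c4 _ S[unfolded I_def lnM_def], of "Mn n" fallback]
          unfolding C_def \<theta>_def L_def I_def by simp
      qed
      moreover have "Mn n * exp (Sn n) = exp (- (g / 8) * n + Z)"
      proof -
        have "n * (ln k - I / 2 + g / 2) + (n * (g / 4 + g / 8 - \<kappa>) + Z) = - (g / 8) * n + Z"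
          unfolding g_def by (simp add: field_simps)
        then show ?thesis unfolding Mn_def Sn_def exp_add[symmetric] by (rule arg_cong[where f = exp])
      qed
      moreover have "1 / Mn n * (real k ^ n * exp (n * (\<theta> - I / 2) + 3 * c\<^sup>2 / d)) \<le> exp (- (3 * g / 8) * n + 3 * c\<^sup>2 / d)"
      proof -
        have e1: "1 / Mn n = exp (- (n * (ln k - I / 2 + g / 2)))"
          unfolding Mn_def by (simp only: exp_minus inverse_eq_divide)
        have e2: "real k ^ n = exp (n * ln k)" using k by (simp add: exp_of_nat_mult)
        have "1 / Mn n * (real k ^ n * exp (n * (\<theta> - I / 2) + 3 * c\<^sup>2 / d))
            = exp (- (n * (ln k - I / 2 + g / 2)) + (n * ln k + (n * (\<theta> - I / 2) + 3 * c\<^sup>2 / d)))"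
          by (simp only: e1 e2 exp_add)
        moreover have "- (n * (ln k - I / 2 + g / 2)) + (n * ln k + (n * (\<theta> - I / 2) + 3 * c\<^sup>2 / d)) = n * (\<theta> - g / 2) + 3 * c\<^sup>2 / d"
          by (simp add: algebra_simps)
        moreover have "n * (\<theta> - g / 2) + 3 * c\<^sup>2 / d \<le> - (3 * g / 8) * n + 3 * c\<^sup>2 / d"
        proof -
          have "n * (\<theta> - g / 2) \<le> n * (- (3 * g / 8))" using \<theta> by (intro mult_left_mono) auto
          then show ?thesis by (simp only: mult.commute[of "- (3 * g / 8)"] add_le_cancel_right)
        qed
        ultimately show ?thesis by (simp only: exp_le_cancel_iff)
      qed
      moreover have "1 - (p + q + r' + s') \<le> t" if "1 - (p + q + r + s) \<le> t" "r = r'" "s \<le> s'" for p q r s r' s' t :: real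
        using that by linarith
      ultimately show ?case unfolding bd_def by blast
    qed
    have ex: "(\<lambda>n. exp (- s * real n + t)) \<longlonglongrightarrow> 0" if "s > 0" for s t :: real
      using that by real_asymp
    have "bd \<longlonglongrightarrow> 0 + 0 + 0 + 0"
      unfolding bd_def using g by (intro tendsto_add lim_const_over_n ex) auto
    then have "(\<lambda>n. 1 - bd n) \<longlonglongrightarrow> 1 - 0" by (intro tendsto_diff) auto
    then have low: "(\<lambda>n. 1 - bd n) \<longlonglongrightarrow> 1" by simp
    show "?P \<longlonglongrightarrow> 1"
      by (rule tendsto_sandwich[OF lower _ low tendsto_const]) simp
  qed
  show ?thesis
    by (rule exI[of _ \<delta>0], intro conjI allI impI, rule \<delta>0, erule conjE, rule key, assumption, assumption)
qed

theorem theorem2: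
  fixes k :: nat and a b d \<tau> :: real
  defines "d \<equiv> (a + (real k - 1) * b) / real k"
  defines "\<tau> \<equiv> dual_root d"
  assumes "k \<ge> 2" and "a \<ge> 0" and "b \<ge> 0" and "d > 1"
    and "(a * ln a + (real k - 1) * b * ln b) / real k
           - (a + (real k - 1) * b) / real k * ln ((a + (real k - 1) * b) / real k)
         > min ((1 - \<tau>) / (1 - \<tau> * real k / (a + (real k - 1) * b)) * (2 * ln (real k)))
               (2 * ln (real k)
                 - 2 * ln 2 * exp (- a / real k) * (1 - (1 - exp (- b / real k)) ^ (k - 1)))"
  shows "\<exists>\<delta>\<^sub>0>0. \<forall>\<delta>. 0 < \<delta> \<and> \<delta> < \<delta>\<^sub>0 \<longrightarrow>
           (\<exists>\<epsilon>>0. \<forall>fallback. (\<forall>n G. fallback n G \<in> labellings n k) \<longrightarrow>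
              (\<lambda>n. measure_pmf.prob
                     (planted_and_output n k a b (typicality_sampling fallback n k a b \<delta>))
                     {(\<sigma>, \<sigma>'). agreement n k \<sigma> \<sigma>' \<ge> 1 / real k + \<epsilon>})
                \<longlonglongrightarrow> 1)"
proof -
  have k: "k > 0" using assms(3) by simp
  have d0: "d > 0" using assms(6) by simp
  have deq: "d = (a + (real k - 1) * b) / k" by (simp add: d_def)
  define I where "I = kl_rate k a b d"
  define \<kappa>2 where "\<kappa>2 = ln 2 * exp (- a / k) * (1 - (1 - exp (- b / k)) ^ (k - 1))"
  have lnk: "0 \<le> ln (real k)" using k by simp
  have "\<tau> * real k / (a + (real k - 1) * b) = \<tau> / d" using d0 k by (simp add: d_def)
  moreover have "I = (a * ln a + (real k - 1) * b * ln b) / real k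
      - (a + (real k - 1) * b) / real k * ln ((a + (real k - 1) * b) / real k)"
    unfolding I_def using kl_rate_eq[OF assms(4,5) k deq d0] by (simp add: deq[symmetric])
  ultimately have "I > min ((1 - \<tau>) / (1 - \<tau> / d) * (2 * ln k)) (2 * ln k - 2 * \<kappa>2)"
    using assms(7) by (simp add: \<kappa>2_def mult.assoc)
  then consider "I > (1 - \<tau>) / (1 - \<tau> / d) * (2 * ln k)" | "I > 2 * ln k - 2 * \<kappa>2"
    by (auto simp: min_def split: if_splits)
  then obtain \<kappa> :: real where \<kappa>: "\<kappa> > ln k - I / 2"
    "\<And>\<eta>. \<eta> > 0 \<Longrightarrow> \<forall>\<^sub>F n in sequentially. n * (\<kappa> - \<eta>) \<le> label_entropy n k a b"
  proof cases
    case 1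
    obtain r where r: "ln k - I / 2 < ln k * ((1 + d * (1 - ext_prob d r)) * exp (- (d * (1 - ext_prob d r))))
        - I / 2 * (1 - (1 - ext_prob d (Suc r))\<^sup>2)"
      using peeling_gap[OF assms(6) lnk 1[unfolded \<tau>_def]] unfolding Let_def by blast
    show ?thesis
      by (rule that[OF r]) (unfold I_def, rule entropy_lower_peeling[OF assms(4,5) k deq d0])
  next
    case 2
    then have "ln k - I / 2 < \<kappa>2" by linarith
    then show ?thesis
    proof (rule that)
      show "\<forall>\<^sub>F n in sequentially. n * (\<kappa>2 - \<eta>) \<le> label_entropy n k a b" if "\<eta> > 0" for \<eta>
        unfolding \<kappa>2_def by (rule entropy_lower_singletons[OF assms(4,5) k d0[unfolded deq] that])
    qed
  qed
  show ?thesis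
    by (rule typicality_sampling_succeeds[OF assms(4,5,3) deq d0 \<kappa>(1)[unfolded I_def] \<kappa>(2)])
qed

end
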